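(* Let $(M,g)$ be a connected closed Riemannian $n$-manifold, $n\ge 1$, let $p\ge 1$ be an integer, and let $f$ be a Morse function on $M$ such that the metric $g$ is adapted to $f$. Let $\mathscr{D}^p(M,g)$ be the space of divergence-free symmetric Killing $p$-tensors. Then $$\dim \mathscr{D}^p(M,g)\le \sum_i \dim\ker \bar K(x_i),$$ where the sum is over all critical points $x_i$ of $f$ and $\bar K(x_i)$ is the model operator at $x_i$. Furthermore, for a critical point $x$ of $f$ with Morse index $m$, the integers $$K^{n,p}_m=\dim\ker\bar K(x)$$ depend only on $n$, $p$ and $m$, and satisfy: (a) $K^{n,p}_m=0$ if $m\ge p$ or if $m=n$. (b) $K^{n,1}_0=\binom{n+1}{2}$. (c) $K^{n,2}_0=1$ if $n=1$; $K^{n,2}_0=3$ if $n=2$; and $K^{n,2}_0=\frac1n\binom{n+2}{3}\binom{n+1}{2}-\frac{n(n+3)}{2}$ if $n\ge 3$.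
   Context: **Symmetric tensors.** $S^p(M)=\Gamma(\mathrm{Sym}^p(T^*M))$ is the space of smooth sections of the $p$-th symmetric power of $T^*M$ (with $S^{-1}(M)=0$). The symmetric product is $\alpha_1\cdots\alpha_p=\sum_{\sigma\in\mathfrak{S}_p}\alpha_{\sigma(1)}\otimes\cdots\otimes\alpha_{\sigma(p)}$ for 1-forms $\alpha_i$. The pointwise inner product is $\langle \alpha_1\cdots\alpha_p,\beta_1\cdots\beta_p\rangle=\sum_{\sigma\in \mathfrak{S}_p}\langle\alpha_1,\beta_{\sigma(1)}\rangle\cdots\langle\alpha_p,\beta_{\sigma(p)}\rangle$, and $(\alpha,\beta)=\int_M\langle\alpha,\beta\rangle$ is the $L^2$ inner product. For a 1-form $\gamma$ with metric dual vector field $\gamma^*$, define $c_\gamma:S^p(M)\to S^{p+1}(M)$, $c_\gamma(\alpha)=\gamma\alpha$ (symmetric product), and $a_\gamma:S^p(M)\to S^{p-1}(M)$, $a_\gamma(\alpha)=\gamma^*\lrcorner\,\alpha$ (contraction, i.e. the derivation of the symmetric algebra with $a_\gamma(\mu)=\langle\gamma,\mu\rangle$ on 1-forms $\mu$). **Operators.** Let $\nabla$ be the connection on $\mathrm{Sym}^p(T^*M)$ induced by the Levi-Civita connection, $\{e_k\}$ a local orthonormal frame of $TM$ and $\{e^k\}$ its dual coframe; write $c_k=c_{e^k}$, $a_k=a_{e^k}$. The symmetric covariant derivative is $d^s=\sum_k c_k\nabla_{e_k}:S^p(M)\to S^{p+1}(M)$, and its formal adjoint, the divergence operator, is $d^{s*}=-\sum_k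 a_k\nabla_{e_k}:S^{p+1}(M)\to S^p(M)$. A tensor $\alpha\in S^p(M)$ is Killing if $d^s\alpha=0$ and divergence-free if $d^{s*}\alpha=0$. Put $D=d^{s*}d^s+d^sd^{s*}:S^p(M)\to S^p(M)$ and $\mathscr{D}^p(M,g)=\ker D=\ker d^s\cap\ker d^{s*}$. **Adapted metric.** The metric $g$ is adapted to the Morse function $f$ if around each critical point $x$ of $f$, of index $m$ say, there are local coordinates $y_1,\dots,y_n$ with $y_k(x)=0$, $f(y)=f(0)-\frac12 y_1^2-\cdots-\frac12y_m^2+\frac12y_{m+1}^2+\cdots+\frac12y_n^2$, and $g=(dy_1)^2+\cdots+(dy_n)^2$. **Model operators.** For $t\in\mathbb{R}$ let $d_t=e^{-tf}d^se^{tf}$, let $d_t^*$ be its formal adjoint, and let $D_t=d_t^*d_t+d_{-t}d_{-t}^*$. Then $D_t=D+tB+t^2V$ with $B=d^{s*}c_{df}-c_{df}d^{s*}+a_{df}d^s-d^sa_{df}$ and $V=a_{df}c_{df}+c_{df}a_{df}$, where $B$ and $V$ are bundle endomorphisms of $\mathrm{Sym}^p(T^*M)$. At a critical point $x$, use coordinates $y$ as in the definition of adapted metric and trivialize $\mathrm{Sym}^p(T^*M)$ near $x$ by the coframe $e^k=dy_k$, so that $D=\sum_{k,\ell}\frac{\partial^2}{\partial y_k\partial y_\ell}D_{k\ell}(y)+$ lower order terms, with matrix coefficients. The model operator is $\bar K(x)=\bar D+\bar B+\bar V$, where $\bar D=\sum_{k,\ell}\frac{\partial^2}{\partial y_k\partial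 y_\ell}D_{k\ell}(0)$, $\bar B=B(0)$ is an endomorphism of $\mathrm{Sym}^p(T_x^*M)$, and $\bar V=\frac12\sum_{k,\ell}\frac{\partial^2V}{\partial y_k\partial y_\ell}(0)\,y_ky_\ell$ is the quadratic part of $V$ at $x$. It acts in $L^2(\mathbb{R}^n)\otimes \mathrm{Sym}^p(T_x^*M)$ as the (self-adjoint) closure from the domain $C_0^\infty(\mathbb{R}^n)\otimes \mathrm{Sym}^p(T^*_xM)$, and $\ker\bar K(x)$ is its kernel there. *)

theory Defs
  imports "HOL-Analysis.Analysis" "HOL-Library.Function_Algebras"
begin

section \<open>Real-valued function spaces as vector spaces\<close>

text \<open>Tangent vectors (derivations), tensors and tensor fields are all functions into the reals,
  iterated; the pointwise operations make them real vector spaces, so that the library notions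
  \<open>subspace\<close>, \<open>span\<close>, \<open>dim\<close> apply.\<close>

instantiation "fun" :: (type, real_vector) real_vector
begin

definition scaleR_fun_def: "scaleR a f = (\<lambda>x. a *\<^sub>R f x)"

instance
  by standard
    (simp_all add: scaleR_fun_def plus_fun_def fun_eq_iff scaleR_add_right scaleR_add_left)

end

text \<open>Dimension of the quotient of \<open>W\<close> by its intersection with \<open>N\<close>: \<open>B\<close> represents a basis of the quotient.\<close>

definition basis_mod :: "'v::real_vector set \<Rightarrow> 'v set \<Rightarrow> 'v set \<Rightarrow> bool" where
  "basis_mod W N B \<longleftrightarrow>
     B \<subseteq> W \<and> independent B \<and> span B \<inter> N \<subseteq> {0} \<and> (\<forall>w\<in>W. \<exists>b\<in>span B. w - b \<in> N)"

definition finite_dim_mod :: "'v::real_vector set \<Rightarrow> 'v set \<Rightarrow> bool" where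
  "finite_dim_mod W N \<longleftrightarrow> (\<exists>B. finite B \<and> basis_mod W N B)"

definition dim_mod :: "'v::real_vector set \<Rightarrow> 'v set \<Rightarrow> nat" where
  "dim_mod W N = card (SOME B. basis_mod W N B)"


section \<open>Smooth manifolds\<close>

definition partial :: "'n \<Rightarrow> (real^'n \<Rightarrow> real) \<Rightarrow> real^'n \<Rightarrow> real" where
  "partial k u y = deriv (\<lambda>t. u (y + t *\<^sub>R axis k 1)) 0"

text \<open>Used for open \<open>S\<close> only.\<close>

definition smooth_on :: "(real^'n::finite) set \<Rightarrow> (real^'n \<Rightarrow> real) \<Rightarrow> bool" where
  "smooth_on S u \<longleftrightarrow> (\<forall>ks. \<forall>y\<in>S. foldr partial ks u differentiable (at y))"

type_synonym ('a, 'n) chart = "'a set \<times> ('a \<Rightarrow> real^'n)"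

definition chart_image :: "('a, 'n) chart \<Rightarrow> (real^'n) set" where
  "chart_image c = snd c ` fst c"

definition chart_inv :: "('a, 'n) chart \<Rightarrow> real^'n \<Rightarrow> 'a" where
  "chart_inv c = inv_into (fst c) (snd c)"

definition is_chart :: "'a topology \<Rightarrow> ('a, 'n::finite) chart \<Rightarrow> bool" where
  "is_chart X c \<longleftrightarrow> openin X (fst c) \<and> open (chart_image c) \<and>
     homeomorphic_map (subtopology X (fst c)) (top_of_set (chart_image c)) (snd c)"

definition smooth_transition :: "('a, 'n::finite) chart \<Rightarrow> ('a, 'n) chart \<Rightarrow> bool" where
  "smooth_transition c d \<longleftrightarrow>
     (\<forall>i. smooth_on (snd c ` (fst c \<inter> fst d)) (\<lambda>y. snd d (chart_inv c y) $ i))"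

definition compatible :: "('a, 'n::finite) chart \<Rightarrow> ('a, 'n) chart \<Rightarrow> bool" where
  "compatible c d \<longleftrightarrow> smooth_transition c d \<and> smooth_transition d c"

definition points :: "('a, 'n) chart set \<Rightarrow> 'a set" where
  "points A = \<Union> (fst ` A)"

text \<open>A smooth manifold (without boundary) of dimension \<open>CARD('n)\<close>: a topological space \<open>X\<close> with a maximal
  smooth atlas \<open>A\<close>.\<close>

definition smooth_manifold :: "'a topology \<Rightarrow> ('a, 'n::finite) chart set \<Rightarrow> bool" where
  "smooth_manifold X A \<longleftrightarrow>
     Hausdorff_space X \<and> second_countable X \<and> topspace X = points A \<and>
     (\<forall>c\<in>A. is_chart X c) \<and> (\<forall>c\<in>A. \<forall>d\<in>A. compatible c d) \<and>
     (\<forall>c. is_chart X c \<and> (\<forall>d\<in>A. compatible c d) \<longrightarrow> c \<in> A)"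

definition smooth_functions :: "('a, 'n::finite) chart set \<Rightarrow> ('a \<Rightarrow> real) set" where
  "smooth_functions A = {u. \<forall>c\<in>A. smooth_on (chart_image c) (u \<circ> chart_inv c)}"

text \<open>Tangent vectors are derivations of the algebra of smooth functions at \<open>x\<close>, extended by \<open>0\<close> to
  non-smooth functions.\<close>

definition tangent_space :: "('a, 'n::finite) chart set \<Rightarrow> 'a \<Rightarrow> (('a \<Rightarrow> real) \<Rightarrow> real) set" where
  "tangent_space A x = {v.
     (\<forall>u. u \<notin> smooth_functions A \<longrightarrow> v u = 0) \<and>
     (\<forall>u\<in>smooth_functions A. \<forall>w\<in>smooth_functions A. \<forall>a b.
        v (\<lambda>z. a * u z + b * w z) = a * v u + b * v w) \<and>
     (\<forall>u\<in>smooth_functions A. \<forall>w\<in>smooth_functions A.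
        v (\<lambda>z. u z * w z) = u x * v w + w x * v u)}"

definition coord_vector ::
  "('a, 'n::finite) chart set \<Rightarrow> ('a, 'n) chart \<Rightarrow> 'n \<Rightarrow> 'a \<Rightarrow> ('a \<Rightarrow> real) \<Rightarrow> real" where
  "coord_vector A c i x = (\<lambda>u. if u \<in> smooth_functions A
     then partial i (u \<circ> chart_inv c) (snd c x) else 0)"


section \<open>Symmetric tensors\<close>

text \<open>The \<open>p\<close>-th symmetric power of the dual of \<open>T\<close>, realised (via the convention
  \<open>\<alpha>\<^sub>1 \<cdots> \<alpha>\<^sub>p = \<Sum>\<sigma>. \<alpha>\<^bsub>\<sigma>(1)\<^esub> \<otimes> \<cdots> \<otimes> \<alpha>\<^bsub>\<sigma>(p)\<^esub>\<close>) as the symmetric \<open>p\<close>-linear forms on \<open>T\<close>; arguments are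
  collected in a list, and the value is \<open>0\<close> off the lists of length \<open>p\<close> over \<open>T\<close>.\<close>

definition sym_forms :: "nat \<Rightarrow> 'v::real_vector set \<Rightarrow> ('v list \<Rightarrow> real) set" where
  "sym_forms p T = {\<omega>.
     (\<forall>vs. \<not> (length vs = p \<and> set vs \<subseteq> T) \<longrightarrow> \<omega> vs = 0) \<and>
     (\<forall>vs ws. mset vs = mset ws \<longrightarrow> \<omega> vs = \<omega> ws) \<and>
     (\<forall>v\<in>T. \<forall>w\<in>T. \<forall>a b vs. Suc (length vs) = p \<and> set vs \<subseteq> T \<longrightarrow>
        \<omega> ((a *\<^sub>R v + b *\<^sub>R w) # vs) = a * \<omega> (v # vs) + b * \<omega> (w # vs))}"

type_synonym 'a tensor_field = "'a \<Rightarrow> (('a \<Rightarrow> real) \<Rightarrow> real) list \<Rightarrow> real"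

text \<open>Tensors on Euclidean space are given by their components, indexed by lists of coordinates.\<close>

type_synonym 'n comps = "'n list \<Rightarrow> real"

definition sym_comps :: "nat \<Rightarrow> 'n comps set" where
  "sym_comps p = {T. (\<forall>J. length J \<noteq> p \<longrightarrow> T J = 0) \<and> (\<forall>I J. mset I = mset J \<longrightarrow> T I = T J)}"

definition components ::
  "('a, 'n::finite) chart set \<Rightarrow> ('a, 'n) chart \<Rightarrow> 'a tensor_field \<Rightarrow> real^'n \<Rightarrow> 'n comps" where
  "components A c \<alpha> y J =
     \<alpha> (chart_inv c y) (map (\<lambda>i. coord_vector A c i (chart_inv c y)) J)"

definition sym_tensors :: "('a, 'n::finite) chart set \<Rightarrow> nat \<Rightarrow> 'a tensor_field set" where
  "sym_tensors A p = {\<alpha>.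
     (\<forall>x\<in>points A. \<alpha> x \<in> sym_forms p (tangent_space A x)) \<and>
     (\<forall>x. x \<notin> points A \<longrightarrow> \<alpha> x = 0) \<and>
     (\<forall>c\<in>A. \<forall>J. smooth_on (chart_image c) (\<lambda>y. components A c \<alpha> y J))}"

definition riemannian_metric :: "('a, 'n::finite) chart set \<Rightarrow> 'a tensor_field \<Rightarrow> bool" where
  "riemannian_metric A g \<longleftrightarrow> g \<in> sym_tensors A 2 \<and>
     (\<forall>x\<in>points A. \<forall>v\<in>tangent_space A x. v \<noteq> 0 \<longrightarrow> g x [v, v] > 0)"

definition closed_connected_riemannian ::
  "'a topology \<Rightarrow> ('a, 'n::finite) chart set \<Rightarrow> 'a tensor_field \<Rightarrow> bool" where
  "closed_connected_riemannian X A g \<longleftrightarrow>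
     smooth_manifold X A \<and> compact_space X \<and> connected_space X \<and> riemannian_metric A g"

definition metric_matrix ::
  "('a, 'n::finite) chart set \<Rightarrow> 'a tensor_field \<Rightarrow> ('a, 'n) chart \<Rightarrow> real^'n \<Rightarrow> real^'n^'n" where
  "metric_matrix A g c y = (\<chi> i j. components A c g y [i, j])"


section \<open>The operators, in local coordinates\<close>

text \<open>In this section \<open>G\<close> is the matrix of the metric in local coordinates, and \<open>\<alpha>\<close> a symmetric tensor field
  in components.\<close>

type_synonym 'n metric = "real^'n \<Rightarrow> real^'n^'n"
type_synonym 'n field = "real^'n \<Rightarrow> 'n comps"

definition christoffel :: "'n::finite metric \<Rightarrow> 'n \<Rightarrow> 'n \<Rightarrow> 'n \<Rightarrow> real^'n \<Rightarrow> real" where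
  "christoffel G k i j y = 1/2 * (\<Sum>l\<in>UNIV. matrix_inv (G y) $ k $ l *
     (partial i (\<lambda>z. G z $ j $ l) y + partial j (\<lambda>z. G z $ i $ l) y - partial l (\<lambda>z. G z $ i $ j) y))"

definition nabla :: "'n::finite metric \<Rightarrow> 'n \<Rightarrow> 'n field \<Rightarrow> 'n field" where
  "nabla G i \<alpha> y J = partial i (\<lambda>z. \<alpha> z J) y
     - (\<Sum>s<length J. \<Sum>k\<in>UNIV. christoffel G k i (J ! s) y * \<alpha> y (J[s := k]))"

text \<open>Symmetric multiplication by the covector \<open>\<gamma>\<close>: with the above convention,
  \<open>(\<gamma>T)(v\<^sub>0,\<dots>,v\<^sub>p) = \<Sum>s. \<gamma>(v\<^sub>s) T(v\<^sub>0,\<dots>,v\<^sub>p without v\<^sub>s)\<close>.\<close>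

definition sym_mult :: "real^'n \<Rightarrow> 'n comps \<Rightarrow> 'n comps" where
  "sym_mult \<gamma> T J = (\<Sum>s<length J. \<gamma> $ (J ! s) * T (take s J @ drop (Suc s) J))"

text \<open>Contraction with the vector dual to \<open>\<gamma>\<close> with respect to the inner product matrix \<open>Q\<close>.  Insertion of a vector
  into one slot is the derivation of the symmetric algebra extending evaluation on covectors.\<close>

definition sym_contract :: "real^'n::finite^'n \<Rightarrow> real^'n \<Rightarrow> 'n comps \<Rightarrow> 'n comps" where
  "sym_contract Q \<gamma> T J = (\<Sum>i\<in>UNIV. (matrix_inv Q *v \<gamma>) $ i * T (i # J))"

text \<open>The expressions \<open>\<Sum>k. c\<^sub>k \<nabla>\<^bsub>e\<^sub>k\<^esub>\<close> and \<open>-\<Sum>k. a\<^sub>k \<nabla>\<^bsub>e\<^sub>k\<^esub>\<close> are the same for every frame \<open>e\<^sub>k\<close> with dual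
  coframe \<open>e\<^sup>k\<close>, orthonormal or not; they are written here in the coordinate frame.\<close>

definition sym_deriv :: "'n::finite metric \<Rightarrow> 'n field \<Rightarrow> 'n field" where
  "sym_deriv G \<alpha> y = (\<Sum>k\<in>UNIV. sym_mult (axis k 1) (nabla G k \<alpha> y))"

definition sym_div :: "'n::finite metric \<Rightarrow> 'n field \<Rightarrow> 'n field" where
  "sym_div G \<alpha> y = - (\<Sum>k\<in>UNIV. sym_contract (G y) (axis k 1) (nabla G k \<alpha> y))"

definition killing_div_free ::
  "('a, 'n::finite) chart set \<Rightarrow> 'a tensor_field \<Rightarrow> nat \<Rightarrow> 'a tensor_field set" where
  "killing_div_free A g p = {\<alpha> \<in> sym_tensors A p. \<forall>c\<in>A. \<forall>y\<in>chart_image c.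
     sym_deriv (metric_matrix A g c) (components A c \<alpha>) y = 0 \<and>
     sym_div (metric_matrix A g c) (components A c \<alpha>) y = 0}"

definition op_D :: "'n::finite metric \<Rightarrow> 'n field \<Rightarrow> 'n field" where
  "op_D G \<alpha> = sym_div G (sym_deriv G \<alpha>) + sym_deriv G (sym_div G \<alpha>)"

text \<open>\<open>F\<close> is a function in local coordinates.\<close>

definition grad_comps :: "(real^'n \<Rightarrow> real) \<Rightarrow> real^'n \<Rightarrow> real^'n" where
  "grad_comps F y = (\<chi> i. partial i F y)"

definition c_d :: "(real^'n \<Rightarrow> real) \<Rightarrow> 'n field \<Rightarrow> 'n field" where
  "c_d F \<alpha> y = sym_mult (grad_comps F y) (\<alpha> y)"

definition a_d :: "'n::finite metric \<Rightarrow> (real^'n \<Rightarrow> real) \<Rightarrow> 'n field \<Rightarrow> 'n field" where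
  "a_d G F \<alpha> y = sym_contract (G y) (grad_comps F y) (\<alpha> y)"

definition op_B :: "'n::finite metric \<Rightarrow> (real^'n \<Rightarrow> real) \<Rightarrow> 'n field \<Rightarrow> 'n field" where
  "op_B G F \<alpha> = sym_div G (c_d F \<alpha>) - c_d F (sym_div G \<alpha>)
     + a_d G F (sym_deriv G \<alpha>) - sym_deriv G (a_d G F \<alpha>)"

definition op_V :: "'n::finite metric \<Rightarrow> (real^'n \<Rightarrow> real) \<Rightarrow> 'n field \<Rightarrow> 'n field" where
  "op_V G F \<alpha> = a_d G F (c_d F \<alpha>) + c_d F (a_d G F \<alpha>)"


section \<open>Morse functions and adapted metrics\<close>

definition critical_points :: "('a, 'n::finite) chart set \<Rightarrow> ('a \<Rightarrow> real) \<Rightarrow> 'a set" where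
  "critical_points A f = {x \<in> points A. \<forall>v\<in>tangent_space A x. v f = 0}"

definition hessian :: "('a, 'n::finite) chart \<Rightarrow> ('a \<Rightarrow> real) \<Rightarrow> 'a \<Rightarrow> real^'n^'n" where
  "hessian c f x = (\<chi> i j. partial i (partial j (f \<circ> chart_inv c)) (snd c x))"

definition morse_function :: "('a, 'n::finite) chart set \<Rightarrow> ('a \<Rightarrow> real) \<Rightarrow> bool" where
  "morse_function A f \<longleftrightarrow> f \<in> smooth_functions A \<and>
     (\<forall>x\<in>critical_points A f. \<forall>c\<in>A. x \<in> fst c \<longrightarrow> invertible (hessian c f x))"

text \<open>The maximal dimension of a subspace on which the Hessian is negative definite; it does not depend on
  the chart, so the maximum may be taken over all charts at \<open>x\<close>.\<close>

definition morse_index :: "('a, 'n::finite) chart set \<Rightarrow> ('a \<Rightarrow> real) \<Rightarrow> 'a \<Rightarrow> nat" where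
  "morse_index A f x = Max {dim S | S c. c \<in> A \<and> x \<in> fst c \<and> subspace S \<and>
     (\<forall>w\<in>S. w \<noteq> 0 \<longrightarrow> w \<bullet> (hessian c f x *v w) < 0)}"

text \<open>The set \<open>N\<close> of \<open>m\<close> negative directions replaces the ordering \<open>1,\<dots>,m,m+1,\<dots>,n\<close> of the coordinates.
  The condition \<open>g = (dy\<^sub>1)\<^sup>2 + \<cdots> + (dy\<^sub>n)\<^sup>2\<close> says that the coordinate frame is orthonormal.\<close>

definition adapted_chart :: "('a, 'n::finite) chart set \<Rightarrow> 'a tensor_field \<Rightarrow> ('a \<Rightarrow> real) \<Rightarrow> 'a
    \<Rightarrow> ('a, 'n) chart \<Rightarrow> bool" where
  "adapted_chart A g f x c \<longleftrightarrow> c \<in> A \<and> x \<in> fst c \<and> snd c x = 0 \<and>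
     (\<exists>N. card N = morse_index A f x \<and> (\<forall>y\<in>chart_image c.
        f (chart_inv c y) = f x - (\<Sum>k\<in>N. 1/2 * (y $ k)\<^sup>2) + (\<Sum>k\<in>-N. 1/2 * (y $ k)\<^sup>2))) \<and>
     (\<forall>y\<in>chart_image c. metric_matrix A g c y = mat 1)"

definition adapted_metric ::
  "('a, 'n::finite) chart set \<Rightarrow> 'a tensor_field \<Rightarrow> ('a \<Rightarrow> real) \<Rightarrow> bool" where
  "adapted_metric A g f \<longleftrightarrow> (\<forall>x\<in>critical_points A f. \<exists>c. adapted_chart A g f x c)"


section \<open>The model operator\<close>

text \<open>For a second order operator \<open>D = \<Sum>k l. \<partial>\<^sub>k \<partial>\<^sub>l D\<^sub>k\<^sub>l(y) + \<close> lower order terms with symmetric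
  \<open>D\<^sub>k\<^sub>l = D\<^sub>l\<^sub>k\<close>, one has \<open>D (y\<^sub>k y\<^sub>l T) (0) = 2 D\<^sub>k\<^sub>l(0) T\<close> for constant \<open>T\<close>.\<close>

definition coeff_D :: "'n::finite metric \<Rightarrow> 'n \<Rightarrow> 'n \<Rightarrow> 'n comps \<Rightarrow> 'n comps" where
  "coeff_D G k l T = (1/2) *\<^sub>R op_D G (\<lambda>y. (y $ k * y $ l) *\<^sub>R T) 0"

definition model_D :: "'n::finite metric \<Rightarrow> 'n field \<Rightarrow> 'n field" where
  "model_D G u y = (\<Sum>k\<in>UNIV. \<Sum>l\<in>UNIV. coeff_D G k l (\<lambda>J. partial k (partial l (\<lambda>z. u z J)) y))"

text \<open>\<open>op_B\<close> and \<open>op_V\<close> are of order zero, so their endomorphisms are found by applying them to constants.\<close>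

definition model_B :: "'n::finite metric \<Rightarrow> (real^'n \<Rightarrow> real) \<Rightarrow> 'n comps \<Rightarrow> 'n comps" where
  "model_B G F T = op_B G F (\<lambda>_. T) 0"

definition model_V :: "'n::finite metric \<Rightarrow> (real^'n \<Rightarrow> real) \<Rightarrow> real^'n \<Rightarrow> 'n comps \<Rightarrow> 'n comps" where
  "model_V G F y T J = 1/2 * (\<Sum>k\<in>UNIV. \<Sum>l\<in>UNIV.
     partial k (partial l (\<lambda>z. op_V G F (\<lambda>_. T) z J)) 0 * y $ k * y $ l)"

definition model_op :: "'n::finite metric \<Rightarrow> (real^'n \<Rightarrow> real) \<Rightarrow> 'n field \<Rightarrow> 'n field" where
  "model_op G F u y = model_D G u y + model_B G F (u y) + model_V G F y (u y)"

text \<open>The factor \<open>1/p!\<close> relates the inner product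
  \<open>\<langle>\<alpha>\<^sub>1 \<cdots> \<alpha>\<^sub>p, \<beta>\<^sub>1 \<cdots> \<beta>\<^sub>p\<rangle> = \<Sum>\<sigma>. \<Prod>i. \<langle>\<alpha>\<^sub>i, \<beta>\<^bsub>\<sigma>(i)\<^esub>\<rangle>\<close> to the one of the tensor power.\<close>

definition sym_norm2 :: "nat \<Rightarrow> 'n::finite comps \<Rightarrow> real" where
  "sym_norm2 p T = (\<Sum>J | length J = p. (T J)\<^sup>2) / fact p"

definition L2_norm2 :: "nat \<Rightarrow> 'n::finite field \<Rightarrow> ennreal" where
  "L2_norm2 p u = (\<integral>\<^sup>+ y. ennreal (sym_norm2 p (u y)) \<partial>lborel)"

definition L2_fields :: "nat \<Rightarrow> 'n::finite field set" where
  "L2_fields p = {u. (\<forall>y. u y \<in> sym_comps p) \<and> (\<forall>J. (\<lambda>y. u y J) \<in> borel_measurable lborel) \<and>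
     L2_norm2 p u < \<infinity>}"

definition null_fields :: "'n::finite field set" where
  "null_fields = {u. AE y in lborel. u y = 0}"

definition test_fields :: "nat \<Rightarrow> 'n::finite field set" where
  "test_fields p = {u. (\<forall>y. u y \<in> sym_comps p) \<and> (\<forall>J. smooth_on UNIV (\<lambda>y. u y J)) \<and>
     bounded {y. u y \<noteq> 0}}"

text \<open>The graph of the closure of \<open>L\<close> from the test fields, on representatives of \<open>L\<^sup>2\<close> classes.\<close>

definition closure_graph :: "nat \<Rightarrow> ('n::finite field \<Rightarrow> 'n field) \<Rightarrow> ('n field \<times> 'n field) set" where
  "closure_graph p L = {(u, w). u \<in> L2_fields p \<and> w \<in> L2_fields p \<and>
     (\<exists>s. (\<forall>j::nat. s j \<in> test_fields p) \<and>
        (\<lambda>j. L2_norm2 p (s j - u)) \<longlonglongrightarrow> 0 \<and> (\<lambda>j. L2_norm2 p (L (s j) - w)) \<longlonglongrightarrow> 0)}"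

text \<open>The kernel of the model operator in the coordinates \<open>c\<close> at a critical point, as a space of functions; the
  kernel in \<open>L\<^sup>2\<close> is its quotient by \<open>null_fields\<close>.\<close>

definition model_kernel :: "('a, 'n::finite) chart set \<Rightarrow> 'a tensor_field \<Rightarrow> ('a \<Rightarrow> real) \<Rightarrow> nat
    \<Rightarrow> ('a, 'n) chart \<Rightarrow> 'n field set" where
  "model_kernel A g f p c =
     {u. (u, 0) \<in> closure_graph p (model_op (metric_matrix A g c) (f \<circ> chart_inv c))}"

definition model_kernel_dim :: "('a, 'n::finite) chart set \<Rightarrow> 'a tensor_field \<Rightarrow> ('a \<Rightarrow> real) \<Rightarrow> nat
    \<Rightarrow> ('a, 'n) chart \<Rightarrow> nat" where
  "model_kernel_dim A g f p c = dim_mod (model_kernel A g f p c) null_fields"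

end

theory Submission
  imports Defs "HOL-Library.Multiset"
begin

text \<open>In an adapted chart at a critical point the function is, up to a constant,
\<open>F y = (\<Sum>k. e k * y\<^sub>k\<^sup>2) / 2\<close> with signs
\<open>e k = 1\<close> or \<open>e k = -1\<close>. The model operator is \<open>d\<^sub>F\<^sup>* d\<^sub>F + d' d'\<^sup>*\<close> for the flat operators
\<open>d\<^sub>F = exp (- F) d\<^sup>s exp F\<close> and \<open>d' = exp F d\<^sup>s exp (- F)\<close> (\<open>model_op_eq_witten_laplacian\<close>), so an element \<open>u\<close> of the
kernel of its closure is a limit of test fields for which both terms of the energy tend to zero
(\<open>energy_identity\<close>). In the limit \<open>T = exp F u\<close> is a divergence-free Killing tensor of Euclidean space. The
Killing equation is read along lines: the form \<open>T (h, \<dots>, h)\<close> is constant in the direction \<open>h\<close>. This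
conservation law passes to \<open>L\<^sup>2\<close> limits, and finitely many of its instances determine \<open>T\<close> by polarization, as a
polynomial. Hence the kernel consists of the square integrable \<open>exp (- F) P\<close>, where \<open>P\<close> is a polynomial
divergence-free Killing tensor (\<open>kernel_is_flat_killing\<close>, \<open>flat_killing_in_kernel\<close>).

If some \<open>e k\<close> is \<open>-1\<close>, square integrability kills the components of \<open>P\<close> one after the other, because the
Killing equation makes each of them independent of \<open>y\<^sub>k\<close> once the preceding ones vanish
(\<open>growing_flat_killing_zero\<close>). So the kernel is zero at every critical point of positive index. At index zero
the Gaussian makes every \<open>exp (- F) P\<close> square integrable, and the dimension is that of the space
\<open>flat_killing p\<close> of all \<open>P\<close>, which depends on \<open>n\<close> and \<open>p\<close> alone.

The inequality is then local. A function on a closed manifold has a minimum, a critical point of index zero,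
where the metric is flat in an adapted chart. Restriction to that chart sends the divergence-free Killing
tensors of the manifold into \<open>flat_killing p\<close>, injectively by unique continuation
(\<open>unique_continuation_ball\<close>), and one summand bounds the left-hand side.

For \<open>p = 1\<close> and \<open>p = 2\<close> the Taylor coefficients of \<open>P\<close> at the origin are described by symmetries, cyclic
sums and traces; each of these linear conditions is onto its target, apart from the cases \<open>n = 1\<close> and
\<open>n = 2\<close>, and rank-nullity gives the dimensions.\<close>

section \<open>Partial derivatives and smooth functions\<close>

lemma partial_eq_derivative:
 assumes "(u has_derivative D) (at y)"
 shows "partial k u y = D (axis k 1)"
proof -
 have lin: "((%t. y + t *\<^sub>R axis k 1) has_derivative (%t. t *\<^sub>R axis k 1)) (at (0::real))"
  by (auto intro!: derivative_eq_intros)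
 have "((%t. u (y + t *\<^sub>R axis k 1)) has_derivative (%t. D (t *\<^sub>R axis k 1))) (at (0::real))"
  by (rule has_derivative_compose[OF lin]) (use assms in simp)
 moreover have "(%t. D (t *\<^sub>R axis k 1)) = (*) (D (axis k 1))"
  using has_derivative_linear[OF assms] by (auto simp: linear_scale mult.commute)
 ultimately have "((%t. u (y + t *\<^sub>R axis k 1)) has_field_derivative D (axis k 1)) (at 0)"
  by (simp add: has_field_derivative_def)
 thus ?thesis
  by (simp add: partial_def DERIV_imp_deriv)
qed

lemma vec_eq_sum_axis: "h = (\<Sum>k\<in>UNIV. h $ k *\<^sub>R axis k (1::real))"
 using basis_expansion[of h] by (simp add: scalar_mult_eq_scaleR)

lemma has_derivative_partials:
 fixes u :: "real^'n::finite => real"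
 assumes "u differentiable (at y)"
 shows "(u has_derivative (%h. \<Sum>k\<in>UNIV. h $ k * partial k u y)) (at y)"
proof -
 obtain D where D: "(u has_derivative D) (at y)"
  using assms by (auto simp: differentiable_def)
 have "D h = (\<Sum>k\<in>UNIV. h $ k * partial k u y)" for h
 proof -
  have "D h = D (\<Sum>k\<in>UNIV. h $ k *\<^sub>R axis k 1)"
   using vec_eq_sum_axis[of h] by simp
  also have "... = (\<Sum>k\<in>UNIV. h $ k * D (axis k 1))"
   using has_derivative_linear[OF D] by (simp add: linear_sum linear_scale)
  finally show ?thesis
   by (simp add: partial_eq_derivative[OF D])
 qed
 hence "D = (%h. \<Sum>k\<in>UNIV. h $ k * partial k u y)" by auto
 with D show ?thesis by simp
qed

lemma partial_cong:
 assumes "open S" "y \<in> S" "!!z. z \<in> S ==> u z = w z"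
 shows "partial k u y = partial k w y"
proof -
 have "isCont (%t. y + t *\<^sub>R axis k 1) t" for t :: real
  by (intro continuous_intros)
 hence "open ((%t. y + t *\<^sub>R axis k 1) -` S)"
  using assms(1) by (intro continuous_open_vimage) auto
 hence "\<forall>\<^sub>F t in nhds (0::real). y + t *\<^sub>R axis k 1 \<in> S"
  using eventually_nhds_in_open[of "(%t. y + t *\<^sub>R axis k 1) -` S" "0::real"] assms(2) by simp
 hence "\<forall>\<^sub>F t in nhds (0::real). u (y + t *\<^sub>R axis k 1) = w (y + t *\<^sub>R axis k 1)"
  by eventually_elim (use assms(3) in auto)
 thus ?thesis
  unfolding partial_def by (rule deriv_cong_ev) simp
qed

lemma differentiable_cong_open:
 assumes "open S" "y \<in> S" "!!z. z \<in> S ==> u z = w z" "u differentiable (at y)"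
 shows "w differentiable (at y)"
 using assms has_derivative_transform_within_open[of u _ y UNIV S w]
 by (auto simp: differentiable_def)

lemma partial_const [simp]: "partial k (%_. a) y = 0"
 by (simp add: partial_def)

lemma partial_nth [simp]: "partial k (%y. y $ i) y = (if k = i then 1 else 0)"
 by (subst partial_eq_derivative[where D = "%h. h $ i"])
   (auto intro!: bounded_linear_imp_has_derivative bounded_linear_vec_nth simp: axis_def)

lemma partial_add:
 assumes "u differentiable (at y)" "w differentiable (at y)"
 shows "partial k (%z. u z + w z) y = partial k u y + partial k w y"
 using partial_eq_derivative[OF has_derivative_add[OF has_derivative_partials has_derivative_partials], OF assms]
 by (simp add: axis_def sum.delta if_distrib[of "%x. x * _"] cong: if_cong)

lemma partial_mult:
 assumes "u differentiable (at y)" "w differentiable (at y)"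
 shows "partial k (%z. u z * w z) y = partial k u y * w y + u y * partial k w y"
 using partial_eq_derivative[OF has_derivative_mult[OF has_derivative_partials has_derivative_partials], OF assms]
 by (simp add: axis_def sum.delta if_distrib[of "%x. x * _"] cong: if_cong)

lemma partial_cmult:
 assumes "u differentiable (at y)"
 shows "partial k (%z. a * u z) y = a * partial k u y"
 using partial_mult[of "%_. a" y u k] assms by simp

lemma partial_minus:
 assumes "u differentiable (at y)"
 shows "partial k (%z. - u z) y = - partial k u y"
 using partial_cmult[of u y k "-1"] assms by simp

lemma partial_diff:
 assumes "u differentiable (at y)" "w differentiable (at y)"
 shows "partial k (%z. u z - w z) y = partial k u y - partial k w y"
 using partial_add[of u y "%z. - w z" k] assms by (simp add: partial_minus)

lemma partial_sum:
 assumes "!!i. i \<in> I ==> u i differentiable (at y)"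
 shows "partial k (%z. \<Sum>i\<in>I. u i z) y = (\<Sum>i\<in>I. partial k (u i) y)"
 using assms by (induction I rule: infinite_finite_induct) (simp_all add: partial_add)

lemma partial_chain_real:
 assumes "u differentiable (at y)" "(f has_real_derivative d) (at (u y))"
 shows "partial k (%z. f (u z)) y = d * partial k u y"
  and "(%z. f (u z)) differentiable (at y)"
proof -
 have "((%z. f (u z)) has_derivative (%h. d * (\<Sum>k\<in>UNIV. h $ k * partial k u y))) (at y)"
  using has_derivative_compose[OF has_derivative_partials[OF assms(1)], of f "(*) d"] assms(2)
  by (simp add: has_field_derivative_def)
 thus "partial k (%z. f (u z)) y = d * partial k u y"
  and "(%z. f (u z)) differentiable (at y)"
  by (auto simp: partial_eq_derivative axis_def sum.delta if_distrib[of "%x. x * _"] differentiable_def cong: if_cong)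
qed

lemma has_derivative_vec_partials:
 fixes \<phi> :: "real^'m::finite => real^'n::finite"
 assumes "!!i. (%y. \<phi> y $ i) differentiable (at y)"
 shows "(\<phi> has_derivative (%h. \<chi> i. \<Sum>k\<in>UNIV. h $ k * partial k (%y. \<phi> y $ i) y)) (at y)"
 unfolding has_derivative_componentwise_within[of \<phi>]
proof
 fix b :: "real^'n" assume "b \<in> Basis"
 then obtain i where "b = axis i 1" by (auto simp: Basis_vec_def)
 thus "((%x. \<phi> x \<bullet> b) has_derivative (%x. (\<chi> i. \<Sum>k\<in>UNIV. x $ k * partial k (%y. \<phi> y $ i) y) \<bullet> b)) (at y)"
  using has_derivative_partials[OF assms[of i]] by (simp add: inner_axis)
qed

lemma partial_chain_vec:
 fixes \<phi> :: "real^'m::finite => real^'n::finite"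
 assumes "!!i. (%y. \<phi> y $ i) differentiable (at y)" "F differentiable (at (\<phi> y))"
 shows "partial k (%z. F (\<phi> z)) y = (\<Sum>i\<in>UNIV. partial i F (\<phi> y) * partial k (%z. \<phi> z $ i) y)"
  and "(%z. F (\<phi> z)) differentiable (at y)"
proof -
 have "((%z. F (\<phi> z)) has_derivative
   (%h. \<Sum>i\<in>UNIV. (\<chi> i. \<Sum>k\<in>UNIV. h $ k * partial k (%y. \<phi> y $ i) y) $ i * partial i F (\<phi> y))) (at y)"
  by (rule has_derivative_compose[OF has_derivative_vec_partials has_derivative_partials]) (use assms in auto)
 thus "partial k (%z. F (\<phi> z)) y = (\<Sum>i\<in>UNIV. partial i F (\<phi> y) * partial k (%z. \<phi> z $ i) y)"
  and "(%z. F (\<phi> z)) differentiable (at y)"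
  by (auto simp: partial_eq_derivative axis_def sum.delta if_distrib[of "%x. x * _"] differentiable_def mult.commute cong: if_cong)
qed

lemma smooth_on_differentiable: "smooth_on S u ==> y \<in> S ==> u differentiable (at y)"
 unfolding smooth_on_def by (drule spec[of _ "[]"]) simp

lemma smooth_on_partial: "smooth_on S u ==> smooth_on S (partial k u)"
 unfolding smooth_on_def
proof (intro allI ballI)
 fix ks y assume "\<forall>ks. \<forall>y\<in>S. foldr partial ks u differentiable at y" "y \<in> S"
 hence "foldr partial (ks @ [k]) u differentiable at y" by blast
 thus "foldr partial ks (partial k u) differentiable at y" by simp
qed

lemma smooth_on_subset: "smooth_on S u ==> T \<subseteq> S ==> smooth_on T u"
 unfolding smooth_on_def by blast

lemma smooth_on_continuous: "smooth_on S u ==> continuous_on S u"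
 by (meson continuous_at_imp_continuous_on differentiable_imp_continuous_within smooth_on_differentiable)

lemma foldr_partial_cong:
 assumes "open S" "!!z. z \<in> S ==> u z = w z" "y \<in> S"
 shows "foldr partial ks u y = foldr partial ks w y"
 using assms(3)
proof (induction ks arbitrary: y)
 case (Cons k ks)
 thus ?case using partial_cong[OF assms(1), of y "foldr partial ks u" "foldr partial ks w"] by simp
qed (use assms in auto)

lemma smooth_on_local:
 assumes "!!y. y \<in> S ==> \<exists>T w. open T & y \<in> T & smooth_on T w & (\<forall>z\<in>T. u z = w z)"
 shows "smooth_on S u"
 unfolding smooth_on_def
proof (intro allI ballI)
 fix ks y assume "y \<in> S"
 then obtain T w where T: "open T" "y \<in> T" "smooth_on T w" "\<forall>z\<in>T. u z = w z"
  using assms by blast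
 hence "foldr partial ks w differentiable at y" unfolding smooth_on_def by blast
 thus "foldr partial ks u differentiable at y"
  by (rule differentiable_cong_open[OF T(1,2), rotated])
    (rule foldr_partial_cong[OF T(1)], use T(4) in auto)
qed

text \<open>Since the definition iterates partial derivatives, smoothness is coinductive: a class of
 differentiable functions that contains, up to equality on the open set, the partial derivatives of its
 members consists of smooth functions.\<close>

lemma smooth_on_coinduct:
 assumes "open S" "R u"
  and "!!u y. R u ==> y \<in> S ==> u differentiable (at y)"
  and "!!u k. R u ==> \<exists>w. R w & (\<forall>y\<in>S. partial k u y = w y)"
 shows "smooth_on S u"
 unfolding smooth_on_def
proof (intro allI ballI)
 fix ks y assume y: "y \<in> S"
 have "\<exists>w. R w & (\<forall>y\<in>S. foldr partial ks u y = w y)"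
 proof (induction ks)
  case (Cons k ks)
  then obtain w where w: "R w" "\<forall>y\<in>S. foldr partial ks u y = w y" by blast
  obtain w' where w': "R w'" "\<forall>y\<in>S. partial k w y = w' y" using assms(4) w by blast
  have "\<forall>y\<in>S. foldr partial (k # ks) u y = w' y"
   using partial_cong[OF assms(1), of _ "foldr partial ks u" w k] w w' by (metis foldr.simps(2) o_apply)
  with w' show ?case by blast
 qed (use assms(2) in auto)
 then obtain w where w: "R w" "\<forall>y\<in>S. foldr partial ks u y = w y" by blast
 show "foldr partial ks u differentiable at y"
  by (rule differentiable_cong_open[OF assms(1) y _ assms(3)[OF w(1) y]]) (use w(2) in auto)
qed

text \<open>The functions \<open>x\<^sup>-\<^sup>k exp (- 1/x)\<close>, extended by \<open>0\<close> to the left, form a family that is closed under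
 differentiation up to linear combinations; \<open>flat_exp 0\<close> is the source of all bump functions below.\<close>

definition flat_exp :: "nat => real => real" where
 "flat_exp k x = (if x > 0 then inverse x ^ k * exp (- inverse x) else 0)"

lemma power_over_fact_le_exp:
 assumes "x >= (0::real)" shows "x ^ m / fact m <= exp x"
proof -
 have "x ^ m / fact m <= (\<Sum>i\<in>{m}. x ^ i / fact i)" by simp
 also have "... <= (\<Sum>i. x ^ i / fact i)"
  using assms summable_exp_generic[of x] by (intro sum_le_suminf) (auto simp: divide_inverse mult.commute)
 also have "... = exp x" by (simp add: exp_def divide_inverse mult.commute)
 finally show ?thesis .
qed

lemma flat_exp_bound: "\<bar>flat_exp k x\<bar> <= fact (k + m) * \<bar>x\<bar> ^ m"
proof (cases "x > 0")
 case True
 have "inverse x ^ (k + m) / fact (k + m) <= exp (inverse x)"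
  using True by (intro power_over_fact_le_exp) simp
 hence "inverse x ^ (k + m) <= fact (k + m) * exp (inverse x)"
  by (simp add: divide_le_eq mult.commute)
 hence "inverse x ^ (k + m) * exp (- inverse x) <= fact (k + m) * exp (inverse x) * exp (- inverse x)"
  by (intro mult_right_mono) auto
 hence "inverse x ^ (k + m) * exp (- inverse x) <= fact (k + m)"
  by (simp add: mult.assoc flip: exp_add)
 hence "x ^ m * (inverse x ^ (k + m) * exp (- inverse x)) <= x ^ m * fact (k + m)"
  by (rule mult_left_mono) (use True in simp)
 moreover have "x ^ m * inverse x ^ m = 1"
  using True by (simp flip: power_mult_distrib)
 hence "x ^ m * (inverse x ^ (k + m) * exp (- inverse x)) = flat_exp k x"
  using True by (simp add: flat_exp_def power_add mult.assoc[symmetric] mult.commute[of "x ^ m"])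
 moreover have "flat_exp k x >= 0" by (simp add: flat_exp_def)
 ultimately have "\<bar>flat_exp k x\<bar> <= x ^ m * fact (k + m)" by simp
 thus ?thesis using True by (simp add: mult.commute)
qed (simp add: flat_exp_def)

lemma flat_exp_derivative:
 "(flat_exp k has_real_derivative (- real k * flat_exp (k + 1) x + flat_exp (k + 2) x)) (at x)"
proof -
 consider "x > 0" | "x < 0" | "x = 0" by linarith
 thus ?thesis
 proof cases
  case 1
  have inv: "(inverse has_real_derivative - (inverse x * inverse x)) (at x)"
   using 1 DERIV_inverse[of x UNIV] by (simp add: power2_eq_square)
  have "((%x. inverse x ^ k) has_real_derivative - real k * inverse x ^ (k + 1)) (at x)"
   using DERIV_power[OF inv, of k] by (cases k) (simp_all add: algebra_simps)
  moreover have "((%x. exp (- inverse x)) has_real_derivative exp (- inverse x) * (inverse x * inverse x)) (at x)"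
   using DERIV_fun_exp[OF DERIV_minus[OF inv]] by simp
  ultimately have "((%x. inverse x ^ k * exp (- inverse x)) has_real_derivative
    (- real k * flat_exp (k + 1) x + flat_exp (k + 2) x)) (at x)"
   by (rule DERIV_mult[THEN DERIV_cong]) (use 1 in \<open>simp add: flat_exp_def algebra_simps\<close>)
  thus ?thesis
   by (rule has_field_derivative_transform_within_open[where S = "{0<..}"]) (use 1 in \<open>auto simp: flat_exp_def\<close>)
 next
  case 2
  have "((%x. 0) has_real_derivative 0) (at x)" by simp
  hence "(flat_exp k has_real_derivative 0) (at x)"
   by (rule has_field_derivative_transform_within_open[where S = "{..<0}"]) (use 2 in \<open>auto simp: flat_exp_def\<close>)
  with 2 show ?thesis by (simp add: flat_exp_def)
 next
  case 3
  have "((%h. (flat_exp k (0 + h) - flat_exp k 0) / h) \<longlongrightarrow> 0) (at 0)"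
  proof (rule Lim_null_comparison)
   show "\<forall>\<^sub>F h in at 0. norm ((flat_exp k (0 + h) - flat_exp k 0) / h) <= fact (k + 2) * \<bar>h\<bar>"
   proof (intro always_eventually allI)
    fix h :: real
    show "norm ((flat_exp k (0 + h) - flat_exp k 0) / h) <= fact (k + 2) * \<bar>h\<bar>"
    using flat_exp_bound[of k h 2]
    by (cases "h = 0") (simp_all add: flat_exp_def[of _ 0] power2_eq_square pos_divide_le_eq mult.assoc del: abs_mult_self_eq fact_Suc)
   qed
   have "((%h. fact (k + 2) * \<bar>h\<bar>) \<longlongrightarrow> fact (k + 2) * \<bar>0\<bar>) (at (0::real))"
    by (intro tendsto_intros)
   thus "((%h. fact (k + 2) * \<bar>h\<bar>) \<longlongrightarrow> 0) (at (0::real))" by simp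
  qed
  with 3 show ?thesis by (simp add: DERIV_def flat_exp_def)
 qed
qed

text \<open>The closure properties of smooth functions are proved together: derivatives of composite expressions
 are sums and products of composite expressions.\<close>

inductive smooth_expr :: "(real^'n::finite) set => (real^'n => real) => bool" for S where
 base: "smooth_on S u ==> smooth_expr S u"
| const: "smooth_expr S (%_. a)"
| add: "smooth_expr S u ==> smooth_expr S w ==> smooth_expr S (%y. u y + w y)"
| mult: "smooth_expr S u ==> smooth_expr S w ==> smooth_expr S (%y. u y * w y)"
| inverse: "smooth_expr S u ==> (\<forall>y\<in>S. u y ~= 0) ==> smooth_expr S (%y. inverse (u y))"
| exp: "smooth_expr S u ==> smooth_expr S (%y. exp (u y))"
| flat_exp: "smooth_expr S u ==> smooth_expr S (%y. flat_exp k (u y))"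
| comp: "open T ==> smooth_on T F ==> (\<forall>i. smooth_expr S (%y. \<phi> y $ i)) ==> (\<forall>y\<in>S. \<phi> y \<in> T) ==>
  smooth_expr S (%y. F (\<phi> y :: real^'n))"

lemma smooth_expr_sum: "(!!i. i \<in> I ==> smooth_expr S (u i)) ==> smooth_expr S (%y. \<Sum>i\<in>I. u i y)"
 by (induction I rule: infinite_finite_induct) (auto intro: smooth_expr.intros)

lemma smooth_expr_step:
 assumes "smooth_expr S u"
 shows "(\<forall>y\<in>S. u differentiable (at y)) & (\<forall>k. \<exists>w. smooth_expr S w & (\<forall>y\<in>S. partial k u y = w y))"
 using assms
proof induction
 case (base u)
 thus ?case by (metis smooth_expr.base smooth_on_differentiable smooth_on_partial)
next
 case (const a)
 thus ?case by (auto intro!: exI[of _ "%_. 0"] smooth_expr.const)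
next
 case (add u w)
 thus ?case by (auto simp: partial_add) (metis (no_types, lifting) smooth_expr.add)
next
 case (mult u w)
 have "\<exists>v. smooth_expr S v & (\<forall>y\<in>S. partial k (%y. u y * w y) y = v y)" for k
 proof -
  obtain u' where u': "smooth_expr S u'" "\<forall>y\<in>S. partial k u y = u' y" using mult.IH by blast
  obtain w' where w': "smooth_expr S w'" "\<forall>y\<in>S. partial k w y = w' y" using mult.IH by blast
  have "smooth_expr S (%y. u' y * w y + u y * w' y)"
   by (intro smooth_expr.intros u' w' mult.hyps)
  thus ?thesis using u' w' mult.IH by (auto simp: partial_mult)
 qed
 thus ?case using mult.IH by auto
next
 case (inverse u)
 have D: "(inverse has_real_derivative - (inverse (u y) * inverse (u y))) (at (u y))" if "y \<in> S" for y
  using DERIV_inverse[of "u y" UNIV] inverse.hyps that by (simp add: power2_eq_square)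
 have "\<exists>v. smooth_expr S v & (\<forall>y\<in>S. partial k (%y. inverse (u y)) y = v y)" for k
 proof -
  obtain u' where u': "smooth_expr S u'" "\<forall>y\<in>S. partial k u y = u' y" using inverse.IH by blast
  have "smooth_expr S (%y. -1 * (inverse (u y) * inverse (u y)) * u' y)"
   by (intro smooth_expr.intros u' inverse.hyps)
  thus ?thesis using u' inverse.IH by (auto intro!: exI simp: partial_chain_real(1)[OF _ D])
 qed
 thus ?case using inverse.IH partial_chain_real(2)[where u = u, OF _ D] by blast
next
 case (exp u)
 have D: "(exp has_real_derivative exp (u y)) (at (u y))" for y by simp
 have "\<exists>v. smooth_expr S v & (\<forall>y\<in>S. partial k (%y. exp (u y)) y = v y)" for k
 proof -
  obtain u' where u': "smooth_expr S u'" "\<forall>y\<in>S. partial k u y = u' y" using exp.IH by blast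
  have "smooth_expr S (%y. exp (u y) * u' y)"
   by (intro smooth_expr.intros u' exp.hyps)
  thus ?thesis using u' exp.IH by (auto intro!: exI simp: partial_chain_real(1)[OF _ D])
 qed
 thus ?case using exp.IH partial_chain_real(2)[where u = u, OF _ D] by blast
next
 case (flat_exp u m)
 have "\<exists>v. smooth_expr S v & (\<forall>y\<in>S. partial k (%y. flat_exp m (u y)) y = v y)" for k
 proof -
  obtain u' where u': "smooth_expr S u'" "\<forall>y\<in>S. partial k u y = u' y" using flat_exp.IH by blast
  have "smooth_expr S (%y. ((- real m) * flat_exp (m + 1) (u y) + flat_exp (m + 2) (u y)) * u' y)"
   by (intro smooth_expr.intros u' flat_exp.hyps)
  thus ?thesis using u' flat_exp.IH by (auto intro!: exI simp: partial_chain_real(1)[OF _ flat_exp_derivative])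
 qed
 thus ?case using flat_exp.IH partial_chain_real(2)[where u = u, OF _ flat_exp_derivative] by blast
next
 case (comp T F \<phi>)
 have F: "F differentiable (at (\<phi> y))" if "y \<in> S" for y
  using comp that smooth_on_differentiable by blast
 have "\<exists>v. smooth_expr S v & (\<forall>y\<in>S. partial k (%y. F (\<phi> y)) y = v y)" for k
 proof -
  have "\<forall>i. \<exists>w. smooth_expr S w & (\<forall>y\<in>S. partial k (%y. \<phi> y $ i) y = w y)" using comp.IH by blast
  then obtain w where w: "smooth_expr S (w i)" "\<forall>y\<in>S. partial k (%y. \<phi> y $ i) y = w i y" for i by metis
  have "smooth_expr S (%y. partial i F (\<phi> y))" for i
   by (rule smooth_expr.comp[of T]) (use comp in \<open>auto intro: smooth_on_partial\<close>)
  hence "smooth_expr S (%y. \<Sum>i\<in>UNIV. partial i F (\<phi> y) * w i y)"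
   using w by (intro smooth_expr_sum smooth_expr.mult)
  moreover have "partial k (%y. F (\<phi> y)) y = (\<Sum>i\<in>UNIV. partial i F (\<phi> y) * w i y)" if "y \<in> S" for y
   using partial_chain_vec(1)[of \<phi> y F k] w(2) comp.IH F that by simp
  ultimately show ?thesis by blast
 qed
 moreover have "(%y. F (\<phi> y)) differentiable (at y)" if "y \<in> S" for y
  using partial_chain_vec(2)[of \<phi> y F] comp.IH F that by simp
 ultimately show ?case by blast
qed

lemma smooth_expr_smooth: "open S ==> smooth_expr S u ==> smooth_on S u"
 using smooth_expr_step by (intro smooth_on_coinduct[where R = "smooth_expr S"]) blast+

lemma smooth_on_const [simp]: "smooth_on S (%_. a)"
proof -
 have "partial k (%_. b) = (%_. 0)" for k :: 'a and b by (simp add: fun_eq_iff)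
 hence "foldr partial ks (%_. a) = (%_. if ks = [] then a else 0)" for ks :: "'a list"
  by (induction ks) auto
 thus ?thesis by (simp add: smooth_on_def)
qed

lemma differentiable_nth [simp]: "(%y. y $ i) differentiable (at (y::real^'n::finite))"
 using bounded_linear_imp_differentiable[OF bounded_linear_vec_nth] .

lemma smooth_on_nth: assumes "open S" shows "smooth_on S (%y. y $ i)"
proof (rule smooth_on_coinduct[where R = "%u. u = (%y. y $ i) \<or> (\<exists>a. u = (%_. a))", OF assms])
 fix u :: "real^'a => real" and k
 assume "u = (%y. y $ i) \<or> (\<exists>a. u = (%_. a))"
 thus "\<exists>w. (w = (%y. y $ i) \<or> (\<exists>a. w = (%_. a))) & (\<forall>y\<in>S. partial k u y = w y)"
  by (intro exI[of _ "%_. if k = i & u = (%y. y $ i) then 1 else 0"]) auto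
qed auto

context
 fixes S :: "(real^'n::finite) set"
 assumes S: "open S"
begin

lemma smooth_on_add: "smooth_on S u ==> smooth_on S w ==> smooth_on S (%y. u y + w y)"
 by (rule smooth_expr_smooth[OF S], rule smooth_expr.add) (simp_all add: smooth_expr.base)

lemma smooth_on_mult: "smooth_on S u ==> smooth_on S w ==> smooth_on S (%y. u y * w y)"
 by (rule smooth_expr_smooth[OF S], rule smooth_expr.mult) (simp_all add: smooth_expr.base)

lemma smooth_on_minus: "smooth_on S u ==> smooth_on S (%y. - u y)"
 using smooth_on_mult[of "%_. -1" u] by simp

lemma smooth_on_diff: "smooth_on S u ==> smooth_on S w ==> smooth_on S (%y. u y - w y)"
 using smooth_on_add[of u "%y. - w y"] smooth_on_minus by simp

lemma smooth_on_sum: "(!!i. i \<in> I ==> smooth_on S (u i)) ==> smooth_on S (%y. \<Sum>i\<in>I. u i y)"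
 by (rule smooth_expr_smooth[OF S], rule smooth_expr_sum) (simp add: smooth_expr.base)

lemma smooth_on_exp: "smooth_on S u ==> smooth_on S (%y. exp (u y))"
 by (rule smooth_expr_smooth[OF S], rule smooth_expr.exp) (simp_all add: smooth_expr.base)

lemma smooth_on_flat_exp: "smooth_on S u ==> smooth_on S (%y. flat_exp k (u y))"
 by (rule smooth_expr_smooth[OF S], rule smooth_expr.flat_exp) (simp_all add: smooth_expr.base)

lemma smooth_on_compose:
 fixes \<phi> :: "real^'n => real^'n"
 shows "open T ==> smooth_on T F ==> (!!i. smooth_on S (%y. \<phi> y $ i)) ==> (!!y. y \<in> S ==> \<phi> y \<in> T) ==>
  smooth_on S (%y. F (\<phi> y))"
 by (rule smooth_expr_smooth[OF S], rule smooth_expr.comp[of T]) (simp_all add: smooth_expr.base)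

end

definition bump :: "real^'n::finite => real => real^'n => real" where
 "bump z r y = flat_exp 0 (r\<^sup>2 - (\<Sum>i\<in>UNIV. (y $ i - z $ i)\<^sup>2))"

lemma smooth_on_bump: "open S ==> smooth_on S (bump z r)"
 unfolding bump_def power2_eq_square
 by (intro smooth_on_flat_exp smooth_on_diff smooth_on_sum smooth_on_mult smooth_on_nth smooth_on_const)

lemma sum_sq_eq_dist: "(\<Sum>i\<in>UNIV. (y $ i - z $ i)\<^sup>2) = (dist z (y::real^'n::finite))\<^sup>2"
 by (simp add: dist_vec_def L2_set_def sum_nonneg dist_real_def power2_commute)

lemma bump_eq:
 assumes "r >= 0"
 shows "bump z r y = (if y \<in> ball z r then exp (- inverse (r\<^sup>2 - (dist z y)\<^sup>2)) else 0)"
proof -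
 have "(dist z y)\<^sup>2 < r\<^sup>2 \<longleftrightarrow> dist z y < r"
  using assms by (metis power_strict_mono power_less_imp_less_base zero_le_dist zero_less_numeral)
 thus ?thesis by (simp add: bump_def sum_sq_eq_dist flat_exp_def)
qed

lemma bump_pos: "y \<in> ball z r ==> bump z r y > 0"
 using bump_eq[of r z y] zero_le_dist[of z y] by (simp del: zero_le_dist)

lemma bump_zero: "r >= 0 ==> y \<notin> ball z r ==> bump z r y = 0"
 by (simp add: bump_eq)

lemma bump_nonneg: "bump z r y >= 0"
 by (simp add: bump_def flat_exp_def)

text \<open>Hadamard's lemma. The coefficient functions are \<open>\<integral>\<^sub>0\<^sup>1 \<partial>\<^sub>k u (z + t (y - z)) dt\<close>; differentiating under the integral sign
 produces integrals of the same kind with one more power of \<open>t\<close>, so they are smooth by coinduction.\<close>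

definition ray_average :: "real^'n::finite => nat => (real^'n => real) => real^'n => real" where
 "ray_average z m u y = integral (cbox 0 1) (%t. t ^ m * u (z + t *\<^sub>R (y - z)))"

lemma ray_in_ball:
 fixes y :: "'a::real_normed_vector"
 assumes "y \<in> ball z r" "t \<in> cbox 0 (1::real)"
 shows "z + t *\<^sub>R (y - z) \<in> ball z r"
proof -
 have "norm (t *\<^sub>R (y - z)) <= norm (y - z)"
  using assms(2) by (simp add: mult_left_le_one_le)
 also have "... < r" using assms(1) by (simp add: dist_norm norm_minus_commute)
 finally show ?thesis by (simp add: dist_norm)
qed

lemma continuous_on_ray:
 assumes "continuous_on (ball z r) (u :: real^'n::finite => real)"
 shows "continuous_on (ball z r \<times> cbox 0 1) (%(y, t). t ^ m * u (z + t *\<^sub>R (y - z)))"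
 unfolding case_prod_beta
 by (intro continuous_intros continuous_on_compose2[OF assms]) (use ray_in_ball in fastforce)

lemma ray_integrable:
 assumes "continuous_on (ball z r) (u :: real^'n::finite => real)" "y \<in> ball z r"
 shows "(%t. t ^ m * u (z + t *\<^sub>R (y - z))) integrable_on cbox 0 1"
 by (intro integrable_continuous continuous_intros continuous_on_compose2[OF assms(1)])
   (use ray_in_ball[OF assms(2)] in auto)

lemma ray_average_derivative:
 assumes u: "smooth_on (ball z r) u" and y: "y \<in> ball z r"
 shows "(ray_average z m u has_derivative (%h. \<Sum>k\<in>UNIV. h $ k * ray_average z (Suc m) (partial k u) y)) (at y)"
proof -
 let ?c = "%k x t. t ^ Suc m * partial k u (z + t *\<^sub>R (x - z))"
 let ?fx = "%x t. \<Sum>k\<in>UNIV. ?c k x t *\<^sub>R blinfun_inner_right (axis k (1::real))"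
 have cont: "continuous_on (ball z r) u" "!!k. continuous_on (ball z r) (partial k u)"
  using u smooth_on_partial smooth_on_continuous by blast+
 have "((%x. integral (cbox 0 1) (%t. t ^ m * u (z + t *\<^sub>R (x - z)))) has_derivative
   blinfun_apply (integral (cbox 0 1) (?fx y))) (at y within ball z r)"
 proof (rule leibniz_rule)
  fix x t assume x: "x \<in> ball z r" and t: "t \<in> cbox (0::real) 1"
  have "u differentiable (at (z + t *\<^sub>R (x - z)))"
   using smooth_on_differentiable[OF u ray_in_ball[OF x t]] .
  note D = has_derivative_partials[OF this]
  have ray: "((%x. z + t *\<^sub>R (x - z)) has_derivative (%h. t *\<^sub>R h)) (at x within ball z r)"
   by (auto intro!: derivative_eq_intros)
  have "((%x. t ^ m * u (z + t *\<^sub>R (x - z))) has_derivative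
    (%h. t ^ m * (\<Sum>k\<in>UNIV. (t *\<^sub>R h) $ k * partial k u (z + t *\<^sub>R (x - z))))) (at x within ball z r)"
   by (rule has_derivative_mult_right[OF has_derivative_compose[OF ray D]])
  moreover have "(%h. t ^ m * (\<Sum>k\<in>UNIV. (t *\<^sub>R h) $ k * partial k u (z + t *\<^sub>R (x - z)))) = blinfun_apply (?fx x t)"
   by (auto simp: fun_eq_iff blinfun.sum_left blinfun.scaleR_left inner_axis' sum_distrib_left intro!: sum.cong)
  ultimately show "((%x. t ^ m * u (z + t *\<^sub>R (x - z))) has_derivative blinfun_apply (?fx x t)) (at x within ball z r)"
   by simp
 next
  show "continuous_on (ball z r \<times> cbox 0 1) (%(x, t). ?fx x t)"
   using continuous_on_ray[OF cont(2), of "Suc m"] unfolding case_prod_beta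
   by (intro continuous_on_sum continuous_on_scaleR continuous_on_const) auto
 qed (use y cont ray_integrable in auto)
 moreover have "blinfun_apply (integral (cbox 0 1) (?fx y)) = (%h. \<Sum>k\<in>UNIV. h $ k * ray_average z (Suc m) (partial k u) y)"
 proof -
  have "(?c k y has_integral ray_average z (Suc m) (partial k u) y) (cbox 0 1)" for k
   unfolding ray_average_def by (rule integrable_integral[OF ray_integrable[OF cont(2) y]])
  hence "(?fx y has_integral (\<Sum>k\<in>UNIV. ray_average z (Suc m) (partial k u) y *\<^sub>R blinfun_inner_right (axis k 1))) (cbox 0 1)"
   by (intro has_integral_sum has_integral_scaleR_left) auto
  thus ?thesis
   by (auto simp: integral_unique fun_eq_iff blinfun.sum_left blinfun.scaleR_left inner_axis' mult.commute)
 qed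
 ultimately show ?thesis
  using y at_within_open[OF y open_ball] by (simp add: ray_average_def[abs_def])
qed

lemma smooth_on_ray_average:
 assumes "smooth_on (ball z r) u"
 shows "smooth_on (ball z r) (ray_average z m u)"
proof (rule smooth_on_coinduct[where R = "%w. \<exists>m u. smooth_on (ball z r) u & w = ray_average z m u"])
 fix w :: "real^'a => real" and k
 assume "\<exists>m u. smooth_on (ball z r) u & w = ray_average z m u"
 then obtain m u where w: "smooth_on (ball z r) u" "w = ray_average z m u" by blast
 have "\<forall>y\<in>ball z r. partial k w y = ray_average z (Suc m) (partial k u) y"
  using partial_eq_derivative[OF ray_average_derivative[OF w(1)]]
  by (simp add: w(2) axis_def sum.delta if_distrib[of "%x. x * _"] cong: if_cong)
 with w show "\<exists>w'. (\<exists>m u. smooth_on (ball z r) u & w' = ray_average z m u) & (\<forall>y\<in>ball z r. partial k w y = w' y)"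
  using smooth_on_partial by blast
next
 fix w :: "real^'a => real" and y
 assume "\<exists>m u. smooth_on (ball z r) u & w = ray_average z m u" "y \<in> ball z r"
 thus "w differentiable (at y)"
  using ray_average_derivative unfolding differentiable_def by blast
qed (use assms in auto)

lemma hadamard:
 assumes u: "smooth_on (ball z r) u"
 obtains h where "!!k. smooth_on (ball z r) (h k)" "!!k. h k z = partial k u z"
  "!!y. y \<in> ball z r ==> u y = u z + (\<Sum>k\<in>UNIV. (y $ k - z $ k) * h k y)"
proof
 show "smooth_on (ball z r) (ray_average z 0 (partial k u))" for k
  by (intro smooth_on_ray_average smooth_on_partial u)
 show "ray_average z 0 (partial k u) z = partial k u z" for k
  by (simp add: ray_average_def)
 fix y assume y: "y \<in> ball z r"
 have cont: "continuous_on (ball z r) (partial k u)" for k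
  using u smooth_on_partial smooth_on_continuous by blast
 have 1: "((%t. \<Sum>k\<in>UNIV. (y $ k - z $ k) * partial k u (z + t *\<^sub>R (y - z))) has_integral
   u (z + 1 *\<^sub>R (y - z)) - u (z + 0 *\<^sub>R (y - z))) {0..1}"
 proof (rule fundamental_theorem_of_calculus)
  fix t :: real assume t: "t \<in> {0..1}"
  hence "z + t *\<^sub>R (y - z) \<in> ball z r" using ray_in_ball[OF y] by simp
  note D = has_derivative_partials[OF smooth_on_differentiable[OF u this]]
  have ray: "((%t. z + t *\<^sub>R (y - z)) has_derivative (%s. s *\<^sub>R (y - z))) (at t within {0..1})"
   by (auto intro!: derivative_eq_intros)
  have "((%t. u (z + t *\<^sub>R (y - z))) has_derivative
    (%s. \<Sum>k\<in>UNIV. (s *\<^sub>R (y - z)) $ k * partial k u (z + t *\<^sub>R (y - z)))) (at t within {0..1})"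
   by (rule has_derivative_compose[OF ray D])
  thus "((%t. u (z + t *\<^sub>R (y - z))) has_vector_derivative
    (\<Sum>k\<in>UNIV. (y $ k - z $ k) * partial k u (z + t *\<^sub>R (y - z)))) (at t within {0..1})"
   by (simp add: has_vector_derivative_def sum_distrib_left mult.assoc)
 qed simp
 have 2: "((%t. \<Sum>k\<in>UNIV. (y $ k - z $ k) * partial k u (z + t *\<^sub>R (y - z))) has_integral
   (\<Sum>k\<in>UNIV. (y $ k - z $ k) * ray_average z 0 (partial k u) y)) {0..1}"
  using integrable_integral[OF ray_integrable[OF cont y, of 0]]
  by (intro has_integral_sum has_integral_mult_right) (auto simp: ray_average_def)
 show "u y = u z + (\<Sum>k\<in>UNIV. (y $ k - z $ k) * ray_average z 0 (partial k u) y)"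
  using has_integral_unique[OF 1 2] by simp
qed

section \<open>Symmetric tensors in components\<close>

lemma sum_fun_apply [simp]: "(\<Sum>i\<in>I. f i) x = (\<Sum>i\<in>I. f i x)"
 by (induction I rule: infinite_finite_induct) auto

lemma scaleR_fun_apply [simp]: "(a *\<^sub>R f) x = a *\<^sub>R f x"
 by (simp add: scaleR_fun_def)

abbreviation omit :: "nat => 'x list => 'x list" where
 "omit s J \<equiv> take s J @ drop (Suc s) J"

lemma mset_omit: "s < length J ==> mset (J ! s # omit s J) = mset J"
 using id_take_nth_drop[of s J] by (metis mset.simps(2) mset_append union_mset_add_mset_right)

lemma length_omit: "s < length J ==> length (omit s J) = length J - 1"
 by simp

lemma sum_omit_Cons:
 "(\<Sum>s<length (j # J). f ((j # J) ! s) (omit s (j # J))) = f j J + (\<Sum>s<length J. f (J ! s) (j # omit s J))"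
 by (simp add: sum.lessThan_Suc_shift del: sum.lessThan_Suc)

abbreviation multi_indices :: "nat => 'n::finite list set" where
 "multi_indices p \<equiv> {J. length J = p}"

lemma finite_multi_indices [simp]: "finite (multi_indices p)"
 using finite_lists_length_eq[OF finite[of UNIV], of p] by simp

lemma sum_multi_indices_Suc:
 fixes f :: "'n::finite list => 'c::comm_monoid_add"
 shows "(\<Sum>J\<in>multi_indices (Suc p). f J) = (\<Sum>k\<in>UNIV. \<Sum>J\<in>multi_indices p. f (k # J))"
proof -
 have "multi_indices (Suc p) = (%(k, J). k # J) ` (UNIV \<times> (multi_indices p :: 'n list set))"
  by (auto simp: length_Suc_conv)
 moreover have "inj_on (%(k, J). k # J) (UNIV \<times> (multi_indices p :: 'n list set))"
  by (auto simp: inj_on_def)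
 ultimately show ?thesis
  using sum.reindex[of "%(k, J). k # J" "UNIV \<times> multi_indices p" f]
  by (simp add: sum.cartesian_product case_prod_beta comp_def)
qed

lemma sum_multi_indices_omit:
 fixes \<phi> :: "'n::finite => 'n list => 'c::comm_monoid_add"
 shows "s <= p ==> (\<Sum>J\<in>multi_indices (Suc p). \<phi> (J ! s) (omit s J)) = (\<Sum>k\<in>UNIV. \<Sum>J\<in>multi_indices p. \<phi> k J)"
proof (induction p arbitrary: s \<phi>)
 case 0
 thus ?case by (simp add: sum_multi_indices_Suc)
next
 case (Suc p)
 show ?case
 proof (cases s)
  case 0
  thus ?thesis by (simp add: sum_multi_indices_Suc[of _ "Suc p"])
 next
  case (Suc s')
  have "(\<Sum>J\<in>multi_indices (Suc (Suc p)). \<phi> (J ! s) (omit s J))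
    = (\<Sum>j\<in>UNIV. \<Sum>J\<in>multi_indices (Suc p). \<phi> (J ! s') (j # omit s' J))"
   by (subst sum_multi_indices_Suc) (simp add: Suc)
  also have "... = (\<Sum>j\<in>UNIV. \<Sum>k\<in>UNIV. \<Sum>J\<in>multi_indices p. \<phi> k (j # J))"
   using Suc Suc.prems by (subst Suc.IH) auto
  also have "... = (\<Sum>k\<in>UNIV. \<Sum>J\<in>multi_indices (Suc p). \<phi> k J)"
   by (subst sum.swap) (simp add: sum_multi_indices_Suc[of _ p])
  finally show ?thesis .
 qed
qed

text \<open>Symmetric multiplication is adjoint to insertion: this identity is behind both the formal adjointness of
 the two differential operators and the positivity of the model operator.\<close>

lemma sum_multi_indices_all_omit:
 fixes \<phi> :: "'n::finite => 'n list => real"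
 assumes "!!(I::'n list) J. mset I = mset J ==> \<beta> I = \<beta> J"
 shows "(\<Sum>J\<in>multi_indices (Suc p). (\<Sum>s<length J. \<phi> (J ! s) (omit s J)) * \<beta> J)
  = (real p + 1) * (\<Sum>k\<in>UNIV. \<Sum>J\<in>multi_indices p. \<phi> k J * \<beta> (k # J))"
proof -
 have "(\<Sum>J\<in>multi_indices (Suc p). (\<Sum>s<length J. \<phi> (J ! s) (omit s J)) * \<beta> J)
   = (\<Sum>J\<in>multi_indices (Suc p). \<Sum>s<Suc p. \<phi> (J ! s) (omit s J) * \<beta> (J ! s # omit s J))"
  unfolding sum_distrib_right
 proof (intro sum.cong)
  fix J :: "'n list" and s assume "J \<in> multi_indices (Suc p)" "s \<in> {..<Suc p}"
  hence "\<beta> J = \<beta> (J ! s # omit s J)"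
   by (intro assms) (simp only: mset_omit mem_Collect_eq lessThan_iff)
  thus "\<phi> (J ! s) (omit s J) * \<beta> J = \<phi> (J ! s) (omit s J) * \<beta> (J ! s # omit s J)" by simp
 qed auto
 also have "... = (\<Sum>s<Suc p. \<Sum>k\<in>UNIV. \<Sum>J\<in>multi_indices p. \<phi> k J * \<beta> (k # J))"
  by (subst sum.swap, rule sum.cong[OF refl])
    (rule sum_multi_indices_omit[of _ p "%k J. \<phi> k J * \<beta> (k # J)"], simp)
 finally show ?thesis by simp
qed

lemma sym_comps_sym: "T \<in> sym_comps p ==> mset I = mset J ==> T I = T J"
 unfolding sym_comps_def by blast

lemma sym_comps_off: "T \<in> sym_comps p ==> length J ~= p ==> T J = 0"
 unfolding sym_comps_def by blast

lemma sym_compsI: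
 "(!!J. length J ~= p ==> T J = 0) ==> (!!I J. mset I = mset J ==> T I = T J) ==> T \<in> sym_comps p"
 unfolding sym_comps_def by blast

lemma subspace_sym_comps: "subspace (sym_comps p)"
proof (rule subspaceI)
 fix S T :: "'n comps" and a :: real
 assume S: "S \<in> sym_comps p" and T: "T \<in> sym_comps p"
 show "S + T \<in> sym_comps p"
  by (rule sym_compsI) (simp_all add: sym_comps_off[OF S] sym_comps_off[OF T], metis sym_comps_sym[OF S] sym_comps_sym[OF T])
 show "a *\<^sub>R S \<in> sym_comps p"
  by (rule sym_compsI) (simp_all add: sym_comps_off[OF S], metis sym_comps_sym[OF S])
qed (auto intro: sym_compsI)

text \<open>The polynomial function \<open>h \<mapsto> T (h, \<dots>, h, J)\<close> with \<open>q\<close> entries \<open>h\<close>.\<close>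

fun diag :: "nat => 'n::finite comps => real^'n => 'n comps" where
 "diag 0 T h J = T J"
| "diag (Suc q) T h J = (\<Sum>k\<in>UNIV. h $ k * diag q T h (k # J))"

lemma diag_add: "diag q (%J. T J + S J) h J = diag q T h J + diag q S h J"
 by (induction q arbitrary: J) (simp_all add: algebra_simps sum.distrib)

lemma diag_cmult: "diag q (%J. a * T J) h J = a * diag q T h J"
 by (induction q arbitrary: J) (simp_all add: algebra_simps sum_distrib_left)

lemma diag_diff: "diag q (%J. T J - S J) h J = diag q T h J - diag q S h J"
 using diag_add[of q T "%J. - 1 * S J" h J] diag_cmult[of q "-1" S h J] by simp

lemma diag_zero [simp]: "diag q (%_. 0) h J = 0"
 by (induction q arbitrary: J) simp_all

lemma diag_cong:
 "(!!L. length L = q + length J ==> T L = S L) ==> diag q T h J = diag q S h J"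
 by (induction q arbitrary: J) simp_all

lemma diag_bound:
 assumes "!!L. length L = q + length J ==> \<bar>T L\<bar> <= B"
 shows "\<bar>diag q T h J\<bar> <= (\<Sum>k\<in>UNIV. \<bar>h $ k\<bar>) ^ q * B"
 using assms
proof (induction q arbitrary: J)
 case (Suc q)
 have "\<bar>diag (Suc q) T h J\<bar> <= (\<Sum>k\<in>UNIV. \<bar>h $ k\<bar> * \<bar>diag q T h (k # J)\<bar>)"
  unfolding diag.simps by (rule order_trans[OF sum_abs]) (simp add: abs_mult)
 also have "... <= (\<Sum>k\<in>UNIV. \<bar>h $ k\<bar> * ((\<Sum>k\<in>UNIV. \<bar>h $ k\<bar>) ^ q * B))"
  using Suc by (intro sum_mono mult_left_mono) auto
 also have "... = (\<Sum>k\<in>UNIV. \<bar>h $ k\<bar>) ^ Suc q * B"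
  by (simp add: sum_distrib_right mult.assoc)
 finally show ?case .
qed simp

lemma diag_has_derivative_line:
 assumes "!!L. ((%t. T t L) has_real_derivative T' L) (at t within A)"
 shows "((%t. diag q (T t) h J) has_real_derivative diag q T' h J) (at t within A)"
 using assms
 by (induction q arbitrary: J) (auto intro!: DERIV_sum DERIV_cmult)

lemma diag_sym_product:
 fixes G :: "'n::finite => 'n comps"
 shows "diag q (%J. \<Sum>s<length J. G (J ! s) (omit s J)) h J
  = real q * (\<Sum>k\<in>UNIV. h $ k * diag (q - 1) (G k) h J) + (\<Sum>s<length J. diag q (G (J ! s)) h (omit s J))"
proof (induction q arbitrary: J)
 case (Suc q)
 let ?S = "%J. \<Sum>s<length J. G (J ! s) (omit s J)"
 have sw: "real q * (\<Sum>k\<in>UNIV. h $ k * (\<Sum>l\<in>UNIV. h $ l * diag (q - 1) (G l) h (k # J)))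
   = real q * (\<Sum>l\<in>UNIV. h $ l * diag q (G l) h J)"
 proof (cases q)
  case (Suc r)
  have "(\<Sum>k\<in>UNIV. h $ k * (\<Sum>l\<in>UNIV. h $ l * diag r (G l) h (k # J)))
    = (\<Sum>k\<in>UNIV. \<Sum>l\<in>UNIV. h $ k * (h $ l * diag r (G l) h (k # J)))"
   by (simp add: sum_distrib_left)
  also have "... = (\<Sum>l\<in>UNIV. h $ l * (\<Sum>k\<in>UNIV. h $ k * diag r (G l) h (k # J)))"
   by (subst sum.swap) (simp add: sum_distrib_left mult.left_commute)
  finally show ?thesis by (simp add: Suc)
 qed simp
 have "diag (Suc q) ?S h J = (\<Sum>k\<in>UNIV. h $ k * (real q * (\<Sum>l\<in>UNIV. h $ l * diag (q - 1) (G l) h (k # J))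
   + (diag q (G k) h J + (\<Sum>s<length J. diag q (G (J ! s)) h (k # omit s J)))))"
  unfolding diag.simps Suc.IH
  by (simp only: sum_omit_Cons[where f = "%k L. diag q (G k) h L"])
 also have "... = real q * (\<Sum>k\<in>UNIV. h $ k * (\<Sum>l\<in>UNIV. h $ l * diag (q - 1) (G l) h (k # J)))
   + (\<Sum>k\<in>UNIV. h $ k * diag q (G k) h J)
   + (\<Sum>k\<in>UNIV. \<Sum>s<length J. h $ k * diag q (G (J ! s)) h (k # omit s J))"
  by (simp add: distrib_left sum.distrib sum_distrib_left mult.left_commute)
 also have "(\<Sum>k\<in>UNIV. \<Sum>s<length J. h $ k * diag q (G (J ! s)) h (k # omit s J))
   = (\<Sum>s<length J. diag (Suc q) (G (J ! s)) h (omit s J))"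
  by (subst sum.swap) simp
 finally show ?case unfolding sw by (simp add: distrib_right)
qed simp

text \<open>Iterated finite differences in the coordinate directions listed in \<open>js\<close>, as a combination of the values of
 \<open>g\<close> at the points \<open>nodes d js z\<close>.\<close>

fun fdiff :: "real => 'n::finite list => (real^'n => real) => real^'n => real" where
 "fdiff d [] g z = g z"
| "fdiff d (j # js) g z = fdiff d js g (z - d *\<^sub>R axis j 1) - fdiff d js g z"

fun nodes :: "real => 'n::finite list => real^'n => (real^'n) set" where
 "nodes d [] z = {z}"
| "nodes d (j # js) z = nodes d js (z - d *\<^sub>R axis j 1) \<union> nodes d js z"

lemma fdiff_cong: "(!!w. w \<in> nodes d js z ==> g w = g' w) ==> fdiff d js g z = fdiff d js g' z"
 by (induction js arbitrary: z) auto

lemma fdiff_bound: "(!!w. w \<in> nodes d js z ==> \<bar>g w\<bar> <= B) ==> \<bar>fdiff d js g z\<bar> <= 2 ^ length js * B"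
proof (induction js arbitrary: z)
 case (Cons j js)
 have "\<bar>fdiff d js g (z - d *\<^sub>R axis j 1)\<bar> <= 2 ^ length js * B" "\<bar>fdiff d js g z\<bar> <= 2 ^ length js * B"
  using Cons by auto
 thus ?case by simp
qed simp

lemma finite_nodes: "finite (nodes d js z)"
 by (induction js arbitrary: z) auto

lemma nodes_dist:
 fixes d :: real
 shows "w \<in> nodes d js z ==> dist z w <= real (length js) * \<bar>d\<bar>"
proof (induction js arbitrary: z)
 case (Cons j js)
 then consider "w \<in> nodes d js (z - d *\<^sub>R axis j 1)" | "w \<in> nodes d js z" by auto
 thus ?case
 proof cases
  case 1
  have "dist z (z - d *\<^sub>R axis j 1) = \<bar>d\<bar>" by (simp add: dist_norm)
  with Cons.IH[OF 1] dist_triangle[of z w "z - d *\<^sub>R axis j 1"] show ?thesis by (simp add: algebra_simps)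
 next
  case 2
  with Cons.IH[OF 2] show ?thesis by (simp add: algebra_simps)
 qed
qed simp

lemma fdiff_add: "fdiff d js (%z. f z + g z) z = fdiff d js f z + fdiff d js g z"
 by (induction js arbitrary: z) auto

lemma fdiff_cmult: "fdiff d js (%z. a * f z) z = a * fdiff d js f z"
 by (induction js arbitrary: z) (auto simp: algebra_simps)

lemma fdiff_zero: "fdiff d js (%z. 0) z = 0"
 by (induction js arbitrary: z) auto

lemma fdiff_const: "fdiff d js (%z. c) z = (if js = [] then c else 0)"
 by (induction js arbitrary: z) auto

lemma fdiff_sum: "fdiff d js (%z. \<Sum>i\<in>I. f i z) z = (\<Sum>i\<in>I. fdiff d js (f i) z)"
 by (induction I rule: infinite_finite_induct) (auto simp: fdiff_zero fdiff_add)

lemma fdiff_polynomial: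
 "(!!z. real_polynomial_function (%x. g x z)) ==> real_polynomial_function (%x. fdiff d js (g x) z)"
 by (induction js arbitrary: z) auto

text \<open>A product rule: a linear factor can absorb at most one difference.\<close>

lemma fdiff_linear_factor:
 "fdiff d js (%z. (x - z) $ k * f z) z = (x - z) $ k * fdiff d js f z
  + (\<Sum>s<length js. d * (if js ! s = k then 1 else 0) * fdiff d (omit s js) f (z - d *\<^sub>R axis (js ! s) 1))"
proof (induction js arbitrary: z)
 case (Cons j js)
 define S where "S z = (\<Sum>s<length js. d * (if js ! s = k then 1 else 0) * fdiff d (omit s js) f (z - d *\<^sub>R axis (js ! s) 1))" for z
 have "fdiff d (j # js) (%z. (x - z) $ k * f z) z
   = (x - (z - d *\<^sub>R axis j 1)) $ k * fdiff d js f (z - d *\<^sub>R axis j 1) + S (z - d *\<^sub>R axis j 1)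
    - ((x - z) $ k * fdiff d js f z + S z)"
  by (simp only: fdiff.simps Cons.IH S_def)
 moreover have "S (z - d *\<^sub>R axis j 1) - S z = (\<Sum>s<length js. d * (if js ! s = k then 1 else 0) *
   fdiff d (j # omit s js) f (z - d *\<^sub>R axis (js ! s) 1))"
  unfolding S_def sum_subtractf[symmetric] fdiff.simps right_diff_distrib
  by (intro sum.cong refl) (simp add: diff_diff_eq add.commute)
 moreover have "(x - (z - d *\<^sub>R axis j 1)) $ k = (x - z) $ k + d * (if j = k then 1 else 0)"
  by (simp add: axis_def)
 ultimately have "fdiff d (j # js) (%z. (x - z) $ k * f z) z
   = (x - z) $ k * fdiff d (j # js) f z + (d * (if j = k then 1 else 0) * fdiff d js f (z - d *\<^sub>R axis j 1)
    + (\<Sum>s<length js. d * (if js ! s = k then 1 else 0) * fdiff d (j # omit s js) f (z - d *\<^sub>R axis (js ! s) 1)))"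
  by (simp only: fdiff.simps) (simp only: algebra_simps)
 thus ?case
  by (simp only: sum_omit_Cons[where f = "%i L. d * (if i = k then 1 else 0) * fdiff d L f (z - d *\<^sub>R axis i 1)"])
qed simp

text \<open>Each difference lowers the degree by one, so \<open>q\<close> differences leave the leading coefficient of a polynomial of
degree \<open>q\<close>, and further differences leave nothing.\<close>

lemma fdiff_diag:
 fixes T :: "'n::finite comps"
 assumes sym: "!!I J. mset I = mset J ==> T I = T J"
 shows "length js >= q ==> fdiff d js (%z. diag q T (x - z) J) z
  = (if length js = q then fact q * d ^ q * T (js @ J) else 0)"
proof (induction q arbitrary: js J z)
 case 0
 thus ?case by (simp add: fdiff_const)
next
 case (Suc q)
 have "fdiff d js (%z. diag (Suc q) T (x - z) J) z
   = (\<Sum>k\<in>UNIV. fdiff d js (%z. (x - z) $ k * diag q T (x - z) (k # J)) z)"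
  by (simp add: fdiff_sum)
 also have "... = (\<Sum>k\<in>UNIV. \<Sum>s<length js. d * (if js ! s = k then 1 else 0) *
   (if length js = Suc q then fact q * d ^ q * T (omit s js @ k # J) else 0))"
  unfolding fdiff_linear_factor
  by (intro sum.cong refl) (use Suc in \<open>auto intro!: sum.cong simp del: sum.lessThan_Suc\<close>)
 also have "... = (\<Sum>s<length js. if length js = Suc q then d * (fact q * d ^ q * T (omit s js @ js ! s # J)) else 0)"
  by (subst sum.swap, intro sum.cong refl) (simp add: if_distrib[of "%x. _ * x"] if_distrib[of "%x. x * _"] sum.delta cong: if_cong)
 also have "... = (\<Sum>s<length js. if length js = Suc q then d * (fact q * d ^ q * T (js @ J)) else 0)"
 proof (intro sum.cong refl)
  fix s assume "s \<in> {..<length js}"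
  hence s: "s < length js" by simp
  have "mset (omit s js @ js ! s # J) = mset (js ! s # omit s js) + mset J" by simp
  also have "... = mset (js @ J)" unfolding mset_omit[OF s] by simp
  finally have "T (omit s js @ js ! s # J) = T (js @ J)" by (rule sym)
  thus "(if length js = Suc q then d * (fact q * d ^ q * T (omit s js @ js ! s # J)) else 0)
    = (if length js = Suc q then d * (fact q * d ^ q * T (js @ J)) else 0)" by simp
 qed
 also have "... = (if length js = Suc q then fact (Suc q) * d ^ Suc q * T (js @ J) else 0)"
  by (simp add: algebra_simps)
 finally show ?case .
qed

text \<open>Polarization: a symmetric form is recovered from the values \<open>T (x - z, \<dots>, x - z)\<close> at finitely many points
 \<open>z\<close>, with coefficients that depend neither on \<open>T\<close> nor on \<open>x\<close>. The independence of \<open>x\<close> is what makes the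
 formula useful: it turns a family of identities between two points into a formula for a tensor field.\<close>

lemma polarization:
 assumes "T \<in> sym_comps p" "length J = p"
 shows "fdiff d J (%z. diag p T (x - z) []) z = fact p * d ^ p * T J"
 using fdiff_diag[OF sym_comps_sym[OF assms(1)], where q = p and js = J and J = "[]" and d = d and x = x and z = z]
  assms(2) by simp

section \<open>The operators in a flat chart\<close>

definition flat_deriv :: "'n::finite field => 'n field" where
 "flat_deriv \<alpha> y J = (\<Sum>s<length J. partial (J ! s) (%z. \<alpha> z (omit s J)) y)"

definition flat_div :: "'n::finite field => 'n field" where
 "flat_div \<alpha> y J = - (\<Sum>k\<in>UNIV. partial k (%z. \<alpha> z (k # J)) y)"

lemma sym_deriv_eq: "sym_deriv G \<alpha> y J = (\<Sum>s<length J. nabla G (J ! s) \<alpha> y (omit s J))"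
proof -
 have "sym_deriv G \<alpha> y J = (\<Sum>k\<in>UNIV. \<Sum>s<length J. axis k 1 $ (J ! s) * nabla G k \<alpha> y (omit s J))"
  by (simp add: sym_deriv_def sym_mult_def)
 also have "... = (\<Sum>s<length J. \<Sum>k\<in>UNIV. if k = J ! s then nabla G k \<alpha> y (omit s J) else 0)"
  by (subst sum.swap) (auto simp: axis_def intro!: sum.cong)
 finally show ?thesis by (simp add: sum.delta)
qed

lemma matrix_inv_mat_1: "matrix_inv (mat 1 :: real^'n::finite^'n) = mat 1"
 unfolding matrix_inv_def
 by (rule some_equality) (auto simp: matrix_mul_lid matrix_mul_rid)

context
 fixes U :: "(real^'n::finite) set" and G :: "'n metric"
 assumes U: "open U" and G: "!!y. y \<in> U ==> G y = mat 1"
begin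

lemma nabla_flat: "y \<in> U ==> nabla G k \<alpha> y J = partial k (%z. \<alpha> z J) y"
proof -
 assume y: "y \<in> U"
 have "partial l (%z. G z $ i $ j) y = 0" for i j l
  using partial_cong[OF U y, of "%z. G z $ i $ j" "%_. mat 1 $ i $ j"] G by simp
 thus ?thesis by (simp add: nabla_def christoffel_def)
qed

lemma sym_deriv_flat: "y \<in> U ==> sym_deriv G \<alpha> y = flat_deriv \<alpha> y"
 by (rule ext) (simp add: sym_deriv_eq nabla_flat flat_deriv_def)

lemma sym_div_flat: "y \<in> U ==> sym_div G \<alpha> y = flat_div \<alpha> y"
 by (rule ext)
   (simp add: sym_div_def sym_contract_def nabla_flat flat_div_def G matrix_inv_mat_1 axis_def
    if_distrib[of "%x. x * _"] sum.delta cong: if_cong)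

end

lemma sum_nth_eq_sum_mset: "(\<Sum>s<length J. g (J ! s)) = (\<Sum>i\<in>#mset J. g i)"
 by (induction J) (simp_all add: sum.lessThan_Suc_shift del: sum.lessThan_Suc)

lemma flat_deriv_sym_comps:
 assumes "!!y. \<alpha> y \<in> sym_comps p"
 shows "flat_deriv \<alpha> y \<in> sym_comps (Suc p)"
proof -
 have "flat_deriv \<alpha> y J = 0" if "length J ~= Suc p" for J
 proof -
  have "\<alpha> z (omit s J) = 0" if "s < length J" for z s
   using that \<open>length J ~= Suc p\<close> by (intro sym_comps_off[OF assms]) auto
  thus ?thesis by (simp add: flat_deriv_def)
 qed
 moreover have "flat_deriv \<alpha> y I = flat_deriv \<alpha> y J" if "mset I = mset J" for I J
 proof -
  have *: "flat_deriv \<alpha> y J = (\<Sum>i\<in>#mset J. partial i (%z. \<alpha> z (SOME L. mset L = mset J - {#i#})) y)" for J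
  proof -
   have "partial (J ! s) (%z. \<alpha> z (omit s J)) y = partial (J ! s) (%z. \<alpha> z (SOME L. mset L = mset J - {#J ! s#})) y"
    if "s < length J" for s
   proof -
    have m: "mset (omit s J) = mset J - {#J ! s#}"
    using mset_omit[OF that] by (metis add_mset_remove_trivial mset.simps(2))
    hence "mset (SOME L. mset L = mset J - {#J ! s#}) = mset J - {#J ! s#}" by (rule someI)
    hence "(%z. \<alpha> z (omit s J)) = (%z. \<alpha> z (SOME L. mset L = mset J - {#J ! s#}))"
    using m by (intro ext sym_comps_sym[OF assms]) simp
    thus ?thesis by simp
   qed
   thus ?thesis
    unfolding flat_deriv_def sum_nth_eq_sum_mset[symmetric] by (intro sum.cong) auto
  qed
  show ?thesis unfolding *[of I] *[of J] that ..
 qed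
 ultimately show ?thesis by (intro sym_compsI)
qed

lemma flat_div_sym_comps:
 assumes "!!y. \<alpha> y \<in> sym_comps p" "p >= 1"
 shows "flat_div \<alpha> y \<in> sym_comps (p - 1)"
proof -
 have "flat_div \<alpha> y J = 0" if "length J ~= p - 1" for J
  using sym_comps_off[OF assms(1), of "_ # J"] that assms(2) by (simp add: flat_div_def)
 moreover have "flat_div \<alpha> y I = flat_div \<alpha> y J" if "mset I = mset J" for I J
 proof -
  have "(%z. \<alpha> z (k # I)) = (%z. \<alpha> z (k # J))" for k
   using that by (intro ext sym_comps_sym[OF assms(1)]) simp
  thus ?thesis by (simp add: flat_div_def)
 qed
 ultimately show ?thesis by (intro sym_compsI)
qed

lemma diag_flat_deriv:
 "diag (Suc p) (flat_deriv \<alpha> y) h [] = (real p + 1) * diag p (%J. \<Sum>k\<in>UNIV. h $ k * partial k (%z. \<alpha> z J) y) h []"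
proof -
 have "diag (Suc p) (flat_deriv \<alpha> y) h []
   = (real p + 1) * (\<Sum>k\<in>UNIV. h $ k * diag p (%J. partial k (%z. \<alpha> z J) y) h [])"
  using diag_sym_product[of "Suc p" "%k J. partial k (%z. \<alpha> z J) y" h "[]"]
  by (simp add: flat_deriv_def[abs_def])
 also have "(\<Sum>k\<in>I. h $ k * diag p (%J. partial k (%z. \<alpha> z J) y) h [])
   = diag p (%J. \<Sum>k\<in>I. h $ k * partial k (%z. \<alpha> z J) y) h []" for I
  by (induction I rule: infinite_finite_induct) (simp_all add: diag_add diag_cmult)
 finally show ?thesis .
qed

lemma has_derivative_ray:
 assumes "u differentiable (at (z + t *\<^sub>R h))"
 shows "((%t. u (z + t *\<^sub>R h)) has_real_derivative (\<Sum>k\<in>UNIV. h $ k * partial k u (z + t *\<^sub>R h))) (at t within A)"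
proof -
 have ray: "((%t. z + t *\<^sub>R h) has_derivative (%s. s *\<^sub>R h)) (at t within A)"
  by (auto intro!: derivative_eq_intros)
 show ?thesis
  using has_derivative_compose[OF ray has_derivative_partials[OF assms]]
  unfolding has_field_derivative_def
  by (rule has_derivative_eq_rhs) (auto simp: sum_distrib_right sum_distrib_left mult_ac intro!: sum.cong)
qed

lemma diag_along_line:
 assumes "!!J. (%y. \<alpha> y J) differentiable (at (z + t *\<^sub>R h))"
 shows "((%t. diag p (\<alpha> (z + t *\<^sub>R h)) h []) has_real_derivative
  diag (Suc p) (flat_deriv \<alpha> (z + t *\<^sub>R h)) h [] / (real p + 1)) (at t within A)"
 unfolding diag_flat_deriv
 using diag_has_derivative_line[of "%t. \<alpha> (z + t *\<^sub>R h)", OF has_derivative_ray[OF assms]]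
 by (simp add: add_nonneg_eq_0_iff)

section \<open>Linear algebra in spaces without a finite-dimensional type\<close>

lemma inj_on_linear_iff:
 assumes "linear f" "subspace V"
 shows "inj_on f V \<longleftrightarrow> (\<forall>x\<in>V. f x = 0 --> x = 0)"
proof
 assume inj: "inj_on f V"
 show "\<forall>x\<in>V. f x = 0 --> x = 0"
  using inj_onD[OF inj, of _ 0] assms by (auto simp: linear_0 subspace_0)
next
 assume *: "\<forall>x\<in>V. f x = 0 --> x = 0"
 show "inj_on f V"
 proof (rule inj_onI)
  fix x y assume "x \<in> V" "y \<in> V" "f x = f y"
  hence "f (x - y) = 0" "x - y \<in> V" using assms by (auto simp: linear_diff subspace_diff)
  with * show "x = y" by auto
 qed
qed

lemma finite_dim_of_injective:
 fixes L :: "'v::real_vector => 'w::real_vector"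
 assumes V: "subspace V" and L: "linear L" "!!x. x \<in> V ==> L x = 0 ==> x = 0" and F: "L ` V \<subseteq> span F" "finite F"
 obtains B where "finite B" "independent B" "span B = V" "card B <= card F" "dim V = card B"
proof -
 obtain B where B: "B \<subseteq> V" "independent B" "V \<subseteq> span B" using maximal_independent_subset by blast
 have span: "span B = V" using B V by (simp add: span_subspace)
 have inj: "inj_on L (span B)" using inj_on_linear_iff[OF L(1) V] L(2) span by blast
 have "independent (L ` B)"
  using linear_independent_injective_image[OF L(1) B(2) inj] .
 hence "finite (L ` B) & card (L ` B) <= card F"
  using independent_span_bound[OF F(2)] F(1) B(1) by blast
 moreover have "inj_on L B" using inj span_superset inj_on_subset by blast
 ultimately have "finite B" "card B <= card F" by (auto simp: finite_image_iff card_image)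
 thus ?thesis using that B(2) span dim_eq_card[of B V] V by (simp add: span_eq_iff[THEN iffD2])
qed

lemma finite_support_in_span:
 fixes f :: "'a => real"
 assumes "finite S" "!!x. x \<notin> S ==> f x = 0"
 shows "f \<in> span ((%s x. if x = s then 1 else 0) ` S)"
proof -
 have "f = (\<Sum>s\<in>S. f s *\<^sub>R (%x. if x = s then 1 else 0))"
 proof
  fix x
  have "(\<Sum>s\<in>S. f s *\<^sub>R (%x. if x = s then 1 else 0)) x = (\<Sum>s\<in>S. if x = s then f s else 0)"
   unfolding sum_fun_apply by (rule sum.cong) auto
  thus "f x = (\<Sum>s\<in>S. f s *\<^sub>R (%x. if x = s then 1 else 0)) x"
   using assms by auto
 qed
 moreover have "(\<Sum>s\<in>S. f s *\<^sub>R (%x. if x = s then 1 else 0)) \<in> span ((%s x. if x = s then 1 else (0::real)) ` S)"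
  by (intro span_sum span_scale span_base) auto
 ultimately show ?thesis by simp
qed

text \<open>Rank-nullity for a subspace of a possibly infinite-dimensional space, such as a space of tensor
fields, that lies in the span of a finite set.\<close>

lemma dim_kernel_image:
 fixes f :: "'v::real_vector => 'w::real_vector"
 assumes f: "linear f" and V: "subspace V" and fin: "finite A" "V \<subseteq> span A"
 shows "dim V = dim (f ` V) + dim {x \<in> V. f x = 0}"
proof -
 let ?N = "{x \<in> V. f x = 0}"
 have N: "subspace ?N"
  using V f by (auto simp: subspace_def linear_0 linear_add linear_scale)
 obtain C where C: "C \<subseteq> ?N" "independent C" "?N \<subseteq> span C" using maximal_independent_subset by blast
 obtain B where B: "C \<subseteq> B" "B \<subseteq> V" "independent B" "V \<subseteq> span B"
  using maximal_independent_subset_extend[of C V] C by blast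
 define D where "D = B - C"
 have finB: "finite B" using independent_span_bound[OF fin(1) B(3)] B(2) fin(2) by blast
 obtain g where g: "linear g" "\<forall>x\<in>B. g x = (if x \<in> D then x else 0)"
  using linear_independent_extend[OF B(3), of "%x. if x \<in> D then x else 0"] by auto
 have gC: "g x = 0" if "x \<in> span C" for x
 proof (rule linear_eq_0_on_span[OF g(1) _ that])
  show "g x = 0" if "x \<in> C" for x using g(2) B(1) that by (auto simp: D_def)
 qed
 have gD: "g x = x" if "x \<in> span D" for x
 proof (rule linear_eq_on[OF g(1) linear_ident that])
  show "g x = x" if "x \<in> D" for x using g(2) that by (auto simp: D_def)
 qed
 have spanD: "span D \<subseteq> V" using B(2) V by (metis D_def Diff_subset span_minimal subset_trans)
 have inj: "inj_on f (span D)"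
  unfolding inj_on_linear_iff[OF f subspace_span]
 proof (intro ballI impI)
  fix x assume "x \<in> span D" "f x = 0"
  hence "x \<in> span C" using C(3) spanD by blast
  thus "x = 0" using gC gD \<open>x \<in> span D\<close> by metis
 qed
 have indD: "independent D" using B(3) by (metis D_def Diff_subset independent_mono)
 have "independent (f ` D)" using linear_independent_injective_image[OF f indD inj] .
 moreover have "span (f ` D) = span (f ` V)"
 proof
  show "span (f ` D) \<subseteq> span (f ` V)" using spanD span_superset by (intro span_mono image_mono) blast
  have "f ` V \<subseteq> span (f ` D)"
  proof
   fix w assume "w \<in> f ` V"
   then obtain x where x: "x \<in> span B" "w = f x" using B(4) by blast
   have "f b \<in> span (f ` D)" if "b \<in> B" for b
    using that C(1) by (cases "b \<in> C") (auto simp: D_def span_zero intro: span_base)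
   hence "f ` B \<subseteq> span (f ` D)" by blast
   hence "span (f ` B) \<subseteq> span (f ` D)" by (simp add: span_minimal)
   thus "w \<in> span (f ` D)" using x linear_span_image[OF f, of B] by blast
  qed
  thus "span (f ` V) \<subseteq> span (f ` D)" by (simp add: span_minimal)
 qed
 ultimately have 1: "dim (f ` V) = card (f ` D)" by (metis dim_eq_card)
 have "inj_on f D" using inj span_superset inj_on_subset by blast
 hence 2: "card (f ` D) = card D" by (rule card_image)
 have 3: "dim ?N = card C" using C dim_unique by blast
 have 4: "dim V = card B" using B dim_unique by blast
 have "card B = card D + card C"
  using finB B(1) by (simp add: D_def card_Diff_subset finite_subset card_mono)
 with 1 2 3 4 show ?thesis by simp
qed

text \<open>Representing the second basis modulo \<open>N\<close> in the span of the first is injective, which gives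
the inequality of cardinalities and makes the dimension modulo \<open>N\<close> well defined.\<close>

lemma basis_mod_card_le:
 assumes B: "basis_mod W N B" "finite B" and B': "basis_mod W N B'" and N: "subspace N"
 shows "finite B'" "card B' <= card B"
proof -
 have "\<forall>b\<in>B'. \<exists>c\<in>span B. b - c \<in> N" using B(1) B' unfolding basis_mod_def by blast
 then obtain \<phi> where \<phi>: "!!b. b \<in> B' ==> \<phi> b \<in> span B & b - \<phi> b \<in> N" by metis
 have ind: "independent B'" using B' unfolding basis_mod_def by blast
 obtain g where g: "linear g" "\<forall>x\<in>B'. g x = \<phi> x"
  using linear_independent_extend[OF ind, of \<phi>] by auto
 have "subspace {x. x - g x \<in> N}"
  using g(1) N by (auto simp: subspace_def linear_0 linear_add linear_scale algebra_simps simp flip: scaleR_diff_right)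
   (metis add_diff_add subspace_add)+
 hence "span B' \<subseteq> {x. x - g x \<in> N}"
  by (rule span_minimal[rotated]) (use g \<phi> in auto)
 hence "inj_on g (span B')"
  unfolding inj_on_linear_iff[OF g(1) subspace_span]
  using B' unfolding basis_mod_def by (auto simp: subset_iff)
 hence "independent (g ` B')" "inj_on g B'"
  using linear_independent_injective_image[OF g(1) ind] span_superset inj_on_subset by blast+
 moreover have "g ` B' \<subseteq> span B" using g \<phi> by auto
 ultimately have "finite (g ` B')" "card (g ` B') <= card B"
  using independent_span_bound[OF B(2)] by blast+
 with \<open>inj_on g B'\<close> show "finite B'" "card B' <= card B"
  by (auto simp: finite_image_iff card_image)
qed

lemma dim_mod_eq_card:
 assumes "basis_mod W N B" "finite B" "subspace N"
 shows "dim_mod W N = card B"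
proof -
 have "basis_mod W N (SOME B. basis_mod W N B)" using assms(1) by (rule someI)
 thus ?thesis
  unfolding dim_mod_def using basis_mod_card_le[OF _ _ _ assms(3)] assms(1,2) by (meson antisym)
qed

section \<open>Unique continuation\<close>

text \<open>A Killing-type equation with right-hand side bounded by the tensor itself propagates zeros outwards, by
steps of a fixed size \<open>\<epsilon>\<close>. In the ball of radius \<open>r + \<epsilon>\<close> choose a point \<open>w\<close> where the tensor is largest.
Polarization recovers the tensor at \<open>w\<close> from its increments along the segments from nodes close to the centre,
where the tensor vanishes. Only a piece of each segment of length of order \<open>\<epsilon>\<close> leaves the ball of radius \<open>r\<close>, and
there the increment is bounded by \<open>\<epsilon>\<close> times the maximum; for small \<open>\<epsilon>\<close> the maximum is zero.\<close>

lemma unique_continuation_ball: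
 fixes \<alpha> :: "'n::finite field"
 assumes sym: "!!y. y \<in> ball z0 R ==> \<alpha> y \<in> sym_comps p"
  and diff: "!!J y. y \<in> ball z0 R ==> (%y. \<alpha> y J) differentiable (at y)"
  and bound: "!!y L. y \<in> ball z0 R ==> length L = Suc p ==>
   \<bar>flat_deriv \<alpha> y L\<bar> <= C * (\<Sum>J\<in>multi_indices p. \<bar>\<alpha> y J\<bar>)"
  and zero: "!!y. y \<in> ball z0 \<rho> ==> \<alpha> y = 0" and \<rho>: "0 < \<rho>" "\<rho> <= R" and y: "y \<in> ball z0 R"
 shows "\<alpha> y = 0"
proof (cases "y \<in> ball z0 \<rho>")
 case False
 define N where "N y = (\<Sum>J\<in>multi_indices p. \<bar>\<alpha> y J\<bar>)" for y
 define R' where "R' = (dist z0 y + R) / 2"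
 have R': "dist z0 y < R'" "R' < R" "\<rho> < R'" using False y by (auto simp: R'_def)
 define d where "d = \<rho> / (2 * (real p + 1))"
 define H where "H = real CARD('n) * (2 * R)"
 define \<kappa> where "\<kappa> = real (card (multi_indices p :: 'n list set)) * (2 ^ p * (4 / \<rho> * (H ^ Suc p * C)) / d ^ p)"
 have d: "d > 0" "p * \<bar>d\<bar> <= \<rho> / 2" using \<rho> by (auto simp: d_def field_simps)
 have C: "0 <= C \<or> N y = 0" if "y \<in> ball z0 R" for y
 proof (rule ccontr)
  assume *: "~ ?thesis"
  have "0 <= N y" by (simp add: N_def sum_nonneg)
  with * have "C < 0" "N y > 0" by auto
  hence "C * N y < 0" by (rule mult_neg_pos)
  moreover have "0 <= C * N y"
   using bound[OF that, of "replicate (Suc p) undefined"] by (simp add: N_def del: replicate_Suc)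
  ultimately show False by simp
 qed
 have N0: "\<alpha> y = 0" if "N y = 0" "y \<in> ball z0 R" for y
 proof
  fix J
  have "\<bar>\<alpha> y J\<bar> = 0" if "length J = p"
   using that \<open>N y = 0\<close> by (simp add: N_def sum_nonneg_eq_0_iff)
  thus "\<alpha> y J = 0 J" using sym_comps_off[OF sym[OF that(2)], of J] by fastforce
 qed
 have step: "\<alpha> x = 0"
  if r: "\<rho> <= r" "r + \<epsilon> <= R'" and \<epsilon>: "0 < \<epsilon>" "\<epsilon> <= \<rho> / 4" "\<kappa> * \<epsilon> < 1"
   and IH: "!!y. y \<in> ball z0 r ==> \<alpha> y = 0" and x: "x \<in> ball z0 (r + \<epsilon>)" for r \<epsilon> x
 proof (rule ccontr)
  assume "\<alpha> x ~= 0"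
  let ?B = "cball z0 (r + \<epsilon>)"
  have B: "?B \<subseteq> ball z0 R" using r R' by auto
  have "continuous_on ?B N"
   unfolding N_def
   by (intro continuous_intros continuous_at_imp_continuous_on ballI differentiable_imp_continuous_within diff)
    (use B in blast)
  moreover have "?B ~= {}" using x zero_le_dist[of z0 x] by (auto simp del: zero_le_dist)
  ultimately obtain w where w: "w \<in> ?B" "!!y. y \<in> ?B ==> N y <= N w"
   using continuous_attains_sup[of ?B N] by auto
  have "N w > 0"
  proof -
   have "x \<in> ball z0 R" by (rule subsetD[OF B]) (use x in simp)
   hence "N x ~= 0" using N0[of x] \<open>\<alpha> x ~= 0\<close> by blast
   moreover have "N x >= 0" by (simp add: N_def sum_nonneg)
   ultimately have "N x > 0" by simp
   thus ?thesis using w(2)[of x] x by auto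
  qed
  hence C0: "C >= 0" using C[of w] w(1) B by auto
  have H0: "H >= 0" using \<rho> by (simp add: H_def)
  have node: "\<bar>diag p (\<alpha> w) (w - z) []\<bar> <= 4 / \<rho> * \<epsilon> * (H ^ Suc p * C * N w)" if z: "dist z0 z <= \<rho> / 2" for z
  proof -
   define h where "h = w - z"
   define a where "a = r + \<epsilon> - \<rho> / 2"
   define g where "g t = diag p (\<alpha> (z + t *\<^sub>R h)) h []" for t
   have a: "a >= \<rho> / 2" using r \<epsilon> by (simp add: a_def)
   have point: "dist z0 (z + t *\<^sub>R h) <= \<rho> / 2 + t * a" if "0 <= t" "t <= 1" for t
   proof -
    have "z + t *\<^sub>R h - z0 = (1 - t) *\<^sub>R (z - z0) + t *\<^sub>R (w - z0)"
    by (simp add: h_def algebra_simps)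
    hence "norm (z + t *\<^sub>R h - z0) <= (1 - t) * norm (z - z0) + t * norm (w - z0)"
    using that by (metis norm_triangle_ineq norm_scaleR abs_of_nonneg diff_ge_0_iff_ge)
    also have "... <= (1 - t) * (\<rho> / 2) + t * (r + \<epsilon>)"
    using that z w(1) by (intro add_mono mult_left_mono) (auto simp: dist_norm norm_minus_commute)
    also have "... = \<rho> / 2 + t * a" by (simp add: a_def algebra_simps diff_divide_distrib add_divide_distrib)
    finally show ?thesis by (simp add: dist_norm norm_minus_commute)
   qed
   have in_B: "z + t *\<^sub>R h \<in> ?B" if "0 <= t" "t <= 1" for t
   proof -
    have "t * a <= 1 * a" using that a \<rho> by (intro mult_right_mono) auto
    thus ?thesis using point[OF that] by (simp add: a_def)
   qed
   define t0 where "t0 = 1 - 2 * \<epsilon> / a"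
   have a0: "a > 0" using a \<rho> by simp
   have t0: "0 <= t0" "t0 < 1" using a0 a \<epsilon> \<rho> by (auto simp: t0_def field_simps)
   have "t0 * a = a - 2 * \<epsilon>" using a0 by (simp add: t0_def field_simps)
   hence "z + t0 *\<^sub>R h \<in> ball z0 r"
    using point[of t0] t0 \<epsilon> by (simp add: a_def)
   hence g0: "g t0 = 0" using IH by (simp add: g_def zero_fun_def)
   have "(g has_real_derivative diag (Suc p) (flat_deriv \<alpha> (z + t *\<^sub>R h)) h [] / (real p + 1)) (at t)"
    if "t0 <= t" "t <= 1" for t
    unfolding g_def by (intro diag_along_line diff) (use in_B[of t] that t0 B in auto)
   from MVT2[OF t0(2) this] obtain t where t: "t0 < t" "t < 1"
    and g1: "g 1 - g t0 = (1 - t0) * (diag (Suc p) (flat_deriv \<alpha> (z + t *\<^sub>R h)) h [] / (real p + 1))"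
    by blast
   let ?y = "z + t *\<^sub>R h"
   have yB: "?y \<in> ?B" using in_B t t0 by auto
   have "\<bar>flat_deriv \<alpha> ?y L\<bar> <= C * N w" if "length L = Suc p" for L
   proof -
    have "\<bar>flat_deriv \<alpha> ?y L\<bar> <= C * N ?y" unfolding N_def using bound that yB B by blast
    also have "... <= C * N w" using w(2)[OF yB] C0 by (intro mult_left_mono)
    finally show ?thesis .
   qed
   hence "\<bar>diag (Suc p) (flat_deriv \<alpha> ?y) h []\<bar> <= (\<Sum>k\<in>UNIV. \<bar>h $ k\<bar>) ^ Suc p * (C * N w)"
    by (intro diag_bound) auto
   also have "... <= H ^ Suc p * (C * N w)"
   proof -
    have "norm h <= dist z0 w + dist z0 z" unfolding h_def using norm_triangle_ineq4[of "w - z0" "z - z0"]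
    by (simp add: dist_norm norm_minus_commute)
    also have "... <= 2 * R" using z w(1) r R' \<rho> by auto
    finally have "norm h <= 2 * R" .
    hence "\<bar>h $ k\<bar> <= 2 * R" for k using component_le_norm_cart[of h k] by linarith
    hence "(\<Sum>k\<in>UNIV. \<bar>h $ k\<bar>) <= H"
    using sum_bounded_above[of UNIV "%k. \<bar>h $ k\<bar>" "2 * R"] by (simp add: H_def)
    thus ?thesis using C0 \<open>N w > 0\<close> by (intro mult_right_mono power_mono) (auto intro: sum_nonneg)
   qed
   finally have D: "\<bar>diag (Suc p) (flat_deriv \<alpha> ?y) h []\<bar> <= H ^ Suc p * (C * N w)" .
   have "\<bar>g 1\<bar> = (1 - t0) * (\<bar>diag (Suc p) (flat_deriv \<alpha> ?y) h []\<bar> / (real p + 1))"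
    using g1 g0 t0 by (simp add: abs_mult)
   also have "... <= (4 / \<rho> * \<epsilon>) * (H ^ Suc p * (C * N w))"
   proof (intro mult_mono)
    have "2 * \<epsilon> / a <= 2 * \<epsilon> / (\<rho> / 2)" using a \<rho> \<epsilon> by (intro divide_left_mono) auto
    thus "1 - t0 <= 4 / \<rho> * \<epsilon>" by (simp add: t0_def)
    have "\<bar>diag (Suc p) (flat_deriv \<alpha> ?y) h []\<bar> / (real p + 1) <= \<bar>diag (Suc p) (flat_deriv \<alpha> ?y) h []\<bar> / 1"
    by (intro divide_left_mono) auto
    thus "\<bar>diag (Suc p) (flat_deriv \<alpha> ?y) h []\<bar> / (real p + 1) <= H ^ Suc p * (C * N w)"
    using D by simp
   qed (use \<epsilon> \<rho> in auto)
   finally show ?thesis by (simp add: g_def h_def mult.assoc)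
  qed
  have comp: "\<bar>\<alpha> w J\<bar> <= 2 ^ p * (4 / \<rho> * \<epsilon> * (H ^ Suc p * C * N w)) / d ^ p" if J: "length J = p" for J
  proof -
   have "fact p * d ^ p * \<bar>\<alpha> w J\<bar> = \<bar>fdiff d J (%z. diag p (\<alpha> w) (w - z) []) z0\<bar>"
    using d w(1) B by (subst polarization[OF sym J]) (auto simp: abs_mult)
   also have "... <= 2 ^ length J * (4 / \<rho> * \<epsilon> * (H ^ Suc p * C * N w))"
    by (intro fdiff_bound node) (rule order_trans[OF nodes_dist], assumption, use J d in simp)
   finally have *: "fact p * (d ^ p * \<bar>\<alpha> w J\<bar>) <= 2 ^ p * (4 / \<rho> * \<epsilon> * (H ^ Suc p * C * N w))"
    unfolding J by (simp only: mult.assoc)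
   have "1 * (d ^ p * \<bar>\<alpha> w J\<bar>) <= fact p * (d ^ p * \<bar>\<alpha> w J\<bar>)"
    using d by (intro mult_right_mono) (auto simp: fact_ge_1)
   from order_trans[OF this *] show ?thesis
    unfolding pos_le_divide_eq[OF zero_less_power[OF d(1)]] by (simp only: mult_1 mult.commute[of _ "d ^ p"])
  qed
  have "N w <= real (card (multi_indices p :: 'n list set)) * (2 ^ p * (4 / \<rho> * \<epsilon> * (H ^ Suc p * C * N w)) / d ^ p)"
   unfolding N_def[of w] by (rule sum_bounded_above) (use comp in \<open>auto simp: N_def\<close>)
  also have "... = (\<kappa> * \<epsilon>) * N w" by (simp add: \<kappa>_def mult_ac)
  also have "... < 1 * N w" using \<open>N w > 0\<close> \<epsilon> by (intro mult_strict_right_mono) auto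
  finally show False by simp
 qed
 obtain n :: nat where n: "real n > max (\<kappa> * (R' - \<rho>)) (4 * (R' - \<rho>) / \<rho>)" "n > 0"
  by (metis gr0I less_add_same_cancel1 max_less_iff_conj of_nat_add of_nat_less_iff order_less_trans reals_Archimedean2 zero_less_one add_pos_pos of_nat_0_less_iff)
 define \<epsilon> where "\<epsilon> = (R' - \<rho>) / real n"
 have \<epsilon>: "0 < \<epsilon>" "\<epsilon> <= \<rho> / 4" "\<kappa> * \<epsilon> < 1" "\<rho> + real n * \<epsilon> = R'"
  using n R' \<rho> by (auto simp: \<epsilon>_def field_simps)
 have "m <= n ==> \<forall>y\<in>ball z0 (\<rho> + real m * \<epsilon>). \<alpha> y = 0" for m
 proof (induction m)
  case 0
  thus ?case using zero by auto
 next
  case (Suc m)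
  have "real (Suc m) * \<epsilon> <= real n * \<epsilon>" using Suc.prems \<epsilon>(1) by (intro mult_right_mono) auto
  hence "\<rho> + real m * \<epsilon> + \<epsilon> <= R'" using \<epsilon>(4) by (simp add: algebra_simps)
  moreover have "\<rho> <= \<rho> + real m * \<epsilon>" using \<epsilon>(1) by simp
  ultimately have "\<forall>y\<in>ball z0 (\<rho> + real m * \<epsilon> + \<epsilon>). \<alpha> y = 0"
   using step[of "\<rho> + real m * \<epsilon>" \<epsilon>] Suc \<epsilon> by (meson Suc_leD)
  thus ?case by (simp add: algebra_simps)
 qed
 from this[of n] show ?thesis using \<epsilon>(4) R'(1) by auto
qed (use zero in auto)

section \<open>Killing tensors on Euclidean space are polynomial\<close>

text \<open>The conservation law of a Killing tensor along the segment between two points.\<close>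

lemma killing_two_points:
 assumes S: "convex S" "x \<in> S" "z \<in> S"
  and diff: "!!J y. y \<in> S ==> (%y. \<alpha> y J) differentiable (at y)" and kill: "!!y. y \<in> S ==> flat_deriv \<alpha> y = 0"
 shows "diag p (\<alpha> x) (x - z) [] = diag p (\<alpha> z) (x - z) []"
proof -
 define g where "g t = diag p (\<alpha> (z + t *\<^sub>R (x - z))) (x - z) []" for t
 have in_S: "z + t *\<^sub>R (x - z) \<in> S" if "t \<in> {0..1}" for t
  using convexD[OF S(1) S(3) S(2), of "1 - t" t] that by (simp add: algebra_simps)
 have "(g has_real_derivative 0) (at t within {0..1})" if t: "t \<in> {0..1}" for t
 proof -
  have "(g has_real_derivative diag (Suc p) (flat_deriv \<alpha> (z + t *\<^sub>R (x - z))) (x - z) [] / (real p + 1)) (at t within {0..1})"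
   unfolding g_def by (intro diag_along_line diff in_S t)
  moreover have "diag (Suc p) (flat_deriv \<alpha> (z + t *\<^sub>R (x - z))) (x - z) [] = 0"
   unfolding kill[OF in_S[OF t]] zero_fun_def by (rule diag_zero)
  ultimately show ?thesis by simp
 qed
 then obtain c where "\<forall>t\<in>{0..1}. g t = c"
  using has_field_derivative_zero_constant[of "{0..1}" g] by auto
 hence "g 1 = g 0" by auto
 thus ?thesis by (simp add: g_def)
qed

text \<open>The tensor field recovered by polarization from the values of \<open>\<alpha>\<close> at the nodes around \<open>z\<close>.\<close>

definition interpolant :: "nat => real => real^'n::finite => 'n field => 'n field" where
 "interpolant p d z \<alpha> x J =
   (if length J = p then fdiff d J (%w. diag p (\<alpha> w) (x - w) []) z / (fact p * d ^ p) else 0)"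

lemma interpolant_eq:
 assumes "\<alpha> x \<in> sym_comps p" "d > 0"
  and "!!J w. length J = p ==> w \<in> nodes d J z ==> diag p (\<alpha> x) (x - w) [] = diag p (\<alpha> w) (x - w) []"
 shows "interpolant p d z \<alpha> x = \<alpha> x"
proof
 fix J
 show "interpolant p d z \<alpha> x J = \<alpha> x J"
 proof (cases "length J = p")
  case True
  have "fdiff d J (%w. diag p (\<alpha> w) (x - w) []) z = fdiff d J (%w. diag p (\<alpha> x) (x - w) []) z"
   by (rule fdiff_cong) (use assms(3)[OF True] in simp)
  thus ?thesis
   using assms(2) True by (simp add: interpolant_def polarization[OF assms(1) True])
 qed (use sym_comps_off[OF assms(1)] in \<open>simp add: interpolant_def\<close>)
qed

lemma linear_interpolant:
 fixes z :: "real^'n::finite"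
 shows "linear (interpolant p d z)"
proof (rule linearI)
 fix \<alpha> \<beta> :: "'n field" and a :: real
 show "interpolant p d z (\<alpha> + \<beta>) = interpolant p d z \<alpha> + interpolant p d z \<beta>"
  by (intro ext) (simp add: interpolant_def plus_fun_def diag_add fdiff_add add_divide_distrib)
 show "interpolant p d z (a *\<^sub>R \<alpha>) = a *\<^sub>R interpolant p d z \<alpha>"
  by (intro ext) (simp add: interpolant_def scaleR_fun_def diag_cmult fdiff_cmult)
qed

lemma polynomial_nth_diff: "real_polynomial_function (%x. (x - w) $ k)"
 unfolding vector_minus_component
 by (rule real_polynomial_function_diff[OF real_polynomial_function.intros(1)[OF bounded_linear_vec_nth]
   real_polynomial_function.intros(2)])

lemma polynomial_diag: "real_polynomial_function (%x. diag q T (x - w) J)"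
proof (induction q arbitrary: J)
 case (Suc q)
 show ?case unfolding diag.simps
  by (intro real_polynomial_function_sum real_polynomial_function.intros(4) polynomial_nth_diff Suc.IH finite)
qed (simp add: real_polynomial_function.intros(2))

lemma polynomial_interpolant: "real_polynomial_function (%x. interpolant p d z \<alpha> x J)"
proof (cases "length J = p")
 case True
 thus ?thesis
  unfolding interpolant_def
  by simp (intro real_polynomial_function_divide fdiff_polynomial polynomial_diag)
qed (simp add: interpolant_def real_polynomial_function.intros(2))

lemma polynomial_partial:
 fixes q :: "real^'n::finite => real"
 assumes "real_polynomial_function q"
 shows "real_polynomial_function (partial k q)"
 using assms
proof induction
 case (linear f)
 hence "partial k f = (%_. f (axis k 1))"
  by (intro ext partial_eq_derivative bounded_linear_imp_has_derivative)
 thus ?case by (simp add: real_polynomial_function.intros(2))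
next
 case (const c)
 have "partial k (%_. c) = (%_::real^'n. 0)" by (simp add: fun_eq_iff)
 thus ?case by (simp add: real_polynomial_function.intros(2))
next
 case (add f g)
 hence "partial k (%x. f x + g x) = (%x. partial k f x + partial k g x)"
  by (intro ext partial_add differentiable_at_real_polynomial_function)
 with add show ?case by (simp add: real_polynomial_function.intros(3))
next
 case (mult f g)
 hence "partial k (%x. f x * g x) = (%x. partial k f x * g x + f x * partial k g x)"
  by (intro ext partial_mult differentiable_at_real_polynomial_function)
 with mult show ?case by (simp add: real_polynomial_function.intros(3) real_polynomial_function.intros(4))
qed

lemma polynomial_smooth:
 fixes q :: "real^'n::finite => real"
 assumes "real_polynomial_function q"
 shows "smooth_on S q"
proof (rule smooth_on_subset[of UNIV])
 show "smooth_on UNIV q"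
  by (rule smooth_on_coinduct[where R = real_polynomial_function])
    (use assms polynomial_partial differentiable_at_real_polynomial_function in blast)+
qed simp

lemma polynomial_zero_on_ball:
 fixes q :: "'v::real_normed_vector => real"
 assumes q: "real_polynomial_function q" and "r > 0" and zero: "!!y. y \<in> ball z r ==> q y = 0"
 shows "q y = 0"
proof -
 define c where "c t = q (z + t *\<^sub>R (y - z))" for t :: real
 have "polynomial_function (%t. z + t *\<^sub>R (y - z))"
  by (intro polynomial_function_add polynomial_function_const polynomial_function_bounded_linear
    bounded_linear_scaleR_left)
 hence "real_polynomial_function c"
  using real_polynomial_function_compose[OF _ q] by (simp add: c_def[abs_def] comp_def)
 then obtain a n where a: "c = (%t. \<Sum>i\<le>n. a i * t ^ i)"
  using real_polynomial_function_iff_sum by blast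
 define e where "e = r / (norm (y - z) + 1)"
 have pos: "norm (y - z) + 1 > 0" using norm_ge_zero[of "y - z"] by linarith
 have e: "e > 0" using \<open>r > 0\<close> pos by (simp add: e_def)
 have "c t = 0" if "t \<in> {0<..<e}" for t
 proof -
  have "norm (t *\<^sub>R (y - z)) <= t * (norm (y - z) + 1)" using that by (simp add: distrib_left)
  also have "... < e * (norm (y - z) + 1)" using that pos by (intro mult_strict_right_mono) auto
  also have "... = r" using pos by (simp add: e_def)
  finally show ?thesis unfolding c_def by (intro zero) (simp add: dist_norm)
 qed
 hence "{0<..<e} \<subseteq> {t. (\<Sum>i\<le>n. a i * t ^ i) = 0}" by (auto simp: a)
 moreover have "infinite {0<..<e}" using e by simp
 ultimately have "~ finite {t. (\<Sum>i\<le>n. a i * t ^ i) = 0}" using finite_subset by blast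
 hence "\<forall>i\<le>n. a i = 0" unfolding polyfun_finite_roots by blast
 hence "c 1 = 0" by (simp add: a)
 thus ?thesis by (simp add: c_def)
qed

text \<open>The divergence-free Killing tensors of Euclidean space.\<close>

definition flat_killing :: "nat => 'n::finite field set" where
 "flat_killing p = {P. (\<forall>y. P y \<in> sym_comps p) & (\<forall>J. smooth_on UNIV (%y. P y J)) &
   (\<forall>y. flat_deriv P y = 0 & flat_div P y = 0)}"

lemma flat_deriv_add:
 assumes "!!J. (%y. \<alpha> y J) differentiable (at y)" "!!J. (%y. \<beta> y J) differentiable (at y)"
 shows "flat_deriv (\<alpha> + \<beta>) y = flat_deriv \<alpha> y + flat_deriv \<beta> y" "flat_div (\<alpha> + \<beta>) y = flat_div \<alpha> y + flat_div \<beta> y"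
 by (auto simp: fun_eq_iff flat_deriv_def flat_div_def partial_add[OF assms] sum.distrib)

lemma flat_deriv_scale:
 assumes "!!J. (%y. \<alpha> y J) differentiable (at y)"
 shows "flat_deriv (a *\<^sub>R \<alpha>) y = a *\<^sub>R flat_deriv \<alpha> y" "flat_div (a *\<^sub>R \<alpha>) y = a *\<^sub>R flat_div \<alpha> y"
 by (auto simp: fun_eq_iff flat_deriv_def flat_div_def partial_cmult[OF assms] sum_distrib_left)

lemma subspace_flat_killing: "subspace (flat_killing p :: 'n::finite field set)"
proof (rule subspaceI)
 have "flat_deriv 0 y = 0" "flat_div 0 y = 0" for y :: "real^'n"
  by (auto simp: fun_eq_iff flat_deriv_def flat_div_def)
 thus "0 \<in> (flat_killing p :: 'n field set)"
  using subspace_0[OF subspace_sym_comps] by (simp add: flat_killing_def)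
next
 fix \<alpha> \<beta> :: "'n field" and a :: real
 assume \<alpha>: "\<alpha> \<in> flat_killing p" and \<beta>: "\<beta> \<in> flat_killing p"
 have sm: "smooth_on UNIV (%y. \<alpha> y J)" "smooth_on UNIV (%y. \<beta> y J)" for J
  using \<alpha> \<beta> unfolding flat_killing_def by simp_all
 have diff: "(%y. \<alpha> y J) differentiable (at y)" "(%y. \<beta> y J) differentiable (at y)" for J y
  using smooth_on_differentiable[OF sm(1) UNIV_I] smooth_on_differentiable[OF sm(2) UNIV_I] .
 have sym: "\<alpha> y \<in> sym_comps p" "\<beta> y \<in> sym_comps p"
  and zero: "flat_deriv \<alpha> y = 0" "flat_div \<alpha> y = 0" "flat_deriv \<beta> y = 0" "flat_div \<beta> y = 0" for y
  using \<alpha> \<beta> unfolding flat_killing_def by simp_all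
 show "\<alpha> + \<beta> \<in> flat_killing p"
  unfolding flat_killing_def mem_Collect_eq flat_deriv_add[of \<alpha> _ \<beta>, OF diff]
  using subspace_add[OF subspace_sym_comps sym] smooth_on_add[OF open_UNIV sm] by (simp add: zero)
 show "a *\<^sub>R \<alpha> \<in> flat_killing p"
  unfolding flat_killing_def mem_Collect_eq flat_deriv_scale[of \<alpha>, OF diff(1)]
  using subspace_scale[OF subspace_sym_comps sym(1)] smooth_on_mult[OF open_UNIV smooth_on_const sm(1)] by (simp add: zero)
qed

lemma nodes_ball:
 assumes "length J = p" "w \<in> nodes d J z" "real p * \<bar>d\<bar> < r"
 shows "w \<in> ball z r"
 using nodes_dist[OF assms(2)] assms by simp

text \<open>A divergence-free Killing tensor on a ball agrees there with its interpolant, which is polynomial and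
 therefore a divergence-free Killing tensor on the whole space.\<close>

lemma killing_ball_interpolant:
 fixes \<alpha> :: "'n::finite field"
 assumes sym: "!!y. y \<in> ball z r ==> \<alpha> y \<in> sym_comps p"
  and diff: "!!J y. y \<in> ball z r ==> (%y. \<alpha> y J) differentiable (at y)"
  and kill: "!!y. y \<in> ball z r ==> flat_deriv \<alpha> y = 0" and d: "d > 0" "real p * d < r"
 shows "y \<in> ball z r ==> interpolant p d z \<alpha> y = \<alpha> y"
  and "(!!y. y \<in> ball z r ==> flat_div \<alpha> y = 0) ==> interpolant p d z \<alpha> \<in> flat_killing p"
proof -
 let ?P = "interpolant p d z \<alpha>"
 have eq: "?P y = \<alpha> y" if y: "y \<in> ball z r" for y
 proof (rule interpolant_eq)
  show "\<alpha> y \<in> sym_comps p" "d > 0" using sym[OF y] d(1) .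
  fix J w assume "length J = p" "w \<in> nodes d J z"
  hence "w \<in> ball z r" using nodes_ball d by (metis abs_of_pos)
  thus "diag p (\<alpha> y) (y - w) [] = diag p (\<alpha> w) (y - w) []"
   using killing_two_points[of "ball z r"] y diff kill by blast
 qed
 thus "y \<in> ball z r ==> ?P y = \<alpha> y" .
 have r: "r > 0" using d by (meson less_le_not_le linorder_not_less mult_nonneg_nonneg of_nat_0_le_iff order_less_le_trans)
 have poly: "real_polynomial_function (%y. ?P y J)" for J by (rule polynomial_interpolant)
 assume div: "!!y. y \<in> ball z r ==> flat_div \<alpha> y = 0"
 have part: "partial k (%y. ?P y J) y = partial k (%y. \<alpha> y J) y" if "y \<in> ball z r" for k J y
  by (rule partial_cong[OF open_ball that]) (simp add: eq)
 have "?P y \<in> sym_comps p" for y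
 proof (rule sym_compsI)
  show "?P y J = 0" if "length J ~= p" for J using that by (simp add: interpolant_def)
  fix I J :: "'n list" assume IJ: "mset I = mset J"
  have "?P y I - ?P y J = 0"
  proof (rule polynomial_zero_on_ball[where q = "%y. ?P y I - ?P y J", OF real_polynomial_function_diff[OF poly poly] r])
   fix y assume "y \<in> ball z r"
   thus "?P y I - ?P y J = 0" using eq sym_comps_sym[OF sym IJ] by simp
  qed
  thus "?P y I = ?P y J" by simp
 qed
 moreover have "flat_deriv ?P y J = 0" for y J
 proof (rule polynomial_zero_on_ball[where q = "%y. flat_deriv ?P y J", OF _ r])
  show "real_polynomial_function (%y. flat_deriv ?P y J)"
   unfolding flat_deriv_def by (intro real_polynomial_function_sum polynomial_partial poly) auto
  show "flat_deriv ?P y J = 0" if "y \<in> ball z r" for y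
  proof -
   have "flat_deriv ?P y J = flat_deriv \<alpha> y J" by (simp add: flat_deriv_def part[OF that])
   thus ?thesis using kill[OF that] by simp
  qed
 qed
 moreover have "flat_div ?P y J = 0" for y J
 proof (rule polynomial_zero_on_ball[where q = "%y. flat_div ?P y J", OF _ r])
  show "real_polynomial_function (%y. flat_div ?P y J)"
   unfolding flat_div_def by (intro real_polynomial_function_minus real_polynomial_function_sum polynomial_partial poly) auto
  show "flat_div ?P y J = 0" if "y \<in> ball z r" for y
  proof -
   have "flat_div ?P y J = flat_div \<alpha> y J" by (simp add: flat_div_def part[OF that])
   thus ?thesis using div[OF that] by simp
  qed
 qed
 ultimately show "?P \<in> flat_killing p"
  using polynomial_smooth[OF poly] by (auto simp: flat_killing_def fun_eq_iff)
qed

lemma flat_killing_interpolant: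
 assumes "P \<in> flat_killing p" "d > 0"
 shows "interpolant p d z P = P"
proof
 fix y
 define r where "r = real p * d + dist z y + 1"
 have "real p * d < r" "y \<in> ball z r" using assms(2) by (auto simp: r_def add_nonneg_pos add_pos_nonneg)
 thus "interpolant p d z P y = P y"
  using killing_ball_interpolant(1)[of z r P p d y] assms smooth_on_differentiable
  unfolding flat_killing_def by blast
qed

lemma flat_killing_polynomial: "P \<in> flat_killing p ==> real_polynomial_function (%y. P y J)"
 using flat_killing_interpolant[of P p 1 0] polynomial_interpolant[of p 1 0 P J] by simp

text \<open>The interpolant shows that a tensor in this space is determined by its values at finitely many nodes.\<close>

lemma flat_killing_finite_dim:
 obtains B where "finite B" "independent B" "span B = (flat_killing p :: 'n::finite field set)"
proof -
 define Z where "Z = (\<Union>J\<in>multi_indices p. nodes 1 J (0 :: real^'n)) \<times> (multi_indices p :: 'n list set)"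
 have Z: "finite Z" unfolding Z_def by (intro finite_cartesian_product finite_UN_I finite_nodes finite_multi_indices)
 define L :: "'n field => (real^'n) \<times> 'n list => real" where
  "L P = (%(w, J). if (w, J) \<in> Z then P w J else 0)" for P
 have lin: "linear L" by (rule linearI) (auto simp: L_def fun_eq_iff)
 have inj: "P = 0" if P: "P \<in> flat_killing p" and L0: "L P = 0" for P
 proof -
  have node: "P w J = 0" if "length J = p" "w \<in> nodes 1 I 0" "length I = p" for w I J
  proof -
   have "(w, J) \<in> Z" using that by (auto simp: Z_def)
   thus ?thesis using fun_cong[OF L0, of "(w, J)"] by (simp add: L_def)
  qed
  have "interpolant p 1 0 P = 0"
  proof (intro ext)
   fix x J
   have "diag p (P w) (x - w) [] = 0" if "length J = p" "w \<in> nodes 1 J 0" for w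
    using diag_cong[of p "[]" "P w" "%_. 0" "x - w"] node that by simp
   hence "length J = p ==> fdiff 1 J (%w. diag p (P w) (x - w) []) 0 = fdiff 1 J (%_. 0) 0"
    by (intro fdiff_cong)
   thus "interpolant p 1 0 P x J = 0 x J" by (simp add: interpolant_def fdiff_zero)
  qed
  thus ?thesis using flat_killing_interpolant[OF P, of 1 0] by simp
 qed
 have im: "L ` flat_killing p \<subseteq> span ((%s x. if x = s then 1 else 0) ` Z)"
  by (intro image_subsetI finite_support_in_span[OF Z]) (auto simp: L_def)
 show ?thesis
  by (rule finite_dim_of_injective[OF subspace_flat_killing lin _ im finite_imageI[OF Z]]) (use inj that in blast)+
qed

section \<open>Charts and tangent vectors\<close>

context
 fixes X :: "'a topology" and A :: "('a, 'n::finite) chart set"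
 assumes M: "smooth_manifold X A"
begin

lemma chart_facts:
 assumes c: "c \<in> A"
 shows "openin X (fst c)" "open (chart_image c)" "fst c \<subseteq> points A"
  and "x \<in> fst c ==> chart_inv c (snd c x) = x" "x \<in> fst c ==> snd c x \<in> chart_image c"
  and "y \<in> chart_image c ==> chart_inv c y \<in> fst c" "y \<in> chart_image c ==> snd c (chart_inv c y) = y"
proof -
 have ch: "is_chart X c" using M c unfolding smooth_manifold_def by blast
 thus op: "openin X (fst c)" and "open (chart_image c)" unfolding is_chart_def by auto
 show "fst c \<subseteq> points A" using c unfolding points_def by blast
 have "topspace (subtopology X (fst c)) = fst c"
  by (rule topspace_subtopology_subset[OF openin_subset[OF op]])
 hence inj: "inj_on (snd c) (fst c)"
  using ch homeomorphic_imp_injective_map unfolding is_chart_def by metis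
 show "x \<in> fst c ==> chart_inv c (snd c x) = x"
  using inj by (simp add: chart_inv_def)
 show "x \<in> fst c ==> snd c x \<in> chart_image c" by (simp add: chart_image_def)
 show "y \<in> chart_image c ==> chart_inv c y \<in> fst c" "y \<in> chart_image c ==> snd c (chart_inv c y) = y"
  by (auto simp: chart_inv_def chart_image_def inv_into_into f_inv_into_f)
qed

lemma open_chart_image:
 assumes c: "c \<in> A" and V: "openin X V" "V \<subseteq> fst c"
 shows "open (snd c ` V)"
proof -
 have ch: "homeomorphic_map (subtopology X (fst c)) (top_of_set (chart_image c)) (snd c)"
  using M c unfolding smooth_manifold_def is_chart_def by blast
 have "openin (subtopology X (fst c)) V"
  using V chart_facts(1)[OF c] by (simp add: openin_open_subtopology)
 hence "openin (top_of_set (chart_image c)) (snd c ` V)"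
  using homeomorphic_imp_open_map[OF ch] unfolding open_map_def by blast
 thus ?thesis using chart_facts(2)[OF c] openin_open_eq by blast
qed

lemma openin_chart_preimage:
 assumes c: "c \<in> A" and W: "open W" "W \<subseteq> chart_image c"
 shows "openin X (chart_inv c ` W)"
proof -
 have ch: "homeomorphic_map (subtopology X (fst c)) (top_of_set (chart_image c)) (snd c)"
  using M c unfolding smooth_manifold_def is_chart_def by blast
 note f = chart_facts[OF c]
 have top: "topspace (subtopology X (fst c)) = fst c"
  by (rule topspace_subtopology_subset[OF openin_subset[OF f(1)]])
 have "openin (subtopology X (fst c)) {x \<in> topspace (subtopology X (fst c)). snd c x \<in> W}"
  by (rule openin_continuous_map_preimage[OF homeomorphic_imp_continuous_map[OF ch]])
    (use W f(2) openin_open_eq in blast)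
 hence "openin X {x \<in> fst c. snd c x \<in> W}"
  unfolding top openin_open_subtopology[OF f(1)] by blast
 moreover have "{x \<in> fst c. snd c x \<in> W} = chart_inv c ` W"
 proof
  show "{x \<in> fst c. snd c x \<in> W} \<subseteq> chart_inv c ` W"
   using f(4) by (auto intro!: image_eqI[where x = "snd c _"])
  show "chart_inv c ` W \<subseteq> {x \<in> fst c. snd c x \<in> W}" using W f(6,7) by auto
 qed
 ultimately show ?thesis by simp
qed

lemma closedin_chart_compact:
 assumes c: "c \<in> A" and K: "compact K" "K \<subseteq> chart_image c"
 shows "closedin X (chart_inv c ` K)"
proof -
 have ch: "homeomorphic_map (subtopology X (fst c)) (top_of_set (chart_image c)) (snd c)"
  using M c unfolding smooth_manifold_def is_chart_def by blast
 note f = chart_facts[OF c]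
 have top: "topspace (subtopology X (fst c)) = fst c"
  by (rule topspace_subtopology_subset[OF openin_subset[OF f(1)]])
 obtain h where h: "homeomorphic_maps (subtopology X (fst c)) (top_of_set (chart_image c)) (snd c) h"
  using ch homeomorphic_map_maps by blast
 have hy: "h y = chart_inv c y" if "y \<in> chart_image c" for y
 proof -
  have "h (snd c (chart_inv c y)) = chart_inv c y"
   using h f(6)[OF that] top unfolding homeomorphic_maps_def by metis
  thus ?thesis using f(7)[OF that] by simp
 qed
 have "compactin (top_of_set (chart_image c)) K"
  using K by (simp add: compactin_subtopology)
 hence "compactin (subtopology X (fst c)) (h ` K)"
  using h image_compactin unfolding homeomorphic_maps_def by blast
 hence "compactin X (h ` K)" by (simp add: compactin_subtopology)
 moreover have "h ` K = chart_inv c ` K" using hy K by (intro image_cong) auto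
 ultimately show ?thesis
  using M compactin_imp_closedin unfolding smooth_manifold_def by metis
qed

lemma smooth_functionsD: "u \<in> smooth_functions A ==> c \<in> A ==> smooth_on (chart_image c) (u \<circ> chart_inv c)"
 unfolding smooth_functions_def by blast

lemma smooth_functions_lin:
 assumes "u \<in> smooth_functions A" "w \<in> smooth_functions A"
 shows "(%z. a * u z + b * w z) \<in> smooth_functions A"
 using assms unfolding smooth_functions_def comp_def
 by (auto intro!: smooth_on_add smooth_on_mult chart_facts(2))

lemma smooth_functions_mult:
 assumes "u \<in> smooth_functions A" "w \<in> smooth_functions A"
 shows "(%z. u z * w z) \<in> smooth_functions A"
 using assms unfolding smooth_functions_def comp_def
 by (auto intro!: smooth_on_mult chart_facts(2))

lemma smooth_functions_const: "(%z. a) \<in> smooth_functions A"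
 unfolding smooth_functions_def comp_def by simp

lemma smooth_functions_sum:
 "(!!i. i \<in> I ==> u i \<in> smooth_functions A) ==> (%z. \<Sum>i\<in>I. u i z) \<in> smooth_functions A"
proof (induction I rule: infinite_finite_induct)
 case (insert i I)
 thus ?case using smooth_functions_lin[of "u i" "%z. \<Sum>i\<in>I. u i z" 1 1] by simp
qed (simp_all add: smooth_functions_const)

text \<open>Extension by zero of a smooth function with compact support in a chart. Closedness of the support
 uses that the space is Hausdorff.\<close>

lemma smooth_functions_extend:
 assumes c: "c \<in> A" and K: "compact K" "K \<subseteq> chart_image c"
  and w: "smooth_on (chart_image c) w" "!!y. y \<in> chart_image c - K ==> w y = 0"
 shows "(%x. if x \<in> fst c then w (snd c x) else 0) \<in> smooth_functions A" (is "?u \<in> _")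
 unfolding smooth_functions_def
proof (intro CollectI ballI)
 fix d assume d: "d \<in> A"
 note fc = chart_facts[OF c] and fd = chart_facts[OF d]
 show "smooth_on (chart_image d) (?u \<circ> chart_inv d)"
 proof (rule smooth_on_local)
  fix y assume y: "y \<in> chart_image d"
  show "\<exists>T v. open T & y \<in> T & smooth_on T v & (\<forall>z\<in>T. (?u \<circ> chart_inv d) z = v z)"
  proof (cases "chart_inv d y \<in> fst c")
   case True
   let ?T = "snd d ` (fst d \<inter> fst c)"
   have T: "open ?T" by (intro open_chart_image[OF d] openin_Int fd fc) auto
   have "smooth_transition d c"
    using M c d unfolding smooth_manifold_def compatible_def by blast
   hence "smooth_on ?T (%y. w (snd c (chart_inv d y)))"
    unfolding smooth_transition_def
    by (intro smooth_on_compose[OF T fc(2) w(1)]) (use fd fc in auto)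
   moreover have "y \<in> ?T"
    using True fd(6,7)[OF y] by (intro image_eqI[of _ _ "chart_inv d y"]) auto
   moreover have "\<forall>z\<in>?T. (?u \<circ> chart_inv d) z = w (snd c (chart_inv d z))"
    using fd(4) by auto
   ultimately show ?thesis using T by blast
  next
   case False
   let ?T = "snd d ` (fst d - chart_inv c ` K)"
   have "openin X (fst d - chart_inv c ` K)"
    by (intro openin_diff fd(1) closedin_chart_compact[OF c K])
   hence T: "open ?T" by (intro open_chart_image[OF d]) auto
   moreover have "y \<in> ?T"
    using False fd(6,7)[OF y] K(2) fc(6) by (intro image_eqI[of _ _ "chart_inv d y"]) auto
   moreover have "\<forall>z\<in>?T. (?u \<circ> chart_inv d) z = 0"
   proof
    fix z assume "z \<in> ?T"
    then obtain x where x: "x \<in> fst d" "x \<notin> chart_inv c ` K" "z = snd d x" by blast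
    have "w (snd c x) = 0" if "x \<in> fst c"
    proof (rule w(2))
    show "snd c x \<in> chart_image c - K" using that x(2) fc(4,5) by (metis DiffI image_eqI)
    qed
    thus "(?u \<circ> chart_inv d) z = 0" using x fd(4) by simp
   qed
   ultimately show ?thesis using smooth_on_const[of ?T 0] by blast
  qed
 qed
qed

lemma smooth_on_bump_mult:
 assumes S: "open S" and h: "smooth_on (ball z r) h" and s: "0 < s" "s < r"
 shows "smooth_on S (%y. if y \<in> ball z r then bump z s y * h y else 0)"
proof (rule smooth_on_local)
 fix y assume y: "y \<in> S"
 show "\<exists>T w. open T & y \<in> T & smooth_on T w & (\<forall>x\<in>T. (if x \<in> ball z r then bump z s x * h x else 0) = w x)"
 proof (cases "y \<in> ball z r")
  case True
  thus ?thesis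
   by (intro exI[of _ "ball z r"] exI[of _ "%y. bump z s y * h y"])
    (auto intro: smooth_on_mult smooth_on_bump h)
 next
  case False
  thus ?thesis using s
   by (intro exI[of _ "- cball z s"] exI[of _ "%_. 0"]) (auto simp: bump_zero)
 qed
qed

text \<open>A smooth function on the ball around the centre of a chart, cut off by a bump and extended by zero.\<close>

definition cut_off :: "('a, 'n) chart => real^'n => real => (real^'n => real) => 'a => real" where
 "cut_off c z r h x = (if x \<in> fst c then (if snd c x \<in> ball z r then bump z (r/2) (snd c x) * h (snd c x) else 0) else 0)"

lemma smooth_cut_off:
 assumes c: "c \<in> A" and r: "r > 0" "cball z r \<subseteq> chart_image c" and h: "smooth_on (ball z r) h"
 shows "cut_off c z r h \<in> smooth_functions A"
 unfolding cut_off_def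
proof (rule smooth_functions_extend[OF c compact_cball r(2)])
 show "smooth_on (chart_image c) (%y. if y \<in> ball z r then bump z (r / 2) y * h y else 0)"
  by (rule smooth_on_bump_mult[OF chart_facts(2)[OF c] h]) (use r in auto)
qed auto

lemma tangent_lin:
 assumes "v \<in> tangent_space A x" "u \<in> smooth_functions A" "w \<in> smooth_functions A"
 shows "v (%z. a * u z + b * w z) = a * v u + b * v w"
 using assms unfolding tangent_space_def by blast

lemma tangent_mult:
 assumes "v \<in> tangent_space A x" "u \<in> smooth_functions A" "w \<in> smooth_functions A"
 shows "v (%z. u z * w z) = u x * v w + w x * v u"
 using assms unfolding tangent_space_def by blast

lemma tangent_const:
 assumes "v \<in> tangent_space A x" shows "v (%z. a) = 0"
proof -
 have "v (%_. 1) = 0"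
  using tangent_mult[OF assms smooth_functions_const[of 1] smooth_functions_const[of 1]] by simp
 thus ?thesis
  using tangent_lin[OF assms smooth_functions_const[of 1] smooth_functions_const[of 1], of a 0] by simp
qed

lemma tangent_sum:
 assumes "v \<in> tangent_space A x" "!!i. i \<in> I ==> u i \<in> smooth_functions A"
 shows "v (%z. \<Sum>i\<in>I. u i z) = (\<Sum>i\<in>I. v (u i))"
 using assms(2)
proof (induction I rule: infinite_finite_induct)
 case (insert i I)
 hence "u i \<in> smooth_functions A" "(%z. \<Sum>i\<in>I. u i z) \<in> smooth_functions A"
  by (auto intro: smooth_functions_sum)
 note tangent_lin[OF assms(1) this, of 1 1]
 with insert show ?case by simp
qed (simp_all add: tangent_const[OF assms(1)])

lemma coord_vector_tangent:
 assumes c: "c \<in> A" and x: "x \<in> fst c"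
 shows "coord_vector A c i x \<in> tangent_space A x"
proof -
 have d: "(u \<circ> chart_inv c) differentiable (at (snd c x))" if "u \<in> smooth_functions A" for u
  using smooth_on_differentiable smooth_functionsD[OF that c] chart_facts(5)[OF c x] by blast
 have "partial i ((%z. a * u z + b * w z) \<circ> chart_inv c) (snd c x)
   = a * partial i (u \<circ> chart_inv c) (snd c x) + b * partial i (w \<circ> chart_inv c) (snd c x)"
  if "u \<in> smooth_functions A" "w \<in> smooth_functions A" for u w a b
  using d[OF that(1)] d[OF that(2)] unfolding comp_def by (simp add: partial_add partial_cmult)
 moreover have "partial i ((%z. u z * w z) \<circ> chart_inv c) (snd c x)
   = u x * partial i (w \<circ> chart_inv c) (snd c x) + w x * partial i (u \<circ> chart_inv c) (snd c x)"
  if "u \<in> smooth_functions A" "w \<in> smooth_functions A" for u w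
  using d[OF that(1)] d[OF that(2)] chart_facts(4)[OF c x] unfolding comp_def by (simp add: partial_mult)
 ultimately show ?thesis
  unfolding tangent_space_def coord_vector_def
  by (simp add: smooth_functions_lin smooth_functions_mult)
qed

text \<open>Coordinate vectors form a basis of the tangent space. For spanning, multiply \<open>u - u x\<close> by the square of a
 bump: Hadamard's lemma writes the result as a sum of products of global smooth functions, one factor of
 which vanishes at \<open>x\<close>.\<close>

lemma tangent_coord_expansion:
 assumes c: "c \<in> A" and x: "x \<in> fst c" and v: "v \<in> tangent_space A x"
 obtains a where "v = (\<Sum>i\<in>UNIV. a i *\<^sub>R coord_vector A c i x)"
proof -
 define y0 where "y0 = snd c x"
 note f = chart_facts[OF c]
 obtain r where r: "r > 0" "cball y0 r \<subseteq> chart_image c"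
  using f(2) f(5)[OF x] open_contains_cball unfolding y0_def by blast
 have ball: "ball y0 r \<subseteq> chart_image c" using r(2) ball_subset_cball by blast
 define E where "E = cut_off c y0 r"
 define b0 where "b0 = bump y0 (r/2) y0"
 have b0: "b0 > 0" using r by (simp add: b0_def bump_pos)
 have Ex: "E h x = b0 * h y0" for h
  using x r by (simp add: E_def cut_off_def y0_def b0_def)
 have E: "E h \<in> smooth_functions A" if "smooth_on (ball y0 r) h" for h
  unfolding E_def by (rule smooth_cut_off[OF c r that])
 let ?l = "%k y. y $ k - y0 $ k"
 have l: "smooth_on (ball y0 r) (?l k)" for k
  by (intro smooth_on_diff smooth_on_nth smooth_on_const open_ball)
 have "v u = (\<Sum>k\<in>UNIV. (v (E (?l k)) / b0) * coord_vector A c k x u)" for u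
 proof (cases "u \<in> smooth_functions A")
  case True
  let ?F = "u \<circ> chart_inv c"
  have sF: "smooth_on (ball y0 r) ?F" using smooth_functionsD[OF True c] ball smooth_on_subset by blast
  obtain h where h: "!!k. smooth_on (ball y0 r) (h k)" "!!k. h k y0 = partial k ?F y0"
   "!!y. y \<in> ball y0 r ==> ?F y = ?F y0 + (\<Sum>k\<in>UNIV. (y $ k - y0 $ k) * h k y)"
   using hadamard[OF sF] by blast
  have e1: "E (%_. 1) \<in> smooth_functions A" by (rule E) simp
  let ?u0 = "%z. 1 * u z + (- u x) * 1"
  have u0: "?u0 \<in> smooth_functions A" by (rule smooth_functions_lin[OF True smooth_functions_const])
  have pw: "E (%_. 1) z * E (%_. 1) z * ?u0 z = (\<Sum>k\<in>UNIV. E (?l k) z * E (h k) z)" for z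
  proof (cases "z \<in> fst c & snd c z \<in> ball y0 r")
   case True
   hence "u z = u x + (\<Sum>k\<in>UNIV. (snd c z $ k - y0 $ k) * h k (snd c z))"
    using h(3)[of "snd c z"] f(4) x by (simp add: y0_def)
   thus ?thesis
    using True by (simp add: E_def cut_off_def sum_distrib_left mult_ac)
  qed (auto simp: E_def cut_off_def)
  have v1: "v (%z. E (%_. 1) z * E (%_. 1) z * ?u0 z) = b0 * b0 * v u"
  proof -
   have "v (%z. E (%_. 1) z * E (%_. 1) z * ?u0 z)
    = (E (%_. 1) x * E (%_. 1) x) * v ?u0 + ?u0 x * v (%z. E (%_. 1) z * E (%_. 1) z)"
    by (rule tangent_mult[OF v smooth_functions_mult[OF e1 e1] u0])
   moreover have "v ?u0 = 1 * v u + (- u x) * v (%_. 1)"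
    by (rule tangent_lin[OF v True smooth_functions_const])
   ultimately show ?thesis by (simp add: tangent_const[OF v] Ex)
  qed
  have v2: "v (%z. \<Sum>k\<in>UNIV. E (?l k) z * E (h k) z) = (\<Sum>k\<in>UNIV. b0 * partial k ?F y0 * v (E (?l k)))"
  proof -
   have "v (%z. \<Sum>k\<in>UNIV. E (?l k) z * E (h k) z) = (\<Sum>k\<in>UNIV. v (%z. E (?l k) z * E (h k) z))"
    by (rule tangent_sum[OF v]) (intro smooth_functions_mult E l h)
   also have "... = (\<Sum>k\<in>UNIV. E (?l k) x * v (E (h k)) + E (h k) x * v (E (?l k)))"
    by (intro sum.cong refl tangent_mult[OF v] E l h)
   finally show ?thesis by (simp add: Ex h(2))
  qed
  have "b0 * b0 * v u = (\<Sum>k\<in>UNIV. b0 * partial k ?F y0 * v (E (?l k)))"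
   using v1 v2 unfolding pw by simp
  hence "b0 * v u = (\<Sum>k\<in>UNIV. partial k ?F y0 * v (E (?l k)))"
   using b0 by (simp add: mult.assoc flip: sum_distrib_left)
  hence "v u = (\<Sum>k\<in>UNIV. partial k ?F y0 * v (E (?l k))) / b0"
   using b0 by (simp add: field_simps)
  thus ?thesis
   using True by (simp add: coord_vector_def y0_def sum_divide_distrib mult.commute)
 next
  case False
  thus ?thesis using v unfolding tangent_space_def by (simp add: coord_vector_def)
 qed
 hence "v u = (\<Sum>k\<in>UNIV. (v (E (?l k)) / b0) *\<^sub>R coord_vector A c k x) u" for u
  unfolding sum_fun_apply scaleR_fun_apply real_scaleR_def .
 thus ?thesis by (intro that ext)
qed

lemma coord_vector_independent:
 assumes c: "c \<in> A" and x: "x \<in> fst c" and 0: "(\<Sum>i\<in>UNIV. a i *\<^sub>R coord_vector A c i x) = 0"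
 shows "a k = 0"
proof -
 define y0 where "y0 = snd c x"
 note f = chart_facts[OF c]
 obtain r where r: "r > 0" "cball y0 r \<subseteq> chart_image c"
  using f(2) f(5)[OF x] open_contains_cball unfolding y0_def by blast
 let ?l = "%y. y $ k - y0 $ k" and ?b = "bump y0 (r/2)"
 have sm: "smooth_on (ball y0 r) ?l" "smooth_on (ball y0 r) ?b"
  by (intro smooth_on_diff smooth_on_nth smooth_on_const smooth_on_bump open_ball)+
 have y0: "y0 \<in> ball y0 r" using r by simp
 have "partial i (cut_off c y0 r ?l \<circ> chart_inv c) y0 = ?b y0 * (if i = k then 1 else 0)" for i
 proof -
  have "partial i (cut_off c y0 r ?l \<circ> chart_inv c) y0 = partial i (%y. ?b y * ?l y) y0"
  proof (rule partial_cong[OF open_ball y0])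
   fix z assume "z \<in> ball y0 r"
   moreover from this have "z \<in> chart_image c" using r(2) ball_subset_cball by blast
   ultimately show "(cut_off c y0 r ?l \<circ> chart_inv c) z = ?b z * ?l z"
    using f(6,7) by (simp add: cut_off_def)
  qed
  also have "... = partial i ?b y0 * ?l y0 + ?b y0 * partial i ?l y0"
   by (rule partial_mult) (use sm smooth_on_differentiable y0 in blast)+
  finally show ?thesis by (simp add: partial_diff)
 qed
 hence "coord_vector A c i x (cut_off c y0 r ?l) = ?b y0 * (if i = k then 1 else 0)" for i
  using smooth_cut_off[OF c r sm(1)] by (simp add: coord_vector_def y0_def)
 hence "(\<Sum>i\<in>UNIV. a i * (?b y0 * (if i = k then 1 else 0))) = 0"
  using fun_cong[OF 0, of "cut_off c y0 r ?l"] by simp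
 moreover have "(\<Sum>i\<in>UNIV. a i * (?b y0 * (if i = k then 1 else 0))) = (\<Sum>i\<in>UNIV. if i = k then a k * ?b y0 else 0)"
  by (intro sum.cong) auto
 ultimately have "?b y0 * a k = 0" by auto
 thus ?thesis using bump_pos[of y0 y0 "r/2"] r by simp
qed

lemma subspace_tangent_space: "subspace (tangent_space A x)"
 unfolding subspace_def tangent_space_def by (auto simp: algebra_simps)

lemma sym_forms_lin:
 assumes "\<omega> \<in> sym_forms p T" "v \<in> T" "w \<in> T" "Suc (length vs) = p" "set vs \<subseteq> T"
 shows "\<omega> ((a *\<^sub>R v + b *\<^sub>R w) # vs) = a * \<omega> (v # vs) + b * \<omega> (w # vs)"
 using assms unfolding sym_forms_def by blast

lemma sym_forms_sum:
 assumes \<omega>: "\<omega> \<in> sym_forms p T" and T: "subspace T" and vs: "Suc (length vs) = p" "set vs \<subseteq> T"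
  and e: "!!i. e i \<in> T"
 shows "\<omega> ((\<Sum>i\<in>I. a i *\<^sub>R e i) # vs) = (\<Sum>i\<in>I. a i * \<omega> (e i # vs))"
proof (induction I rule: infinite_finite_induct)
 case (insert i I)
 have "\<omega> ((a i *\<^sub>R e i + 1 *\<^sub>R (\<Sum>i\<in>I. a i *\<^sub>R e i)) # vs) = a i * \<omega> (e i # vs) + 1 * \<omega> ((\<Sum>i\<in>I. a i *\<^sub>R e i) # vs)"
  by (rule sym_forms_lin[OF \<omega> e _ vs]) (intro subspace_sum[OF T] subspace_scale[OF T] e)
 with insert show ?case by simp
qed (use sym_forms_lin[OF \<omega> subspace_0[OF T] subspace_0[OF T] vs, of 0 0] in simp_all)

lemma sym_forms_sym: "\<omega> \<in> sym_forms p T ==> mset vs = mset ws ==> \<omega> vs = \<omega> ws"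
 unfolding sym_forms_def by blast

lemma sym_form_zero:
 assumes c: "c \<in> A" and x: "x \<in> fst c" and \<omega>: "\<omega> \<in> sym_forms p (tangent_space A x)"
  and 0: "!!J. length J = p ==> \<omega> (map (%i. coord_vector A c i x) J) = 0"
 shows "\<omega> = 0"
proof -
 let ?e = "%i. coord_vector A c i x"
 have "length vs + length J = p ==> set vs \<subseteq> tangent_space A x ==> \<omega> (vs @ map ?e J) = 0" for vs J
 proof (induction vs arbitrary: J)
  case (Cons v vs)
  obtain a where a: "v = (\<Sum>i\<in>UNIV. a i *\<^sub>R ?e i)"
   using tangent_coord_expansion[OF c x] Cons.prems(2) by auto
  have "\<omega> ((\<Sum>i\<in>UNIV. a i *\<^sub>R ?e i) # vs @ map ?e J) = (\<Sum>i\<in>UNIV. a i * \<omega> (?e i # vs @ map ?e J))"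
   using Cons.prems coord_vector_tangent[OF c x]
   by (intro sym_forms_sum[OF \<omega> subspace_tangent_space]) auto
  also have "... = (\<Sum>i\<in>UNIV. a i * \<omega> (vs @ map ?e (i # J)))"
   by (intro sum.cong refl arg_cong[where f = "(*) _"] sym_forms_sym[OF \<omega>]) simp
  also have "... = 0"
   by (intro sum.neutral ballI) (use Cons.IH[of "_ # J"] Cons.prems in simp)
  finally show ?case using a by simp
 qed (use 0 in simp)
 from this[of _ "[]"] have "length vs = p ==> set vs \<subseteq> tangent_space A x ==> \<omega> vs = 0" for vs by simp
 moreover have "~ (length vs = p & set vs \<subseteq> tangent_space A x) ==> \<omega> vs = 0" for vs
  using \<omega> unfolding sym_forms_def by blast
 ultimately show ?thesis unfolding fun_eq_iff zero_fun_def by blast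
qed

lemma components_sym_comps:
 assumes c: "c \<in> A" and \<alpha>: "\<alpha> \<in> sym_tensors A p" and y: "y \<in> chart_image c"
 shows "components A c \<alpha> y \<in> sym_comps p"
proof -
 have "chart_inv c y \<in> points A" using chart_facts[OF c] y by blast
 hence \<omega>: "\<alpha> (chart_inv c y) \<in> sym_forms p (tangent_space A (chart_inv c y))"
  using \<alpha> unfolding sym_tensors_def by blast
 show ?thesis
 proof (rule sym_compsI)
  show "components A c \<alpha> y J = 0" if "length J ~= p" for J
  proof -
   have "!!vs. length vs ~= p ==> \<alpha> (chart_inv c y) vs = 0"
    using \<omega> unfolding sym_forms_def by blast
   thus ?thesis using that by (simp add: components_def)
  qed
  show "components A c \<alpha> y I = components A c \<alpha> y J" if "mset I = mset J" for I J
   unfolding components_def by (rule sym_forms_sym[OF \<omega>]) (use that in simp)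
 qed
qed

lemma components_zero_imp_zero:
 assumes c: "c \<in> A" and \<alpha>: "\<alpha> \<in> sym_tensors A p" and x: "x \<in> fst c" and 0: "components A c \<alpha> (snd c x) = 0"
 shows "\<alpha> x = 0"
proof (rule sym_form_zero[OF c x, of _ p])
 show "\<alpha> x \<in> sym_forms p (tangent_space A x)"
  using \<alpha> x chart_facts(3)[OF c] unfolding sym_tensors_def by blast
 show "\<alpha> x (map (%i. coord_vector A c i x) J) = 0" for J
  using fun_cong[OF 0, of J] chart_facts(4)[OF c x] by (simp add: components_def)
qed

end

section \<open>Critical points\<close>

lemma partial_half_square:
 "partial i (%y. a * (1/2 * (y $ k)\<^sup>2)) y = a * (y $ k * (if i = k then 1 else 0))"
 "(%y. a * (1/2 * (y $ k)\<^sup>2)) differentiable (at y)" for y :: "real^'n::finite"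
proof -
 have d: "(%y. (y $ k)\<^sup>2) differentiable (at y)" "(%y. 1/2 * (y $ k)\<^sup>2) differentiable (at y)"
  unfolding power2_eq_square by (intro differentiable_mult differentiable_nth differentiable_const)+
 have "partial i (%y. (y $ k)\<^sup>2) y = 2 * y $ k * (if i = k then 1 else 0)"
  unfolding power2_eq_square by (subst partial_mult) auto
 thus "partial i (%y. a * (1/2 * (y $ k)\<^sup>2)) y = a * (y $ k * (if i = k then 1 else 0))"
  using partial_cmult[OF d(1), of i "1/2"] partial_cmult[OF d(2), of i a] by simp
 show "(%y. a * (1/2 * (y $ k)\<^sup>2)) differentiable (at y)"
  by (intro differentiable_mult differentiable_const d)
qed

context
 fixes X :: "'a topology" and A :: "('a, 'n::finite) chart set" and f :: "'a => real"
 assumes M: "smooth_manifold X A" and f: "f \<in> smooth_functions A"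
begin

lemma critical_iff_partials:
 assumes c: "c \<in> A" and x: "x \<in> fst c"
 shows "x \<in> critical_points A f \<longleftrightarrow> (\<forall>i. partial i (f \<circ> chart_inv c) (snd c x) = 0)"
proof
 assume "x \<in> critical_points A f"
 hence "coord_vector A c i x f = 0" for i
  using coord_vector_tangent[OF M c x] unfolding critical_points_def by blast
 thus "\<forall>i. partial i (f \<circ> chart_inv c) (snd c x) = 0"
  using f by (simp add: coord_vector_def)
next
 assume p: "\<forall>i. partial i (f \<circ> chart_inv c) (snd c x) = 0"
 have "v f = 0" if v: "v \<in> tangent_space A x" for v
 proof -
  obtain a where "v = (\<Sum>i\<in>UNIV. a i *\<^sub>R coord_vector A c i x)"
   using tangent_coord_expansion[OF M c x v] by blast
  thus ?thesis using p f by (simp add: coord_vector_def)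
 qed
 thus "x \<in> critical_points A f"
  using chart_facts(3)[OF M c] x unfolding critical_points_def by blast
qed

lemma adapted_chart_gradient:
 assumes c: "adapted_chart A g f x c"
 obtains N where "card N = morse_index A f x"
  "!!y. y \<in> chart_image c ==> (f \<circ> chart_inv c) y = f x + (\<Sum>k\<in>UNIV. (if k \<in> N then -1 else 1) * (1/2 * (y $ k)\<^sup>2))"
  "!!y i. y \<in> chart_image c ==> partial i (f \<circ> chart_inv c) y = (if i \<in> N then -1 else 1) * y $ i"
proof -
 obtain N where N: "card N = morse_index A f x" and
  eq: "!!y. y \<in> chart_image c ==> f (chart_inv c y) = f x - (\<Sum>k\<in>N. 1/2 * (y $ k)\<^sup>2) + (\<Sum>k\<in>-N. 1/2 * (y $ k)\<^sup>2)"
  using c unfolding adapted_chart_def by blast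
 let ?F = "%y :: real^'n. f x + (\<Sum>k\<in>UNIV. (if k \<in> N then -1 else 1) * (1/2 * (y $ k)\<^sup>2))"
 have eq': "(f \<circ> chart_inv c) y = ?F y" if "y \<in> chart_image c" for y
 proof -
  have "(\<Sum>k\<in>UNIV. (if k \<in> N then -1 else 1) * (1/2 * (y $ k)\<^sup>2))
    = (\<Sum>k\<in>N. (if k \<in> N then -1 else 1) * (1/2 * (y $ k)\<^sup>2)) + (\<Sum>k\<in>-N. (if k \<in> N then -1 else 1) * (1/2 * (y $ k)\<^sup>2))"
   using sum.union_disjoint[of N "-N" "%k. (if k \<in> N then -1 else 1) * (1/2 * (y $ k)\<^sup>2)"] by simp
  also have "(\<Sum>k\<in>N. (if k \<in> N then -1 else 1) * (1/2 * (y $ k)\<^sup>2)) = - (\<Sum>k\<in>N. 1/2 * (y $ k)\<^sup>2)"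
   unfolding sum_negf[symmetric] by (rule sum.cong) auto
  also have "(\<Sum>k\<in>-N. (if k \<in> N then -1 else 1) * (1/2 * (y $ k)\<^sup>2)) = (\<Sum>k\<in>-N. 1/2 * (y $ k)\<^sup>2)"
   by (rule sum.cong) auto
  finally show ?thesis using eq[OF that] by simp
 qed
 moreover have "partial i (f \<circ> chart_inv c) y = (if i \<in> N then -1 else 1) * y $ i" if y: "y \<in> chart_image c" for y i
 proof -
  have "c \<in> A" using c unfolding adapted_chart_def by blast
  hence "partial i (f \<circ> chart_inv c) y = partial i ?F y"
   by (intro partial_cong[OF chart_facts(2)[OF M] y] eq')
  also have "... = partial i (%_. f x) y + partial i (%y. \<Sum>k\<in>UNIV. (if k \<in> N then -1 else 1) * (1/2 * (y $ k)\<^sup>2)) y"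
   by (rule partial_add[OF differentiable_const differentiable_sum]) (intro finite ballI partial_half_square(2))+
  also have "partial i (%y. \<Sum>k\<in>UNIV. (if k \<in> N then -1 else 1) * (1/2 * (y $ k)\<^sup>2)) y
    = (\<Sum>k\<in>UNIV. partial i (%y. (if k \<in> N then -1 else 1) * (1/2 * (y $ k)\<^sup>2)) y)"
   by (rule partial_sum[OF partial_half_square(2)])
  also have "... = (\<Sum>k\<in>UNIV. (if k \<in> N then -1 else 1) * (y $ k * (if i = k then 1 else 0)))"
   unfolding partial_half_square(1) ..
  also have "... = (\<Sum>k\<in>UNIV. if k = i then (if i \<in> N then -1 else 1) * y $ i else 0)"
   by (rule sum.cong) auto
  finally show ?thesis by (simp only: sum.delta[OF finite] UNIV_I if_True partial_const add_0)
 qed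
 ultimately show ?thesis using N that by blast
qed

text \<open>In an adapted chart the gradient vanishes at the centre only; with compactness this makes the set of
critical points finite.\<close>

lemma adapted_chart_critical_unique:
 assumes "adapted_chart A g f x c" "z \<in> fst c" "z \<in> critical_points A f"
 shows "z = x"
proof -
 have c: "c \<in> A" "x \<in> fst c" "snd c x = 0" using assms(1) unfolding adapted_chart_def by blast+
 obtain N where p: "!!y i. y \<in> chart_image c ==> partial i (f \<circ> chart_inv c) y = (if i \<in> N then -1 else 1) * y $ i"
  using adapted_chart_gradient[OF assms(1)] by metis
 have "(snd c z) $ i = 0" for i
  using p[OF chart_facts(5)[OF M c(1) assms(2)], of i] critical_iff_partials[OF c(1) assms(2)] assms(3)
  by (auto split: if_splits)
 hence "snd c z = snd c x" using c(3) by (simp add: vec_eq_iff)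
 thus ?thesis using chart_facts(4)[OF M c(1)] assms(2) c(2) by metis
qed

lemma finite_critical_points:
 assumes comp: "compact_space X" and adapted: "adapted_metric A g f"
 shows "finite (critical_points A f)"
proof -
 have top: "topspace X = points A" using M unfolding smooth_manifold_def by blast
 have "\<exists>V. openin X V & x \<in> V & V \<inter> critical_points A f \<subseteq> {x}" if x: "x \<in> points A" for x
 proof (cases "x \<in> critical_points A f")
  case True
  then obtain c where c: "adapted_chart A g f x c" using adapted unfolding adapted_metric_def by blast
  hence "c \<in> A" "x \<in> fst c" unfolding adapted_chart_def by blast+
  thus ?thesis
   using adapted_chart_critical_unique[OF c] chart_facts(1)[OF M] by (intro exI[of _ "fst c"]) blast
 next
  case False
  obtain c where c: "c \<in> A" "x \<in> fst c" using x unfolding points_def by blast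
  note fc = chart_facts[OF M c(1)]
  let ?F = "f \<circ> chart_inv c"
  obtain i where i: "partial i ?F (snd c x) ~= 0" using False critical_iff_partials[OF c] by blast
  have "smooth_on (chart_image c) (partial i ?F)"
   using f c(1) unfolding smooth_functions_def by (blast intro: smooth_on_partial)
  hence "open (chart_image c \<inter> partial i ?F -` (-{0}))"
   by (intro continuous_open_preimage[OF smooth_on_continuous fc(2)]) auto
  moreover have "chart_image c \<inter> partial i ?F -` (-{0}) = {y \<in> chart_image c. partial i ?F y ~= 0}" by blast
  ultimately have W: "open {y \<in> chart_image c. partial i ?F y ~= 0}" by (simp only:)
  hence "openin X (chart_inv c ` {y \<in> chart_image c. partial i ?F y ~= 0})"
   by (rule openin_chart_preimage[OF M c(1)]) blast
  moreover have "x \<in> chart_inv c ` {y \<in> chart_image c. partial i ?F y ~= 0}"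
   using i fc(4,5)[OF c(2)] by (intro image_eqI[of _ _ "snd c x"]) auto
  moreover have "z \<notin> critical_points A f" if z: "z \<in> chart_inv c ` {y \<in> chart_image c. partial i ?F y ~= 0}" for z
  proof -
   obtain y where y: "y \<in> chart_image c" "partial i ?F y ~= 0" "z = chart_inv c y" using z by blast
   thus ?thesis using critical_iff_partials[OF c(1), of z] fc(6,7)[OF y(1)] by auto
  qed
  ultimately show ?thesis by blast
 qed
 then obtain V where V: "!!x. x \<in> points A ==> openin X (V x) & x \<in> V x & V x \<inter> critical_points A f \<subseteq> {x}"
  by metis
 have "compactin X (points A)" using comp top by (simp add: compact_space_def)
 hence "\<forall>\<U>. (\<forall>U\<in>\<U>. openin X U) & points A \<subseteq> \<Union> \<U> --> (\<exists>\<F>. finite \<F> & \<F> \<subseteq> \<U> & points A \<subseteq> \<Union> \<F>)"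
  unfolding compactin_def by blast
 hence "(\<forall>U\<in>V ` points A. openin X U) & points A \<subseteq> \<Union> (V ` points A) -->
   (\<exists>\<F>. finite \<F> & \<F> \<subseteq> V ` points A & points A \<subseteq> \<Union> \<F>)" by (rule spec)
 moreover have "\<forall>U\<in>V ` points A. openin X U" "points A \<subseteq> \<Union> (V ` points A)" using V by blast+
 ultimately obtain \<V> where "finite \<V>" "\<V> \<subseteq> V ` points A" "points A \<subseteq> \<Union> \<V>" by blast
 then obtain Q where Q: "finite Q" "Q \<subseteq> points A" "points A \<subseteq> \<Union> (V ` Q)"
  using finite_subset_image[of \<V> V "points A"] by blast
 have "critical_points A f \<subseteq> Q"
 proof
  fix x assume x: "x \<in> critical_points A f"
  hence "x \<in> points A" unfolding critical_points_def by blast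
  then obtain q where "q \<in> Q" "x \<in> V q" using Q by blast
  thus "x \<in> Q" using V[of q] x Q(2) by blast
 qed
 thus ?thesis using Q(1) finite_subset by blast
qed

lemma continuous_smooth_function: "continuous_map X euclideanreal f"
 unfolding continuous_map_def
proof (intro conjI allI impI)
 fix W :: "real set" assume "openin euclidean W"
 hence W: "open W" by simp
 have top: "topspace X = points A" using M unfolding smooth_manifold_def by blast
 show "openin X {x \<in> topspace X. f x \<in> W}"
 proof (subst openin_subopen, intro ballI)
  fix x assume x: "x \<in> {x \<in> topspace X. f x \<in> W}"
  then obtain c where c: "c \<in> A" "x \<in> fst c" unfolding top points_def by blast
  note fc = chart_facts[OF M c(1)]
  let ?V = "{y \<in> chart_image c. f (chart_inv c y) \<in> W}"
  have "continuous_on (chart_image c) (f \<circ> chart_inv c)"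
   using f c(1) smooth_on_continuous unfolding smooth_functions_def by blast
  hence "open (chart_image c \<inter> (f \<circ> chart_inv c) -` W)"
   by (rule continuous_open_preimage[OF _ fc(2) W])
  moreover have "chart_image c \<inter> (f \<circ> chart_inv c) -` W = ?V" by auto
  ultimately have "open ?V" by (simp only:)
  hence "openin X (chart_inv c ` ?V)" by (intro openin_chart_preimage[OF M c(1)]) auto
  moreover have "x \<in> chart_inv c ` ?V"
   using x fc(4,5)[OF c(2)] by (intro image_eqI[of _ _ "snd c x"]) auto
  moreover have "chart_inv c ` ?V \<subseteq> {x \<in> topspace X. f x \<in> W}" using fc(3,6) top by auto
  ultimately show "\<exists>T. openin X T & x \<in> T & T \<subseteq> {x \<in> topspace X. f x \<in> W}" by blast
 qed
qed auto

text \<open>A step from the minimum in a negative direction of an adapted chart would decrease the function.\<close>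

lemma minimum_index_zero:
 assumes comp: "compact_space X" and adapted: "adapted_metric A g f" and ne: "points A ~= {}"
 obtains x where "x \<in> critical_points A f" "morse_index A f x = 0"
proof -
 have top: "topspace X = points A" using M unfolding smooth_manifold_def by blast
 have "compactin euclideanreal (f ` topspace X)"
  using image_compactin[OF _ continuous_smooth_function] comp by (simp add: compact_space_def)
 hence "compact (f ` points A)" by (simp add: top)
 then obtain x where x: "x \<in> points A" "!!z. z \<in> points A ==> f x <= f z"
  using compact_attains_inf[of "f ` points A"] ne by auto
 have crit: "x \<in> critical_points A f"
 proof -
  obtain c where c: "c \<in> A" "x \<in> fst c" using x unfolding points_def by blast
  note fc = chart_facts[OF M c(1)]
  let ?F = "f \<circ> chart_inv c" and ?y = "snd c x"
  obtain r where r: "r > 0" "ball ?y r \<subseteq> chart_image c"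
   using fc(2) fc(5)[OF c(2)] open_contains_ball by blast
  have "?F differentiable (at ?y)"
   using f c(1) fc(5)[OF c(2)] smooth_on_differentiable unfolding smooth_functions_def by blast
  hence D: "((%t. ?F (?y + t *\<^sub>R axis i 1)) has_real_derivative (\<Sum>k\<in>UNIV. axis i 1 $ k * partial k ?F ?y)) (at 0)" for i
   using has_derivative_ray[of ?F ?y 0 "axis i 1"] by simp
  have "(\<Sum>k\<in>UNIV. axis i 1 $ k * partial k ?F ?y) = 0" for i
  proof (rule DERIV_local_min[OF D r(1)], intro allI impI)
   fix t :: real assume "\<bar>0 - t\<bar> < r"
   hence "?y + t *\<^sub>R axis i 1 \<in> chart_image c" using r(2) by (intro subsetD[OF r(2)]) (simp add: dist_norm)
   hence "chart_inv c (?y + t *\<^sub>R axis i 1) \<in> points A" using fc(3,6) by blast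
   thus "?F (?y + 0 *\<^sub>R axis i 1) <= ?F (?y + t *\<^sub>R axis i 1)" using x(2) fc(4)[OF c(2)] by simp
  qed
  hence "partial i ?F ?y = 0" for i
   by (simp add: axis_def if_distrib[of "%x. x * _"] sum.delta cong: if_cong)
  thus ?thesis using critical_iff_partials[OF c] by blast
 qed
 then obtain c where ad: "adapted_chart A g f x c" using adapted unfolding adapted_metric_def by blast
 hence c: "c \<in> A" "x \<in> fst c" "snd c x = 0" unfolding adapted_chart_def by blast+
 note fc = chart_facts[OF M c(1)]
 obtain N where N: "card N = morse_index A f x" and
  eq: "!!y. y \<in> chart_image c ==> (f \<circ> chart_inv c) y = f x + (\<Sum>k\<in>UNIV. (if k \<in> N then -1 else 1) * (1/2 * (y $ k)\<^sup>2))"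
  and "!!y i. y \<in> chart_image c ==> partial i (f \<circ> chart_inv c) y = (if i \<in> N then -1 else 1) * y $ i"
  by (rule adapted_chart_gradient[OF ad]) (rule that, assumption+)
 obtain r where r: "r > 0" "ball 0 r \<subseteq> chart_image c"
  using fc(2) fc(5)[OF c(2)] c(3) open_contains_ball by metis
 have "N = {}"
 proof (rule ccontr)
  assume "N ~= {}"
  then obtain k where k: "k \<in> N" by blast
  let ?y = "(r/2) *\<^sub>R axis k 1 :: real^'n"
  have y: "?y \<in> chart_image c" using r by (intro subsetD[OF r(2)]) (simp add: dist_norm)
  have "(\<Sum>l\<in>UNIV. (if l \<in> N then -1 else 1) * (1/2 * (?y $ l)\<^sup>2)) = (\<Sum>l\<in>UNIV. if l = k then - (1/2 * (r/2)\<^sup>2) else 0)"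
   by (rule sum.cong) (use k in \<open>auto simp: axis_def\<close>)
  hence "f (chart_inv c ?y) < f x" using eq[OF y] r(1) by simp
  moreover have "chart_inv c ?y \<in> points A" using fc(3,6) y by blast
  ultimately show False using x(2) by fastforce
 qed
 thus ?thesis using that crit N by simp
qed

end

section \<open>Divergence-free Killing tensors on a manifold\<close>

lemma continuous_on_det:
 fixes G :: "real^'n::finite => real^'m::finite^'m"
 assumes "!!i j. continuous_on S (%y. G y $ i $ j)"
 shows "continuous_on S (%y. det (G y))"
 unfolding det_def by (intro continuous_intros assms)

lemma continuous_on_matrix_inv:
 fixes G :: "real^'n::finite => real^'m::finite^'m"
 assumes cont: "!!i j. continuous_on S (%y. G y $ i $ j)" and inv: "!!y. y \<in> S ==> invertible (G y)"
 shows "continuous_on S (%y. matrix_inv (G y) $ k $ l)"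
proof (rule continuous_on_eq)
 let ?r = "%y. det (\<chi> i j. if j = k then axis l 1 $ i else G y $ i $ j) / det (G y)"
 have cd: "continuous_on S (%y. det (\<chi> i j. if j = k then axis l (1::real) $ i else G y $ i $ j))"
 proof (rule continuous_on_det)
  show "continuous_on S (%y. (\<chi> i j. if j = k then axis l (1::real) $ i else G y $ i $ j) $ i $ j)" for i j
   by (cases "j = k") (simp_all add: cont)
 qed
 show "continuous_on S ?r"
  using inv by (intro continuous_on_divide cd continuous_on_det[OF cont]) (auto simp: invertible_det_nz)
 fix y assume y: "y \<in> S"
 have "G y ** matrix_inv (G y) = mat 1"
  using inv[OF y] unfolding invertible_def matrix_inv_def by (metis (mono_tags, lifting) someI_ex)
 hence "G y *v (matrix_inv (G y) *v axis l 1) = axis l 1"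
  by (simp add: matrix_vector_mul_assoc)
 hence "matrix_inv (G y) *v axis l 1 = (\<chi> k. det (\<chi> i j. if j = k then axis l 1 $ i else G y $ i $ j) / det (G y))"
  using cramer[of "G y"] inv[OF y] by (simp add: invertible_det_nz)
 hence "(matrix_inv (G y) *v axis l 1) $ k = ?r y" by simp
 moreover have "(matrix_inv (G y) *v axis l 1) $ k = matrix_inv (G y) $ k $ l"
  by (simp add: matrix_vector_mult_def axis_def if_distrib[of "%x. _ * x"] sum.delta cong: if_cong)
 ultimately show "?r y = matrix_inv (G y) $ k $ l" by simp
qed

lemma sym_div_eq:
 "sym_div G \<alpha> y J = - (\<Sum>k\<in>UNIV. \<Sum>i\<in>UNIV. (matrix_inv (G y) *v axis k 1) $ i * nabla G k \<alpha> y (i # J))"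
 by (simp add: sym_div_def sym_contract_def)

lemma nabla_add:
 assumes "!!J. (%z. \<alpha> z J) differentiable (at y)" "!!J. (%z. \<beta> z J) differentiable (at y)"
 shows "nabla G k (\<alpha> + \<beta>) y J = nabla G k \<alpha> y J + nabla G k \<beta> y J"
 by (simp add: nabla_def partial_add assms distrib_left sum.distrib)

lemma nabla_scale:
 assumes "!!J. (%z. \<alpha> z J) differentiable (at y)"
 shows "nabla G k (a *\<^sub>R \<alpha>) y J = a * nabla G k \<alpha> y J"
 by (simp add: nabla_def partial_cmult assms right_diff_distrib sum_distrib_left mult.left_commute)

context
 fixes X :: "'a topology" and A :: "('a, 'n::finite) chart set" and g :: "'a tensor_field"
 assumes M: "closed_connected_riemannian X A g"
begin

lemma smooth_manifold: "smooth_manifold X A"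
 using M unfolding closed_connected_riemannian_def by blast

lemma metric_matrix_invertible:
 assumes c: "c \<in> A" and y: "y \<in> chart_image c"
 shows "invertible (metric_matrix A g c y)"
proof -
 let ?x = "chart_inv c y" and ?G = "metric_matrix A g c y" and ?T = "tangent_space A (chart_inv c y)"
 let ?e = "%i. coord_vector A c i (chart_inv c y)"
 note fc = chart_facts[OF smooth_manifold c]
 have x: "?x \<in> fst c" "?x \<in> points A" using fc(3,6) y by auto
 have g: "g \<in> sym_tensors A 2" "!!v. v \<in> ?T ==> v ~= 0 ==> g ?x [v, v] > 0"
  using M x unfolding closed_connected_riemannian_def riemannian_metric_def by blast+
 hence \<omega>: "g ?x \<in> sym_forms 2 ?T" using x unfolding sym_tensors_def by blast
 have e: "?e i \<in> ?T" for i by (rule coord_vector_tangent[OF smooth_manifold c x(1)])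
 have "w = 0" if w: "?G *v w = 0" for w
 proof (rule ccontr)
  assume "w ~= 0"
  let ?v = "\<Sum>i\<in>UNIV. w $ i *\<^sub>R ?e i"
  have v: "?v \<in> ?T" by (intro subspace_sum subspace_scale subspace_tangent_space[OF smooth_manifold] e)
  have "?v ~= 0"
   using coord_vector_independent[OF smooth_manifold c x(1), of "%i. w $ i"] \<open>w ~= 0\<close> by (auto simp: vec_eq_iff)
  hence "g ?x [?v, ?v] > 0" using g v by blast
  moreover have "g ?x [?v, ?v] = (\<Sum>i\<in>UNIV. w $ i * g ?x [?e i, ?v])"
   by (rule sym_forms_sum[OF smooth_manifold \<omega> subspace_tangent_space[OF smooth_manifold]]) (use v e in auto)
  moreover have "g ?x [?e i, ?v] = (?G *v w) $ i" for i
  proof -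
   have "g ?x [?e i, ?v] = g ?x [?v, ?e i]" by (rule sym_forms_sym[OF smooth_manifold \<omega>]) simp
   also have "... = (\<Sum>j\<in>UNIV. w $ j * g ?x [?e j, ?e i])"
    by (rule sym_forms_sum[OF smooth_manifold \<omega> subspace_tangent_space[OF smooth_manifold]]) (use e in auto)
   also have "... = (\<Sum>j\<in>UNIV. w $ j * g ?x [?e i, ?e j])"
    by (intro sum.cong refl arg_cong[where f = "(*) _"] sym_forms_sym[OF smooth_manifold \<omega>]) simp
   finally show ?thesis by (simp add: matrix_vector_mult_def metric_matrix_def components_def mult.commute)
  qed
  ultimately show False using w by simp
 qed
 thus ?thesis using matrix_left_invertible_ker invertible_left_inverse by blast
qed

lemma christoffel_bounded:
 assumes c: "c \<in> A" and K: "compact K" "K \<subseteq> chart_image c"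
 obtains C where "C >= 0" "!!y k i j. y \<in> K ==> \<bar>christoffel (metric_matrix A g c) k i j y\<bar> <= C"
proof -
 have "g \<in> sym_tensors A 2"
  using M unfolding closed_connected_riemannian_def riemannian_metric_def by blast
 hence sm: "smooth_on (chart_image c) (%y. metric_matrix A g c y $ i $ j)" for i j
  using c unfolding sym_tensors_def metric_matrix_def by simp
 have "continuous_on K (christoffel (metric_matrix A g c) k i j)" for k i j
 proof (rule continuous_on_subset[OF _ K(2)])
  show "continuous_on (chart_image c) (christoffel (metric_matrix A g c) k i j)"
   unfolding christoffel_def[abs_def]
   by (intro continuous_intros continuous_on_matrix_inv smooth_on_continuous smooth_on_partial sm
    metric_matrix_invertible[OF c])
 qed
 hence "bounded (christoffel (metric_matrix A g c) k i j ` K)" for k i j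
  by (rule compact_imp_bounded[OF compact_continuous_image[OF _ K(1)]])
 hence "\<exists>B. \<forall>y\<in>K. \<bar>christoffel (metric_matrix A g c) k i j y\<bar> <= B" for k i j
  unfolding bounded_iff by auto
 then obtain B where B: "!!k i j y. y \<in> K ==> \<bar>christoffel (metric_matrix A g c) k i j y\<bar> <= B k i j" by metis
 show ?thesis
 proof
  show "0 <= (\<Sum>k\<in>UNIV. \<Sum>i\<in>UNIV. \<Sum>j\<in>UNIV. \<bar>B k i j\<bar>)" by (intro sum_nonneg) auto
  fix y k i j assume "y \<in> K"
  hence "\<bar>christoffel (metric_matrix A g c) k i j y\<bar> <= \<bar>B k i j\<bar>" by (rule order_trans[OF B abs_ge_self])
  also have "... <= (\<Sum>j\<in>UNIV. \<bar>B k i j\<bar>)" by (rule member_le_sum) auto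
  also have "... <= (\<Sum>i\<in>UNIV. \<Sum>j\<in>UNIV. \<bar>B k i j\<bar>)"
   by (rule member_le_sum[of i UNIV "%i. \<Sum>j\<in>UNIV. \<bar>B k i j\<bar>"]) (auto intro: sum_nonneg)
  also have "... <= (\<Sum>k\<in>UNIV. \<Sum>i\<in>UNIV. \<Sum>j\<in>UNIV. \<bar>B k i j\<bar>)"
   by (rule member_le_sum[of k UNIV "%k. \<Sum>i\<in>UNIV. \<Sum>j\<in>UNIV. \<bar>B k i j\<bar>"]) (auto intro: sum_nonneg)
  finally show "\<bar>christoffel (metric_matrix A g c) k i j y\<bar> <= (\<Sum>k\<in>UNIV. \<Sum>i\<in>UNIV. \<Sum>j\<in>UNIV. \<bar>B k i j\<bar>)" .
 qed
qed

text \<open>In a chart the Killing equation expresses the flat symmetric derivative by the components themselves,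
 which is the hypothesis of unique continuation.\<close>

lemma killing_flat_deriv_bound:
 fixes \<alpha> :: "'n field"
 assumes kill: "sym_deriv G \<alpha> y = 0" and C: "!!k i j. \<bar>christoffel G k i j y\<bar> <= C" and L: "length L = Suc p"
 shows "\<bar>flat_deriv \<alpha> y L\<bar> <= (real (Suc p) * (real p * (real CARD('n) * C))) * (\<Sum>J\<in>multi_indices p. \<bar>\<alpha> y J\<bar>)"
proof -
 let ?N = "\<Sum>J\<in>multi_indices p. \<bar>\<alpha> y J\<bar>"
 have N: "\<bar>\<alpha> y J\<bar> <= ?N" if "length J = p" for J
  by (rule member_le_sum) (use that in auto)
 have C0: "C >= 0" using C[of undefined undefined undefined] by linarith
 define E where "E s = (\<Sum>t<length (omit s L). \<Sum>k\<in>UNIV. christoffel G k (L ! s) (omit s L ! t) y * \<alpha> y ((omit s L)[t := k]))" for s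
 have "0 = (\<Sum>s<length L. partial (L ! s) (%z. \<alpha> z (omit s L)) y - E s)"
  using fun_cong[OF kill, of L] unfolding sym_deriv_eq nabla_def E_def by simp
 hence eq: "flat_deriv \<alpha> y L = (\<Sum>s<length L. E s)"
  by (simp add: flat_deriv_def sum_subtractf)
 have E: "\<bar>E s\<bar> <= real p * (real CARD('n) * (C * ?N))" if s: "s < length L" for s
 proof -
  have len: "length (omit s L) = p" using length_omit[OF s] L by simp
  have inner: "\<bar>\<Sum>k\<in>UNIV. christoffel G k (L ! s) (omit s L ! t) y * \<alpha> y ((omit s L)[t := k])\<bar> <= real CARD('n) * (C * ?N)" for t
  proof -
   have "\<bar>\<Sum>k\<in>UNIV. christoffel G k (L ! s) (omit s L ! t) y * \<alpha> y ((omit s L)[t := k])\<bar>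
    <= (\<Sum>k\<in>(UNIV::'n set). C * ?N)"
   proof (rule order_trans[OF sum_abs], rule sum_mono)
    fix k
    show "\<bar>christoffel G k (L ! s) (omit s L ! t) y * \<alpha> y ((omit s L)[t := k])\<bar> <= C * ?N"
    unfolding abs_mult by (intro mult_mono C N C0) (use len in auto)
   qed
   thus ?thesis by simp
  qed
  have "\<bar>E s\<bar> <= (\<Sum>t<length (omit s L). real CARD('n) * (C * ?N))"
   unfolding E_def by (rule order_trans[OF sum_abs], rule sum_mono, rule inner)
  thus ?thesis unfolding len by simp
 qed
 have "\<bar>flat_deriv \<alpha> y L\<bar> <= (\<Sum>s<length L. real p * (real CARD('n) * (C * ?N)))"
  unfolding eq by (rule order_trans[OF sum_abs], rule sum_mono, rule E) simp
 thus ?thesis by (simp add: L mult.assoc del: of_nat_Suc)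
qed

lemma killing_components:
 assumes \<alpha>: "\<alpha> \<in> killing_div_free A g p" and c: "c \<in> A"
 shows "\<alpha> \<in> sym_tensors A p" "y \<in> chart_image c ==> components A c \<alpha> y \<in> sym_comps p"
  "y \<in> chart_image c ==> (%y. components A c \<alpha> y J) differentiable (at y)"
  "y \<in> chart_image c ==> sym_deriv (metric_matrix A g c) (components A c \<alpha>) y = 0"
  "y \<in> chart_image c ==> sym_div (metric_matrix A g c) (components A c \<alpha>) y = 0"
proof -
 show 1: "\<alpha> \<in> sym_tensors A p" using \<alpha> unfolding killing_div_free_def by blast
 show "y \<in> chart_image c ==> components A c \<alpha> y \<in> sym_comps p"
  by (rule components_sym_comps[OF smooth_manifold c 1])
 show "y \<in> chart_image c ==> (%y. components A c \<alpha> y J) differentiable (at y)"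
  using 1 c smooth_on_differentiable unfolding sym_tensors_def by blast
 show "y \<in> chart_image c ==> sym_deriv (metric_matrix A g c) (components A c \<alpha>) y = 0"
  "y \<in> chart_image c ==> sym_div (metric_matrix A g c) (components A c \<alpha>) y = 0"
  using \<alpha> c unfolding killing_div_free_def by blast+
qed

text \<open>The set of points near which the tensor vanishes is open; by the local statement it is also closed, and the
manifold is connected.\<close>

lemma unique_continuation:
 assumes \<alpha>: "\<alpha> \<in> killing_div_free A g p" and V: "openin X V" "V ~= {}" "!!x. x \<in> V ==> \<alpha> x = 0"
 shows "\<alpha> = 0"
proof -
 have top: "topspace X = points A" using smooth_manifold unfolding smooth_manifold_def by blast
 define Z where "Z = \<Union> {U. openin X U & (\<forall>x\<in>U. \<alpha> x = 0)}"
 have Zopen: "openin X Z" unfolding Z_def by (rule openin_Union) blast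
 have Z0: "\<alpha> x = 0" if "x \<in> Z" for x using that unfolding Z_def by blast
 have "V \<subseteq> Z" using V unfolding Z_def by blast
 have "openin X (topspace X - Z)"
 proof (subst openin_subopen, intro ballI)
  fix x assume x: "x \<in> topspace X - Z"
  then obtain c where c: "c \<in> A" "x \<in> fst c" unfolding top points_def by blast
  note fc = chart_facts[OF smooth_manifold c(1)]
  note kc = killing_components[OF \<alpha> c(1)]
  define y0 where "y0 = snd c x"
  obtain R where R: "R > 0" "cball y0 R \<subseteq> chart_image c"
   using fc(2) fc(5)[OF c(2)] open_contains_cball unfolding y0_def by blast
  obtain C where C: "C >= 0" "!!y k i j. y \<in> cball y0 R ==> \<bar>christoffel (metric_matrix A g c) k i j y\<bar> <= C"
   using christoffel_bounded[OF c(1) compact_cball R(2)] by blast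
  let ?U = "chart_inv c ` ball y0 (R/2)"
  have sub: "ball y0 (R/2) \<subseteq> chart_image c" using R by (auto intro!: subsetD[OF R(2)])
  have U: "openin X ?U" by (rule openin_chart_preimage[OF smooth_manifold c(1) open_ball sub])
  have "?U \<inter> Z = {}"
  proof (rule ccontr)
   assume "?U \<inter> Z ~= {}"
   then obtain z where z: "z \<in> ball y0 (R/2)" "chart_inv c z \<in> Z" by blast
   have zi: "z \<in> chart_image c" using z(1) sub by blast
   have in_R: "y \<in> cball y0 R" if "y \<in> ball z (R/2)" for y
    using that z(1) dist_triangle[of y0 y z] by simp
   have "open (snd c ` (Z \<inter> fst c))"
    by (intro open_chart_image[OF smooth_manifold c(1)] openin_Int Zopen fc(1)) auto
   moreover have "z \<in> snd c ` (Z \<inter> fst c)"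
    using z(2) fc(6,7)[OF zi] by (intro image_eqI[of _ _ "chart_inv c z"]) auto
   ultimately obtain e where e: "e > 0" "ball z e \<subseteq> snd c ` (Z \<inter> fst c)"
    using open_contains_ball by blast
   have zero: "components A c \<alpha> y = 0" if y: "y \<in> ball z (min e (R/2))" for y
   proof -
    have "y \<in> snd c ` (Z \<inter> fst c)" using y e(2) by auto
    hence "\<alpha> (chart_inv c y) = 0" using fc(4) Z0 by auto
    thus ?thesis by (intro ext) (simp add: components_def)
   qed
   have comps: "components A c \<alpha> y = 0" if y: "y \<in> ball z (R/2)" for y
   proof (rule unique_continuation_ball[where \<rho> = "min e (R/2)", OF _ _ _ zero _ _ y])
    fix w assume w: "w \<in> ball z (R/2)"
    hence wi: "w \<in> chart_image c" using in_R R(2) by blast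
    show "components A c \<alpha> w \<in> sym_comps p" "(%y. components A c \<alpha> y J) differentiable (at w)" for J
    using kc(2,3)[OF wi] .
    show "\<bar>flat_deriv (components A c \<alpha>) w L\<bar>
    <= (real (Suc p) * (real p * (real CARD('n) * C))) * (\<Sum>J\<in>multi_indices p. \<bar>components A c \<alpha> w J\<bar>)"
    if "length L = Suc p" for L
    by (rule killing_flat_deriv_bound[OF kc(4)[OF wi] C(2)[OF in_R[OF w]] that])
   qed (use e R in auto)
   have "openin X (chart_inv c ` ball z (R/2))"
    by (rule openin_chart_preimage[OF smooth_manifold c(1) open_ball]) (use in_R R(2) in blast)
   moreover have "\<forall>w \<in> chart_inv c ` ball z (R/2). \<alpha> w = 0"
   proof
    fix w assume "w \<in> chart_inv c ` ball z (R/2)"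
    then obtain y where y: "y \<in> ball z (R/2)" "w = chart_inv c y" by blast
    hence yi: "y \<in> chart_image c" using in_R R(2) by blast
    show "\<alpha> w = 0"
    by (rule components_zero_imp_zero[OF smooth_manifold c(1) kc(1)])
    (use comps[OF y(1)] y(2) fc(6,7)[OF yi] in auto)
   qed
   moreover have "x \<in> chart_inv c ` ball z (R/2)"
    using z(1) fc(4)[OF c(2)] by (intro image_eqI[of _ _ y0]) (auto simp: y0_def dist_commute)
   ultimately have "x \<in> Z" unfolding Z_def by blast
   with x show False by blast
  qed
  moreover have "x \<in> ?U" using fc(4)[OF c(2)] R by (intro image_eqI[of _ _ y0]) (auto simp: y0_def)
  moreover have "?U \<subseteq> topspace X" using U openin_subset by blast
  ultimately show "\<exists>T. openin X T & x \<in> T & T \<subseteq> topspace X - Z" using U by blast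
 qed
 hence "closedin X Z" using openin_subset[OF Zopen] unfolding closedin_def by blast
 hence "Z = topspace X"
  using M Zopen V(2) \<open>V \<subseteq> Z\<close> unfolding closed_connected_riemannian_def connected_space_clopen_in by blast
 hence "\<alpha> x = 0" if "x \<in> points A" for x using Z0 that top by blast
 moreover have "\<alpha> x = 0" if "x \<notin> points A" for x
  using \<alpha> that unfolding killing_div_free_def sym_tensors_def by blast
 ultimately show ?thesis unfolding fun_eq_iff[of \<alpha>] zero_fun_apply by blast
qed

lemma sym_formsI:
 "(!!vs. ~ (length vs = p & set vs \<subseteq> T) ==> \<omega> vs = 0) ==> (!!vs ws. mset vs = mset ws ==> \<omega> vs = \<omega> ws) ==>
  (!!v w a b vs. v \<in> T ==> w \<in> T ==> Suc (length vs) = p ==> set vs \<subseteq> T ==>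
   \<omega> ((a *\<^sub>R v + b *\<^sub>R w) # vs) = a * \<omega> (v # vs) + b * \<omega> (w # vs)) ==> \<omega> \<in> sym_forms p T"
 unfolding sym_forms_def by blast

lemma subspace_sym_forms:
 fixes T :: "'v::real_vector set"
 shows "subspace (sym_forms p T)"
proof (rule subspaceI)
 fix \<omega> \<eta> :: "'v list => real" and a :: real
 assume \<omega>: "\<omega> \<in> sym_forms p T" and \<eta>: "\<eta> \<in> sym_forms p T"
 have off: "~ (length vs = p & set vs \<subseteq> T) ==> \<omega> vs = 0" "~ (length vs = p & set vs \<subseteq> T) ==> \<eta> vs = 0" for vs
  using \<omega> \<eta> unfolding sym_forms_def by blast+
 note sym = sym_forms_sym[OF smooth_manifold \<omega>] sym_forms_sym[OF smooth_manifold \<eta>]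
 note lin = sym_forms_lin[OF smooth_manifold \<omega>] sym_forms_lin[OF smooth_manifold \<eta>]
 show "\<omega> + \<eta> \<in> sym_forms p T"
 proof (rule sym_formsI)
  show "(\<omega> + \<eta>) vs = 0" if "~ (length vs = p & set vs \<subseteq> T)" for vs
   by (simp only: plus_fun_apply off[OF that])
  show "(\<omega> + \<eta>) vs = (\<omega> + \<eta>) ws" if "mset vs = mset ws" for vs ws
   by (simp only: plus_fun_apply sym[OF that])
  show "(\<omega> + \<eta>) ((a *\<^sub>R v + b *\<^sub>R w) # vs) = a * (\<omega> + \<eta>) (v # vs) + b * (\<omega> + \<eta>) (w # vs)"
   if "v \<in> T" "w \<in> T" "Suc (length vs) = p" "set vs \<subseteq> T" for v w a b vs
   unfolding plus_fun_apply lin(1)[OF that] lin(2)[OF that] by (simp add: algebra_simps)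
 qed
 show "a *\<^sub>R \<omega> \<in> sym_forms p T"
 proof (rule sym_formsI)
  show "(a *\<^sub>R \<omega>) vs = 0" if "~ (length vs = p & set vs \<subseteq> T)" for vs
   by (simp only: scaleR_fun_apply off[OF that] scaleR_zero_right)
  show "(a *\<^sub>R \<omega>) vs = (a *\<^sub>R \<omega>) ws" if "mset vs = mset ws" for vs ws
   by (simp only: scaleR_fun_apply sym[OF that])
  show "(a *\<^sub>R \<omega>) ((c *\<^sub>R v + b *\<^sub>R w) # vs) = c * (a *\<^sub>R \<omega>) (v # vs) + b * (a *\<^sub>R \<omega>) (w # vs)"
   if "v \<in> T" "w \<in> T" "Suc (length vs) = p" "set vs \<subseteq> T" for v w c b vs
   unfolding scaleR_fun_apply lin(1)[OF that] by (simp add: algebra_simps)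
 qed
qed (rule sym_formsI, simp_all)

lemma subspace_killing_div_free: "subspace (killing_div_free A g p)"
proof (rule subspaceI)
 have "components A c 0 = 0" for c by (intro ext) (simp add: components_def)
 moreover have "sym_deriv G 0 y = 0" "sym_div G 0 y = 0" for G :: "'n metric" and y
  by (auto simp: fun_eq_iff sym_deriv_eq sym_div_eq nabla_def)
 moreover have "0 \<in> sym_tensors A p"
  unfolding sym_tensors_def components_def mem_Collect_eq zero_fun_apply[where x = "_ :: 'a"]
 proof (intro conjI ballI allI impI)
  show "0 \<in> sym_forms p (tangent_space A x)" for x by (rule subspace_0[OF subspace_sym_forms])
 qed simp_all
 ultimately show "0 \<in> killing_div_free A g p" by (simp add: killing_div_free_def)
next
 fix \<alpha> \<beta> and a :: real
 assume \<alpha>: "\<alpha> \<in> killing_div_free A g p" and \<beta>: "\<beta> \<in> killing_div_free A g p"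
 have comp: "components A c (\<alpha> + \<beta>) = components A c \<alpha> + components A c \<beta>"
  "components A c (a *\<^sub>R \<alpha>) = a *\<^sub>R components A c \<alpha>" for c
  by (intro ext, simp add: components_def)+
 have st: "\<alpha> \<in> sym_tensors A p" "\<beta> \<in> sym_tensors A p" using \<alpha> \<beta> unfolding killing_div_free_def by blast+
 have sm: "smooth_on (chart_image c) (%y. components A c \<alpha> y J)" "smooth_on (chart_image c) (%y. components A c \<beta> y J)"
  if "c \<in> A" for c J using st that unfolding sym_tensors_def by blast+
 have stD: "!!x. x \<in> points A ==> \<gamma> x \<in> sym_forms p (tangent_space A x)" "!!x. x \<notin> points A ==> \<gamma> x = 0"
  if "\<gamma> \<in> sym_tensors A p" for \<gamma> using that unfolding sym_tensors_def by blast+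
 have "\<alpha> + \<beta> \<in> sym_tensors A p"
  unfolding sym_tensors_def mem_Collect_eq
 proof (intro conjI ballI allI impI)
  show "(\<alpha> + \<beta>) x \<in> sym_forms p (tangent_space A x)" if "x \<in> points A" for x
   using subspace_add[OF subspace_sym_forms stD(1)[OF st(1) that] stD(1)[OF st(2) that]] by simp
  show "(\<alpha> + \<beta>) x = 0" if "x \<notin> points A" for x
   using stD(2)[OF st(1) that] stD(2)[OF st(2) that] by simp
  show "smooth_on (chart_image c) (%y. components A c (\<alpha> + \<beta>) y J)" if "c \<in> A" for c J
   unfolding comp plus_fun_apply by (intro smooth_on_add[OF chart_facts(2)[OF smooth_manifold that]] sm that)
 qed
 moreover have "a *\<^sub>R \<alpha> \<in> sym_tensors A p"
  unfolding sym_tensors_def mem_Collect_eq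
 proof (intro conjI ballI allI impI)
  show "(a *\<^sub>R \<alpha>) x \<in> sym_forms p (tangent_space A x)" if "x \<in> points A" for x
   using subspace_scale[OF subspace_sym_forms stD(1)[OF st(1) that]] by simp
  show "(a *\<^sub>R \<alpha>) x = 0" if "x \<notin> points A" for x using stD(2)[OF st(1) that] by simp
  show "smooth_on (chart_image c) (%y. components A c (a *\<^sub>R \<alpha>) y J)" if "c \<in> A" for c J
   unfolding comp scaleR_fun_apply real_scaleR_def
   by (intro smooth_on_mult[OF chart_facts(2)[OF smooth_manifold that]] smooth_on_const sm that)
 qed
 moreover have "sym_deriv G (components A c (\<alpha> + \<beta>)) y = sym_deriv G (components A c \<alpha>) y + sym_deriv G (components A c \<beta>) y"
  "sym_div G (components A c (\<alpha> + \<beta>)) y = sym_div G (components A c \<alpha>) y + sym_div G (components A c \<beta>) y"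
  "sym_deriv G (components A c (a *\<^sub>R \<alpha>)) y = a *\<^sub>R sym_deriv G (components A c \<alpha>) y"
  "sym_div G (components A c (a *\<^sub>R \<alpha>)) y = a *\<^sub>R sym_div G (components A c \<alpha>) y"
  if "c \<in> A" "y \<in> chart_image c" for c y and G :: "'n metric"
 proof -
  note d = killing_components(3)[OF \<alpha> that(1,2)] killing_components(3)[OF \<beta> that(1,2)]
  show "sym_deriv G (components A c (\<alpha> + \<beta>)) y = sym_deriv G (components A c \<alpha>) y + sym_deriv G (components A c \<beta>) y"
   "sym_div G (components A c (\<alpha> + \<beta>)) y = sym_div G (components A c \<alpha>) y + sym_div G (components A c \<beta>) y"
   "sym_deriv G (components A c (a *\<^sub>R \<alpha>)) y = a *\<^sub>R sym_deriv G (components A c \<alpha>) y"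
   "sym_div G (components A c (a *\<^sub>R \<alpha>)) y = a *\<^sub>R sym_div G (components A c \<alpha>) y"
   unfolding comp
   by (intro ext, simp add: sym_deriv_eq sym_div_eq nabla_add nabla_scale d sum.distrib distrib_left sum_distrib_left mult.left_commute)+
 qed
 ultimately show "\<alpha> + \<beta> \<in> killing_div_free A g p" "a *\<^sub>R \<alpha> \<in> killing_div_free A g p"
  using killing_components(4,5)[OF \<alpha>] killing_components(4,5)[OF \<beta>] unfolding killing_div_free_def by auto
qed

text \<open>Restriction to a flat chart, read as a polynomial tensor field on Euclidean space, is injective on
 divergence-free Killing tensors.\<close>

lemma killing_div_free_finite_dim:
 assumes ne: "points A ~= {} ==> \<exists>c\<in>A. 0 \<in> chart_image c & (\<forall>y\<in>chart_image c. metric_matrix A g c y = mat 1)"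
 obtains B where "finite B" "span B = killing_div_free A g p"
  "dim (killing_div_free A g p) <= dim (flat_killing p :: 'n field set)" "points A = {} ==> dim (killing_div_free A g p) = 0"
proof (cases "points A = {}")
 case True
 have "\<alpha> = 0" if "\<alpha> \<in> killing_div_free A g p" for \<alpha>
  using that True unfolding killing_div_free_def sym_tensors_def by auto
 hence eq: "killing_div_free A g p = {0}" using subspace_0[OF subspace_killing_div_free] by blast
 have "dim (killing_div_free A g p) = 0"
  by (rule dim_unique[of "{}"]) (simp_all add: eq independent_empty)
 thus ?thesis using that[of "{}"] eq by simp
next
 case False
 then obtain c where c: "c \<in> A" "0 \<in> chart_image c" "!!y. y \<in> chart_image c ==> metric_matrix A g c y = mat 1"
  using ne by blast
 note fc = chart_facts[OF smooth_manifold c(1)]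
 obtain r where r: "r > 0" "ball 0 r \<subseteq> chart_image c" using fc(2) c(2) open_contains_ball by metis
 define d where "d = r / (real p + 1)"
 have d: "d > 0" "real p * d < r" using r by (auto simp: d_def field_simps)
 define L where "L \<alpha> = interpolant p d 0 (components A c \<alpha>)" for \<alpha>
 have "linear (components A c)"
  by (rule linearI) (intro ext, simp add: components_def)+
 hence L: "linear L" unfolding L_def using linear_compose[OF _ linear_interpolant] by (simp add: comp_def)
 have flat: "flat_deriv (components A c \<alpha>) y = 0" "flat_div (components A c \<alpha>) y = 0"
  if "\<alpha> \<in> killing_div_free A g p" "y \<in> ball 0 r" for \<alpha> y
 proof -
  have y: "y \<in> chart_image c" using that r by blast
  show "flat_deriv (components A c \<alpha>) y = 0" "flat_div (components A c \<alpha>) y = 0"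
   using killing_components(4,5)[OF that(1) c(1) y]
    sym_deriv_flat[OF fc(2), of "metric_matrix A g c"] sym_div_flat[OF fc(2), of "metric_matrix A g c"] c(3) y by auto
 qed
 have int: "L \<alpha> \<in> flat_killing p" "!!y. y \<in> ball 0 r ==> L \<alpha> y = components A c \<alpha> y"
  if \<alpha>: "\<alpha> \<in> killing_div_free A g p" for \<alpha>
 proof -
  have kc: "components A c \<alpha> y \<in> sym_comps p" "(%y. components A c \<alpha> y J) differentiable (at y)" if "y \<in> ball 0 r" for y J
   using killing_components(2,3)[OF \<alpha> c(1)] that r by blast+
  show "L \<alpha> \<in> flat_killing p" unfolding L_def
   by (rule killing_ball_interpolant(2)[OF kc flat(1)[OF \<alpha>] d flat(2)[OF \<alpha>]])
  show "L \<alpha> y = components A c \<alpha> y" if "y \<in> ball 0 r" for y unfolding L_def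
   by (rule killing_ball_interpolant(1)[OF kc flat(1)[OF \<alpha>] d that])
 qed
 have inj: "\<alpha> = 0" if \<alpha>: "\<alpha> \<in> killing_div_free A g p" and "L \<alpha> = 0" for \<alpha>
 proof (rule unique_continuation[OF \<alpha>])
  show "openin X (chart_inv c ` ball 0 r)"
   by (rule openin_chart_preimage[OF smooth_manifold c(1) open_ball r(2)])
  show "chart_inv c ` ball 0 r ~= {}" using r by auto
  fix x assume "x \<in> chart_inv c ` ball 0 r"
  then obtain y where y: "y \<in> ball 0 r" "x = chart_inv c y" by blast
  hence yi: "y \<in> chart_image c" using r by blast
  have "components A c \<alpha> y = 0" using int(2)[OF \<alpha> y(1)] \<open>L \<alpha> = 0\<close> by simp
  thus "\<alpha> x = 0"
   by (intro components_zero_imp_zero[OF smooth_manifold c(1) killing_components(1)[OF \<alpha> c(1)]])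
    (use y(2) fc(6,7)[OF yi] in auto)
 qed
 obtain F where F: "finite F" "independent F" "span F = (flat_killing p :: 'n field set)"
  using flat_killing_finite_dim by blast
 have im: "L ` killing_div_free A g p \<subseteq> span F" using int(1) F(3) by auto
 obtain B where B: "finite B" "span B = killing_div_free A g p" "card B <= card F" "dim (killing_div_free A g p) = card B"
  by (rule finite_dim_of_injective[OF subspace_killing_div_free L _ im F(1)]) (use inj in blast)+
 have "dim (flat_killing p :: 'n field set) = card F"
  using F(2,3) by (metis dim_span_eq_card_independent)
 with B False show ?thesis using that by simp
qed

end

section \<open>The model operator\<close>

text \<open>With \<open>F y = (\<Sum>k. e k * y\<^sub>k\<^sup>2) / 2\<close> these are conjugates of the partial derivatives, \<open>exp (- F) \<partial>\<^sub>k exp F\<close> and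
 \<open>exp F \<partial>\<^sub>k exp (- F)\<close>.\<close>

definition witten :: "('n => real) => 'n::finite => (real^'n => real) => real^'n => real" where
 "witten e k u y = partial k u y + e k * y $ k * u y"

definition witten_adj :: "('n => real) => 'n::finite => (real^'n => real) => real^'n => real" where
 "witten_adj e k u y = partial k u y - e k * y $ k * u y"

text \<open>The operators \<open>exp (- F) d\<^sup>s exp F\<close> and \<open>exp (- F) d\<^sup>s\<^sup>* exp F\<close>, and the model operator in factored form.\<close>

definition witten_deriv :: "('n => real) => 'n::finite field => 'n field" where
 "witten_deriv e u y J = (\<Sum>s<length J. witten e (J ! s) (%z. u z (omit s J)) y)"

definition witten_div :: "('n => real) => 'n::finite field => 'n field" where
 "witten_div e u y J = - (\<Sum>k\<in>UNIV. witten e k (%z. u z (k # J)) y)"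

definition witten_laplacian :: "('n => real) => 'n::finite field => 'n field" where
 "witten_laplacian e u y J =
   - (\<Sum>k\<in>UNIV. witten_adj e k (%z. witten_deriv e u z (k # J)) y)
   + (\<Sum>s<length J. witten_adj e (J ! s) (%z. witten_div e u z (omit s J)) y)"

lemma witten_adj_witten:
 assumes "w differentiable (at y)" "partial l w differentiable (at y)"
 shows "witten_adj e k (witten e l w) y = partial k (partial l w) y + (if k = l then e k * w y else 0)
  + e l * y $ l * partial k w y - e k * y $ k * partial l w y - e k * y $ k * (e l * y $ l * w y)"
proof -
 have "partial k (witten e l w) y = partial k (partial l w) y + partial k (%z. e l * (z $ l * w z)) y"
  unfolding witten_def[abs_def]
  by (subst partial_add) (simp_all add: assms mult.assoc differentiable_mult)
 also have "partial k (%z. e l * (z $ l * w z)) y = e l * ((if k = l then 1 else 0) * w y + y $ l * partial k w y)"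
  by (subst partial_cmult) (simp_all add: assms partial_mult differentiable_mult)
 finally have eq: "partial k (witten e l w) y = partial k (partial l w) y
   + e l * ((if k = l then 1 else 0) * w y + y $ l * partial k w y)" .
 show ?thesis unfolding witten_adj_def eq unfolding witten_def by (auto simp: algebra_simps)
qed

lemma differentiable_witten:
 assumes "w differentiable (at y)" "partial l w differentiable (at y)"
 shows "witten e l w differentiable (at y)"
 unfolding witten_def[abs_def] by (simp add: assms differentiable_mult differentiable_add)

lemma witten_adj_sum:
 assumes "!!i. i \<in> I ==> w i differentiable (at y)" "finite I"
 shows "witten_adj e k (%z. \<Sum>i\<in>I. w i z) y = (\<Sum>i\<in>I. witten_adj e k (w i) y)"
 by (simp add: witten_adj_def partial_sum[OF assms(1)] sum_distrib_left sum_subtractf)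

lemma witten_adj_add:
 assumes "u differentiable (at y)" "w differentiable (at y)"
 shows "witten_adj e k (%z. u z + w z) y = witten_adj e k u y + witten_adj e k w y"
 by (simp add: witten_adj_def partial_add[OF assms] algebra_simps)

lemma witten_adj_minus:
 assumes "u differentiable (at y)"
 shows "witten_adj e k (%z. - u z) y = - witten_adj e k u y"
 by (simp add: witten_adj_def partial_minus[OF assms])

lemma sum_delta_nth:
 fixes T :: "'n::finite list => real"
 assumes sym: "!!I J. mset I = mset J ==> T I = T J" and s: "s < length J"
 shows "(\<Sum>k\<in>UNIV. if k = J ! s then a k * T (k # omit s J) else 0) = a (J ! s) * T J"
proof -
 have "(\<Sum>k\<in>UNIV. if k = J ! s then a k * T (k # omit s J) else 0) = a (J ! s) * T (J ! s # omit s J)"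
  by (simp add: sum.delta)
 also have "T (J ! s # omit s J) = T J" by (rule sym[OF mset_omit[OF s]])
 finally show ?thesis .
qed

text \<open>The expanded form of the model operator: the first-order terms cancel.\<close>

lemma witten_laplacian_expand:
 fixes u :: "'n::finite field"
 assumes diff: "!!J. (%z. u z J) differentiable (at y)" "!!k J. partial k (%z. u z J) differentiable (at y)"
  and sym: "!!I J. mset I = mset J ==> u y I = u y J"
 shows "witten_laplacian e u y J =
   - (\<Sum>k\<in>UNIV. partial k (partial k (%z. u z J)) y)
   - (\<Sum>k\<in>UNIV. \<Sum>s<length J. partial k (partial (J ! s) (%z. u z (k # omit s J))) y
    + partial (J ! s) (partial k (%z. u z (k # omit s J))) y)
   - ((\<Sum>k\<in>UNIV. e k) + 2 * (\<Sum>s<length J. e (J ! s))) * u y J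
   + (\<Sum>k\<in>UNIV. (e k * y $ k)\<^sup>2 * u y J)
   + 2 * (\<Sum>k\<in>UNIV. \<Sum>s<length J. e k * y $ k * (e (J ! s) * y $ (J ! s) * u y (k # omit s J)))"
proof -
 let ?W = "%k l L. witten_adj e k (witten e l (%z. u z L)) y"
 note d = differentiable_witten[OF diff]
 have 1: "witten_adj e k (%z. witten_deriv e u z (k # J)) y = ?W k k J + (\<Sum>s<length J. ?W k (J ! s) (k # omit s J))" for k
 proof -
  have "(%z. witten_deriv e u z (k # J))
    = (%z. witten e k (%z. u z J) z + (\<Sum>s<length J. witten e (J ! s) (%z. u z (k # omit s J)) z))"
   unfolding witten_deriv_def by (subst sum_omit_Cons[where f = "%i L. witten e i (%z. u z L) _"]) simp
  thus ?thesis
   by (simp only:) (subst witten_adj_add, simp_all add: d witten_adj_sum differentiable_sum)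
 qed
 have 2: "witten_adj e j (%z. witten_div e u z L) y = - (\<Sum>k\<in>UNIV. ?W j k (k # L))" for j L
  unfolding witten_div_def by (subst witten_adj_minus) (simp_all add: d witten_adj_sum differentiable_sum)
 have W: "?W k l L = partial k (partial l (%z. u z L)) y + (if k = l then e k * u y L else 0)
  + e l * y $ l * partial k (%z. u z L) y - e k * y $ k * partial l (%z. u z L) y - e k * y $ k * (e l * y $ l * u y L)" for k l L
  by (rule witten_adj_witten[OF diff])
 have cross: "?W k (J ! s) (k # omit s J) + ?W (J ! s) k (k # omit s J)
   = (partial k (partial (J ! s) (%z. u z (k # omit s J))) y + partial (J ! s) (partial k (%z. u z (k # omit s J))) y)
    + 2 * (if k = J ! s then e k * u y (k # omit s J) else 0)
    - 2 * (e k * y $ k * (e (J ! s) * y $ (J ! s) * u y (k # omit s J)))" for k s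
  unfolding W by (auto simp: algebra_simps)
 have "witten_laplacian e u y J
   = - (\<Sum>k\<in>UNIV. ?W k k J) - ((\<Sum>k\<in>UNIV. \<Sum>s<length J. ?W k (J ! s) (k # omit s J))
    + (\<Sum>s<length J. \<Sum>k\<in>UNIV. ?W (J ! s) k (k # omit s J)))"
  unfolding witten_laplacian_def 1 2 by (simp add: sum.distrib sum_negf)
 also have "(\<Sum>s<length J. \<Sum>k\<in>UNIV. ?W (J ! s) k (k # omit s J)) = (\<Sum>k\<in>UNIV. \<Sum>s<length J. ?W (J ! s) k (k # omit s J))"
  by (rule sum.swap)
 also have "(\<Sum>k\<in>UNIV. \<Sum>s<length J. ?W k (J ! s) (k # omit s J)) + ... = (\<Sum>k\<in>UNIV. \<Sum>s<length J.
   (partial k (partial (J ! s) (%z. u z (k # omit s J))) y + partial (J ! s) (partial k (%z. u z (k # omit s J))) y)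
    + 2 * (if k = J ! s then e k * u y (k # omit s J) else 0)
    - 2 * (e k * y $ k * (e (J ! s) * y $ (J ! s) * u y (k # omit s J))))"
  unfolding sum.distrib[symmetric] cross ..
 also have "... = (\<Sum>k\<in>UNIV. \<Sum>s<length J.
   (partial k (partial (J ! s) (%z. u z (k # omit s J))) y + partial (J ! s) (partial k (%z. u z (k # omit s J))) y))
   + 2 * (\<Sum>k\<in>UNIV. \<Sum>s<length J. if k = J ! s then e k * u y (k # omit s J) else 0)
   - 2 * (\<Sum>k\<in>UNIV. \<Sum>s<length J. e k * y $ k * (e (J ! s) * y $ (J ! s) * u y (k # omit s J)))"
  by (simp only: sum.distrib sum_subtractf sum_distrib_left)
 also have "(\<Sum>k\<in>UNIV. \<Sum>s<length J. if k = J ! s then e k * u y (k # omit s J) else 0) = (\<Sum>s<length J. e (J ! s)) * u y J"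
  unfolding sum_distrib_right
 proof (subst sum.swap, rule sum.cong[OF refl])
  fix s assume s: "s \<in> {..<length J}"
  show "(\<Sum>k\<in>UNIV. if k = J ! s then e k * u y (k # omit s J) else 0) = e (J ! s) * u y J"
   by (rule sum_delta_nth[of "u y" s J e]) (rule sym, assumption, use s in simp)
 qed
 also have "(\<Sum>k\<in>UNIV. ?W k k J) = (\<Sum>k\<in>UNIV. partial k (partial k (%z. u z J)) y) + (\<Sum>k\<in>UNIV. e k) * u y J
   - (\<Sum>k\<in>UNIV. (e k * y $ k)\<^sup>2 * u y J)"
  unfolding W by (simp add: sum.distrib sum_subtractf sum_distrib_right power2_eq_square mult_ac)
 finally show ?thesis by (simp add: algebra_simps)
qed

lemma flat_second_order:
 fixes \<alpha> :: "'n::finite field"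
 assumes diff: "!!k J. partial k (%z. \<alpha> z J) differentiable (at y)"
 shows "flat_div (flat_deriv \<alpha>) y J + flat_deriv (flat_div \<alpha>) y J =
   - (\<Sum>k\<in>UNIV. partial k (partial k (%z. \<alpha> z J)) y)
   - (\<Sum>k\<in>UNIV. \<Sum>s<length J. partial k (partial (J ! s) (%z. \<alpha> z (k # omit s J))) y
    + partial (J ! s) (partial k (%z. \<alpha> z (k # omit s J))) y)"
proof -
 have "partial k (%z. flat_deriv \<alpha> z (k # J)) y = partial k (partial k (%z. \<alpha> z J)) y
   + (\<Sum>s<length J. partial k (partial (J ! s) (%z. \<alpha> z (k # omit s J))) y)" for k
 proof -
  have "(%z. flat_deriv \<alpha> z (k # J))
    = (%z. partial k (%z. \<alpha> z J) z + (\<Sum>s<length J. partial (J ! s) (%z. \<alpha> z (k # omit s J)) z))"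
   unfolding flat_deriv_def by (subst sum_omit_Cons[where f = "%i L. partial i (%z. \<alpha> z L) _"]) simp
  thus ?thesis
   by (simp only:) (subst partial_add, simp_all add: diff partial_sum differentiable_sum)
 qed
 moreover have "partial j (%z. flat_div \<alpha> z L) y = - (\<Sum>k\<in>UNIV. partial j (partial k (%z. \<alpha> z (k # L))) y)" for j L
  unfolding flat_div_def by (subst partial_minus) (simp_all add: diff partial_sum differentiable_sum)
 ultimately have "flat_div (flat_deriv \<alpha>) y J + flat_deriv (flat_div \<alpha>) y J =
   - (\<Sum>k\<in>UNIV. partial k (partial k (%z. \<alpha> z J)) y)
   - ((\<Sum>k\<in>UNIV. \<Sum>s<length J. partial k (partial (J ! s) (%z. \<alpha> z (k # omit s J))) y)
    + (\<Sum>s<length J. \<Sum>k\<in>UNIV. partial (J ! s) (partial k (%z. \<alpha> z (k # omit s J))) y))"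
  by (simp add: flat_div_def[of "flat_deriv \<alpha>"] flat_deriv_def[of "flat_div \<alpha>"] sum.distrib sum_negf)
 also have "(\<Sum>s<length J. \<Sum>k\<in>UNIV. partial (J ! s) (partial k (%z. \<alpha> z (k # omit s J))) y)
   = (\<Sum>k\<in>UNIV. \<Sum>s<length J. partial (J ! s) (partial k (%z. \<alpha> z (k # omit s J))) y)"
  by (rule sum.swap)
 finally show ?thesis by (simp add: sum.distrib)
qed

lemma partial_quadratic:
 fixes q :: "'n::finite => 'n => real"
 shows "partial l (%z. \<Sum>a\<in>UNIV. \<Sum>b\<in>UNIV. q a b * (z $ a * z $ b)) = (%z. \<Sum>a\<in>UNIV. (q a l + q l a) * z $ a)"
  and "partial k (%z. \<Sum>a\<in>UNIV. (q a l + q l a) * z $ a) y = q k l + q l k"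
proof -
 show "partial l (%z. \<Sum>a\<in>UNIV. \<Sum>b\<in>UNIV. q a b * (z $ a * z $ b)) = (%z. \<Sum>a\<in>UNIV. (q a l + q l a) * z $ a)"
 proof
  fix z :: "real^'n"
  have d: "(%z. q a b * (z $ a * z $ b)) differentiable (at z)" for a b
   by (intro differentiable_mult differentiable_const differentiable_nth)
  have p: "partial l (%z. q a b * (z $ a * z $ b)) z = (if l = a then q a b * z $ b else 0) + (if l = b then q a b * z $ a else 0)" for a b
   by (subst partial_cmult) (simp_all add: differentiable_mult partial_mult)
  have "partial l (%z. \<Sum>a\<in>UNIV. \<Sum>b\<in>UNIV. q a b * (z $ a * z $ b)) z
    = (\<Sum>a\<in>UNIV. \<Sum>b\<in>UNIV. (if l = a then q a b * z $ b else 0) + (if l = b then q a b * z $ a else 0))"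
   by (subst partial_sum, rule differentiable_sum) (simp_all add: d partial_sum[OF d] p)
  also have "... = (\<Sum>a\<in>UNIV. \<Sum>b\<in>UNIV. if l = a then q a b * z $ b else 0) + (\<Sum>a\<in>UNIV. \<Sum>b\<in>UNIV. if l = b then q a b * z $ a else 0)"
   by (simp only: sum.distrib)
  also have "(\<Sum>a\<in>UNIV. \<Sum>b\<in>UNIV. if l = a then q a b * z $ b else 0) = (\<Sum>b\<in>UNIV. q l b * z $ b)"
   by (subst sum.swap) (simp add: sum.delta')
  also have "(\<Sum>a\<in>UNIV. \<Sum>b\<in>UNIV. if l = b then q a b * z $ a else 0) = (\<Sum>a\<in>UNIV. q a l * z $ a)"
   by (simp add: sum.delta')
  finally show "partial l (%z. \<Sum>a\<in>UNIV. \<Sum>b\<in>UNIV. q a b * (z $ a * z $ b)) z = (\<Sum>a\<in>UNIV. (q a l + q l a) * z $ a)"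
   by (simp add: sum.distrib distrib_right add.commute)
 qed
 have "partial k (%z. \<Sum>a\<in>UNIV. (q a l + q l a) * z $ a) y = (\<Sum>a\<in>UNIV. (q a l + q l a) * (if k = a then 1 else 0))"
  by (subst partial_sum) (simp_all add: differentiable_mult partial_cmult)
 also have "... = (\<Sum>a\<in>UNIV. if k = a then q a l + q l a else 0)" by (rule sum.cong) auto
 finally show "partial k (%z. \<Sum>a\<in>UNIV. (q a l + q l a) * z $ a) y = q k l + q l k" by (simp add: sum.delta')
qed

lemma quadratic_from_hessian:
 fixes q :: "'n::finite => 'n => real"
 shows "1/2 * (\<Sum>k\<in>UNIV. \<Sum>l\<in>UNIV. (q k l + q l k) * y k * y l) = (\<Sum>k\<in>UNIV. \<Sum>l\<in>UNIV. q k l * (y k * y l))"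
proof -
 have "(\<Sum>k\<in>UNIV. \<Sum>l\<in>UNIV. q l k * (y k * y l)) = (\<Sum>k\<in>UNIV. \<Sum>l\<in>UNIV. q k l * (y k * y l))"
  by (subst sum.swap) (simp add: mult_ac)
 hence "(\<Sum>k\<in>UNIV. \<Sum>l\<in>UNIV. (q k l + q l k) * y k * y l) = 2 * (\<Sum>k\<in>UNIV. \<Sum>l\<in>UNIV. q k l * (y k * y l))"
  by (simp add: distrib_right sum.distrib mult.assoc)
 thus ?thesis by simp
qed

lemma sum_swap3: "(\<Sum>k\<in>A. \<Sum>l\<in>B. \<Sum>a\<in>C. f k l a) = (\<Sum>a\<in>C. \<Sum>k\<in>A. \<Sum>l\<in>B. f k l a)"
proof -
 have "(\<Sum>k\<in>A. \<Sum>l\<in>B. \<Sum>a\<in>C. f k l a) = (\<Sum>k\<in>A. \<Sum>a\<in>C. \<Sum>l\<in>B. f k l a)"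
  by (intro sum.cong refl sum.swap)
 also have "... = (\<Sum>a\<in>C. \<Sum>k\<in>A. \<Sum>l\<in>B. f k l a)" by (rule sum.swap)
 finally show ?thesis .
qed

lemma sum_sym_delta:
 fixes H :: "'n::finite => 'n => real"
 shows "(\<Sum>k\<in>UNIV. \<Sum>l\<in>UNIV. ((if b = k then 1 else 0) * (if a = l then 1 else 0)
   + (if b = l then 1 else 0) * (if a = k then 1 else 0)) * H k l) = H b a + H a b"
proof -
 have "(\<Sum>k\<in>UNIV. \<Sum>l\<in>UNIV. ((if b = k then 1 else 0) * (if a = l then 1 else 0)
   + (if b = l then 1 else 0) * (if a = k then 1 else 0)) * H k l)
  = (\<Sum>k\<in>UNIV. (\<Sum>l\<in>UNIV. if a = l then (if b = k then H k l else 0) else 0) + (\<Sum>l\<in>UNIV. if b = l then (if a = k then H k l else 0) else 0))"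
  unfolding sum.distrib[symmetric] by (intro sum.cong refl) auto
 thus ?thesis by (simp add: sum.distrib sum.delta')
qed

context
 fixes U :: "(real^'n::finite) set" and G :: "'n metric" and F :: "real^'n => real" and e :: "'n => real"
 assumes U: "open U" "0 \<in> U" and G: "!!y. y \<in> U ==> G y = mat 1"
  and F: "!!y i. y \<in> U ==> partial i F y = e i * y $ i"
begin

lemma sym_ops_at_0: "sym_div G \<alpha> 0 = flat_div \<alpha> 0" "sym_deriv G \<alpha> 0 = flat_deriv \<alpha> 0"
 by (rule sym_div_flat[OF U(1) _ U(2)] sym_deriv_flat[OF U(1) _ U(2)], rule G, assumption)+

lemma op_D_flat: "op_D G \<alpha> 0 J = flat_div (flat_deriv \<alpha>) 0 J + flat_deriv (flat_div \<alpha>) 0 J"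
proof -
 have "sym_div G (sym_deriv G \<alpha>) 0 = flat_div (sym_deriv G \<alpha>) 0" by (rule sym_ops_at_0)
 also have "... = flat_div (flat_deriv \<alpha>) 0"
  unfolding flat_div_def[abs_def]
  by (intro ext arg_cong[where f = uminus] sum.cong refl partial_cong[OF U]) (simp add: sym_deriv_flat[OF U(1) G])
 finally have 1: "sym_div G (sym_deriv G \<alpha>) 0 = flat_div (flat_deriv \<alpha>) 0" .
 have "sym_deriv G (sym_div G \<alpha>) 0 = flat_deriv (sym_div G \<alpha>) 0" by (rule sym_ops_at_0)
 also have "... = flat_deriv (flat_div \<alpha>) 0"
  unfolding flat_deriv_def[abs_def]
  by (intro ext sum.cong refl partial_cong[OF U]) (simp add: sym_div_flat[OF U(1) G])
 finally show ?thesis using 1 by (simp add: op_D_def)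
qed

lemma coeff_D_flat:
 "coeff_D G k l T J = 1/2 * (
   - (\<Sum>a\<in>UNIV. ((if a = k then 1 else 0) * (if a = l then 1 else 0) + (if a = l then 1 else 0) * (if a = k then 1 else 0)) * T J)
   - (\<Sum>a\<in>UNIV. \<Sum>s<length J. 2 * (((if J ! s = k then 1 else 0) * (if a = l then 1 else 0)
    + (if J ! s = l then 1 else 0) * (if a = k then 1 else 0)) * T (a # omit s J))))"
proof -
 let ?\<alpha> = "%y. (y $ k * y $ l) *\<^sub>R T"
 have p1: "partial b (%z. ?\<alpha> z L) = (%z. ((if b = k then 1 else 0) * z $ l + z $ k * (if b = l then 1 else 0)) * T L)" for b L
 proof
  fix z :: "real^'n"
  have "partial b (%z. T L * (z $ k * z $ l)) z = T L * ((if b = k then 1 else 0) * z $ l + z $ k * (if b = l then 1 else 0))"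
   by (subst partial_cmult) (simp_all add: differentiable_mult partial_mult)
  thus "partial b (%z. ?\<alpha> z L) z = ((if b = k then 1 else 0) * z $ l + z $ k * (if b = l then 1 else 0)) * T L"
   by (simp add: mult.commute)
 qed
 have d: "partial b (%z. ?\<alpha> z L) differentiable (at 0)" for b L
  unfolding p1 by (intro differentiable_mult differentiable_add differentiable_const differentiable_nth)
 have p2: "partial a (partial b (%z. ?\<alpha> z L)) 0
   = ((if b = k then 1 else 0) * (if a = l then 1 else 0) + (if b = l then 1 else 0) * (if a = k then 1 else 0)) * T L" for a b L
 proof -
  have "partial a (%z. T L * ((if b = k then 1 else 0) * z $ l + (if b = l then 1 else 0) * z $ k)) 0
    = T L * ((if b = k then 1 else 0) * (if a = l then 1 else 0) + (if b = l then 1 else 0) * (if a = k then 1 else 0))"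
   by (subst partial_cmult, intro differentiable_mult differentiable_add differentiable_const differentiable_nth,
    subst partial_add) (auto simp: partial_cmult differentiable_mult)
  thus ?thesis unfolding p1 by (simp add: mult.commute)
 qed
 have "coeff_D G k l T J = 1/2 * (flat_div (flat_deriv ?\<alpha>) 0 J + flat_deriv (flat_div ?\<alpha>) 0 J)"
  by (simp add: coeff_D_def op_D_flat)
 also have "flat_div (flat_deriv ?\<alpha>) 0 J + flat_deriv (flat_div ?\<alpha>) 0 J =
   - (\<Sum>a\<in>UNIV. partial a (partial a (%z. ?\<alpha> z J)) 0)
   - (\<Sum>a\<in>UNIV. \<Sum>s<length J. partial a (partial (J ! s) (%z. ?\<alpha> z (a # omit s J))) 0
    + partial (J ! s) (partial a (%z. ?\<alpha> z (a # omit s J))) 0)"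
  by (rule flat_second_order[OF d])
 finally show ?thesis unfolding p2 by (simp add: algebra_simps)
qed

lemma model_D_flat:
 "model_D G u y J =
   - (\<Sum>k\<in>UNIV. partial k (partial k (%z. u z J)) y)
   - (\<Sum>k\<in>UNIV. \<Sum>s<length J. partial k (partial (J ! s) (%z. u z (k # omit s J))) y
    + partial (J ! s) (partial k (%z. u z (k # omit s J))) y)"
proof -
 let ?H = "%L k l. partial k (partial l (%z. u z L)) y"
 let ?d = "%a b k l. (if b = k then 1 else 0) * (if a = l then 1 else 0) + (if b = l then 1 else 0) * (if a = k then 1 else (0::real))"
 have "model_D G u y J = (\<Sum>k\<in>UNIV. \<Sum>l\<in>UNIV. 1/2 * (- (\<Sum>a\<in>UNIV. ?d a a k l * ?H J k l)
   - (\<Sum>a\<in>UNIV. \<Sum>s<length J. 2 * (?d a (J ! s) k l * ?H (a # omit s J) k l))))"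
  by (simp add: model_D_def coeff_D_flat)
 also have "... = - (1/2 * (\<Sum>k\<in>UNIV. \<Sum>l\<in>UNIV. \<Sum>a\<in>UNIV. ?d a a k l * ?H J k l))
   - (\<Sum>k\<in>UNIV. \<Sum>l\<in>UNIV. \<Sum>a\<in>UNIV. \<Sum>s<length J. ?d a (J ! s) k l * ?H (a # omit s J) k l)"
  by (simp only: sum_distrib_left sum_subtractf sum_negf right_diff_distrib mult_minus_right) (simp add: mult.assoc)
 also have "(\<Sum>k\<in>UNIV. \<Sum>l\<in>UNIV. \<Sum>a\<in>UNIV. ?d a a k l * ?H J k l) = (\<Sum>a\<in>UNIV. \<Sum>k\<in>UNIV. \<Sum>l\<in>UNIV. ?d a a k l * ?H J k l)"
  by (rule sum_swap3)
 also have "(\<Sum>k\<in>UNIV. \<Sum>l\<in>UNIV. \<Sum>a\<in>UNIV. \<Sum>s<length J. ?d a (J ! s) k l * ?H (a # omit s J) k l)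
   = (\<Sum>a\<in>UNIV. \<Sum>s<length J. \<Sum>k\<in>UNIV. \<Sum>l\<in>UNIV. ?d a (J ! s) k l * ?H (a # omit s J) k l)"
  by (subst sum_swap3, intro sum.cong refl, rule sum_swap3)
 finally have "model_D G u y J = - (1/2 * (\<Sum>a\<in>UNIV. ?H J a a + ?H J a a))
   - (\<Sum>a\<in>UNIV. \<Sum>s<length J. ?H (a # omit s J) (J ! s) a + ?H (a # omit s J) a (J ! s))"
  unfolding sum_sym_delta .
 thus ?thesis by (simp add: sum.distrib add.commute sum_distrib_left[symmetric])
qed

lemma model_B_flat:
 assumes T: "!!I J. mset I = mset J ==> T I = T J"
 shows "model_B G F T J = - ((\<Sum>k\<in>UNIV. e k) + 2 * (\<Sum>s<length J. e (J ! s))) * T J"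
proof -
 have del: "(\<Sum>s<length J. \<Sum>k\<in>UNIV. if k = J ! s then e k * T (k # omit s J) else 0) = (\<Sum>s<length J. e (J ! s) * T J)"
 proof (rule sum.cong[OF refl])
  fix s assume s: "s \<in> {..<length J}"
  show "(\<Sum>k\<in>UNIV. if k = J ! s then e k * T (k # omit s J) else 0) = e (J ! s) * T J"
   by (rule sum_delta_nth[of T s J e]) (rule T, assumption, use s in simp)
 qed
 have grad: "grad_comps F y $ i = e i * y $ i" if "y \<in> U" for y i
  using F[OF that] by (simp add: grad_comps_def)
 have grad0: "grad_comps F 0 = 0" by (simp add: vec_eq_iff grad[OF U(2)])
 have c: "c_d F (%_. T) y L = (\<Sum>s<length L. e (L ! s) * y $ (L ! s) * T (omit s L))" if "y \<in> U" for y L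
  by (simp add: c_d_def sym_mult_def grad[OF that])
 have a: "a_d G F (%_. T) y L = (\<Sum>k\<in>UNIV. e k * y $ k * T (k # L))" if "y \<in> U" for y L
  by (simp add: a_d_def sym_contract_def G[OF that] matrix_inv_mat_1 grad[OF that])
 have lin: "(%z::real^'n. a * z $ i * b) differentiable (at y)" "partial k (%z. a * z $ i * b) y = (if k = i then a * b else 0)"
  for a b i k and y :: "real^'n"
 proof -
  show "(%z::real^'n. a * z $ i * b) differentiable (at y)"
   by (intro differentiable_mult differentiable_const differentiable_nth)
  have "partial k (%z. (a * b) * z $ i) y = (a * b) * (if k = i then 1 else 0)"
   by (subst partial_cmult) simp_all
  thus "partial k (%z. a * z $ i * b) y = (if k = i then a * b else 0)" by (simp add: mult_ac)
 qed
 have "sym_div G (c_d F (%_. T)) 0 J = - (\<Sum>k\<in>UNIV. partial k (%z. \<Sum>s<length (k # J). e ((k # J) ! s) * z $ ((k # J) ! s) * T (omit s (k # J))) 0)"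
  unfolding sym_ops_at_0 flat_div_def
  by (intro arg_cong[where f = uminus] sum.cong refl partial_cong[OF U] c)
 also have "... = - (\<Sum>k\<in>UNIV. \<Sum>s<length (k # J). if k = (k # J) ! s then e ((k # J) ! s) * T (omit s (k # J)) else 0)"
  by (simp only: partial_sum[OF lin(1)] lin(2))
 also have "... = - (\<Sum>k\<in>UNIV. e k * T J + (\<Sum>s<length J. if k = J ! s then e (J ! s) * T (k # omit s J) else 0))"
  by (subst sum_omit_Cons[where f = "%i L. if _ = i then e i * T L else 0"]) simp
 also have "... = - ((\<Sum>k\<in>UNIV. e k) * T J + (\<Sum>s<length J. \<Sum>k\<in>UNIV. if k = J ! s then e k * T (k # omit s J) else 0))"
  by (subst sum.swap) (auto simp: sum.distrib sum_distrib_right intro!: sum.cong)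
 also have "(\<Sum>s<length J. \<Sum>k\<in>UNIV. if k = J ! s then e k * T (k # omit s J) else 0) = (\<Sum>s<length J. e (J ! s)) * T J"
  unfolding sum_distrib_right by (rule del)
 finally have 1: "sym_div G (c_d F (%_. T)) 0 J = - ((\<Sum>k\<in>UNIV. e k) * T J + (\<Sum>s<length J. e (J ! s)) * T J)" .
 have "sym_deriv G (a_d G F (%_. T)) 0 J = (\<Sum>s<length J. partial (J ! s) (%z. \<Sum>k\<in>UNIV. e k * z $ k * T (k # omit s J)) 0)"
  unfolding sym_ops_at_0 flat_deriv_def
  by (intro sum.cong refl partial_cong[OF U] a)
 also have "... = (\<Sum>s<length J. \<Sum>k\<in>UNIV. if J ! s = k then e k * T (k # omit s J) else 0)"
  by (simp only: partial_sum[OF lin(1)] lin(2))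
 also have "... = (\<Sum>s<length J. \<Sum>k\<in>UNIV. if k = J ! s then e k * T (k # omit s J) else 0)"
  by (intro sum.cong refl) auto
 also have "... = (\<Sum>s<length J. e (J ! s)) * T J"
  unfolding sum_distrib_right by (rule del)
 finally have 2: "sym_deriv G (a_d G F (%_. T)) 0 J = (\<Sum>s<length J. e (J ! s)) * T J" .
 have "c_d F (sym_div G (%_. T)) 0 J = 0" "a_d G F (sym_deriv G (%_. T)) 0 J = 0"
  by (simp_all add: c_d_def a_d_def sym_mult_def sym_contract_def grad0)
 thus ?thesis using 1 2 by (simp add: model_B_def op_B_def algebra_simps)
qed

lemma model_V_flat:
 "model_V G F y T J = (\<Sum>k\<in>UNIV. (e k * y $ k)\<^sup>2 * T J)
   + 2 * (\<Sum>k\<in>UNIV. \<Sum>s<length J. e k * y $ k * (e (J ! s) * y $ (J ! s) * T (k # omit s J)))"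
proof -
 define q where "q a b = (if a = b then e a * e b * T J else 0)
  + 2 * (\<Sum>s<length J. if b = J ! s then e a * e b * T (a # omit s J) else 0)" for a b
 have Q: "(\<Sum>a\<in>UNIV. \<Sum>b\<in>UNIV. q a b * (z $ a * z $ b)) = (\<Sum>k\<in>UNIV. (e k * z $ k)\<^sup>2 * T J)
   + 2 * (\<Sum>k\<in>UNIV. \<Sum>s<length J. e k * z $ k * (e (J ! s) * z $ (J ! s) * T (k # omit s J)))" for z :: "real^'n"
 proof -
  have "(\<Sum>b\<in>UNIV. q a b * (z $ a * z $ b)) = (e a * z $ a)\<^sup>2 * T J
    + 2 * (\<Sum>s<length J. e a * z $ a * (e (J ! s) * z $ (J ! s) * T (a # omit s J)))" for a
  proof -
   have "(\<Sum>b\<in>UNIV. q a b * (z $ a * z $ b)) = (\<Sum>b\<in>UNIV. if a = b then e a * e b * T J * (z $ a * z $ b) else 0)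
    + 2 * (\<Sum>b\<in>UNIV. \<Sum>s<length J. if b = J ! s then e a * e b * T (a # omit s J) * (z $ a * z $ b) else 0)"
    unfolding q_def distrib_right sum.distrib sum_distrib_left sum_distrib_right
    by (intro arg_cong2[where f = "(+)"] sum.cong refl) auto
   also have "(\<Sum>b\<in>UNIV. \<Sum>s<length J. if b = J ! s then e a * e b * T (a # omit s J) * (z $ a * z $ b) else 0)
    = (\<Sum>s<length J. e a * e (J ! s) * T (a # omit s J) * (z $ a * z $ (J ! s)))"
    by (subst sum.swap) (simp add: sum.delta)
   finally show ?thesis by (simp add: sum.delta' power2_eq_square mult_ac)
  qed
  thus ?thesis by (simp add: sum.distrib sum_distrib_left)
 qed
 have V: "op_V G F (%_. T) z J = (\<Sum>a\<in>UNIV. \<Sum>b\<in>UNIV. q a b * (z $ a * z $ b))" if z: "z \<in> U" for z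
 proof -
  have grad: "grad_comps F z $ i = e i * z $ i" for i using F[OF z] by (simp add: grad_comps_def)
  have 1: "a_d G F (c_d F (%_. T)) z J = (\<Sum>k\<in>UNIV. e k * z $ k * (e k * z $ k * T J
    + (\<Sum>s<length J. e (J ! s) * z $ (J ! s) * T (k # omit s J))))"
   unfolding a_d_def c_d_def sym_contract_def sym_mult_def
   by (subst sum_omit_Cons[where f = "%i L. grad_comps F z $ i * T L"]) (simp add: G[OF z] matrix_inv_mat_1 grad)
  have 2: "c_d F (a_d G F (%_. T)) z J = (\<Sum>s<length J. e (J ! s) * z $ (J ! s) * (\<Sum>k\<in>UNIV. e k * z $ k * T (k # omit s J)))"
   by (simp add: a_d_def c_d_def sym_contract_def sym_mult_def G[OF z] matrix_inv_mat_1 grad)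
  also have "... = (\<Sum>k\<in>UNIV. \<Sum>s<length J. e k * z $ k * (e (J ! s) * z $ (J ! s) * T (k # omit s J)))"
   unfolding sum_distrib_left by (subst sum.swap) (simp add: mult.left_commute mult.assoc)
  finally show ?thesis
   unfolding Q op_V_def plus_fun_apply 1
   by (simp add: distrib_left sum.distrib sum_distrib_left power2_eq_square mult.assoc)
 qed
 have "partial k (partial l (%z. op_V G F (%_. T) z J)) 0 = q k l + q l k" for k l
 proof -
  have "partial k (partial l (%z. op_V G F (%_. T) z J)) 0
    = partial k (partial l (%z. \<Sum>a\<in>UNIV. \<Sum>b\<in>UNIV. q a b * (z $ a * z $ b))) 0"
   by (intro partial_cong[OF U] partial_cong[OF U(1)] V)
  thus ?thesis by (simp only: partial_quadratic)
 qed
 hence "model_V G F y T J = 1/2 * (\<Sum>k\<in>UNIV. \<Sum>l\<in>UNIV. (q k l + q l k) * y $ k * y $ l)"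
  by (simp add: model_V_def)
 thus ?thesis unfolding quadratic_from_hessian Q .
qed

text \<open>On both sides the second-order coefficients are constant, the zeroth-order term is a constant endomorphism
and the potential is quadratic; the three parts agree separately.\<close>

lemma model_op_eq_witten_laplacian:
 assumes diff: "!!J. (%z. u z J) differentiable (at y)" "!!k J. partial k (%z. u z J) differentiable (at y)"
  and sym: "!!I J. mset I = mset J ==> u y I = u y J"
 shows "model_op G F u y J = witten_laplacian e u y J"
proof -
 have "model_B G F (u y) J = - ((\<Sum>k\<in>UNIV. e k) + 2 * (\<Sum>s<length J. e (J ! s))) * u y J"
  by (rule model_B_flat) (rule sym)
 moreover have "witten_laplacian e u y J =
   - (\<Sum>k\<in>UNIV. partial k (partial k (%z. u z J)) y)
   - (\<Sum>k\<in>UNIV. \<Sum>s<length J. partial k (partial (J ! s) (%z. u z (k # omit s J))) y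
    + partial (J ! s) (partial k (%z. u z (k # omit s J))) y)
   - ((\<Sum>k\<in>UNIV. e k) + 2 * (\<Sum>s<length J. e (J ! s))) * u y J
   + (\<Sum>k\<in>UNIV. (e k * y $ k)\<^sup>2 * u y J)
   + 2 * (\<Sum>k\<in>UNIV. \<Sum>s<length J. e k * y $ k * (e (J ! s) * y $ (J ! s) * u y (k # omit s J)))"
  by (rule witten_laplacian_expand[OF diff]) (rule sym)
 ultimately show ?thesis
  unfolding model_op_def plus_fun_apply model_D_flat model_V_flat by linarith
qed

end

section \<open>Test functions\<close>

definition test_function :: "(real^'n::finite => real) => bool" where
 "test_function \<psi> \<longleftrightarrow> smooth_on UNIV \<psi> & bounded {y. \<psi> y ~= 0}"

lemma test_function_smooth: "test_function \<psi> ==> smooth_on UNIV \<psi>"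
 by (simp add: test_function_def)

lemma test_function_differentiable: "test_function \<psi> ==> \<psi> differentiable (at y)"
 using smooth_on_differentiable[OF test_function_smooth UNIV_I] .

lemma test_function_support:
 assumes "test_function \<psi>"
 obtains R where "R > 0" "!!y. y \<notin> cball 0 R ==> \<psi> y = 0"
proof -
 obtain b where "!!y. \<psi> y ~= 0 ==> norm y <= b"
  using assms unfolding test_function_def bounded_iff by auto
 thus ?thesis by (intro that[of "max b 1"]) force+
qed

lemma test_functionI:
 assumes "smooth_on UNIV \<psi>" "test_function \<phi>" "!!y. \<phi> y = 0 ==> \<psi> y = 0"
 shows "test_function \<psi>"
 using assms bounded_subset[of "{y. \<phi> y ~= 0}" "{y. \<psi> y ~= 0}"] unfolding test_function_def by blast

lemma test_function_mult: "smooth_on UNIV h ==> test_function \<psi> ==> test_function (%y. h y * \<psi> y)"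
 by (rule test_functionI[of _ \<psi>]) (auto intro: smooth_on_mult test_function_smooth)

lemma test_function_zero: "test_function (%_. 0)"
 by (simp add: test_function_def)

lemma test_function_add: "test_function \<phi> ==> test_function \<psi> ==> test_function (%y. \<phi> y + \<psi> y)"
proof -
 assume \<phi>: "test_function \<phi>" and \<psi>: "test_function \<psi>"
 have "{y. \<phi> y + \<psi> y ~= 0} \<subseteq> {y. \<phi> y ~= 0} \<union> {y. \<psi> y ~= 0}" by auto
 hence "bounded {y. \<phi> y + \<psi> y ~= 0}"
  by (rule bounded_subset[rotated]) (use \<phi> \<psi> in \<open>simp add: test_function_def\<close>)
 thus ?thesis using \<phi> \<psi> by (simp add: test_function_def smooth_on_add)
qed

lemma test_function_minus: "test_function \<psi> ==> test_function (%y. - \<psi> y)"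
 using test_function_mult[of "%_. -1" \<psi>] by simp

lemma test_function_sum: "(!!i. i \<in> I ==> test_function (\<psi> i)) ==> test_function (%y. \<Sum>i\<in>I. \<psi> i y)"
 by (induction I rule: infinite_finite_induct) (auto intro: test_function_zero test_function_add)

lemma test_function_partial:
 assumes "test_function \<psi>" shows "test_function (partial k \<psi>)"
proof -
 obtain R where R: "!!y. y \<notin> cball 0 R ==> \<psi> y = 0" using test_function_support[OF assms] by metis
 have "partial k \<psi> y = 0" if "y \<notin> cball 0 R" for y
 proof -
  have "partial k \<psi> y = partial k (%_. 0) y"
   by (rule partial_cong[of "- cball 0 R"]) (use that R in auto)
  thus ?thesis by simp
 qed
 hence "{y. partial k \<psi> y ~= 0} \<subseteq> cball 0 R" by blast
 thus ?thesis
  using assms bounded_subset[OF bounded_cball] by (auto simp: test_function_def smooth_on_partial)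
qed

lemma smooth_on_linear_factor: "smooth_on UNIV (%y. e * y $ k)"
 by (intro smooth_on_mult smooth_on_const smooth_on_nth open_UNIV)

lemma test_function_witten:
 assumes "test_function \<psi>" shows "test_function (witten e k \<psi>)" "test_function (witten_adj e k \<psi>)"
proof -
 have 1: "test_function (%y. e k * y $ k * \<psi> y)"
  by (rule test_function_mult[OF smooth_on_linear_factor assms])
 show "test_function (witten e k \<psi>)"
  unfolding witten_def[abs_def] by (rule test_function_add[OF test_function_partial[OF assms] 1])
 show "test_function (witten_adj e k \<psi>)"
  unfolding witten_adj_def[abs_def]
  using test_function_add[OF test_function_partial[OF assms] test_function_minus[OF 1]] by simp
qed

lemma test_function_measurable: "test_function \<psi> ==> \<psi> \<in> borel_measurable borel"
 by (intro borel_measurable_continuous_onI smooth_on_continuous test_function_smooth)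

lemma test_function_integrable: "test_function \<psi> ==> integrable lborel \<psi>"
proof -
 assume \<psi>: "test_function \<psi>"
 obtain R where R: "!!y. y \<notin> cball 0 R ==> \<psi> y = 0" using test_function_support[OF \<psi>] by metis
 have "integrable lborel (%x. indicator (cball 0 R) x *\<^sub>R \<psi> x)"
  using smooth_on_continuous[OF test_function_smooth[OF \<psi>]] continuous_on_subset
  by (intro borel_integrable_compact) auto
 moreover have "(%x. indicator (cball 0 R) x *\<^sub>R \<psi> x) = \<psi>"
  using R by (auto simp: fun_eq_iff indicator_def)
 ultimately show ?thesis by simp
qed

lemma test_function_bounded:
 assumes \<psi>: "test_function \<psi>" obtains B where "!!y. \<bar>\<psi> y\<bar> <= B"
proof -
 obtain R where R: "R > 0" "!!y. y \<notin> cball 0 R ==> \<psi> y = 0" using test_function_support[OF \<psi>] by metis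
 have "bounded (\<psi> ` cball 0 R)"
  by (rule compact_imp_bounded[OF compact_continuous_image])
    (use smooth_on_continuous[OF test_function_smooth[OF \<psi>]] continuous_on_subset in auto)
 then obtain B where B: "\<forall>y\<in>cball 0 R. \<bar>\<psi> y\<bar> <= B" unfolding bounded_iff by auto
 have "\<bar>\<psi> y\<bar> <= max B 0" for y using bspec[OF B, of y] R(2)[of y] by (cases "y \<in> cball 0 R") auto
 thus ?thesis by (rule that)
qed

lemma integral_translate:
 fixes \<psi> :: "'v::euclidean_space => real"
 assumes "\<psi> \<in> borel_measurable borel"
 shows "(\<integral>y. \<psi> (y + c) \<partial>lborel) = (\<integral>y. \<psi> y \<partial>lborel)"
proof -
 have "(\<integral>y. \<psi> y \<partial>lborel) = (\<integral>y. \<psi> y \<partial>(distr lborel borel ((+) c)))" by (simp only: lborel_distr_plus)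
 also have "... = (\<integral>y. \<psi> (c + y) \<partial>lborel)" by (rule integral_distr) (use assms in auto)
 finally show ?thesis by (simp add: add.commute)
qed

lemma nn_integral_translate:
 fixes \<psi> :: "'v::euclidean_space => ennreal"
 assumes "\<psi> \<in> borel_measurable borel"
 shows "(\<integral>\<^sup>+y. \<psi> (y + c) \<partial>lborel) = (\<integral>\<^sup>+y. \<psi> y \<partial>lborel)"
proof -
 have "(\<integral>\<^sup>+y. \<psi> y \<partial>lborel) = (\<integral>\<^sup>+y. \<psi> y \<partial>(distr lborel borel ((+) c)))" by (simp only: lborel_distr_plus)
 also have "... = (\<integral>\<^sup>+y. \<psi> (c + y) \<partial>lborel)" by (rule nn_integral_distr) (use assms in auto)
 finally show ?thesis by (simp add: add.commute)
qed

lemma AE_translate: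
 fixes P :: "'v::euclidean_space => bool"
 assumes "AE y in lborel. P y" shows "AE y in lborel. P (y + c)"
proof -
 have "AE y in distr lborel borel ((+) c). P y" using assms by (simp only: lborel_distr_plus)
 hence "AE y in lborel. P (c + y)" by (rule AE_distrD[rotated]) simp
 thus ?thesis by (simp add: add.commute)
qed

text \<open>Translation invariance of the integral makes difference quotients integrate to zero.\<close>

lemma integral_partial_zero:
 assumes \<psi>: "test_function \<psi>" shows "(\<integral>y. partial k \<psi> y \<partial>lborel) = 0"
proof -
 let ?a = "axis k (1::real)"
 obtain R where R: "R > 0" "!!y. y \<notin> cball 0 R ==> \<psi> y = 0" using test_function_support[OF \<psi>] by metis
 obtain B where B: "!!y. \<bar>partial k \<psi> y\<bar> <= B" using test_function_bounded[OF test_function_partial[OF \<psi>]] by metis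
 define t where "t n = inverse (real (Suc n))" for n
 define q where "q n y = (\<psi> (y + t n *\<^sub>R ?a) - \<psi> y) / t n" for n y
 have t: "0 < t n" "t n <= 1" for n by (auto simp: t_def field_simps)
 have D: "((%s. \<psi> (y + s *\<^sub>R ?a)) has_real_derivative partial k \<psi> (y + s *\<^sub>R ?a)) (at s)" for y s
  using has_derivative_ray[OF test_function_differentiable[OF \<psi>], where z = y and t = s and h = ?a and A = UNIV]
  by (simp add: axis_def if_distrib[of "%x. x * _"] sum.delta cong: if_cong)
 have "(%n. \<integral>y. q n y \<partial>lborel) \<longlonglongrightarrow> (\<integral>y. partial k \<psi> y \<partial>lborel)"
 proof (rule integral_dominated_convergence[where w = "%y. B * indicator (cball 0 (R + 1)) y"])
  have "(%n. q n y) \<longlonglongrightarrow> partial k \<psi> y" for y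
  proof -
   have lim: "((%h. (\<psi> (y + (0 + h) *\<^sub>R ?a) - \<psi> (y + 0 *\<^sub>R ?a)) / h) \<longlongrightarrow> partial k \<psi> y) (at 0)"
    using D[of y 0] unfolding DERIV_def by simp
   have "filterlim t (at 0) sequentially"
    using t LIMSEQ_inverse_real_of_nat unfolding t_def by (intro filterlim_atI) auto
   from filterlim_compose[OF lim this] show ?thesis by (simp add: q_def)
  qed
  thus "AE y in lborel. (%n. q n y) \<longlonglongrightarrow> partial k \<psi> y" by simp
  have "norm (q n y) <= B * indicator (cball 0 (R + 1)) y" for n y
  proof (cases "y \<in> cball 0 (R + 1)")
   case True
   obtain s where "\<psi> (y + t n *\<^sub>R ?a) - \<psi> (y + 0 *\<^sub>R ?a) = (t n - 0) * partial k \<psi> (y + s *\<^sub>R ?a)"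
    using MVT2[OF t(1)[of n], of "%s. \<psi> (y + s *\<^sub>R ?a)" "%s. partial k \<psi> (y + s *\<^sub>R ?a)"] D by blast
   hence "q n y = partial k \<psi> (y + s *\<^sub>R ?a)" using t(1)[of n] by (simp add: q_def)
   with True B show ?thesis by simp
  next
   case False
   have "norm y <= norm (y + t n *\<^sub>R ?a) + norm (t n *\<^sub>R ?a)"
    using norm_triangle_ineq4[of "y + t n *\<^sub>R ?a" "t n *\<^sub>R ?a"] by simp
   moreover have "norm (t n *\<^sub>R ?a) <= 1" using t[of n] by simp
   ultimately have "y + t n *\<^sub>R ?a \<notin> cball 0 R" "y \<notin> cball 0 R" using False by auto
   hence "q n y = 0" using R(2) by (simp add: q_def)
   thus ?thesis using False by simp
  qed
  thus "AE y in lborel. norm (q n y) <= B * indicator (cball 0 (R + 1)) y" for n by simp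
  show "integrable lborel (%y. B * indicator (cball 0 (R + 1)) y)"
   using borel_integrable_compact[OF compact_cball, of 0 "R + 1" "%_. B"] by (simp add: mult.commute)
  show "partial k \<psi> \<in> borel_measurable lborel" using test_function_measurable[OF test_function_partial[OF \<psi>]] by simp
  show "q n \<in> borel_measurable lborel" for n
   using test_function_measurable[OF \<psi>] unfolding q_def[abs_def] by measurable
 qed
 moreover have "(\<integral>y. q n y \<partial>lborel) = 0" for n
 proof -
  have m: "\<psi> \<in> borel_measurable borel" by (rule test_function_measurable[OF \<psi>])
  have i: "integrable lborel \<psi>" by (rule test_function_integrable[OF \<psi>])
  have "integrable lborel (%y. \<psi> (t n *\<^sub>R ?a + y))"
   using integrable_distr_eq[of "(+) (t n *\<^sub>R ?a)" lborel borel \<psi>] m i by (simp add: lborel_distr_plus)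
  hence "(\<integral>y. q n y \<partial>lborel) = ((\<integral>y. \<psi> (y + t n *\<^sub>R ?a) \<partial>lborel) - (\<integral>y. \<psi> y \<partial>lborel)) / t n"
   using i by (simp add: q_def add.commute)
  thus ?thesis by (simp add: integral_translate[OF m])
 qed
 ultimately show ?thesis using LIMSEQ_unique[OF _ tendsto_const] by fastforce
qed

lemma witten_adjoint:
 assumes u: "test_function u" and w: "smooth_on UNIV w"
 shows "(\<integral>y. witten_adj e k u y * w y \<partial>lborel) = - (\<integral>y. u y * witten e k w y \<partial>lborel)"
  and "(\<integral>y. witten e k u y * w y \<partial>lborel) = - (\<integral>y. u y * witten_adj e k w y \<partial>lborel)"
proof -
 have wd: "w differentiable (at y)" for y using smooth_on_differentiable[OF w UNIV_I] .
 have sm: "smooth_on UNIV (witten e k w)" "smooth_on UNIV (witten_adj e k w)"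
  unfolding witten_def[abs_def] witten_adj_def[abs_def]
  by (intro smooth_on_add smooth_on_diff smooth_on_mult smooth_on_linear_factor smooth_on_partial w open_UNIV)+
 have i: "integrable lborel (%y. witten e k u y * w y)" "integrable lborel (%y. witten_adj e k u y * w y)"
  "integrable lborel (%y. u y * witten e k w y)" "integrable lborel (%y. u y * witten_adj e k w y)"
  using test_function_integrable[OF test_function_mult[OF w test_function_witten(1)[OF u]], of e k]
   test_function_integrable[OF test_function_mult[OF w test_function_witten(2)[OF u]], of e k]
   test_function_integrable[OF test_function_mult[OF sm(1) u]] test_function_integrable[OF test_function_mult[OF sm(2) u]]
  by (simp_all add: mult.commute)
 have p: "partial k (%y. u y * w y) y = witten_adj e k u y * w y + u y * witten e k w y"
  "partial k (%y. u y * w y) y = witten e k u y * w y + u y * witten_adj e k w y" for y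
  by (simp_all add: partial_mult[OF test_function_differentiable[OF u] wd] witten_def witten_adj_def algebra_simps)
 have 0: "(\<integral>y. partial k (%y. u y * w y) y \<partial>lborel) = 0"
  using integral_partial_zero[OF test_function_mult[OF w u], of k] by (simp add: mult.commute)
 show "(\<integral>y. witten_adj e k u y * w y \<partial>lborel) = - (\<integral>y. u y * witten e k w y \<partial>lborel)"
  using 0 i unfolding p(1) by simp
 show "(\<integral>y. witten e k u y * w y \<partial>lborel) = - (\<integral>y. u y * witten_adj e k w y \<partial>lborel)"
  using 0 i unfolding p(2) by simp
qed

section \<open>The energy identity\<close>

lemma sym_sum_omit:
 assumes \<phi>: "!!k I J. mset I = mset J ==> \<phi> k I = \<phi> k J" and IJ: "mset I = mset J"
 shows "(\<Sum>s<length I. \<phi> (I ! s) (omit s I)) = (\<Sum>s<length J. \<phi> (J ! s) (omit s J))"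
proof -
 have *: "(\<Sum>s<length J. \<phi> (J ! s) (omit s J)) = (\<Sum>i\<in>#mset J. \<phi> i (SOME L. mset L = mset J - {#i#}))" for J
 proof -
  have "\<phi> (J ! s) (omit s J) = \<phi> (J ! s) (SOME L. mset L = mset J - {#J ! s#})" if "s < length J" for s
  proof -
   have m: "mset (omit s J) = mset J - {#J ! s#}"
    using mset_omit[OF that] by (metis add_mset_remove_trivial mset.simps(2))
   hence "mset (SOME L. mset L = mset J - {#J ! s#}) = mset J - {#J ! s#}" by (rule someI)
   thus ?thesis using m by (intro \<phi>) simp
  qed
  thus ?thesis
   unfolding sum_nth_eq_sum_mset[symmetric] by (intro sum.cong) auto
 qed
 show ?thesis unfolding *[of I] *[of J] IJ ..
qed

lemma test_field_components:
 assumes "u \<in> test_fields p"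
 shows "test_function (%y. u y J)" "mset I = mset J ==> u y I = u y J"
proof -
 have "bounded {y. u y ~= 0}" "smooth_on UNIV (%y. u y J)" using assms unfolding test_fields_def by blast+
 moreover have "{y. u y J ~= 0} \<subseteq> {y. u y ~= 0}" by auto
 ultimately show "test_function (%y. u y J)" using bounded_subset unfolding test_function_def by blast
 show "mset I = mset J ==> u y I = u y J" using assms sym_comps_sym unfolding test_fields_def by blast
qed

context
 fixes u :: "'n::finite field" and p :: nat and e :: "'n => real"
 assumes u: "u \<in> test_fields p"
begin

lemma test_function_witten_deriv: "test_function (%y. witten_deriv e u y J)"
 unfolding witten_deriv_def by (intro test_function_sum test_function_witten(1)[of "%z. u z _"] test_field_components[OF u])

lemma test_function_witten_div: "test_function (%y. witten_div e u y J)"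
 unfolding witten_div_def
 by (intro test_function_minus test_function_sum test_function_witten(1)[of "%z. u z _"] test_field_components[OF u])

lemma test_function_witten_laplacian: "test_function (%y. witten_laplacian e u y J)"
 unfolding witten_laplacian_def
 by (intro test_function_add test_function_minus test_function_sum test_function_witten(2) test_function_witten_deriv
   test_function_witten_div)

lemma witten_deriv_sym: "mset I = mset J ==> witten_deriv e u y I = witten_deriv e u y J"
 unfolding witten_deriv_def
proof (rule sym_sum_omit[where \<phi> = "%k L. witten e k (%z. u z L) y"])
 fix k and I J :: "'n list" assume "mset I = mset J"
 hence "(%z. u z I) = (%z. u z J)" using test_field_components(2)[OF u] by blast
 thus "witten e k (%z. u z I) y = witten e k (%z. u z J) y" by simp
qed

text \<open>Integration by parts turns the factored form of the model operator into a sum of squares.\<close>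

lemma energy_identity:
 assumes p: "p >= 1"
 shows "(\<Sum>J\<in>multi_indices p. \<integral>y. witten_laplacian e u y J * u y J \<partial>lborel)
  = (\<Sum>L\<in>multi_indices (Suc p). \<integral>y. (witten_deriv e u y L)\<^sup>2 \<partial>lborel) / (real p + 1)
   + real p * (\<Sum>J\<in>multi_indices (p - 1). \<integral>y. (witten_div e u y J)\<^sup>2 \<partial>lborel)"
proof -
 let ?D = "%L y. witten_deriv e u y L" and ?E = "%J y. witten_div e u y J"
 note tu = test_field_components(1)[OF u] and su = test_field_components(2)[OF u]
 have int: "integrable lborel (%y. a y * b y)" if "test_function a" "test_function b" for a b :: "real^'n => real"
  by (intro test_function_integrable test_function_mult that test_function_smooth)
 have 1: "(\<Sum>J\<in>multi_indices p. \<Sum>k\<in>UNIV. \<integral>y. ?D (k # J) y * witten e k (%z. u z J) y \<partial>lborel)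
   = (\<Sum>L\<in>multi_indices (Suc p). \<integral>y. (?D L y)\<^sup>2 \<partial>lborel) / (real p + 1)"
 proof -
  have "(\<Sum>L\<in>multi_indices (Suc p). \<integral>y. (?D L y)\<^sup>2 \<partial>lborel)
    = (\<integral>y. (\<Sum>L\<in>multi_indices (Suc p). (\<Sum>s<length L. witten e (L ! s) (%z. u z (omit s L)) y) * ?D L y) \<partial>lborel)"
   unfolding witten_deriv_def[symmetric] power2_eq_square
   by (rule Bochner_Integration.integral_sum[symmetric], rule int[OF test_function_witten_deriv test_function_witten_deriv])
  also have "... = (\<integral>y. (real p + 1) * (\<Sum>k\<in>UNIV. \<Sum>J\<in>multi_indices p. witten e k (%z. u z J) y * ?D (k # J) y) \<partial>lborel)"
   by (subst sum_multi_indices_all_omit[where \<phi> = "%k J. witten e k (%z. u z J) _"]) (auto intro: witten_deriv_sym)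
  also have "... = (real p + 1) * (\<Sum>k\<in>UNIV. \<Sum>J\<in>multi_indices p. \<integral>y. witten e k (%z. u z J) y * ?D (k # J) y \<partial>lborel)"
   using int[OF test_function_witten(1)[OF tu] test_function_witten_deriv] by simp
  also have "(\<Sum>k\<in>UNIV. \<Sum>J\<in>multi_indices p. \<integral>y. witten e k (%z. u z J) y * ?D (k # J) y \<partial>lborel)
    = (\<Sum>J\<in>multi_indices p. \<Sum>k\<in>UNIV. \<integral>y. ?D (k # J) y * witten e k (%z. u z J) y \<partial>lborel)"
   by (subst sum.swap) (simp add: mult.commute)
  finally show ?thesis by (simp add: add_nonneg_eq_0_iff)
 qed
 have 2: "(\<Sum>J\<in>multi_indices p. \<integral>y. (\<Sum>s<length J. witten_adj e (J ! s) (?E (omit s J)) y) * u y J \<partial>lborel)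
   = real p * (\<Sum>J\<in>multi_indices (p - 1). \<integral>y. (?E J y)\<^sup>2 \<partial>lborel)"
 proof -
  obtain p' where p': "p = Suc p'" using p by (cases p) auto
  have "(\<Sum>J\<in>multi_indices p. \<integral>y. (\<Sum>s<length J. witten_adj e (J ! s) (?E (omit s J)) y) * u y J \<partial>lborel)
    = (\<integral>y. (\<Sum>J\<in>multi_indices p. (\<Sum>s<length J. witten_adj e (J ! s) (?E (omit s J)) y) * u y J) \<partial>lborel)"
   by (rule Bochner_Integration.integral_sum[symmetric], rule int[OF test_function_sum tu],
    rule test_function_witten(2)[OF test_function_witten_div])
  also have "... = (\<integral>y. real p * (\<Sum>k\<in>UNIV. \<Sum>J\<in>multi_indices p'. witten_adj e k (?E J) y * u y (k # J)) \<partial>lborel)"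
   unfolding p' by (subst sum_multi_indices_all_omit[where \<phi> = "%k J. witten_adj e k (?E J) _"]) (auto intro: su)
  also have "... = real p * (\<Sum>k\<in>UNIV. \<Sum>J\<in>multi_indices p'. \<integral>y. witten_adj e k (?E J) y * u y (k # J) \<partial>lborel)"
   using int[OF test_function_witten(2)[OF test_function_witten_div] tu] by simp
  also have "(\<Sum>k\<in>UNIV. \<Sum>J\<in>multi_indices p'. \<integral>y. witten_adj e k (?E J) y * u y (k # J) \<partial>lborel)
    = (\<Sum>k\<in>UNIV. \<Sum>J\<in>multi_indices p'. \<integral>y. ?E J y * (- witten e k (%z. u z (k # J)) y) \<partial>lborel)"
   by (simp add: witten_adjoint(1)[OF test_function_witten_div test_function_smooth[OF tu]])
  also have "... = (\<Sum>J\<in>multi_indices p'. \<integral>y. (?E J y)\<^sup>2 \<partial>lborel)"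
  proof (subst sum.swap, rule sum.cong[OF refl])
   fix J :: "'n list"
   have "(\<Sum>k\<in>UNIV. \<integral>y. ?E J y * (- witten e k (%z. u z (k # J)) y) \<partial>lborel)
    = (\<integral>y. (\<Sum>k\<in>UNIV. ?E J y * (- witten e k (%z. u z (k # J)) y)) \<partial>lborel)"
    using int[OF test_function_witten_div test_function_minus[OF test_function_witten(1)[OF tu]]] by simp
   also have "... = (\<integral>y. (?E J y)\<^sup>2 \<partial>lborel)"
    unfolding sum_distrib_left[symmetric] sum_negf witten_div_def[symmetric] by (simp add: power2_eq_square)
   finally show "(\<Sum>k\<in>UNIV. \<integral>y. ?E J y * (- witten e k (%z. u z (k # J)) y) \<partial>lborel) = (\<integral>y. (?E J y)\<^sup>2 \<partial>lborel)" .
  qed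
  finally show ?thesis by (simp add: p')
 qed
 have "(\<integral>y. witten_laplacian e u y J * u y J \<partial>lborel)
   = (\<Sum>k\<in>UNIV. \<integral>y. ?D (k # J) y * witten e k (%z. u z J) y \<partial>lborel)
    + (\<integral>y. (\<Sum>s<length J. witten_adj e (J ! s) (?E (omit s J)) y) * u y J \<partial>lborel)" for J
 proof -
  have "(\<integral>y. witten_laplacian e u y J * u y J \<partial>lborel)
    = (\<integral>y. - (\<Sum>k\<in>UNIV. witten_adj e k (?D (k # J)) y * u y J) + (\<Sum>s<length J. witten_adj e (J ! s) (?E (omit s J)) y) * u y J \<partial>lborel)"
   unfolding witten_laplacian_def by (simp add: algebra_simps sum_distrib_left)
  also have "... = (\<integral>y. - (\<Sum>k\<in>UNIV. witten_adj e k (?D (k # J)) y * u y J) \<partial>lborel)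
    + (\<integral>y. (\<Sum>s<length J. witten_adj e (J ! s) (?E (omit s J)) y) * u y J \<partial>lborel)"
  proof (rule Bochner_Integration.integral_add)
   show "integrable lborel (%y. - (\<Sum>k\<in>UNIV. witten_adj e k (?D (k # J)) y * u y J))"
    by (intro Bochner_Integration.integrable_minus Bochner_Integration.integrable_sum
    int[OF test_function_witten(2)[OF test_function_witten_deriv] tu])
   show "integrable lborel (%y. (\<Sum>s<length J. witten_adj e (J ! s) (?E (omit s J)) y) * u y J)"
    by (rule int[OF test_function_sum tu], rule test_function_witten(2)[OF test_function_witten_div])
  qed
  also have "(\<integral>y. - (\<Sum>k\<in>UNIV. witten_adj e k (?D (k # J)) y * u y J) \<partial>lborel)
    = - (\<Sum>k\<in>UNIV. \<integral>y. witten_adj e k (?D (k # J)) y * u y J \<partial>lborel)"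
   using int[OF test_function_witten(2)[OF test_function_witten_deriv] tu] by simp
  finally show ?thesis
   by (simp add: witten_adjoint(1)[OF test_function_witten_deriv test_function_smooth[OF tu]] sum_negf)
 qed
 thus ?thesis by (simp only: sum.distrib 1 2)
qed

end

section \<open>The kernel of the model operator\<close>

definition sq_int :: "(real^'n::finite => real) => ennreal" where
 "sq_int f = (\<integral>\<^sup>+y. ennreal ((f y)\<^sup>2) \<partial>lborel)"

lemma sq_int_test: "test_function \<psi> ==> sq_int \<psi> = ennreal (\<integral>y. (\<psi> y)\<^sup>2 \<partial>lborel)"
 unfolding sq_int_def power2_eq_square
 by (rule nn_integral_eq_integral[OF test_function_integrable[OF test_function_mult[OF test_function_smooth]]]) auto

lemma product_integrable:
 assumes [measurable]: "f \<in> borel_measurable lborel" "g \<in> borel_measurable lborel"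
  and fin: "sq_int f < \<infinity>" "sq_int g < \<infinity>"
 shows "integrable lborel (%y. f y * g y)" "ennreal ((\<integral>y. f y * g y \<partial>lborel)\<^sup>2) <= sq_int f * sq_int g"
proof -
 have cs: "(\<integral>\<^sup>+y. ennreal \<bar>f y * g y\<bar> \<partial>lborel)\<^sup>2 <= sq_int f * sq_int g"
  using Cauchy_Schwarz_nn_integral[of "%y. ennreal \<bar>f y\<bar>" lborel "%y. ennreal \<bar>g y\<bar>"]
  by (simp add: sq_int_def ennreal_power abs_mult ennreal_mult)
 also have "sq_int f * sq_int g < \<infinity>" using fin by (simp add: ennreal_mult_less_top)
 finally have "(\<integral>\<^sup>+y. ennreal \<bar>f y * g y\<bar> \<partial>lborel) < \<infinity>"
  by (auto simp: power2_eq_square ennreal_mult_less_top)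
 thus i: "integrable lborel (%y. f y * g y)" by (intro integrableI_bounded) auto
 have "ennreal ((\<integral>y. f y * g y \<partial>lborel)\<^sup>2) = (ennreal \<bar>\<integral>y. f y * g y \<partial>lborel\<bar>)\<^sup>2"
  by (simp add: ennreal_power)
 also have "... <= (\<integral>\<^sup>+y. ennreal \<bar>f y * g y\<bar> \<partial>lborel)\<^sup>2"
  using integral_norm_bound_ennreal[OF i] by (intro power_mono) auto
 finally show "ennreal ((\<integral>y. f y * g y \<partial>lborel)\<^sup>2) <= sq_int f * sq_int g" using cs by (rule order_trans)
qed

text \<open>Cauchy-Schwarz for a sequence tending to zero against a bounded one.\<close>

lemma pairing_tendsto_zero:
 assumes f: "!!j. f j \<in> borel_measurable lborel" and g: "!!j. g j \<in> borel_measurable lborel"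
  and lim: "(%j. sq_int (f j)) \<longlonglongrightarrow> 0" and bound: "\<forall>\<^sub>F j in sequentially. sq_int (g j) <= M" and M: "M < \<infinity>"
 shows "(%j. \<integral>y. f j y * g j y \<partial>lborel) \<longlonglongrightarrow> 0"
proof -
 have fin: "\<forall>\<^sub>F j in sequentially. sq_int (f j) < \<infinity>"
  using lim by (rule order_tendstoD(2)) simp
 have "(%j. ennreal ((\<integral>y. f j y * g j y \<partial>lborel)\<^sup>2)) \<longlonglongrightarrow> 0"
 proof (rule tendsto_sandwich[OF _ _ tendsto_const])
  show "\<forall>\<^sub>F j in sequentially. ennreal ((\<integral>y. f j y * g j y \<partial>lborel)\<^sup>2) <= M * sq_int (f j)"
   using fin bound
  proof eventually_elim
   case (elim j)
   hence "sq_int (g j) < \<infinity>" using M by (meson order_le_less_trans)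
   hence "ennreal ((\<integral>y. f j y * g j y \<partial>lborel)\<^sup>2) <= sq_int (f j) * sq_int (g j)"
    using product_integrable(2)[OF f g] elim by blast
   also have "... <= sq_int (f j) * M" using elim by (intro mult_left_mono) auto
   finally show ?case by (simp add: mult.commute)
  qed
  show "(%j. M * sq_int (f j)) \<longlonglongrightarrow> 0"
   using ennreal_tendsto_cmult[OF _ lim, of M] M by (simp add: top.not_eq_extremum)
 qed simp
 hence "(%j. (\<integral>y. f j y * g j y \<partial>lborel)\<^sup>2) \<longlonglongrightarrow> 0"
  by (subst (asm) ennreal_0[symmetric], subst (asm) tendsto_ennreal_iff) auto
 hence "(%j. sqrt ((\<integral>y. f j y * g j y \<partial>lborel)\<^sup>2)) \<longlonglongrightarrow> sqrt 0" by (rule tendsto_real_sqrt)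
 thus ?thesis by (simp add: tendsto_rabs_zero_iff)
qed

lemma sq_int_component_le:
 assumes m: "!!J. (%y. u y J) \<in> borel_measurable lborel" and J: "length J = p"
 shows "sq_int (%y. u y J) <= ennreal (fact p) * L2_norm2 p u"
proof -
 have le: "(u y J)\<^sup>2 <= fact p * sym_norm2 p (u y)" for y
  using member_le_sum[of J "multi_indices p" "%J. (u y J)\<^sup>2"] J by (simp add: sym_norm2_def)
 hence "sq_int (%y. u y J) <= (\<integral>\<^sup>+y. ennreal (fact p) * ennreal (sym_norm2 p (u y)) \<partial>lborel)"
  unfolding sq_int_def by (intro nn_integral_mono) (simp add: le ennreal_leI flip: ennreal_mult')
 also have "... = ennreal (fact p) * L2_norm2 p u"
  unfolding L2_norm2_def sym_norm2_def
  by (intro nn_integral_cmult measurable_compose[OF _ measurable_ennreal] borel_measurable_divide borel_measurable_sum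
    borel_measurable_power borel_measurable_const m)
 finally show ?thesis .
qed

lemma L2_norm2_le:
 assumes m: "!!J. (%y. u y J) \<in> borel_measurable lborel"
 shows "L2_norm2 p u <= (\<Sum>J\<in>multi_indices p. sq_int (%y. u y J))"
proof -
 have le: "sym_norm2 p (u y) <= (\<Sum>J\<in>multi_indices p. (u y J)\<^sup>2)" for y
  unfolding sym_norm2_def by (rule divide_left_mono[of 1 _ "_", simplified]) (auto simp: fact_ge_1 sum_nonneg)
 hence "L2_norm2 p u <= (\<integral>\<^sup>+y. (\<Sum>J\<in>multi_indices p. ennreal ((u y J)\<^sup>2)) \<partial>lborel)"
  unfolding L2_norm2_def by (intro nn_integral_mono) (simp add: sum_ennreal ennreal_leI le)
 also have "... = (\<Sum>J\<in>multi_indices p. sq_int (%y. u y J))"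
  unfolding sq_int_def
 proof (rule nn_integral_sum)
  fix J
  have [measurable]: "(%y. u y J) \<in> borel_measurable borel" using m[of J] by simp
  show "(%y. ennreal ((u y J)\<^sup>2)) \<in> borel_measurable lborel" by measurable
 qed
 finally show ?thesis .
qed

definition quadratic :: "('n => real) => real^'n::finite => real" where
 "quadratic e y = (\<Sum>k\<in>UNIV. e k * (1/2 * (y $ k)\<^sup>2))"

lemma partial_quadratic_form: "partial k (quadratic e) y = e k * y $ k" "quadratic e differentiable (at y)"
proof -
 have "partial k (quadratic e) y = (\<Sum>i\<in>UNIV. e i * (y $ i * (if k = i then 1 else 0)))"
  unfolding quadratic_def[abs_def]
  by (subst partial_sum[OF partial_half_square(2)]) (simp only: partial_half_square(1))
 also have "... = (\<Sum>i\<in>UNIV. if i = k then e k * y $ k else 0)" by (rule sum.cong) auto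
 finally show "partial k (quadratic e) y = e k * y $ k" by simp
 show "quadratic e differentiable (at y)"
  unfolding quadratic_def[abs_def] by (intro differentiable_sum finite ballI partial_half_square(2))
qed

lemma smooth_quadratic: "smooth_on UNIV (quadratic e)"
 unfolding quadratic_def[abs_def] power2_eq_square
 by (intro smooth_on_sum smooth_on_mult smooth_on_const smooth_on_nth open_UNIV)

lemma smooth_exp_quadratic: "smooth_on UNIV (%y. exp (c * quadratic e y))"
 by (intro smooth_on_exp smooth_on_mult smooth_on_const smooth_quadratic open_UNIV)

lemma partial_exp_quadratic:
 assumes "w differentiable (at y)"
 shows "partial k (%y. exp (quadratic e y) * w y) y = exp (quadratic e y) * witten e k w y"
  and "partial k (%y. exp (- quadratic e y) * w y) y = exp (- quadratic e y) * witten_adj e k w y"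
  and "witten e k (%y. exp (- quadratic e y) * w y) y = exp (- quadratic e y) * partial k w y"
proof -
 have E: "((exp :: real => real) has_real_derivative exp x) (at x)" for x by (rule DERIV_exp)
 have E': "((%x. exp (- x)) has_real_derivative - exp (- x)) (at x)" for x :: real
  by (auto intro!: derivative_eq_intros)
 note c = partial_chain_real[OF partial_quadratic_form(2)[of e y] E] partial_chain_real[OF partial_quadratic_form(2)[of e y] E']
 show "partial k (%y. exp (quadratic e y) * w y) y = exp (quadratic e y) * witten e k w y"
  by (subst partial_mult[OF c(2) assms]) (simp add: c(1) partial_quadratic_form witten_def algebra_simps)
 show *: "partial k (%y. exp (- quadratic e y) * w y) y = exp (- quadratic e y) * witten_adj e k w y"
  by (subst partial_mult[OF c(4) assms]) (simp add: c(3) partial_quadratic_form witten_adj_def algebra_simps)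
 show "witten e k (%y. exp (- quadratic e y) * w y) y = exp (- quadratic e y) * partial k w y"
  unfolding witten_def * witten_adj_def by (simp add: algebra_simps)
qed

lemma diag_measurable:
 assumes "!!L. (%x. T x L) \<in> borel_measurable M" "!!k. (%x. h x $ k) \<in> borel_measurable M"
 shows "(%x. diag q (T x) (h x) J) \<in> borel_measurable M"
 using assms by (induction q arbitrary: J) auto

lemma diag_sq_bound:
 fixes T :: "'n::finite comps"
 shows "(diag p T h [])\<^sup>2 <= ((\<Sum>k\<in>UNIV. \<bar>h $ k\<bar>) ^ p)\<^sup>2 * (\<Sum>J\<in>multi_indices p. (T J)\<^sup>2)"
proof -
 have "\<bar>T L\<bar> <= sqrt (\<Sum>J\<in>multi_indices p. (T J)\<^sup>2)" if "length L = p" for L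
  using member_le_sum[of L "multi_indices p" "%J. (T J)\<^sup>2"] that by (intro real_le_rsqrt) simp
 hence "\<bar>diag p T h []\<bar> <= (\<Sum>k\<in>UNIV. \<bar>h $ k\<bar>) ^ p * sqrt (\<Sum>J\<in>multi_indices p. (T J)\<^sup>2)"
  by (intro diag_bound) simp
 hence "\<bar>diag p T h []\<bar>\<^sup>2 <= ((\<Sum>k\<in>UNIV. \<bar>h $ k\<bar>) ^ p * sqrt (\<Sum>J\<in>multi_indices p. (T J)\<^sup>2))\<^sup>2"
  by (intro power_mono) auto
 thus ?thesis by (simp add: power_mult_distrib sum_nonneg)
qed

text \<open>The square of an increment is at most the mean square of the derivative; this replaces differentiation
by a quantity that is controlled in \<open>L\<^sup>2\<close>.\<close>

lemma sq_increment_le: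
 fixes g g' :: "real => real"
 assumes D: "!!t. (g has_real_derivative g' t) (at t)" and cont: "continuous_on UNIV g'"
 shows "ennreal ((g 1 - g 0)\<^sup>2) <= (\<integral>\<^sup>+t. ennreal ((g' t)\<^sup>2) * indicator {0..1} t \<partial>lborel)"
proof -
 let ?m = "g 1 - g 0"
 have 1: "(g' has_integral ?m) {0..1}"
  by (rule fundamental_theorem_of_calculus)
    (use D in \<open>auto simp: has_real_derivative_iff_has_vector_derivative[symmetric] intro: has_field_derivative_at_within\<close>)
 have "(%t. (g' t)\<^sup>2) integrable_on {0..1}"
  by (intro integrable_continuous_real continuous_intros continuous_on_subset[OF cont]) auto
 then obtain I where I: "((%t. (g' t)\<^sup>2) has_integral I) {0..1}" by blast
 have "((%t. (g' t)\<^sup>2 - 2 * ?m * g' t + ?m\<^sup>2) has_integral (I - 2 * ?m * ?m + ?m\<^sup>2)) {0..1}"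
  using has_integral_add[OF has_integral_diff[OF I has_integral_mult_right[OF 1, of "2 * ?m"]] has_integral_const_real[of "?m\<^sup>2" 0 1]]
  by simp
 hence "0 <= I - 2 * ?m * ?m + ?m\<^sup>2"
 proof (rule has_integral_nonneg)
  fix t :: real
  have "0 <= (g' t - ?m)\<^sup>2" by simp
  thus "0 <= (g' t)\<^sup>2 - 2 * ?m * g' t + ?m\<^sup>2" by (simp only: power2_diff) (simp add: mult_ac)
 qed
 hence "?m\<^sup>2 <= I" by (simp add: power2_eq_square algebra_simps)
 hence "ennreal (?m\<^sup>2) <= ennreal I" by (rule ennreal_leI)
 also have "ennreal I = (\<integral>\<^sup>+t. ennreal ((g' t)\<^sup>2) * indicator {0..1} t \<partial>lborel)"
  by (rule nn_integral_has_integral_lebesgue'[OF _ I, symmetric]) simp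
 finally show ?thesis .
qed

text \<open>Tonelli and translation invariance.\<close>

lemma nn_integral_shift_average:
 fixes q :: "real^'n::finite => real"
 assumes cont: "continuous_on UNIV q" and q: "!!y. 0 <= q y" and C: "0 <= C"
 shows "(\<integral>\<^sup>+x. indicator B x * (\<integral>\<^sup>+t. ennreal (C * q (x + t *\<^sub>R h)) * indicator {0..1} t \<partial>lborel) \<partial>lborel)
  <= ennreal C * (\<integral>\<^sup>+y. ennreal (q y) \<partial>lborel)"
proof -
 let ?f = "%(x, t). ennreal (C * q (x + t *\<^sub>R h)) * indicator {0..1::real} t"
 have "continuous_on UNIV (%z :: (real^'n) \<times> real. C * q (fst z + snd z *\<^sub>R h))"
  by (intro continuous_intros continuous_on_compose2[OF cont]) auto
 hence "(%z :: (real^'n) \<times> real. C * q (fst z + snd z *\<^sub>R h)) \<in> borel_measurable borel"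
  by (rule borel_measurable_continuous_onI)
 hence [measurable]: "(%z :: (real^'n) \<times> real. C * q (fst z + snd z *\<^sub>R h)) \<in> borel_measurable (lborel \<Otimes>\<^sub>M lborel)"
  by (simp add: lborel_prod)
 have m: "?f \<in> borel_measurable (lborel \<Otimes>\<^sub>M lborel)"
  unfolding case_prod_beta by measurable
 have [measurable]: "q \<in> borel_measurable borel" by (rule borel_measurable_continuous_onI[OF cont])
 have "(\<integral>\<^sup>+x. indicator B x * (\<integral>\<^sup>+t. ennreal (C * q (x + t *\<^sub>R h)) * indicator {0..1} t \<partial>lborel) \<partial>lborel)
   <= (\<integral>\<^sup>+x. (\<integral>\<^sup>+t. ?f (x, t) \<partial>lborel) \<partial>lborel)"
  by (intro nn_integral_mono) (auto simp: indicator_def)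
 also have "... = (\<integral>\<^sup>+t. (\<integral>\<^sup>+x. ?f (x, t) \<partial>lborel) \<partial>lborel)"
  by (rule lborel_pair.Fubini[OF m, symmetric])
 also have "... = (\<integral>\<^sup>+t. ennreal C * (\<integral>\<^sup>+y. ennreal (q y) \<partial>lborel) * indicator {0..1::real} t \<partial>lborel)"
 proof (rule nn_integral_cong)
  fix t :: real
  have "(\<integral>\<^sup>+x. ?f (x, t) \<partial>lborel) = (\<integral>\<^sup>+x. ennreal (C * q (x + t *\<^sub>R h)) \<partial>lborel) * indicator {0..1} t"
   by (simp add: nn_integral_multc)
  also have "(\<integral>\<^sup>+x. ennreal (C * q (x + t *\<^sub>R h)) \<partial>lborel) = (\<integral>\<^sup>+y. ennreal (C * q y) \<partial>lborel)"
   by (rule nn_integral_translate) measurable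
  also have "... = ennreal C * (\<integral>\<^sup>+y. ennreal (q y) \<partial>lborel)"
   using C q by (simp add: ennreal_mult nn_integral_cmult)
  finally show "(\<integral>\<^sup>+x. ?f (x, t) \<partial>lborel) = ennreal C * (\<integral>\<^sup>+y. ennreal (q y) \<partial>lborel) * indicator {0..1} t" .
 qed
 also have "... = ennreal C * (\<integral>\<^sup>+y. ennreal (q y) \<partial>lborel)"
  by (simp add: nn_integral_cmult)
 finally show ?thesis .
qed

text \<open>A nonempty open set is not a null set.\<close>

lemma continuous_AE_zero:
 fixes f :: "real^'n::finite => real"
 assumes cont: "continuous_on S f" and S: "open S" and AE: "AE y in lborel. y \<in> S --> f y = 0" and y: "y \<in> S"
 shows "f y = 0"
proof (rule ccontr)
 assume "f y ~= 0"
 have "open (S \<inter> f -` (-{0}))" by (rule continuous_open_preimage[OF cont S]) auto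
 then obtain r where r: "r > 0" "ball y r \<subseteq> S \<inter> f -` (-{0})"
  using \<open>f y ~= 0\<close> y open_contains_ball by (metis ComplI IntI singletonD vimageI)
 have "AE z in lborel. z \<notin> ball y r" using AE by eventually_elim (use r(2) in auto)
 hence "ball y r \<in> null_sets lborel" by (subst AE_iff_null_sets) auto
 hence "measure lborel (ball y r) = 0" by (simp add: measure_eq_0_null_sets)
 thus False using content_ball_pos[OF r(1), of y] by simp
qed

context
 fixes e :: "'n::finite => real" and p :: nat and u :: "'n field" and s :: "nat => 'n field"
 assumes e: "!!k. e k = 1 \<or> e k = -1" and p: "p >= 1" and u: "u \<in> L2_fields p"
  and s: "!!j. s j \<in> test_fields p" and su: "(%j. L2_norm2 p (s j - u)) \<longlonglongrightarrow> 0"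
  and Ls: "(%j. L2_norm2 p (witten_laplacian e (s j))) \<longlonglongrightarrow> 0"
begin

lemma measurable_components: "(%y. u y J) \<in> borel_measurable lborel" "(%y. s j y J) \<in> borel_measurable lborel"
 using u test_function_measurable[OF test_field_components(1)[OF s]] unfolding L2_fields_def by auto

lemma approx_component:
 assumes J: "length J = p"
 shows "(%j. sq_int (%y. s j y J - u y J)) \<longlonglongrightarrow> 0" "sq_int (%y. u y J) < \<infinity>"
  "\<exists>M<\<infinity>. \<forall>\<^sub>F j in sequentially. sq_int (%y. s j y J) <= M"
proof -
 have fact: "ennreal (fact p) < top" by simp
 have "sq_int (%y. (s j - u) y J) <= ennreal (fact p) * L2_norm2 p (s j - u)" for j
  by (rule sq_int_component_le[OF _ J]) (simp add: borel_measurable_diff[OF measurable_components(2,1), simplified])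
 hence le: "sq_int (%y. s j y J - u y J) <= ennreal (fact p) * L2_norm2 p (s j - u)" for j
  by simp
 show lim: "(%j. sq_int (%y. s j y J - u y J)) \<longlonglongrightarrow> 0"
  by (rule tendsto_sandwich[OF _ always_eventually tendsto_const])
    (use le ennreal_tendsto_cmult[OF fact su] in auto)
 have "sq_int (%y. u y J) <= ennreal (fact p) * L2_norm2 p u"
  by (rule sq_int_component_le[OF measurable_components(1) J])
 also have "... < \<infinity>" using u by (simp add: L2_fields_def ennreal_mult_less_top)
 finally show fin: "sq_int (%y. u y J) < \<infinity>" .
 have sq: "sq_int (%y. s j y J) <= 2 * sq_int (%y. s j y J - u y J) + 2 * sq_int (%y. u y J)" for j
 proof -
  have [measurable]: "(%y. s j y J) \<in> borel_measurable borel" "(%y. u y J) \<in> borel_measurable borel"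
   using measurable_components by auto
  have "sq_int (%y. s j y J) <= (\<integral>\<^sup>+y. 2 * ennreal ((s j y J - u y J)\<^sup>2) + 2 * ennreal ((u y J)\<^sup>2) \<partial>lborel)"
   unfolding sq_int_def
  proof (rule nn_integral_mono)
   fix y
   have "0 <= (s j y J - 2 * u y J)\<^sup>2" by simp
   hence "(s j y J)\<^sup>2 <= 2 * (s j y J - u y J)\<^sup>2 + 2 * (u y J)\<^sup>2"
    by (simp add: power2_eq_square algebra_simps)
   hence "ennreal ((s j y J)\<^sup>2) <= ennreal (2 * (s j y J - u y J)\<^sup>2 + 2 * (u y J)\<^sup>2)" by (rule ennreal_leI)
   thus "ennreal ((s j y J)\<^sup>2) <= 2 * ennreal ((s j y J - u y J)\<^sup>2) + 2 * ennreal ((u y J)\<^sup>2)"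
    by (simp add: ennreal_plus ennreal_mult')
  qed
  also have "... = 2 * sq_int (%y. s j y J - u y J) + 2 * sq_int (%y. u y J)"
   unfolding sq_int_def by (simp add: nn_integral_add nn_integral_cmult)
  finally show ?thesis .
 qed
 have "\<forall>\<^sub>F j in sequentially. sq_int (%y. s j y J - u y J) < 1"
  using lim by (rule order_tendstoD(2)) simp
 hence "\<forall>\<^sub>F j in sequentially. sq_int (%y. s j y J) <= 2 + 2 * sq_int (%y. u y J)"
 proof eventually_elim
  case (elim j)
  have "2 * sq_int (%y. s j y J - u y J) <= 2 * 1" by (intro mult_left_mono) (use elim in auto)
  from order_trans[OF sq[of j] add_right_mono[OF this]] show ?case by simp
 qed
 moreover have "2 + 2 * sq_int (%y. u y J) < \<infinity>" using fin by (simp add: ennreal_mult_less_top)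
 ultimately show "\<exists>M<\<infinity>. \<forall>\<^sub>F j in sequentially. sq_int (%y. s j y J) <= M" by blast
qed

text \<open>Pairing the approximating fields with their images under the operator makes both nonnegative terms of
the energy tend to zero.\<close>

lemma energy_tendsto_zero:
 "length L = Suc p ==> (%j. sq_int (%y. witten_deriv e (s j) y L)) \<longlonglongrightarrow> 0"
 "length J = p - 1 ==> (%j. sq_int (%y. witten_div e (s j) y J)) \<longlonglongrightarrow> 0"
proof -
 define X where "X j = (\<Sum>J\<in>multi_indices p. \<integral>y. witten_laplacian e (s j) y J * s j y J \<partial>lborel)" for j
 have "(%j. \<integral>y. witten_laplacian e (s j) y J * s j y J \<partial>lborel) \<longlonglongrightarrow> 0" if J: "length J = p" for J
 proof -
  have m: "(%y. witten_laplacian e (s j) y J) \<in> borel_measurable lborel" for j J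
   using test_function_measurable[OF test_function_witten_laplacian[OF s]] by simp
  have "(%j. sq_int (%y. witten_laplacian e (s j) y J)) \<longlonglongrightarrow> 0"
   by (rule tendsto_sandwich[OF _ always_eventually tendsto_const])
    (use sq_int_component_le[OF m J] ennreal_tendsto_cmult[OF _ Ls, of "ennreal (fact p)"] in auto)
  moreover obtain M where "M < \<infinity>" "\<forall>\<^sub>F j in sequentially. sq_int (%y. s j y J) <= M"
   using approx_component(3)[OF J] by blast
  ultimately show ?thesis
   by (intro pairing_tendsto_zero[where M = M] m measurable_components(2))
 qed
 hence X0: "X \<longlonglongrightarrow> 0" unfolding X_def by (intro tendsto_null_sum) auto
 have nn: "0 <= (\<integral>y. (f y)\<^sup>2 \<partial>lborel)" for f :: "real^'n => real" by simp
 have Xeq: "X j = (\<Sum>L\<in>multi_indices (Suc p). \<integral>y. (witten_deriv e (s j) y L)\<^sup>2 \<partial>lborel) / (real p + 1)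
   + real p * (\<Sum>J\<in>multi_indices (p - 1). \<integral>y. (witten_div e (s j) y J)\<^sup>2 \<partial>lborel)" for j
  unfolding X_def by (rule energy_identity[OF s p])
 have nnA: "0 <= (\<Sum>L\<in>multi_indices (Suc p). \<integral>y. (witten_deriv e (s j) y L)\<^sup>2 \<partial>lborel) / (real p + 1)"
  and nnB: "0 <= real p * (\<Sum>J\<in>multi_indices (p - 1). \<integral>y. (witten_div e (s j) y J)\<^sup>2 \<partial>lborel)" for j
  by (intro divide_nonneg_nonneg mult_nonneg_nonneg sum_nonneg nn; simp)+
 show "(%j. sq_int (%y. witten_deriv e (s j) y L)) \<longlonglongrightarrow> 0" if L: "length L = Suc p"
 proof -
  have le: "(\<integral>y. (witten_deriv e (s j) y L)\<^sup>2 \<partial>lborel) <= (real p + 1) * X j" for j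
  proof -
   have "(\<integral>y. (witten_deriv e (s j) y L)\<^sup>2 \<partial>lborel) <= (\<Sum>L\<in>multi_indices (Suc p). \<integral>y. (witten_deriv e (s j) y L)\<^sup>2 \<partial>lborel)"
    by (rule member_le_sum) (use L in auto)
   also have "... = (real p + 1) * ((\<Sum>L\<in>multi_indices (Suc p). \<integral>y. (witten_deriv e (s j) y L)\<^sup>2 \<partial>lborel) / (real p + 1))"
    by (simp add: add_nonneg_eq_0_iff)
   also have "... <= (real p + 1) * X j"
    by (intro mult_left_mono) (use Xeq[of j] nnB[of j] in auto)
   finally show ?thesis .
  qed
  have "(%j. \<integral>y. (witten_deriv e (s j) y L)\<^sup>2 \<partial>lborel) \<longlonglongrightarrow> 0"
   by (rule tendsto_sandwich[OF _ _ tendsto_const tendsto_mult_right_zero[OF X0, of "real p + 1"]])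
    (intro always_eventually allI nn le)+
  hence "(%j. ennreal (\<integral>y. (witten_deriv e (s j) y L)\<^sup>2 \<partial>lborel)) \<longlonglongrightarrow> ennreal 0" by (rule tendsto_ennrealI)
  thus ?thesis by (simp add: sq_int_test[OF test_function_witten_deriv[OF s]])
 qed
 show "(%j. sq_int (%y. witten_div e (s j) y J)) \<longlonglongrightarrow> 0" if J: "length J = p - 1"
 proof -
  have le: "(\<integral>y. (witten_div e (s j) y J)\<^sup>2 \<partial>lborel) <= X j" for j
  proof -
   have "1 * (\<integral>y. (witten_div e (s j) y J)\<^sup>2 \<partial>lborel) <= real p * (\<Sum>J\<in>multi_indices (p - 1). \<integral>y. (witten_div e (s j) y J)\<^sup>2 \<partial>lborel)"
    by (intro mult_mono member_le_sum[of J "multi_indices (p - 1)" "%J. \<integral>y. (witten_div e (s j) y J)\<^sup>2 \<partial>lborel"]) (use J p in auto)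
   thus ?thesis using Xeq[of j] nnA[of j] by linarith
  qed
  have "(%j. \<integral>y. (witten_div e (s j) y J)\<^sup>2 \<partial>lborel) \<longlonglongrightarrow> 0"
   by (rule tendsto_sandwich[OF _ _ tendsto_const X0]) (intro always_eventually allI nn le)+
  hence "(%j. ennreal (\<integral>y. (witten_div e (s j) y J)\<^sup>2 \<partial>lborel)) \<longlonglongrightarrow> ennreal 0" by (rule tendsto_ennrealI)
  thus ?thesis by (simp add: sq_int_test[OF test_function_witten_div[OF s]])
 qed
qed

lemma weak_limit:
 assumes I: "length I = p" and \<psi>: "test_function \<psi>"
 shows "(%j. \<integral>y. witten e k (%z. s j z I) y * \<psi> y \<partial>lborel) \<longlonglongrightarrow> - (\<integral>y. u y I * witten_adj e k \<psi> y \<partial>lborel)"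
  and "integrable lborel (%y. u y I * witten_adj e k \<psi> y)"
proof -
 let ?a = "witten_adj e k \<psi>"
 have a: "test_function ?a" by (rule test_function_witten(2)[OF \<psi>])
 have ma: "?a \<in> borel_measurable lborel" using test_function_measurable[OF a] by simp
 have fa: "sq_int ?a < \<infinity>" using sq_int_test[OF a] by simp
 show iu: "integrable lborel (%y. u y I * ?a y)"
  by (rule product_integrable(1)[OF measurable_components(1) ma approx_component(2)[OF I] fa])
 have iss: "integrable lborel (%y. s j y I * ?a y)" for j
  by (rule test_function_integrable[OF test_function_mult[OF test_function_smooth[OF test_field_components(1)[OF s]] a]])
 have "(%j. \<integral>y. (s j y I - u y I) * ?a y \<partial>lborel) \<longlonglongrightarrow> 0"
  by (rule pairing_tendsto_zero[OF _ ma approx_component(1)[OF I], where M = "sq_int ?a"])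
    (use measurable_components fa in auto)
 hence "(%j. (\<integral>y. s j y I * ?a y \<partial>lborel) - (\<integral>y. u y I * ?a y \<partial>lborel)) \<longlonglongrightarrow> 0"
  using iu iss by (simp add: left_diff_distrib)
 hence "(%j. \<integral>y. s j y I * ?a y \<partial>lborel) \<longlonglongrightarrow> (\<integral>y. u y I * ?a y \<partial>lborel)"
  by (rule LIM_zero_cancel)
 hence "(%j. - (\<integral>y. s j y I * ?a y \<partial>lborel)) \<longlonglongrightarrow> - (\<integral>y. u y I * ?a y \<partial>lborel)" by (rule tendsto_minus)
 thus "(%j. \<integral>y. witten e k (%z. s j z I) y * \<psi> y \<partial>lborel) \<longlonglongrightarrow> - (\<integral>y. u y I * ?a y \<partial>lborel)"
  by (simp add: witten_adjoint(2)[OF test_field_components(1)[OF s] test_function_smooth[OF \<psi>]])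
qed

text \<open>After integration by parts the two first-order equations involve only \<open>u\<close>, and pass to the limit.\<close>

lemma weak_equations:
 assumes \<psi>: "test_function \<psi>"
 shows "length L = Suc p ==> (\<Sum>i<length L. \<integral>y. u y (omit i L) * witten_adj e (L ! i) \<psi> y \<partial>lborel) = 0"
  and "length J = p - 1 ==> (\<Sum>k\<in>UNIV. \<integral>y. u y (k # J) * witten_adj e k \<psi> y \<partial>lborel) = 0"
proof -
 have m\<psi>: "\<psi> \<in> borel_measurable lborel" using test_function_measurable[OF \<psi>] by simp
 have f\<psi>: "sq_int \<psi> < \<infinity>" using sq_int_test[OF \<psi>] by simp
 have int: "integrable lborel (%y. witten e k (%z. s j z I) y * \<psi> y)" for j k I
  by (rule test_function_integrable[OF test_function_mult[OF test_function_smooth[OF test_function_witten(1)[OF test_field_components(1)[OF s]]] \<psi>]])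
 show "(\<Sum>i<length L. \<integral>y. u y (omit i L) * witten_adj e (L ! i) \<psi> y \<partial>lborel) = 0" if L: "length L = Suc p"
 proof -
  have "(%j. \<integral>y. witten_deriv e (s j) y L * \<psi> y \<partial>lborel) \<longlonglongrightarrow> 0"
   by (rule pairing_tendsto_zero[OF _ m\<psi> energy_tendsto_zero(1)[OF L], where M = "sq_int \<psi>"])
    (use test_function_measurable[OF test_function_witten_deriv[OF s]] f\<psi> in auto)
  moreover have "(\<integral>y. witten_deriv e (s j) y L * \<psi> y \<partial>lborel) = (\<Sum>i<length L. \<integral>y. witten e (L ! i) (%z. s j z (omit i L)) y * \<psi> y \<partial>lborel)" for j
   unfolding witten_deriv_def sum_distrib_right by (rule Bochner_Integration.integral_sum) (rule int)
  moreover have "(%j. \<Sum>i<length L. \<integral>y. witten e (L ! i) (%z. s j z (omit i L)) y * \<psi> y \<partial>lborel)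
    \<longlonglongrightarrow> (\<Sum>i<length L. - (\<integral>y. u y (omit i L) * witten_adj e (L ! i) \<psi> y \<partial>lborel))"
   by (intro tendsto_sum weak_limit(1) \<psi>) (use L in simp)
  ultimately have "(\<Sum>i<length L. - (\<integral>y. u y (omit i L) * witten_adj e (L ! i) \<psi> y \<partial>lborel)) = 0"
   using LIMSEQ_unique by simp
  thus ?thesis by (simp add: sum_negf)
 qed
 show "(\<Sum>k\<in>UNIV. \<integral>y. u y (k # J) * witten_adj e k \<psi> y \<partial>lborel) = 0" if J: "length J = p - 1"
 proof -
  have 1: "(%j. \<integral>y. witten_div e (s j) y J * \<psi> y \<partial>lborel) \<longlonglongrightarrow> 0"
   by (rule pairing_tendsto_zero[OF _ m\<psi> energy_tendsto_zero(2)[OF J], where M = "sq_int \<psi>"])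
    (use test_function_measurable[OF test_function_witten_div[OF s]] f\<psi> in auto)
  have 2: "(\<integral>y. witten_div e (s j) y J * \<psi> y \<partial>lborel) = - (\<Sum>k\<in>UNIV. \<integral>y. witten e k (%z. s j z (k # J)) y * \<psi> y \<partial>lborel)" for j
   unfolding witten_div_def mult_minus_left sum_distrib_right using int by simp
  have 3: "(%j. - (\<Sum>k\<in>UNIV. \<integral>y. witten e k (%z. s j z (k # J)) y * \<psi> y \<partial>lborel))
    \<longlonglongrightarrow> - (\<Sum>k\<in>UNIV. - (\<integral>y. u y (k # J) * witten_adj e k \<psi> y \<partial>lborel))"
   by (intro tendsto_minus tendsto_sum weak_limit(1) \<psi>) (use J p in simp)
  have "- (\<Sum>k\<in>UNIV. - (\<integral>y. u y (k # J) * witten_adj e k \<psi> y \<partial>lborel)) = 0"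
   using LIMSEQ_unique[OF 3 1[unfolded 2]] .
  thus ?thesis by (simp add: sum_negf)
 qed
qed

lemma line_increment:
 "ennreal ((diag p (%J. exp (quadratic e (x + h)) * s j (x + h) J) h [] - diag p (%J. exp (quadratic e x) * s j x J) h [])\<^sup>2)
  <= (\<integral>\<^sup>+t. ennreal (((\<Sum>k\<in>UNIV. \<bar>h $ k\<bar>) ^ Suc p)\<^sup>2 * exp (2 * quadratic e (x + t *\<^sub>R h)) *
    (\<Sum>L\<in>multi_indices (Suc p). (witten_deriv e (s j) (x + t *\<^sub>R h) L)\<^sup>2)) * indicator {0..1} t \<partial>lborel)"
proof -
 define w where "w y J = exp (quadratic e y) * s j y J" for y J
 have sd: "(%y. s j y J) differentiable (at y)" for y J
  by (rule test_function_differentiable[OF test_field_components(1)[OF s]])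
 have w_sm: "smooth_on UNIV (%y. w y J)" for J
  unfolding w_def using smooth_on_mult[OF open_UNIV smooth_exp_quadratic[of 1] test_function_smooth[OF test_field_components(1)[OF s]]]
  by simp
 have wd: "flat_deriv w y L = exp (quadratic e y) * witten_deriv e (s j) y L" for y L
  unfolding flat_deriv_def witten_deriv_def w_def by (simp add: partial_exp_quadratic(1)[OF sd] sum_distrib_left)
 define g where "g t = diag p (w (x + t *\<^sub>R h)) h []" for t
 define g' where "g' t = diag (Suc p) (flat_deriv w (x + t *\<^sub>R h)) h [] / (real p + 1)" for t
 have D: "(g has_real_derivative g' t) (at t)" for t
  unfolding g_def g'_def by (rule diag_along_line) (rule smooth_on_differentiable[OF w_sm UNIV_I])
 have cont_diag: "continuous_on UNIV (%t. diag q (T t) h J)" if "!!L. continuous_on UNIV (%t. T t L)" for q J and T :: "real => 'n comps"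
  using that by (induction q arbitrary: J) (auto intro!: continuous_intros)
 have "continuous_on UNIV (%t. flat_deriv w (x + t *\<^sub>R h) L)" for L
  unfolding flat_deriv_def
  by (intro continuous_intros continuous_on_compose2[OF smooth_on_continuous[OF smooth_on_partial[OF w_sm]]]) auto
 hence cont: "continuous_on UNIV g'"
  unfolding g'_def by (intro continuous_on_divide cont_diag continuous_on_const) (auto simp: add_nonneg_eq_0_iff)
 have "(g' t)\<^sup>2 <= ((\<Sum>k\<in>UNIV. \<bar>h $ k\<bar>) ^ Suc p)\<^sup>2 * exp (2 * quadratic e (x + t *\<^sub>R h)) *
   (\<Sum>L\<in>multi_indices (Suc p). (witten_deriv e (s j) (x + t *\<^sub>R h) L)\<^sup>2)" for t
 proof -
  have "(g' t)\<^sup>2 = (diag (Suc p) (flat_deriv w (x + t *\<^sub>R h)) h [])\<^sup>2 / (real p + 1)\<^sup>2"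
   by (simp add: g'_def power_divide)
  also have "... <= (diag (Suc p) (flat_deriv w (x + t *\<^sub>R h)) h [])\<^sup>2 / 1"
   by (intro divide_left_mono) (auto simp: one_le_power)
  also have "... <= ((\<Sum>k\<in>UNIV. \<bar>h $ k\<bar>) ^ Suc p)\<^sup>2 * (\<Sum>L\<in>multi_indices (Suc p). (flat_deriv w (x + t *\<^sub>R h) L)\<^sup>2)"
   by (simp only: div_by_1 diag_sq_bound)
  also have "(\<Sum>L\<in>multi_indices (Suc p). (flat_deriv w (x + t *\<^sub>R h) L)\<^sup>2) = exp (2 * quadratic e (x + t *\<^sub>R h)) *
    (\<Sum>L\<in>multi_indices (Suc p). (witten_deriv e (s j) (x + t *\<^sub>R h) L)\<^sup>2)"
   unfolding wd power_mult_distrib sum_distrib_left[symmetric] by (simp add: exp_double)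
  finally show ?thesis by (simp add: mult.assoc)
 qed
 hence "(\<integral>\<^sup>+t. ennreal ((g' t)\<^sup>2) * indicator {0..1} t \<partial>lborel)
   <= (\<integral>\<^sup>+t. ennreal (((\<Sum>k\<in>UNIV. \<bar>h $ k\<bar>) ^ Suc p)\<^sup>2 * exp (2 * quadratic e (x + t *\<^sub>R h)) *
    (\<Sum>L\<in>multi_indices (Suc p). (witten_deriv e (s j) (x + t *\<^sub>R h) L)\<^sup>2)) * indicator {0..1} t \<partial>lborel)"
  by (intro nn_integral_mono mult_right_mono ennreal_leI) auto
 with sq_increment_le[OF D cont] show ?thesis
  unfolding g_def w_def by (auto intro: order_trans)
qed

lemma exp_quadratic_le: "norm y <= r ==> exp (2 * quadratic e y) <= exp (r\<^sup>2)"
proof -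
 assume "norm y <= r"
 have "2 * quadratic e y = (\<Sum>k\<in>UNIV. e k * (y $ k)\<^sup>2)"
  by (simp add: quadratic_def sum_distrib_left mult.left_commute)
 also have "... <= (\<Sum>k\<in>UNIV. (y $ k)\<^sup>2)"
  using e by (intro sum_mono) (metis abs_ge_self abs_minus_cancel abs_one mult_1 mult_le_cancel_right1 mult_minus1 neg_le_0_iff_le order_trans zero_le_power2)
 also have "... = (norm y)\<^sup>2" using sum_sq_eq_dist[of y 0] by simp
 also have "... <= r\<^sup>2" by (rule power_mono) (use \<open>norm y <= r\<close> in auto)
 finally show ?thesis by simp
qed

definition unweighted :: "'n field" where "unweighted y J = exp (quadratic e y) * u y J"

lemma unweighted_measurable: "(%y. unweighted y J) \<in> borel_measurable borel"
proof -
 have [measurable]: "(%y. u y J) \<in> borel_measurable borel" using measurable_components(1) by simp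
 have "(%y. exp (1 * quadratic e y)) \<in> borel_measurable borel"
  by (rule borel_measurable_continuous_onI[OF smooth_on_continuous[OF smooth_exp_quadratic]])
 hence [measurable]: "(%y. exp (quadratic e y)) \<in> borel_measurable borel" by simp
 show ?thesis unfolding unweighted_def by measurable
qed

text \<open>The increment along \<open>h\<close> of the approximating field is controlled by its energy, and the errors at both
ends by the \<open>L\<^sup>2\<close> distance, on each ball around the origin.\<close>

lemma line_conserved: "AE x in lborel. diag p (unweighted (x + h)) h [] = diag p (unweighted x) h []"
proof -
 let ?H = "((\<Sum>k\<in>UNIV. \<bar>h $ k\<bar>) ^ p)\<^sup>2" and ?H' = "((\<Sum>k\<in>UNIV. \<bar>h $ k\<bar>) ^ Suc p)\<^sup>2"
 have "AE x in lborel. x \<in> cball 0 (real R) --> diag p (unweighted (x + h)) h [] = diag p (unweighted x) h []" for R :: nat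
 proof -
  define E where "E = exp ((real R + norm h)\<^sup>2)"
  have E: "E >= 0" by (simp add: E_def)
  have expE: "exp (2 * quadratic e (x + t *\<^sub>R h)) <= E" if "x \<in> cball 0 (real R)" "t \<in> {0..1}" for x t
  proof -
   have "norm (x + t *\<^sub>R h) <= norm x + \<bar>t\<bar> * norm h" by (metis norm_triangle_ineq norm_scaleR)
   also have "... <= real R + 1 * norm h" using that by (intro add_mono mult_right_mono) auto
   finally show ?thesis unfolding E_def by (intro exp_quadratic_le) simp
  qed
  define N where "N = (\<integral>\<^sup>+x. indicator (cball 0 (real R)) x * ennreal ((diag p (unweighted (x + h)) h [] - diag p (unweighted x) h [])\<^sup>2) \<partial>lborel)"
  define err where "err j y = (\<Sum>J\<in>multi_indices p. (s j y J - u y J)\<^sup>2)" for j y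
  define q where "q j y = (\<Sum>L\<in>multi_indices (Suc p). (witten_deriv e (s j) y L)\<^sup>2)" for j y
  define X where "X j = ennreal 3 * (ennreal (?H * E) * (\<integral>\<^sup>+y. ennreal (err j y) \<partial>lborel)
    + ennreal (?H' * E) * (\<integral>\<^sup>+y. ennreal (q j y) \<partial>lborel)
    + ennreal (?H * E) * (\<integral>\<^sup>+y. ennreal (err j y) \<partial>lborel))" for j
  have [measurable]: "(%y. s j y J) \<in> borel_measurable borel" "(%y. u y J) \<in> borel_measurable borel" for j J
   using measurable_components by auto
  have [measurable]: "err j \<in> borel_measurable borel" for j unfolding err_def[abs_def] by measurable
  have q_cont: "continuous_on UNIV (q j)" for j
   unfolding q_def[abs_def]
   by (intro continuous_intros smooth_on_continuous test_function_smooth test_function_witten_deriv[OF s])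
  have q0: "0 <= q j y" and err0: "0 <= err j y" for j y by (simp_all add: q_def err_def sum_nonneg)
  have "N <= X j" for j
  proof -
   define dl where "dl y = diag p (%J. exp (quadratic e y) * u y J) h [] - diag p (%J. exp (quadratic e y) * s j y J) h []" for y
   define inc where "inc x = diag p (%J. exp (quadratic e (x + h)) * s j (x + h) J) h [] - diag p (%J. exp (quadratic e x) * s j x J) h []" for x
   have dl: "(dl y)\<^sup>2 <= ?H * (exp (2 * quadratic e y) * err j y)" for y
   proof -
    have "dl y = diag p (%J. exp (quadratic e y) * (u y J - s j y J)) h []"
    unfolding dl_def diag_diff[symmetric] by (simp add: right_diff_distrib)
    hence "(dl y)\<^sup>2 <= ?H * (\<Sum>J\<in>multi_indices p. (exp (quadratic e y) * (u y J - s j y J))\<^sup>2)"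
    by (simp only: diag_sq_bound)
    also have "(\<Sum>J\<in>multi_indices p. (exp (quadratic e y) * (u y J - s j y J))\<^sup>2) = exp (2 * quadratic e y) * err j y"
    unfolding err_def sum_distrib_left by (intro sum.cong refl) (simp add: power_mult_distrib exp_double power2_commute)
    finally show ?thesis .
   qed
   have dlE: "(dl (x + t *\<^sub>R h))\<^sup>2 <= ?H * E * err j (x + t *\<^sub>R h)" if "x \<in> cball 0 (real R)" "t \<in> {0..1}" for x t
   proof -
    have "?H * (exp (2 * quadratic e (x + t *\<^sub>R h)) * err j (x + t *\<^sub>R h)) <= ?H * (E * err j (x + t *\<^sub>R h))"
    by (intro mult_left_mono mult_right_mono expE that err0) auto
    with dl[of "x + t *\<^sub>R h"] show ?thesis by (simp add: mult.assoc)
   qed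
   have incE: "indicator (cball 0 (real R)) x * ennreal ((inc x)\<^sup>2)
    <= indicator (cball 0 (real R)) x * (\<integral>\<^sup>+t. ennreal (?H' * E * q j (x + t *\<^sub>R h)) * indicator {0..1} t \<partial>lborel)" for x
   proof (cases "x \<in> cball 0 (real R)")
    case True
    have "ennreal ((inc x)\<^sup>2) <= (\<integral>\<^sup>+t. ennreal (?H' * exp (2 * quadratic e (x + t *\<^sub>R h)) * q j (x + t *\<^sub>R h)) * indicator {0..1} t \<partial>lborel)"
    unfolding inc_def q_def by (rule line_increment)
    also have "... <= (\<integral>\<^sup>+t. ennreal (?H' * E * q j (x + t *\<^sub>R h)) * indicator {0..1} t \<partial>lborel)"
    proof (rule nn_integral_mono)
    fix t :: real
    show "ennreal (?H' * exp (2 * quadratic e (x + t *\<^sub>R h)) * q j (x + t *\<^sub>R h)) * indicator {0..1} t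
    <= ennreal (?H' * E * q j (x + t *\<^sub>R h)) * indicator {0..1} t"
    proof (cases "t \<in> {0..1}")
    case t: True
    have "?H' * exp (2 * quadratic e (x + t *\<^sub>R h)) * q j (x + t *\<^sub>R h) <= ?H' * E * q j (x + t *\<^sub>R h)"
    by (intro mult_right_mono mult_left_mono expE True t q0) auto
    from ennreal_leI[OF this] show ?thesis using t by simp
    qed simp
    qed
    finally show ?thesis using True by simp
   qed simp
   have pt: "indicator (cball 0 (real R)) x * ennreal ((diag p (unweighted (x + h)) h [] - diag p (unweighted x) h [])\<^sup>2)
    <= ennreal 3 * (ennreal (?H * E * err j (x + h)) + indicator (cball 0 (real R)) x *
    (\<integral>\<^sup>+t. ennreal (?H' * E * q j (x + t *\<^sub>R h)) * indicator {0..1} t \<partial>lborel) + ennreal (?H * E * err j x))" for x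
   proof (cases "x \<in> cball 0 (real R)")
    case True
    have eq: "diag p (unweighted (x + h)) h [] - diag p (unweighted x) h [] = dl (x + h) + inc x - dl x"
    by (simp add: dl_def inc_def unweighted_def[abs_def])
    have "(a + b - c)\<^sup>2 <= 3 * (a\<^sup>2 + b\<^sup>2 + c\<^sup>2)" for a b c :: real
    proof -
    have "3 * (a\<^sup>2 + b\<^sup>2 + c\<^sup>2) - (a + b - c)\<^sup>2 = (a - b)\<^sup>2 + (a + c)\<^sup>2 + (b + c)\<^sup>2"
    by (simp add: power2_eq_square algebra_simps)
    thus ?thesis by (smt (verit) zero_le_power2)
    qed
    hence "(diag p (unweighted (x + h)) h [] - diag p (unweighted x) h [])\<^sup>2 <= 3 * ((dl (x + h))\<^sup>2 + (inc x)\<^sup>2 + (dl x)\<^sup>2)"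
    unfolding eq .
    also have "... <= 3 * (?H * E * err j (x + h) + (inc x)\<^sup>2 + ?H * E * err j x)"
    using dlE[OF True, of 1] dlE[OF True, of 0] by (intro mult_left_mono add_mono order_refl) simp_all
    finally have "ennreal ((diag p (unweighted (x + h)) h [] - diag p (unweighted x) h [])\<^sup>2)
    <= ennreal (3 * (?H * E * err j (x + h) + (inc x)\<^sup>2 + ?H * E * err j x))" by (rule ennreal_leI)
    also have "... = ennreal 3 * (ennreal (?H * E * err j (x + h)) + ennreal ((inc x)\<^sup>2) + ennreal (?H * E * err j x))"
    using E err0 by (simp add: ennreal_mult' ennreal_plus)
    also have "... <= ennreal 3 * (ennreal (?H * E * err j (x + h)) + indicator (cball 0 (real R)) x *
    (\<integral>\<^sup>+t. ennreal (?H' * E * q j (x + t *\<^sub>R h)) * indicator {0..1} t \<partial>lborel) + ennreal (?H * E * err j x))"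
    using incE[of x] True by (intro mult_left_mono add_mono) auto
    finally show ?thesis using True by simp
   qed simp
   have mI: "(%x. indicator (cball 0 (real R)) x * (\<integral>\<^sup>+t. ennreal (?H' * E * q j (x + t *\<^sub>R h)) * indicator {0..1} t \<partial>lborel)) \<in> borel_measurable lborel"
   proof -
    have "continuous_on UNIV (%z :: (real^'n) \<times> real. ?H' * E * q j (fst z + snd z *\<^sub>R h))"
    by (intro continuous_intros continuous_on_compose2[OF q_cont]) auto
    hence "(%z :: (real^'n) \<times> real. ?H' * E * q j (fst z + snd z *\<^sub>R h)) \<in> borel_measurable borel"
    by (rule borel_measurable_continuous_onI)
    hence [measurable]: "(%z :: (real^'n) \<times> real. ?H' * E * q j (fst z + snd z *\<^sub>R h)) \<in> borel_measurable (lborel \<Otimes>\<^sub>M lborel)"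
    by (simp add: lborel_prod)
    have "(%z :: (real^'n) \<times> real. ennreal (?H' * E * q j (fst z + snd z *\<^sub>R h)) * indicator {0..1} (snd z)) \<in> borel_measurable (lborel \<Otimes>\<^sub>M lborel)"
    by measurable
    from lborel.borel_measurable_nn_integral_fst[OF this]
    have "(%x. \<integral>\<^sup>+t. ennreal (?H' * E * q j (x + t *\<^sub>R h)) * indicator {0..1} t \<partial>lborel) \<in> borel_measurable lborel"
    by simp
    thus ?thesis by (intro borel_measurable_times_ennreal borel_measurable_indicator) auto
   qed
   have me: "(%x. ennreal (?H * E * err j (x + h))) \<in> borel_measurable lborel" "(%x. ennreal (?H * E * err j x)) \<in> borel_measurable lborel"
    by measurable
   have "N <= (\<integral>\<^sup>+x. ennreal 3 * (ennreal (?H * E * err j (x + h)) + indicator (cball 0 (real R)) x *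
    (\<integral>\<^sup>+t. ennreal (?H' * E * q j (x + t *\<^sub>R h)) * indicator {0..1} t \<partial>lborel) + ennreal (?H * E * err j x)) \<partial>lborel)"
    unfolding N_def by (intro nn_integral_mono pt)
   also have "... = ennreal 3 * ((\<integral>\<^sup>+x. ennreal (?H * E * err j (x + h)) \<partial>lborel) + (\<integral>\<^sup>+x. indicator (cball 0 (real R)) x *
    (\<integral>\<^sup>+t. ennreal (?H' * E * q j (x + t *\<^sub>R h)) * indicator {0..1} t \<partial>lborel) \<partial>lborel) + (\<integral>\<^sup>+x. ennreal (?H * E * err j x) \<partial>lborel))"
    using mI me by (simp add: nn_integral_cmult nn_integral_add)
   also have "(\<integral>\<^sup>+x. ennreal (?H * E * err j (x + h)) \<partial>lborel) = (\<integral>\<^sup>+x. ennreal (?H * E * err j x) \<partial>lborel)"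
    by (rule nn_integral_translate) measurable
   also have "(\<integral>\<^sup>+x. ennreal (?H * E * err j x) \<partial>lborel) = ennreal (?H * E) * (\<integral>\<^sup>+y. ennreal (err j y) \<partial>lborel)"
    using E err0 by (simp add: ennreal_mult nn_integral_cmult)
   finally have "N <= ennreal 3 * (ennreal (?H * E) * (\<integral>\<^sup>+y. ennreal (err j y) \<partial>lborel) + (\<integral>\<^sup>+x. indicator (cball 0 (real R)) x *
    (\<integral>\<^sup>+t. ennreal (?H' * E * q j (x + t *\<^sub>R h)) * indicator {0..1} t \<partial>lborel) \<partial>lborel) + ennreal (?H * E) * (\<integral>\<^sup>+y. ennreal (err j y) \<partial>lborel))" .
   also have "... <= X j"
    unfolding X_def by (intro mult_left_mono add_mono nn_integral_shift_average[OF q_cont q0] order_refl) (use E in auto)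
   finally show ?thesis .
  qed
  moreover have "X \<longlonglongrightarrow> 0"
  proof -
   have "(\<integral>\<^sup>+y. ennreal (err j y) \<partial>lborel) = (\<Sum>J\<in>multi_indices p. sq_int (%y. s j y J - u y J))" for j
    unfolding err_def sq_int_def by (subst nn_integral_sum[symmetric]) (auto simp: sum_ennreal)
   moreover have "(\<integral>\<^sup>+y. ennreal (q j y) \<partial>lborel) = (\<Sum>L\<in>multi_indices (Suc p). sq_int (%y. witten_deriv e (s j) y L))" for j
    unfolding q_def sq_int_def
    by (subst nn_integral_sum[symmetric])
    (use test_function_measurable[OF test_function_witten_deriv[OF s]] in \<open>auto simp: sum_ennreal intro!: measurable_compose[OF _ measurable_ennreal]\<close>)
   moreover have "(%j. \<Sum>J\<in>multi_indices p. sq_int (%y. s j y J - u y J)) \<longlonglongrightarrow> 0"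
    "(%j. \<Sum>L\<in>multi_indices (Suc p). sq_int (%y. witten_deriv e (s j) y L)) \<longlonglongrightarrow> 0"
    by (intro tendsto_null_sum approx_component(1) energy_tendsto_zero(1); simp)+
   ultimately have l: "(%j. \<integral>\<^sup>+y. ennreal (err j y) \<partial>lborel) \<longlonglongrightarrow> 0" "(%j. \<integral>\<^sup>+y. ennreal (q j y) \<partial>lborel) \<longlonglongrightarrow> 0"
    by simp_all
   have c: "(%j. ennreal c * f j) \<longlonglongrightarrow> 0" if "f \<longlonglongrightarrow> 0" for c f
    using ennreal_tendsto_cmult[OF _ that, of "ennreal c"] by simp
   show ?thesis
    unfolding X_def by (rule c[OF tendsto_add_zero[OF tendsto_add_zero[OF c[OF l(1)] c[OF l(2)]] c[OF l(1)]]])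
  qed
  ultimately have "N <= 0" by (intro LIMSEQ_le_const) auto
  hence "N = 0" by simp
  have m1: "(%x. diag p (unweighted (x + h)) h []) \<in> borel_measurable lborel"
   by (rule diag_measurable; use unweighted_measurable in measurable)
  have m2: "(%x. diag p (unweighted x) h []) \<in> borel_measurable lborel"
   by (rule diag_measurable; use unweighted_measurable in measurable)
  have "(%x. indicator (cball 0 (real R)) x * ennreal ((diag p (unweighted (x + h)) h [] - diag p (unweighted x) h [])\<^sup>2)) \<in> borel_measurable lborel"
   by (intro borel_measurable_times_ennreal borel_measurable_indicator measurable_compose[OF _ measurable_ennreal]
    borel_measurable_power borel_measurable_diff m1 m2) auto
  from nn_integral_0_iff_AE[OF this] \<open>N = 0\<close>
  have "AE x in lborel. indicator (cball 0 (real R)) x * ennreal ((diag p (unweighted (x + h)) h [] - diag p (unweighted x) h [])\<^sup>2) = 0"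
   unfolding N_def by blast
  thus ?thesis by eventually_elim (auto simp: indicator_def)
 qed
 hence "AE x in lborel. \<forall>R::nat. x \<in> cball 0 (real R) --> diag p (unweighted (x + h)) h [] = diag p (unweighted x) h []"
  by (subst AE_all_countable) blast
 thus ?thesis
 proof eventually_elim
  case (elim x)
  obtain R :: nat where "norm x <= real R" using real_arch_simple by blast
  thus ?case using elim by auto
 qed
qed

text \<open>By Fubini the conservation law, known for every direction and almost every base point, holds for
almost every base point and almost every direction.\<close>

lemma conserved_from_base: "AE z in lborel. AE x in lborel. diag p (unweighted x) (x - z) [] = diag p (unweighted z) (x - z) []"
proof -
 have m: "(%z :: (real^'n) \<times> (real^'n). diag p (unweighted (fst z + snd z)) (snd z) []) \<in> borel_measurable (lborel \<Otimes>\<^sub>M lborel)"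
  "(%z :: (real^'n) \<times> (real^'n). diag p (unweighted (fst z)) (snd z) []) \<in> borel_measurable (lborel \<Otimes>\<^sub>M lborel)"
 proof -
  have k: "(%x :: real^'n. x $ k) \<in> borel_measurable borel" for k
   by (intro borel_measurable_continuous_onI continuous_intros)
  have 1: "(%z :: (real^'n) \<times> (real^'n). snd z $ k) \<in> borel_measurable (lborel \<Otimes>\<^sub>M lborel)" for k
   by (rule measurable_compose[OF _ k]) simp
  show "(%z :: (real^'n) \<times> (real^'n). diag p (unweighted (fst z + snd z)) (snd z) []) \<in> borel_measurable (lborel \<Otimes>\<^sub>M lborel)"
   by (rule diag_measurable[OF _ 1], rule measurable_compose[OF _ unweighted_measurable]) simp
  show "(%z :: (real^'n) \<times> (real^'n). diag p (unweighted (fst z)) (snd z) []) \<in> borel_measurable (lborel \<Otimes>\<^sub>M lborel)"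
   by (rule diag_measurable[OF _ 1], rule measurable_compose[OF _ unweighted_measurable]) simp
 qed
 have ms: "{z \<in> space (lborel \<Otimes>\<^sub>M lborel). diag p (unweighted (fst z + snd z)) (snd z) [] = diag p (unweighted (fst z)) (snd z) []}
   \<in> sets ((lborel :: (real^'n) measure) \<Otimes>\<^sub>M (lborel :: (real^'n) measure))"
  using m by (rule measurable_equality_set)
 have "AE h in lborel. AE x in lborel. diag p (unweighted (x + h)) h [] = diag p (unweighted x) h []"
  using line_conserved by simp
 hence "AE x in lborel. AE h in lborel. diag p (unweighted (x + h)) h [] = diag p (unweighted x) h []"
  unfolding lborel_pair.AE_commute[where P = "%x h. diag p (unweighted (x + h)) h [] = diag p (unweighted x) h []", OF ms] .
 thus ?thesis
 proof eventually_elim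
  case (elim z)
  from AE_translate[OF elim, of "- z"] show ?case by simp
 qed
qed

text \<open>Almost every \<open>z\<^sub>0\<close> has only good nodes around it. Polarization at such a \<open>z\<^sub>0\<close> expresses the field by
its values at these nodes.\<close>

lemma unweighted_eq_interpolant: "\<exists>z0. AE x in lborel. unweighted x = interpolant p 1 z0 unweighted x"
proof -
 let ?good = "%z. AE x in lborel. diag p (unweighted x) (x - z) [] = diag p (unweighted z) (x - z) []"
 have nodes: "AE z in lborel. \<forall>w\<in>nodes 1 J z. ?good w" for J :: "'n list"
 proof (induction J)
  case Nil
  thus ?case using conserved_from_base by simp
 next
  case (Cons j J)
  from AE_translate[OF Cons, of "- axis j 1"] Cons show ?case
   by eventually_elim auto
 qed
 have "AE z in lborel. \<forall>J\<in>multi_indices p. \<forall>w\<in>nodes 1 J z. ?good w"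
  by (rule AE_finite_allI) (use nodes in auto)
 moreover have "ae_filter (lborel :: (real^'n) measure) ~= bot"
  by (simp add: ae_filter_eq_bot_iff)
 ultimately obtain z0 where z0: "\<forall>J\<in>multi_indices p. \<forall>w\<in>nodes 1 J z0. ?good w"
  using eventually_happens' by blast
 have "AE x in lborel. \<forall>J\<in>multi_indices p. \<forall>w\<in>nodes 1 J z0. diag p (unweighted x) (x - w) [] = diag p (unweighted w) (x - w) []"
  by (intro AE_finite_allI finite_nodes finite_multi_indices) (use z0 in blast)
 hence "AE x in lborel. unweighted x = interpolant p 1 z0 unweighted x"
 proof eventually_elim
  case (elim x)
  have "u x \<in> sym_comps p" using u unfolding L2_fields_def by blast
  hence "exp (quadratic e x) *\<^sub>R u x \<in> sym_comps p" by (rule subspace_scale[OF subspace_sym_comps])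
  moreover have "exp (quadratic e x) *\<^sub>R u x = unweighted x" by (rule ext) (simp add: unweighted_def)
  ultimately have "unweighted x \<in> sym_comps p" by simp
  thus ?case using elim by (intro interpolant_eq[symmetric]) auto
 qed
 thus ?thesis by blast
qed

text \<open>An element of the kernel is a divergence-free Killing tensor times the Gaussian weight: it agrees almost
 everywhere with a polynomial one, for which the weak equations become classical.\<close>

theorem kernel_is_flat_killing: "\<exists>P\<in>flat_killing p. AE y in lborel. u y = exp (- quadratic e y) *\<^sub>R P y"
proof -
 obtain z0 where AEz: "AE x in lborel. unweighted x = interpolant p 1 z0 unweighted x" using unweighted_eq_interpolant by blast
 define P where "P = interpolant p 1 z0 unweighted"
 have poly: "real_polynomial_function (%y. P y J)" for J unfolding P_def by (rule polynomial_interpolant)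
 have sm: "smooth_on UNIV (%y. P y J)" for J by (rule polynomial_smooth[OF poly])
 have Pd: "(%y. P y J) differentiable (at y)" for J y by (rule smooth_on_differentiable[OF sm UNIV_I])
 have uP: "AE y in lborel. u y = exp (- quadratic e y) *\<^sub>R P y"
  using AEz
 proof eventually_elim
  case (elim y)
  have "u y J = exp (- quadratic e y) * unweighted y J" for J by (simp add: unweighted_def exp_minus field_simps)
  thus ?case using elim by (auto simp: P_def)
 qed
 have usym: "u y \<in> sym_comps p" for y using u unfolding L2_fields_def by blast
 have Psym: "P y \<in> sym_comps p" for y
 proof (rule sym_compsI)
  show "P y J = 0" if "length J ~= p" for J using that by (simp add: P_def interpolant_def)
  fix I J :: "'n list" assume IJ: "mset I = mset J"
  have "P y I - P y J = 0"
  proof (rule continuous_AE_zero[where S = UNIV and f = "%y. P y I - P y J"])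
   show "continuous_on UNIV (%y. P y I - P y J)" by (intro continuous_intros smooth_on_continuous sm)
   show "AE y in lborel. y \<in> UNIV --> P y I - P y J = 0"
    using uP
   proof eventually_elim
    case (elim y)
    have "u y I = u y J" by (rule sym_comps_sym[OF usym IJ])
    thus ?case unfolding elim by simp
   qed
  qed auto
  thus "P y I = P y J" by simp
 qed
 let ?g = "%y. exp (- quadratic e y)"
 have sg: "smooth_on UNIV ?g" using smooth_exp_quadratic[of "-1" e] by simp
 have byparts: "(\<integral>y. u y I * witten_adj e k \<psi> y \<partial>lborel) = - (\<integral>y. ?g y * partial k (%z. P z I) y * \<psi> y \<partial>lborel)"
  if \<psi>: "test_function \<psi>" for I k \<psi>
 proof -
  have sgP: "smooth_on UNIV (%y. ?g y * P y I)" by (intro smooth_on_mult sg sm open_UNIV)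
  have "(\<integral>y. u y I * witten_adj e k \<psi> y \<partial>lborel) = (\<integral>y. witten_adj e k \<psi> y * (?g y * P y I) \<partial>lborel)"
  proof (rule integral_cong_AE)
   have a: "witten_adj e k \<psi> \<in> borel_measurable borel"
    by (rule test_function_measurable[OF test_function_witten(2)[OF \<psi>]])
   have b: "(%y. ?g y * P y I) \<in> borel_measurable borel"
    by (rule borel_measurable_continuous_onI[OF smooth_on_continuous[OF sgP]])
   show "(%y. u y I * witten_adj e k \<psi> y) \<in> borel_measurable lborel"
    using measurable_components(1)[of I] a by simp
   show "(%y. witten_adj e k \<psi> y * (?g y * P y I)) \<in> borel_measurable lborel"
    using borel_measurable_times[OF a b] by simp
   show "AE y in lborel. u y I * witten_adj e k \<psi> y = witten_adj e k \<psi> y * (?g y * P y I)"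
    using uP by eventually_elim simp
  qed
  also have "... = - (\<integral>y. \<psi> y * witten e k (%y. ?g y * P y I) y \<partial>lborel)"
   by (rule witten_adjoint(1)[OF \<psi> sgP])
  finally show ?thesis unfolding partial_exp_quadratic(3)[OF Pd] by (simp add: mult_ac)
 qed
 have int: "integrable lborel (%y. ?g y * partial k (%z. P z I) y * \<psi> y)" if \<psi>: "test_function \<psi>" for k I \<psi>
  by (intro test_function_integrable test_function_mult[OF _ \<psi>] smooth_on_mult sg smooth_on_partial sm open_UNIV)
 have vanish: "f y0 = 0" if f: "smooth_on UNIV f" and w: "!!\<psi>. test_function \<psi> ==> (\<integral>y. ?g y * f y * \<psi> y \<partial>lborel) = 0" for f y0
 proof -
  define \<psi> where "\<psi> y = f y * bump y0 1 y" for y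
  have tb: "test_function (bump y0 1)"
   unfolding test_function_def
  proof
   show "smooth_on UNIV (bump y0 1)" by (rule smooth_on_bump) auto
   have "{y. bump y0 1 y ~= 0} \<subseteq> ball y0 1" using bump_zero[of 1 _ y0] by (auto simp del: mem_ball)
   thus "bounded {y. bump y0 1 y ~= 0}" by (rule bounded_subset[OF bounded_ball])
  qed
  have \<psi>: "test_function \<psi>" unfolding \<psi>_def by (rule test_function_mult[OF f tb])
  have t2: "test_function (%y. ?g y * f y * \<psi> y)" by (intro test_function_mult smooth_on_mult sg f \<psi> open_UNIV)
  have nonneg: "0 <= ?g y * f y * \<psi> y" for y
  proof -
   have "?g y * f y * \<psi> y = ?g y * (f y)\<^sup>2 * bump y0 1 y" by (simp add: \<psi>_def power2_eq_square)
   thus ?thesis by (simp only: bump_nonneg zero_le_power2 exp_ge_zero mult_nonneg_nonneg)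
  qed
  have "AE y in lborel. ?g y * f y * \<psi> y = 0"
   using w[OF \<psi>] nonneg
   by (subst (asm) integral_nonneg_eq_0_iff_AE[OF test_function_integrable[OF t2]]) auto
  hence "?g y0 * f y0 * \<psi> y0 = 0"
   by (intro continuous_AE_zero[where S = UNIV and f = "%y. ?g y * f y * \<psi> y"] smooth_on_continuous[OF test_function_smooth[OF t2]]) auto
  moreover have "bump y0 1 y0 > 0" by (rule bump_pos) simp
  ultimately show ?thesis by (simp add: \<psi>_def)
 qed
 have "flat_deriv P y L = 0" for y L
 proof (cases "length L = Suc p")
  case L: True
  show ?thesis
  proof (rule vanish[of "%y. flat_deriv P y L"])
   show "smooth_on UNIV (%y. flat_deriv P y L)"
    unfolding flat_deriv_def by (intro smooth_on_sum smooth_on_partial sm open_UNIV)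
   fix \<psi> :: "real^'n => real" assume \<psi>: "test_function \<psi>"
   have "(\<integral>y. ?g y * flat_deriv P y L * \<psi> y \<partial>lborel) = (\<Sum>i<length L. \<integral>y. ?g y * partial (L ! i) (%z. P z (omit i L)) y * \<psi> y \<partial>lborel)"
    unfolding flat_deriv_def sum_distrib_left sum_distrib_right by (rule Bochner_Integration.integral_sum) (rule int[OF \<psi>])
   also have "... = - (\<Sum>i<length L. \<integral>y. u y (omit i L) * witten_adj e (L ! i) \<psi> y \<partial>lborel)"
    unfolding byparts[OF \<psi>] by (simp add: sum_negf)
   also have "... = 0" using weak_equations(1)[OF \<psi> L] by simp
   finally show "(\<integral>y. ?g y * flat_deriv P y L * \<psi> y \<partial>lborel) = 0" .
  qed
 next
  case False
  thus ?thesis using sym_comps_off[OF flat_deriv_sym_comps[OF Psym]] by simp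
 qed
 moreover have "flat_div P y J = 0" for y J
 proof (cases "length J = p - 1")
  case J: True
  show ?thesis
  proof (rule vanish[of "%y. flat_div P y J"])
   show "smooth_on UNIV (%y. flat_div P y J)"
    unfolding flat_div_def by (intro smooth_on_minus smooth_on_sum smooth_on_partial sm open_UNIV)
   fix \<psi> :: "real^'n => real" assume \<psi>: "test_function \<psi>"
   have "(\<integral>y. ?g y * flat_div P y J * \<psi> y \<partial>lborel) = - (\<integral>y. (\<Sum>k\<in>UNIV. ?g y * partial k (%z. P z (k # J)) y * \<psi> y) \<partial>lborel)"
    unfolding flat_div_def by (simp add: sum_distrib_left sum_distrib_right)
   also have "(\<integral>y. (\<Sum>k\<in>UNIV. ?g y * partial k (%z. P z (k # J)) y * \<psi> y) \<partial>lborel) = (\<Sum>k\<in>UNIV. \<integral>y. ?g y * partial k (%z. P z (k # J)) y * \<psi> y \<partial>lborel)"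
    by (rule Bochner_Integration.integral_sum) (rule int[OF \<psi>])
   also have "- ... = (\<Sum>k\<in>UNIV. \<integral>y. u y (k # J) * witten_adj e k \<psi> y \<partial>lborel)"
    unfolding byparts[OF \<psi>] by (simp add: sum_negf)
   also have "... = 0" by (rule weak_equations(2)[OF \<psi> J])
   finally show "(\<integral>y. ?g y * flat_div P y J * \<psi> y \<partial>lborel) = 0" .
  qed
 next
  case False
  thus ?thesis using sym_comps_off[OF flat_div_sym_comps[OF Psym p]] by simp
 qed
 ultimately have "P \<in> flat_killing p"
  using Psym sm unfolding flat_killing_def by (simp add: fun_eq_iff)
 with uP show ?thesis by blast
qed

end

section \<open>Positive index\<close>

text \<open>Compare the integral of the square over the half space \<open>y\<^sub>k > 0\<close> with its translate by a unit step: the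
weight grows at least by the factor \<open>exp 1\<close>, the function does not change, so a finite integral is zero.\<close>

lemma invariant_growing_zero:
 fixes f :: "real^'n::finite => real"
 assumes k: "e k = -1" and cont: "continuous_on UNIV f"
  and inv: "!!y t. f (y + t *\<^sub>R axis k 1) = f y"
  and fin: "sq_int (%y. exp (- quadratic e y) * f y) < \<infinity>"
 shows "f y = 0"
proof -
 let ?g = "%y. exp (- quadratic e y) * f y"
 let ?S = "{y :: real^'n. 0 < y $ k}"
 let ?h = "axis k 1 :: real^'n"
 have S: "open ?S" by (rule open_halfspace_component_gt_cart)
 have cg: "continuous_on UNIV ?g"
  using continuous_on_mult[OF smooth_on_continuous[OF smooth_exp_quadratic[of "-1" e]] cont] by simp
 have mg: "?g \<in> borel_measurable borel" by (rule borel_measurable_continuous_onI[OF cg])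
 define I where "I = (\<integral>\<^sup>+y. ennreal ((?g y)\<^sup>2) * indicator ?S y \<partial>lborel)"
 have m: "(%y. ennreal ((?g y)\<^sup>2) * indicator ?S y) \<in> borel_measurable borel"
  by (intro borel_measurable_times_ennreal borel_measurable_indicator measurable_compose[OF _ measurable_ennreal]
   borel_measurable_power mg borel_open S)
 have "I <= sq_int ?g" unfolding I_def sq_int_def by (intro nn_integral_mono) (auto simp: indicator_def)
 hence Ifin: "I < \<infinity>" using fin by (rule order.strict_trans1)
 have q: "quadratic e (y + ?h) = quadratic e y - y $ k - 1/2" for y
 proof -
  have "quadratic e (y + ?h) - quadratic e y = (\<Sum>j\<in>UNIV. if j = k then - y $ k - 1/2 else 0)"
   unfolding quadratic_def sum_subtractf[symmetric]
   by (intro sum.cong refl) (auto simp: k axis_def power2_eq_square algebra_simps)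
  thus ?thesis by simp
 qed
 have step: "ennreal (exp 1) * (ennreal ((?g y)\<^sup>2) * indicator ?S y) <= ennreal ((?g (y + ?h))\<^sup>2) * indicator ?S (y + ?h)" for y
 proof (cases "y \<in> ?S")
  case True
  have "?g (y + ?h) = exp (y $ k + 1/2) * ?g y"
   using inv[of y 1] by (simp add: q exp_add[symmetric] algebra_simps)
  hence "(?g (y + ?h))\<^sup>2 = (exp (y $ k + 1/2))\<^sup>2 * (?g y)\<^sup>2" by (simp only: power_mult_distrib)
  also have "(exp (y $ k + 1/2))\<^sup>2 = exp (2 * y $ k + 1)" by (simp add: exp_double[symmetric] algebra_simps)
  finally have "exp 1 * (?g y)\<^sup>2 <= (?g (y + ?h))\<^sup>2"
   using True by (simp only:) (intro mult_right_mono, auto)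
  hence "ennreal (exp 1) * ennreal ((?g y)\<^sup>2) <= ennreal ((?g (y + ?h))\<^sup>2)"
   by (subst ennreal_mult[symmetric]) (auto intro: ennreal_leI)
  thus ?thesis using True by (simp add: indicator_def)
 qed (simp add: indicator_def)
 have "ennreal (exp 1) * I = (\<integral>\<^sup>+y. ennreal (exp 1) * (ennreal ((?g y)\<^sup>2) * indicator ?S y) \<partial>lborel)"
  unfolding I_def by (rule nn_integral_cmult[symmetric]) (use m in simp)
 also have "... <= (\<integral>\<^sup>+y. ennreal ((?g (y + ?h))\<^sup>2) * indicator ?S (y + ?h) \<partial>lborel)"
  by (intro nn_integral_mono step)
 also have "... = I" unfolding I_def by (rule nn_integral_translate[OF m])
 finally have le: "ennreal (exp 1) * I <= I" .
 have "I = 0"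
 proof -
  obtain r where r: "I = ennreal r" "r >= 0" using Ifin by (cases I) auto
  have "exp 1 * r <= r" using le r by (simp add: ennreal_mult'[symmetric])
  moreover have "2 * r <= exp 1 * r" using exp_ge_add_one_self[of 1] r(2) by (intro mult_right_mono) auto
  ultimately have "r = 0" using r(2) by linarith
  thus ?thesis by (simp add: r)
 qed
 hence "AE y in lborel. ennreal ((?g y)\<^sup>2) * indicator ?S y = 0"
  unfolding I_def by (subst (asm) nn_integral_0_iff_AE) (use m in auto)
 hence AE: "AE y in lborel. y \<in> ?S --> f y = 0" by eventually_elim (auto simp: indicator_def)
 let ?t = "\<bar>y $ k\<bar> + 1"
 have "f (y + ?t *\<^sub>R ?h) = 0"
  by (rule continuous_AE_zero[OF continuous_on_subset[OF cont] S AE]) (auto simp: axis_def)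
 thus ?thesis by (simp add: inv)
qed

text \<open>By induction on the number of indices different from \<open>k\<close>. The component of the Killing equation at
\<open>k # J\<close> is a positive multiple of \<open>\<partial>\<^sub>k P\<^sub>J\<close> plus derivatives of components with fewer such indices; so
\<open>P\<^sub>J\<close> does not depend on \<open>y\<^sub>k\<close>.\<close>

lemma growing_flat_killing_zero:
 fixes P :: "'n::finite field"
 assumes k: "e k = -1" and P: "P \<in> flat_killing p"
  and fin: "!!J. length J = p ==> sq_int (%y. exp (- quadratic e y) * P y J) < \<infinity>"
 shows "P y J = 0"
proof -
 have sm: "smooth_on UNIV (%y. P y J)" and sym: "P y \<in> sym_comps p" and D: "flat_deriv P y = 0" for y J
  using P unfolding flat_killing_def by auto
 show ?thesis
 proof (induction "length (filter (%j. j ~= k) J)" arbitrary: J y rule: less_induct)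
  case less
  show ?case
  proof (cases "length J = p")
   case len: True
   have dk: "partial k (%z. P z J) y = 0" for y
   proof -
    have summand: "partial (J ! s) (%z. P z (k # omit s J)) y = (if J ! s = k then partial k (%z. P z J) y else 0)"
    if s: "s < length J" for s
    proof (cases "J ! s = k")
    case True
    hence "mset (k # omit s J) = mset J" using mset_omit[OF s] by simp
    hence "P z (k # omit s J) = P z J" for z by (rule sym_comps_sym[OF sym])
    thus ?thesis using True by simp
    next
    case False
    have "mset (filter (%j. j ~= k) J) = mset (filter (%j. j ~= k) (J ! s # omit s J))"
    unfolding mset_filter mset_omit[OF s] by (rule refl)
    hence "length (filter (%j. j ~= k) J) = length (filter (%j. j ~= k) (J ! s # omit s J))"
    by (rule mset_eq_length)
    hence "length (filter (%j. j ~= k) (k # omit s J)) < length (filter (%j. j ~= k) J)"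
    using False by simp
    from less[OF this] have "P z (k # omit s J) = 0" for z .
    thus ?thesis using False by (simp add: partial_const)
    qed
    have "0 = flat_deriv P y (k # J)" by (simp add: D)
    also have "... = partial k (%z. P z J) y + (\<Sum>s<length J. partial (J ! s) (%z. P z (k # omit s J)) y)"
    unfolding flat_deriv_def length_Cons sum.lessThan_Suc_shift by simp
    also have "... = partial k (%z. P z J) y * (1 + (\<Sum>s<length J. if J ! s = k then 1 else 0))"
    unfolding distrib_left sum_distrib_left by (simp add: summand if_distrib cong: if_cong)
    finally have "partial k (%z. P z J) y * (1 + (\<Sum>s<length J. if J ! s = k then 1 else 0)) = 0" by simp
    moreover have "(\<Sum>s<length J. if J ! s = k then 1 else 0) >= (0::real)" by (intro sum_nonneg) auto
    ultimately show ?thesis by auto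
   qed
   have "P (y + t *\<^sub>R axis k 1) J = P y J" for y t
   proof -
    have "((%t. P (y + t *\<^sub>R axis k 1) J) has_real_derivative 0) (at t)" for t
    using has_derivative_ray[of "%y. P y J" y t "axis k 1" UNIV] smooth_on_differentiable[OF sm]
    by (simp add: axis_def if_distrib[of "%x. x * _"] dk cong: if_cong)
    hence "P (y + t *\<^sub>R axis k 1) J = P (y + 0 *\<^sub>R axis k 1) J" by (intro DERIV_isconst_all) auto
    thus ?thesis by simp
   qed
   thus ?thesis
    by (intro invariant_growing_zero[of e k "%y. P y J", OF k smooth_on_continuous[OF sm] _ fin[OF len]])
  qed (use sym_comps_off[OF sym] in simp)
 qed
qed

section \<open>Index zero: the Gaussian\<close>

lemma quadratic_norm: "quadratic (%_. 1) y = (norm (y :: real^'n::finite))\<^sup>2 / 2"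
 unfolding power2_norm_eq_inner quadratic_def inner_vec_def sum_divide_distrib
 by (intro sum.cong refl) (simp add: power2_eq_square)

lemma gaussian_integral_1d: "(\<integral>\<^sup>+x. ennreal (exp (- x\<^sup>2 / 2)) \<partial>lborel) < \<infinity>"
proof -
 let ?f = "%x :: real. ennreal (exp (1/2 - x)) * indicator {0..} x"
 have m: "?f \<in> borel_measurable borel" by measurable
 have "(\<integral>\<^sup>+x. ?f x \<partial>lborel) = ennreal (0 - (- exp (1/2 - 0)))"
 proof (rule nn_integral_FTC_atLeast)
  show "((%x. - exp (1/2 - x)) has_real_derivative exp (1/2 - x)) (at x)" for x :: real
   by (auto intro!: derivative_eq_intros)
  have "((%x :: real. - exp (1/2) * exp (- x)) \<longlongrightarrow> 0) at_top"
   by (rule tendsto_mult_right_zero[OF filterlim_compose[OF exp_at_bot filterlim_uminus_at_bot_at_top]])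
  thus "((%x :: real. - exp (1/2 - x)) \<longlongrightarrow> 0) at_top" by (simp add: mult_exp_exp)
 qed auto
 hence fin: "(\<integral>\<^sup>+x. ?f x \<partial>lborel) < \<infinity>" by simp
 have le: "ennreal (exp (- x\<^sup>2 / 2)) <= ?f x + ?f (0 + (-1) * x)" for x :: real
 proof -
  have "0 <= (\<bar>x\<bar> - 1)\<^sup>2" by simp
  hence "- x\<^sup>2 / 2 <= 1/2 - \<bar>x\<bar>" by (simp add: power2_eq_square algebra_simps)
  hence le1: "ennreal (exp (- x\<^sup>2 / 2)) <= ennreal (exp (1/2 - \<bar>x\<bar>))" by (intro ennreal_leI) simp
  show ?thesis
  proof (cases "x >= 0")
   case True
   hence "ennreal (exp (1/2 - \<bar>x\<bar>)) = ?f x" by simp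
   with le1 show ?thesis by (simp add: add_increasing2)
  next
   case False
   hence "ennreal (exp (1/2 - \<bar>x\<bar>)) = ?f (0 + (-1) * x)" by simp
   with le1 show ?thesis by (metis add_increasing zero_le)
  qed
 qed
 have m': "(%x. ?f (0 + (-1) * x)) \<in> borel_measurable borel" by measurable
 have "(\<integral>\<^sup>+x. ennreal (exp (- x\<^sup>2 / 2)) \<partial>lborel) <= (\<integral>\<^sup>+x. ?f x + ?f (0 + (-1) * x) \<partial>lborel)"
  by (intro nn_integral_mono le)
 also have "... = (\<integral>\<^sup>+x. ?f x \<partial>lborel) + (\<integral>\<^sup>+x. ?f (0 + (-1) * x) \<partial>lborel)"
  by (rule nn_integral_add) (use m m' in simp_all)
 also have "(\<integral>\<^sup>+x. ?f (0 + (-1) * x) \<partial>lborel) = (\<integral>\<^sup>+x. ?f x \<partial>lborel)"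
  using nn_integral_real_affine[OF m, of "-1" 0] by simp
 also have "(\<integral>\<^sup>+x. ?f x \<partial>lborel) + (\<integral>\<^sup>+x. ?f x \<partial>lborel) < \<infinity>" using fin by simp
 finally show ?thesis .
qed

lemma gaussian_integral: "(\<integral>\<^sup>+y. ennreal (exp (- (norm (y :: real^'n::finite))\<^sup>2 / 2)) \<partial>lborel) < \<infinity>"
proof -
 have "ennreal (exp (- (norm y)\<^sup>2 / 2)) = (\<Prod>b\<in>Basis. ennreal (exp (- (y \<bullet> b)\<^sup>2 / 2)))" for y :: "real^'n"
 proof -
  have "- (norm y)\<^sup>2 / 2 = (\<Sum>b\<in>Basis. - (y \<bullet> b)\<^sup>2 / 2)"
   unfolding power2_norm_eq_inner euclidean_inner[of y y] by (simp add: sum_negf sum_divide_distrib[symmetric] power2_eq_square)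
  thus ?thesis by (simp add: exp_sum prod_ennreal)
 qed
 hence "(\<integral>\<^sup>+y. ennreal (exp (- (norm (y :: real^'n))\<^sup>2 / 2)) \<partial>lborel)
   = (\<integral>\<^sup>+y. (\<Prod>b\<in>Basis. ennreal (exp (- ((y :: real^'n) \<bullet> b)\<^sup>2 / 2))) \<partial>lborel)" by simp
 also have "... = (\<Prod>b\<in>(Basis :: (real^'n) set). (\<integral>\<^sup>+x. ennreal (exp (- x\<^sup>2 / 2)) \<partial>lborel))"
  by (rule nn_integral_lborel_prod[where f = "%_ x. ennreal (exp (- x\<^sup>2 / 2))"]) auto
 also have "... < \<infinity>" using gaussian_integral_1d by (simp add: power_less_top_ennreal)
 finally show ?thesis .
qed

abbreviation gauss :: "real^'n::finite => real" where "gauss y \<equiv> exp (- quadratic (%_. 1) y)"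

abbreviation weight :: "real^'n::finite => real" where "weight y \<equiv> 1 + (norm y)\<^sup>2"

text \<open>The factor \<open>(1 + r)\<^sup>M\<close> is absorbed by half of the exponent.\<close>

lemma gaussian_moment: "sq_int (%y :: real^'n::finite. (weight y) ^ N * gauss y) < \<infinity>"
proof -
 define M where "M = Suc (2 * N)"
 define C where "C = (2 * real M) ^ M"
 have le: "((weight y) ^ N * gauss y)\<^sup>2 <= C * exp (- (norm y)\<^sup>2 / 2)" for y :: "real^'n"
 proof -
  define r where "r = (norm y)\<^sup>2"
  have r: "r >= 0" by (simp add: r_def)
  have "(1 + r) ^ (2 * N) <= (1 + r) ^ M" using r unfolding M_def by (intro power_increasing) auto
  also have "... <= (2 * real M * (1 + (r/2) / real M)) ^ M"
   using r by (intro power_mono) (auto simp: M_def field_simps)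
  also have "... = C * (1 + (r/2) / real M) ^ M" by (simp add: C_def power_mult_distrib)
  also have "... <= C * exp (r/2)"
   using r by (intro mult_left_mono exp_ge_one_plus_x_over_n_power_n) (auto simp: C_def M_def)
  finally have 1: "(1 + r) ^ (2 * N) <= C * exp (r/2)" .
  have "((1 + r) ^ N * exp (- (r/2)))\<^sup>2 = (1 + r) ^ (2 * N) * exp (- r)"
   by (simp add: power_mult_distrib power_mult[symmetric] mult.commute exp_double[symmetric])
  also have "... <= C * exp (r/2) * exp (- r)" using 1 by (intro mult_right_mono) auto
  also have "... = C * exp (- r/2)" by (simp add: mult.assoc exp_add[symmetric])
  finally show ?thesis by (simp add: quadratic_norm r_def)
 qed
 have "sq_int (%y :: real^'n. (weight y) ^ N * gauss y)
   <= (\<integral>\<^sup>+y. ennreal C * ennreal (exp (- (norm (y :: real^'n))\<^sup>2 / 2)) \<partial>lborel)"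
  unfolding sq_int_def
 proof (intro nn_integral_mono)
  fix y :: "real^'n"
  have "ennreal C * ennreal (exp (- (norm y)\<^sup>2 / 2)) = ennreal (C * exp (- (norm y)\<^sup>2 / 2))" by (simp add: ennreal_mult'')
  thus "ennreal (((weight y) ^ N * gauss y)\<^sup>2) <= ennreal C * ennreal (exp (- (norm y)\<^sup>2 / 2))"
   using ennreal_leI[OF le[of y]] by simp
 qed
 also have "... = ennreal C * (\<integral>\<^sup>+y. ennreal (exp (- (norm (y :: real^'n))\<^sup>2 / 2)) \<partial>lborel)"
  by (rule nn_integral_cmult) measurable
 also have "... < \<infinity>" using gaussian_integral[where ?'n = 'n] by (simp add: ennreal_mult_less_top)
 finally show ?thesis .
qed

lemma polynomial_growth:
 fixes q :: "real^'n::finite => real"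
 assumes "real_polynomial_function q"
 shows "\<exists>C N. C >= 0 & (\<forall>y. \<bar>q y\<bar> <= C * (weight y) ^ N)"
 using assms
proof induction
 case (linear f)
 have "norm y <= 1 + (norm y)\<^sup>2" for y :: "real^'n"
 proof -
  have "0 <= (norm y - 1)\<^sup>2" by simp
  hence "2 * norm y <= (norm y)\<^sup>2 + 1" by (simp add: power2_diff)
  thus ?thesis using norm_ge_zero[of y] by linarith
 qed
 moreover obtain K where "K >= 0" "!!y. norm (f y) <= norm y * K" using bounded_linear.nonneg_bounded[OF linear] by blast
 ultimately have "\<bar>f y\<bar> <= K * (weight y) ^ 1" for y
  by (metis mult.commute mult_left_mono order_trans power_one_right real_norm_def)
 thus ?case using \<open>K >= 0\<close> by blast
next
 case (const c)
 have "\<bar>c\<bar> <= \<bar>c\<bar> * (weight y) ^ 0" for y :: "real^'n" by simp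
 thus ?case by (metis abs_ge_zero)
next
 case (add f g)
 then obtain C N D M where CD: "C >= 0" "D >= 0"
  "!!y. \<bar>f y\<bar> <= C * (weight y) ^ N" "!!y. \<bar>g y\<bar> <= D * (weight y) ^ M" by blast
 have "\<bar>f y + g y\<bar> <= (C + D) * (weight y) ^ (max N M)" for y
 proof -
  have "C * (weight y) ^ N <= C * (weight y) ^ (max N M)" "D * (weight y) ^ M <= D * (weight y) ^ (max N M)"
   using CD by (auto intro!: mult_left_mono power_increasing)
  with CD(3,4)[of y] show ?thesis unfolding distrib_right by linarith
 qed
 thus ?case using CD by (metis add_nonneg_nonneg)
next
 case (mult f g)
 then obtain C N D M where CD: "C >= 0" "D >= 0"
  "!!y. \<bar>f y\<bar> <= C * (weight y) ^ N" "!!y. \<bar>g y\<bar> <= D * (weight y) ^ M" by blast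
 have "\<bar>f y * g y\<bar> <= (C * D) * (weight y) ^ (N + M)" for y
 proof -
  have "\<bar>f y * g y\<bar> <= (C * (weight y) ^ N) * (D * (weight y) ^ M)"
   unfolding abs_mult using CD by (intro mult_mono) auto
  thus ?thesis by (simp add: power_add mult_ac)
 qed
 thus ?case using CD by (metis mult_nonneg_nonneg)
qed

text \<open>Sequences of functions that are \<open>1/(j+1)\<close> times a fixed polynomial times the Gaussian.\<close>

definition gaussian_small :: "(nat => real^'n::finite => real) => bool" where
 "gaussian_small w \<longleftrightarrow> (\<exists>C N. C >= 0 &
   (\<forall>j y. \<bar>w j y\<bar> <= inverse (real (Suc j)) * (C * (weight y) ^ N * gauss y)))"

lemma gaussian_small_zero: "gaussian_small (%_ _. 0)"
 unfolding gaussian_small_def by (intro exI[of _ 0]) simp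

lemma gaussian_small_add:
 assumes "gaussian_small v" "gaussian_small w"
 shows "gaussian_small (%j y. v j y + w j y)"
proof -
 let ?g = "%j (y :: real^'a). inverse (real (Suc j)) * gauss y"
 obtain C N D M where CD: "C >= 0" "D >= 0"
  "!!j y. \<bar>v j y\<bar> <= inverse (real (Suc j)) * (C * (weight y) ^ N * gauss y)"
  "!!j y. \<bar>w j y\<bar> <= inverse (real (Suc j)) * (D * (weight y) ^ M * gauss y)"
  using assms unfolding gaussian_small_def by blast
 have "\<bar>v j y + w j y\<bar> <= inverse (real (Suc j)) * ((C + D) * (weight y) ^ (max N M) * gauss y)" for j y
 proof -
  have "inverse (real (Suc j)) * (C * (weight y) ^ N * gauss y)
    <= inverse (real (Suc j)) * (C * (weight y) ^ (max N M) * gauss y)"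
   "inverse (real (Suc j)) * (D * (weight y) ^ M * gauss y)
    <= inverse (real (Suc j)) * (D * (weight y) ^ (max N M) * gauss y)"
   using CD(1,2) by (auto intro!: mult_left_mono mult_right_mono power_increasing)
  with CD(3,4)[of j y] show ?thesis unfolding distrib_right distrib_left by linarith
 qed
 thus ?thesis unfolding gaussian_small_def using CD(1,2) by (metis add_nonneg_nonneg)
qed

lemma gaussian_small_minus: "gaussian_small w ==> gaussian_small (%j y. - w j y)"
 by (simp add: gaussian_small_def)

lemma gaussian_small_sum: "(!!i. i \<in> I ==> gaussian_small (w i)) ==> gaussian_small (%j y. \<Sum>i\<in>I. w i j y)"
 by (induction I rule: infinite_finite_induct) (simp_all add: gaussian_small_zero gaussian_small_add)

lemma gaussian_small_mult:
 assumes a: "!!j y. \<bar>a j y\<bar> <= inverse (real (Suc j)) * (K * (weight y) ^ M)" and q: "real_polynomial_function q"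
 shows "gaussian_small (%j y. a j y * (gauss y * q y))"
proof -
 obtain C N where C: "C >= 0" "!!y. \<bar>q y\<bar> <= C * (weight y) ^ N" using polynomial_growth[OF q] by blast
 have K: "K >= 0" using order_trans[OF abs_ge_zero a[of 0 0]] by simp
 have "\<bar>a j y * (gauss y * q y)\<bar>
   <= inverse (real (Suc j)) * ((K * C) * (weight y) ^ (M + N) * gauss y)" for j y
 proof -
  have "\<bar>a j y * (gauss y * q y)\<bar> = \<bar>a j y\<bar> * (\<bar>q y\<bar> * gauss y)"
   by (simp add: abs_mult)
  also have "... <= (inverse (real (Suc j)) * (K * (weight y) ^ M)) * (C * (weight y) ^ N * gauss y)"
   using K by (intro mult_mono a mult_right_mono C(2)) auto
  also have "... = inverse (real (Suc j)) * ((K * C) * (weight y) ^ (M + N) * gauss y)"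
   by (simp only: power_add mult_ac)
  finally show ?thesis .
 qed
 thus ?thesis unfolding gaussian_small_def using K C(1) by (metis mult_nonneg_nonneg)
qed

lemma gaussian_small_sq_int:
 fixes w :: "nat => real^'n::finite => real"
 assumes "gaussian_small w"
 shows "(%j. sq_int (w j)) \<longlonglongrightarrow> 0"
proof -
 obtain C N where C: "C >= 0"
  "!!j y. \<bar>w j y\<bar> <= inverse (real (Suc j)) * (C * (weight y) ^ N * gauss y)"
  using assms unfolding gaussian_small_def by blast
 let ?h = "%y :: real^'n. (weight y) ^ N * gauss y"
 have hm: "(%y. ennreal ((?h y)\<^sup>2)) \<in> borel_measurable lborel"
  unfolding quadratic_norm by measurable
 define S where "S = sq_int ?h"
 have le: "sq_int (w j) <= ennreal ((inverse (real (Suc j)) * C)\<^sup>2) * S" for j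
 proof -
  have "(w j y)\<^sup>2 <= (inverse (real (Suc j)) * C)\<^sup>2 * (?h y)\<^sup>2" for y
  proof -
   have "\<bar>w j y\<bar> <= \<bar>inverse (real (Suc j)) * C * ?h y\<bar>" using C(2)[of j y] by (simp add: mult.assoc)
   thus ?thesis unfolding power_mult_distrib[symmetric] by (simp only: abs_le_square_iff)
  qed
  hence "sq_int (w j) <= (\<integral>\<^sup>+y. ennreal ((inverse (real (Suc j)) * C)\<^sup>2) * ennreal ((?h y)\<^sup>2) \<partial>lborel)"
   unfolding sq_int_def by (intro nn_integral_mono) (simp only: ennreal_mult''[symmetric] ennreal_leI zero_le_power2)
  also have "... = ennreal ((inverse (real (Suc j)) * C)\<^sup>2) * S"
   unfolding S_def sq_int_def by (rule nn_integral_cmult[OF hm])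
  finally show ?thesis .
 qed
 have "S < \<infinity>" unfolding S_def by (rule gaussian_moment)
 then obtain r where r: "S = ennreal r" "r >= 0" by (cases S) auto
 have "(%j. (inverse (real (Suc j)) * C)\<^sup>2 * r) \<longlonglongrightarrow> (0 * C)\<^sup>2 * r"
  by (intro tendsto_intros LIMSEQ_inverse_real_of_nat)
 hence "(%j. ennreal ((inverse (real (Suc j)) * C)\<^sup>2 * r)) \<longlonglongrightarrow> 0"
  using tendsto_ennrealI by fastforce
 hence lim: "(%j. ennreal ((inverse (real (Suc j)) * C)\<^sup>2) * S) \<longlonglongrightarrow> 0"
  unfolding r(1) using r(2) by (simp add: ennreal_mult)
 show ?thesis
  by (rule tendsto_sandwich[OF _ _ tendsto_const lim]) (simp, rule always_eventually, rule allI, rule le)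
qed

lemma gaussian_small_L2:
 assumes m: "!!j J. (%y. w j y J) \<in> borel_measurable lborel"
  and small: "!!J. length J = p ==> gaussian_small (%j y. w j y J)"
 shows "(%j. L2_norm2 p (w j)) \<longlonglongrightarrow> 0"
proof -
 have "(%j. \<Sum>J\<in>I. sq_int (%y. w j y J)) \<longlonglongrightarrow> 0" if "I \<subseteq> multi_indices p" for I
  using finite_subset[OF that finite_multi_indices] that
 proof (induction I rule: finite_induct)
  case (insert J I)
  thus ?case by (simp add: tendsto_add_zero gaussian_small_sq_int small)
 qed simp
 hence lim: "(%j. \<Sum>J\<in>multi_indices p. sq_int (%y. w j y J)) \<longlonglongrightarrow> 0" by blast
 show ?thesis
  by (rule tendsto_sandwich[OF _ _ tendsto_const lim]) (simp, rule always_eventually, rule allI, rule L2_norm2_le, rule m)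
qed

text \<open>Cut-off functions with support of radius \<open>sqrt (j + 1)\<close>. They are functions of \<open>\<bar>y\<bar>\<^sup>2 / (j + 1)\<close>, so that their
distance from \<open>1\<close> and their derivatives are \<open>1/(j+1)\<close> times a polynomial.\<close>

definition cutoff :: "nat => real^'n::finite => real" where
 "cutoff j y = exp 1 * flat_exp 0 (1 - inverse (real (Suc j)) * (\<Sum>k\<in>UNIV. (y $ k)\<^sup>2))"

lemma sum_sq_norm: "(\<Sum>k\<in>UNIV. (y $ k)\<^sup>2) = (norm (y :: real^'n::finite))\<^sup>2"
 unfolding power2_norm_eq_inner inner_vec_def by (intro sum.cong refl) (simp add: power2_eq_square)

lemma cutoff_test: "test_function (cutoff j)"
proof -
 have "smooth_on UNIV (cutoff j)"
  unfolding cutoff_def[abs_def] power2_eq_square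
  by (intro smooth_on_mult smooth_on_const smooth_on_flat_exp smooth_on_diff smooth_on_sum smooth_on_nth open_UNIV)
 moreover have "{y. cutoff j y ~= 0} \<subseteq> cball 0 (sqrt (real (Suc j)))"
 proof
  fix y :: "real^'n" assume "y \<in> {y. cutoff j y ~= 0}"
  hence "0 < 1 - inverse (real (Suc j)) * (norm y)\<^sup>2"
   by (auto simp: cutoff_def flat_exp_def sum_sq_norm split: if_splits)
  hence "(norm y)\<^sup>2 <= real (Suc j)" by (simp add: field_simps)
  thus "y \<in> cball 0 (sqrt (real (Suc j)))" by (simp add: real_le_rsqrt)
 qed
 hence "bounded {y. cutoff j y ~= 0}" by (rule bounded_subset[OF bounded_cball])
 ultimately show ?thesis by (simp add: test_function_def)
qed

text \<open>With \<open>t = \<bar>y\<bar>\<^sup>2 / (j + 1)\<close> and \<open>t < 1\<close> the cut-off function equals \<open>exp (1 - 1/(1 - t))\<close>, which is at least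
\<open>2 - 1/(1 - t)\<close>; for \<open>t > 1/2\<close> the bound is trivial.\<close>

lemma cutoff_near_one: "\<bar>cutoff j y - 1\<bar> <= inverse (real (Suc j)) * (2 * (weight y) ^ 1)"
proof -
 define t where "t = inverse (real (Suc j)) * (norm y)\<^sup>2"
 have t: "t >= 0" by (simp add: t_def)
 have c: "cutoff j y = exp 1 * flat_exp 0 (1 - t)" by (simp add: cutoff_def sum_sq_norm t_def)
 have "\<bar>cutoff j y - 1\<bar> <= 2 * t"
 proof (cases "t < 1")
  case True
  have "cutoff j y = exp (1 - inverse (1 - t))" using True by (simp add: c flat_exp_def exp_diff exp_minus divide_inverse)
  moreover have "inverse (1 - t) >= 1" using True t by (simp add: one_le_inverse_iff)
  ultimately have le1: "cutoff j y <= 1" and ge: "cutoff j y >= 2 - inverse (1 - t)" and ge0: "cutoff j y >= 0"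
   using exp_ge_add_one_self[of "1 - inverse (1 - t)"] by auto
  show ?thesis
  proof (cases "t <= 1/2")
   case half: True
   have "inverse (1 - t) - 1 <= 2 * t" using half True t mult_mono[of t "1/2" t t] by (simp add: field_simps)
   with le1 ge show ?thesis by simp
  qed (use le1 ge0 in simp)
 next
  case False
  thus ?thesis by (simp add: c flat_exp_def)
 qed
 also have "... <= inverse (real (Suc j)) * (2 * (weight y) ^ 1)" by (simp add: t_def distrib_left)
 finally show ?thesis .
qed

lemma flat_exp_le: "\<bar>flat_exp k x\<bar> <= fact k"
 using flat_exp_bound[of k x 0] by simp

context
 fixes j :: nat and y :: "real^'n::finite"
begin

private abbreviation "c \<equiv> inverse (real (Suc j))"
private abbreviation "r z \<equiv> 1 - c * (\<Sum>k\<in>UNIV. ((z :: real^'n) $ k)\<^sup>2)"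

private lemma r_smooth: "smooth_on UNIV r"
 unfolding power2_eq_square by (intro smooth_on_mult smooth_on_const smooth_on_diff smooth_on_sum smooth_on_nth open_UNIV)

private lemma partial_r: "partial b r z = - 2 * c * z $ b"
proof -
 have d: "(%z :: real^'n. (z $ k)\<^sup>2) differentiable (at z)" for k z
  unfolding power2_eq_square
  by (intro smooth_on_differentiable[OF _ UNIV_I] smooth_on_mult smooth_on_nth open_UNIV)
 have p: "partial b (%z :: real^'n. (z $ k)\<^sup>2) z = (if b = k then 2 * z $ k else 0)" for k
  unfolding power2_eq_square by (subst partial_mult) auto
 have "partial b r z = partial b (%_. 1) z - partial b (%z. c * (\<Sum>k\<in>UNIV. (z $ k)\<^sup>2)) z"
  by (rule partial_diff) (auto intro!: differentiable_mult differentiable_sum d)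
 also have "partial b (%z. c * (\<Sum>k\<in>UNIV. (z $ k)\<^sup>2)) z = c * partial b (%z. \<Sum>k\<in>UNIV. (z $ k)\<^sup>2) z"
  by (rule partial_cmult) (auto intro!: differentiable_sum d)
 also have "partial b (%z. \<Sum>k\<in>UNIV. (z $ k)\<^sup>2) z = 2 * z $ b"
  by (subst partial_sum[OF d]) (simp add: p)
 finally show ?thesis by simp
qed

private lemma partial_flat_r: "partial b (%z. flat_exp m (r z)) z
  = (- real m * flat_exp (m + 1) (r z) + flat_exp (m + 2) (r z)) * (- 2 * c * z $ b)"
 by (subst partial_chain_real(1)[OF smooth_on_differentiable[OF r_smooth UNIV_I] flat_exp_derivative])
   (simp only: partial_r)

private lemma partial_cutoff_eq: "partial b (cutoff j) = (%z. exp 1 * (flat_exp 2 (r z) * (- 2 * c * z $ b)))"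
proof
 fix z :: "real^'n"
 have "(%z. flat_exp 0 (r z)) differentiable (at z)"
  by (rule smooth_on_differentiable[OF smooth_on_flat_exp[OF open_UNIV r_smooth] UNIV_I])
 hence "partial b (cutoff j) z = exp 1 * partial b (%z. flat_exp 0 (r z)) z"
  unfolding cutoff_def[abs_def] by (rule partial_cmult)
 thus "partial b (cutoff j) z = exp 1 * (flat_exp 2 (r z) * (- 2 * c * z $ b))"
  unfolding partial_flat_r by (simp add: numeral_2_eq_2)
qed

private lemma comp_le: "\<bar>y $ b\<bar> <= 1 + (norm y)\<^sup>2"
proof -
 have "\<bar>y $ b\<bar> <= norm y" by (rule component_le_norm_cart)
 moreover have "0 <= (norm y - 1)\<^sup>2" by simp
 hence "2 * norm y <= (norm y)\<^sup>2 + 1" by (simp add: power2_diff)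
 ultimately show ?thesis using norm_ge_zero[of y] by linarith
qed

lemma partial_cutoff_bound: "\<bar>partial b (cutoff j) y\<bar> <= inverse (real (Suc j)) * ((4 * exp 1) * (weight y) ^ 1)"
proof -
 have "\<bar>partial b (cutoff j) y\<bar> = exp 1 * (\<bar>flat_exp 2 (r y)\<bar> * (2 * c * \<bar>y $ b\<bar>))"
  unfolding partial_cutoff_eq by (simp add: abs_mult)
 also have "... <= exp 1 * (2 * (2 * c * weight y))"
  using flat_exp_le[of 2 "r y"] comp_le[of b] by (intro mult_left_mono mult_mono) (auto simp: numeral_2_eq_2)
 also have "... = c * ((4 * exp 1) * (weight y) ^ 1)" by (simp only: power_one_right mult_ac)
 finally show ?thesis .
qed

text \<open>The constant is \<open>4 * 36 + 4\<close>, with \<open>36 = 2 * 3! + 4!\<close> bounding the derivative of \<open>flat_exp 2\<close>.\<close>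

lemma partial2_cutoff_bound:
 "\<bar>partial a (partial b (cutoff j)) y\<bar> <= inverse (real (Suc j)) * ((148 * exp 1) * (weight y) ^ 2)"
proof -
 have df: "(%z. flat_exp 2 (r z)) differentiable (at y)"
  by (rule smooth_on_differentiable[OF smooth_on_flat_exp[OF open_UNIV r_smooth] UNIV_I])
 have dl: "(%z :: real^'n. - 2 * c * z $ b) differentiable (at y)"
  by (rule smooth_on_differentiable[OF _ UNIV_I], intro smooth_on_mult smooth_on_const smooth_on_nth open_UNIV)
 have pl: "partial a (%z :: real^'n. - 2 * c * z $ b) y = - 2 * c * (if a = b then 1 else 0)"
  by (subst partial_cmult) auto
 let ?W = "1 + (norm y)\<^sup>2"
 have W: "1 <= ?W" by simp
 have c: "0 <= c" "c <= 1" by (auto simp: inverse_le_1_iff)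
 have "partial a (partial b (cutoff j)) y
   = exp 1 * (partial a (%z. flat_exp 2 (r z)) y * (- 2 * c * y $ b) + flat_exp 2 (r y) * (- 2 * c * (if a = b then 1 else 0)))"
  unfolding partial_cutoff_eq
  by (subst partial_cmult[OF differentiable_mult[OF df dl]]) (simp only: partial_mult[OF df dl] pl)
 also have "\<bar>\<dots>\<bar> <= exp 1 * (36 * (2 * c * ?W) * (2 * c * ?W) + 2 * (2 * c))"
 proof -
  have "\<bar>- real 2 * flat_exp (2 + 1) (r y) + flat_exp (2 + 2) (r y)\<bar> <= 2 * \<bar>flat_exp 3 (r y)\<bar> + \<bar>flat_exp 4 (r y)\<bar>" by simp
  also have "... <= 2 * fact 3 + fact 4" by (intro add_mono mult_left_mono flat_exp_le) auto
  also have "... = 36" by (simp add: fact_numeral)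
  finally have "\<bar>partial a (%z. flat_exp 2 (r z)) y\<bar> <= 36 * (2 * c * ?W)"
   unfolding partial_flat_r abs_mult using comp_le[of a] by (intro mult_mono) auto
  hence A: "\<bar>partial a (%z. flat_exp 2 (r z)) y * (- 2 * c * y $ b)\<bar> <= 36 * (2 * c * ?W) * (2 * c * ?W)"
   unfolding abs_mult[of _ "- 2 * c * y $ b"] using comp_le[of b] by (intro mult_mono) (auto simp: abs_mult)
  have B: "\<bar>flat_exp 2 (r y) * (- 2 * c * (if a = b then 1 else 0))\<bar> <= 2 * (2 * c)"
   unfolding abs_mult[of "flat_exp 2 (r y)"] using flat_exp_le[of 2 "r y"] c by (intro mult_mono) (auto simp: numeral_2_eq_2)
  show ?thesis unfolding abs_mult[of "exp 1"] abs_exp_cancel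
   by (rule mult_left_mono[OF order_trans[OF abs_triangle_ineq add_mono[OF A B]]]) simp
 qed
 also have "... <= exp 1 * (144 * (c * ?W\<^sup>2) + 4 * (c * ?W\<^sup>2))"
 proof (intro mult_left_mono add_mono)
  have "c * c * ?W\<^sup>2 <= c * ?W\<^sup>2" using c by (intro mult_right_mono) (auto simp: mult_left_le)
  moreover have "36 * (2 * c * w) * (2 * c * w) = 144 * (c * c * w\<^sup>2)" for w by (simp add: power2_eq_square)
  ultimately show "36 * (2 * c * ?W) * (2 * c * ?W) <= 144 * (c * ?W\<^sup>2)" by (simp only:)
  have "1 <= ?W\<^sup>2" using W by (simp add: one_le_power)
  thus "2 * (2 * c) <= 4 * (c * ?W\<^sup>2)" using c mult_left_mono[of 1 "?W\<^sup>2" c] by simp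
 qed simp
 also have "... = c * ((148 * exp 1) * ?W ^ 2)" by (simp add: algebra_simps)
 finally show ?thesis .
qed

end

lemma witten_mult:
 assumes "a differentiable (at y)" "w differentiable (at y)"
 shows "witten e k (%z. a z * w z) y = partial k a y * w y + a y * witten e k w y"
  and "witten_adj e k (%z. a z * w z) y = partial k a y * w y + a y * witten_adj e k w y"
 by (simp_all add: witten_def witten_adj_def partial_mult[OF assms] algebra_simps)

text \<open>Cut off \<open>u = exp (- F) P\<close>. The first-order operators annihilate \<open>u\<close>, so every term of the operator
applied to the product contains a derivative of the cut-off function.\<close>

theorem flat_killing_in_kernel:
 fixes P :: "'n::finite field"
 assumes P: "P \<in> flat_killing p"
 defines "u \<equiv> %y. gauss y *\<^sub>R P y"
 shows "u \<in> L2_fields p"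
  and "\<exists>s. (\<forall>j::nat. s j \<in> test_fields p) & (%j. L2_norm2 p (s j - u)) \<longlonglongrightarrow> 0 &
   (%j. L2_norm2 p (witten_laplacian (%_. 1) (s j))) \<longlonglongrightarrow> 0"
proof -
 let ?e = "%_ :: 'n. 1 :: real"
 let ?g = "%y :: real^'n. exp (- quadratic ?e y)"
 have poly: "real_polynomial_function (%y. P y J)" for J by (rule flat_killing_polynomial[OF P])
 have Psm: "smooth_on UNIV (%y. P y J)" and Psym: "P y \<in> sym_comps p" and PD: "flat_deriv P y = 0" "flat_div P y = 0" for y J
  using P unfolding flat_killing_def by auto
 have Pd: "(%y. P y J) differentiable (at y)" for J y by (rule smooth_on_differentiable[OF Psm UNIV_I])
 have uJ: "u y J = ?g y * P y J" for y J by (simp add: u_def scaleR_fun_def)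
 have gs: "smooth_on UNIV ?g" using smooth_exp_quadratic[of "-1" ?e] by simp
 have us: "smooth_on UNIV (%y. u y J)" for J unfolding uJ by (intro smooth_on_mult gs Psm open_UNIV)
 have um: "(%y. u y J) \<in> borel_measurable lborel" for J
  using borel_measurable_continuous_onI[OF smooth_on_continuous[OF us]] by simp
 have usym: "u y \<in> sym_comps p" for y
  unfolding u_def using subspace_sym_comps Psym by (rule subspace_scale)
 have ud: "(%y. u y J) differentiable (at y)" for J y by (rule smooth_on_differentiable[OF us UNIV_I])
 have udp: "partial k (%y. u y J) differentiable (at y)" for k J y
  by (rule smooth_on_differentiable[OF smooth_on_partial[OF us] UNIV_I])
 have fin: "sq_int (%y. u y J) < \<infinity>" for J
 proof -
  obtain C N where C: "C >= 0" "!!y. \<bar>P y J\<bar> <= C * (weight y) ^ N" using polynomial_growth[OF poly] by blast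
  let ?h = "%y :: real^'n. (weight y) ^ N * ?g y"
  have hm: "(%y. ennreal ((?h y)\<^sup>2)) \<in> borel_measurable lborel" unfolding quadratic_norm by measurable
  have "(u y J)\<^sup>2 <= C\<^sup>2 * (?h y)\<^sup>2" for y
  proof -
   have "\<bar>u y J\<bar> <= \<bar>C * ?h y\<bar>"
    using mult_right_mono[OF C(2)[of y], of "?g y"] C(1) by (simp add: uJ abs_mult mult_ac)
   thus ?thesis unfolding power_mult_distrib[symmetric] by (simp only: abs_le_square_iff)
  qed
  hence "sq_int (%y. u y J) <= (\<integral>\<^sup>+y. ennreal (C\<^sup>2) * ennreal ((?h y)\<^sup>2) \<partial>lborel)"
   unfolding sq_int_def by (intro nn_integral_mono) (simp only: ennreal_mult''[symmetric] ennreal_leI zero_le_power2)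
  also have "... = ennreal (C\<^sup>2) * sq_int ?h" unfolding sq_int_def by (rule nn_integral_cmult[OF hm])
  also have "... < \<infinity>" using gaussian_moment[where ?'n = 'n, of N] by (simp add: ennreal_mult_less_top)
  finally show ?thesis .
 qed
 have "L2_norm2 p u <= (\<Sum>J\<in>multi_indices p. sq_int (%y. u y J))" by (rule L2_norm2_le[OF um])
 also have "... < \<infinity>" using fin by (simp add: ennreal_sum_less_top)
 finally show "u \<in> L2_fields p" using usym um by (simp add: L2_fields_def)
 define s where "s j y = cutoff j y *\<^sub>R u y" for j y
 have sJ: "s j y J = cutoff j y * u y J" for j y J by (simp add: s_def scaleR_fun_def)
 have cs: "smooth_on UNIV (cutoff j :: real^'n => real)" for j by (rule test_function_smooth[OF cutoff_test])
 have cd: "(cutoff j :: real^'n => real) differentiable (at y)" for j y by (rule smooth_on_differentiable[OF cs UNIV_I])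
 have cdp: "partial k (cutoff j) differentiable (at y)" for k j and y :: "real^'n"
  by (rule smooth_on_differentiable[OF smooth_on_partial[OF cs] UNIV_I])
 have st: "s j \<in> test_fields p" for j
 proof -
  have "{y. s j y ~= 0} \<subseteq> {y. cutoff j y ~= 0}" by (auto simp: s_def)
  hence "bounded {y. s j y ~= 0}" using cutoff_test unfolding test_function_def by (metis bounded_subset)
  moreover have "s j y \<in> sym_comps p" for y unfolding s_def using subspace_sym_comps usym by (rule subspace_scale)
  ultimately show ?thesis using smooth_on_mult[OF open_UNIV cs us] by (simp add: test_fields_def sJ)
 qed
 have small_u: "gaussian_small (%j y. a j y * u y J)"
  if "!!j y. \<bar>a j y\<bar> <= inverse (real (Suc j)) * (K * (weight y) ^ M)" for a K M J
  unfolding uJ by (rule gaussian_small_mult[OF that poly])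
 have small_adj: "gaussian_small (%j y. a j y * witten_adj ?e k (%z. u z J) y)"
  if "!!j y. \<bar>a j y\<bar> <= inverse (real (Suc j)) * (K * (weight y) ^ M)" for a K M J k
 proof -
  have adj: "witten_adj ?e k (%z. u z J) y = ?g y * (partial k (%z. P z J) y - 2 * (y $ k * P y J))" for y
   unfolding uJ witten_adj_def[of _ _ "%z. ?g z * P z J"] partial_exp_quadratic(2)[OF Pd] witten_adj_def
   by (simp add: algebra_simps)
  have nth: "real_polynomial_function (%y :: real^'n. y $ k)"
   by (intro real_polynomial_function.intros(1) bounded_linear_vec_nth)
  have "real_polynomial_function (%y. partial k (%z. P z J) y + (-2) * (y $ k * P y J))"
   by (intro real_polynomial_function.intros polynomial_partial poly nth bounded_linear_vec_nth)
  hence "real_polynomial_function (%y. partial k (%z. P z J) y - 2 * (y $ k * P y J))" by simp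
  from gaussian_small_mult[OF that this] show ?thesis unfolding adj .
 qed
 have wu: "witten ?e k (%z. u z J) y = ?g y * partial k (%z. P z J) y" for k J y
  unfolding uJ by (rule partial_exp_quadratic(3)[OF Pd])
 have "witten_deriv ?e u y J = 0" for y J
  unfolding witten_deriv_def wu sum_distrib_left[symmetric] using PD(1)[of y] by (simp add: flat_deriv_def fun_eq_iff)
 have Ds: "witten_deriv ?e (s j) = (%y J. \<Sum>t<length J. partial (J ! t) (cutoff j) y * u y (omit t J))" for j
 proof (intro ext)
  fix y and J :: "'n list"
  have "witten_deriv ?e (s j) y J = (\<Sum>t<length J. partial (J ! t) (cutoff j) y * u y (omit t J)) + cutoff j y * witten_deriv ?e u y J"
   unfolding witten_deriv_def sJ witten_mult(1)[OF cd ud] sum.distrib sum_distrib_left by (rule refl)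
  thus "witten_deriv ?e (s j) y J = (\<Sum>t<length J. partial (J ! t) (cutoff j) y * u y (omit t J))"
   by (simp add: \<open>!!y J. witten_deriv ?e u y J = 0\<close>)
 qed
 have "witten_div ?e u y J = 0" for y J
  unfolding witten_div_def wu sum_distrib_left[symmetric] using PD(2)[of y] by (simp add: flat_div_def fun_eq_iff)
 have Vs: "witten_div ?e (s j) = (%y J. - (\<Sum>k\<in>UNIV. partial k (cutoff j) y * u y (k # J)))" for j
 proof (intro ext)
  fix y and J :: "'n list"
  have "witten_div ?e (s j) y J = - (\<Sum>k\<in>UNIV. partial k (cutoff j) y * u y (k # J)) + cutoff j y * witten_div ?e u y J"
   unfolding witten_div_def sJ witten_mult(1)[OF cd ud] sum.distrib by (simp add: sum_distrib_left)
  thus "witten_div ?e (s j) y J = - (\<Sum>k\<in>UNIV. partial k (cutoff j) y * u y (k # J))"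
   by (simp add: \<open>!!y J. witten_div ?e u y J = 0\<close>)
 qed
 have d: "(%z. partial b (cutoff j) z * u z I) differentiable (at y)" for b j I y
  by (intro differentiable_mult cdp ud)
 have ds: "(%z. \<Sum>k\<in>UNIV. partial k (cutoff j) z * u z (k # I)) differentiable (at y)" for j I y
  by (intro differentiable_sum) (auto intro: d)
 have Ls: "witten_laplacian ?e (s j) y J =
   - (\<Sum>k\<in>UNIV. \<Sum>t<length (k # J). partial k (partial ((k # J) ! t) (cutoff j)) y * u y (omit t (k # J))
    + partial ((k # J) ! t) (cutoff j) y * witten_adj ?e k (%z. u z (omit t (k # J))) y)
   + (\<Sum>t<length J. - (\<Sum>k\<in>UNIV. partial (J ! t) (partial k (cutoff j)) y * u y (k # omit t J)
    + partial k (cutoff j) y * witten_adj ?e (J ! t) (%z. u z (k # omit t J)) y))" for j y J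
  unfolding witten_laplacian_def Ds Vs
  by (simp only: witten_adj_sum[OF d finite_lessThan] witten_adj_sum[OF d finite] witten_adj_minus[OF ds]
    witten_mult(2)[OF cdp ud])
 have "(%j. L2_norm2 p (witten_laplacian ?e (s j))) \<longlonglongrightarrow> 0"
 proof (rule gaussian_small_L2)
  show "(%y. witten_laplacian ?e (s j) y J) \<in> borel_measurable lborel" for j J
   using test_function_measurable[OF test_function_witten_laplacian[OF st]] by simp
  show "gaussian_small (%j y. witten_laplacian ?e (s j) y J)" for J
   unfolding Ls
   by (intro gaussian_small_add gaussian_small_minus gaussian_small_sum
    small_u[OF partial2_cutoff_bound] small_adj[OF partial_cutoff_bound])
 qed
 moreover have "(%j. L2_norm2 p (s j - u)) \<longlonglongrightarrow> 0"
 proof (rule gaussian_small_L2)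
  have eq: "(s j - u) y J = (cutoff j y - 1) * u y J" for j y J by (simp add: sJ algebra_simps)
  show "(%y. (s j - u) y J) \<in> borel_measurable lborel" for j J
   unfolding eq using test_function_measurable[OF cutoff_test] um by measurable
  show "gaussian_small (%j y. (s j - u) y J)" for J
   unfolding eq by (rule small_u[OF cutoff_near_one])
 qed
 ultimately show "\<exists>s. (\<forall>j::nat. s j \<in> test_fields p) & (%j. L2_norm2 p (s j - u)) \<longlonglongrightarrow> 0 &
   (%j. L2_norm2 p (witten_laplacian ?e (s j))) \<longlonglongrightarrow> 0"
  using st by blast
qed

section \<open>Relabelling the coordinates\<close>

text \<open>Relabelling is linear and permutes the coordinate lines, so it commutes with partial derivatives by
the very definition of these.\<close>

lemma relabel_line:
 fixes \<pi> :: "'n::finite => 'k::finite"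
 assumes "bij \<pi>"
 shows "(\<chi> i. (y + t *\<^sub>R axis k 1) $ \<pi> i) = (\<chi> i. y $ \<pi> i) + t *\<^sub>R (axis (inv \<pi> k) 1 :: real^'n)"
 using assms by (auto simp: vec_eq_iff axis_def bij_is_inj inv_f_f bij_is_surj surj_f_inv_f)

lemma relabel_partial:
 fixes \<pi> :: "'n::finite => 'k::finite"
 assumes "bij \<pi>"
 shows "partial k (%y. F (\<chi> i. y $ \<pi> i)) y = partial (inv \<pi> k) F (\<chi> i. y $ \<pi> i)"
 unfolding partial_def relabel_line[OF assms] by (rule refl)

lemma relabel_differentiable:
 fixes \<pi> :: "'n::finite => 'k::finite" and F :: "real^'n => real"
 assumes "F differentiable (at (\<chi> i. y $ \<pi> i))"
 shows "(%y. F (\<chi> i. y $ \<pi> i)) differentiable (at y)"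
 by (rule partial_chain_vec(2)[where \<phi> = "%y. \<chi> i. y $ \<pi> i"]) (use assms in \<open>simp_all add: bounded_linear_imp_differentiable bounded_linear_vec_nth\<close>)

lemma relabel_smooth:
 fixes \<pi> :: "'n::finite => 'k::finite"
 assumes \<pi>: "bij \<pi>" and F: "smooth_on UNIV F"
 shows "smooth_on UNIV (%y. F (\<chi> i. y $ \<pi> i))"
proof (rule smooth_on_coinduct[OF open_UNIV, where R = "%u. \<exists>F. smooth_on UNIV F & u = (%y. F (\<chi> i. y $ \<pi> i))"])
 fix u :: "real^'k => real" and y k
 assume "\<exists>F. smooth_on UNIV F & u = (%y. F (\<chi> i. y $ \<pi> i))"
 then obtain F where F: "smooth_on UNIV F" and u: "u = (%y. F (\<chi> i. y $ \<pi> i))" by blast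
 show "u differentiable (at y)"
  unfolding u by (rule relabel_differentiable[OF smooth_on_differentiable[OF F UNIV_I]])
 show "\<exists>w. (\<exists>F. smooth_on UNIV F & w = (%y. F (\<chi> i. y $ \<pi> i))) & (\<forall>y\<in>UNIV. partial k u y = w y)"
  by (rule exI[of _ "%y. partial (inv \<pi> k) F (\<chi> i. y $ \<pi> i)"])
    (use smooth_on_partial[OF F] in \<open>auto simp: u relabel_partial[OF \<pi>]\<close>)
qed (use F in blast)

text \<open>The dimension depends on the index type only through its cardinality: a bijection of the index types
transports the tensors.\<close>

lemma dim_flat_killing_le:
 assumes card: "CARD('n::finite) = CARD('k::finite)"
 shows "dim (flat_killing p :: 'n field set) <= dim (flat_killing p :: 'k field set)"
proof -
 obtain \<pi> :: "'n => 'k" where \<pi>: "bij \<pi>"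
  using finite_same_card_bij[of "UNIV :: 'n set" "UNIV :: 'k set"] card by auto
 let ?\<sigma> = "inv \<pi>"
 define T :: "'n field => 'k field" where "T P = (%y J. P (\<chi> i. y $ \<pi> i) (map ?\<sigma> J))" for P
 have T_mem: "T P \<in> flat_killing p" if P: "P \<in> flat_killing p" for P
 proof -
  have sm: "smooth_on UNIV (%y. P y J)" and sym: "P y \<in> sym_comps p" and D: "flat_deriv P y = 0" "flat_div P y = 0" for y J
   using P unfolding flat_killing_def by auto
  have "T P y \<in> sym_comps p" for y
  proof (rule sym_compsI)
   fix J :: "'k list" assume "length J ~= p"
   thus "T P y J = 0" unfolding T_def by (intro sym_comps_off[OF sym]) simp
  next
   fix I J :: "'k list" assume "mset I = mset J"
   thus "T P y I = T P y J" unfolding T_def by (intro sym_comps_sym[OF sym]) simp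
  qed
  moreover have "smooth_on UNIV (%y. T P y J)" for J unfolding T_def by (rule relabel_smooth[OF \<pi> sm])
  moreover have "flat_deriv (T P) y = 0" for y
  proof
   fix J
   have "flat_deriv (T P) y J = flat_deriv P (\<chi> i. y $ \<pi> i) (map ?\<sigma> J)"
    unfolding flat_deriv_def T_def relabel_partial[OF \<pi>, of _ "%z. P z _"] by (simp add: take_map drop_map)
   thus "flat_deriv (T P) y J = 0 J" by (simp add: D)
  qed
  moreover have "flat_div (T P) y = 0" for y
  proof
   fix J
   have "flat_div (T P) y J = - (\<Sum>k\<in>UNIV. partial (?\<sigma> k) (%z. P z (?\<sigma> k # map ?\<sigma> J)) (\<chi> i. y $ \<pi> i))"
    unfolding flat_div_def T_def relabel_partial[OF \<pi>, of _ "%z. P z _"] by simp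
   also have "... = flat_div P (\<chi> i. y $ \<pi> i) (map ?\<sigma> J)"
    unfolding flat_div_def
    by (subst sum.reindex_bij_betw[OF bij_imp_bij_inv[OF \<pi>], of "%k. partial k (%z. P z (k # map ?\<sigma> J)) (\<chi> i. y $ \<pi> i)"]) simp
   finally show "flat_div (T P) y J = 0 J" by (simp add: D)
  qed
  ultimately show ?thesis by (simp add: flat_killing_def)
 qed
 have T_lin: "linear T" by (rule linearI) (auto simp: T_def fun_eq_iff scaleR_fun_def)
 have T_inj: "P = 0" if "T P = 0" for P
 proof (intro ext)
  fix y :: "real^'n" and J :: "'n list"
  have "T P (\<chi> k. y $ ?\<sigma> k) (map \<pi> J) = 0" by (simp add: that)
  moreover have "(\<chi> i. (\<chi> k. y $ ?\<sigma> k) $ \<pi> i) = y" "map ?\<sigma> (map \<pi> J) = J"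
   using \<pi> by (auto simp: vec_eq_iff inv_f_f bij_is_inj o_def)
  ultimately show "P y J = 0 y J" by (simp add: T_def)
 qed
 obtain B where B: "finite B" "independent B" "span B = (flat_killing p :: 'n field set)"
  using flat_killing_finite_dim by blast
 obtain B' where B': "finite B'" "independent B'" "span B' = (flat_killing p :: 'k field set)"
  using flat_killing_finite_dim by blast
 have inj: "inj T" using T_inj linear_injective_0[OF T_lin] by blast
 have "independent (T ` B)"
  using linear_independent_injective_image[OF T_lin B(2)] inj_on_subset[OF inj] by blast
 moreover have "T ` B \<subseteq> span B'" using T_mem B(3) B'(3) span_superset[of B] by blast
 ultimately have "card (T ` B) <= card B'" using independent_span_bound[OF B'(1)] by blast
 moreover have "card (T ` B) = card B" by (rule card_image[OF inj_on_subset[OF inj]]) simp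
 moreover have "dim (flat_killing p :: 'n field set) = card B"
  using dim_span_eq_card_independent[OF B(2)] B(3) by simp
 moreover have "dim (flat_killing p :: 'k field set) = card B'"
  using dim_span_eq_card_independent[OF B'(2)] B'(3) by simp
 ultimately show ?thesis by simp
qed

section \<open>Degree\<close>

text \<open>The restriction of a flat Killing tensor to a line through the origin is a polynomial of degree at most \<open>p\<close>.\<close>

definition degree_le :: "nat => (real => real) => bool" where
 "degree_le m g \<longleftrightarrow> (\<exists>a. \<forall>t. g t = (\<Sum>i\<le>m. a i * t ^ i))"

lemma degree_le_add: "degree_le m f ==> degree_le m g ==> degree_le m (%t. f t + g t)"
 unfolding degree_le_def
proof safe
 fix a b assume "\<forall>t. f t = (\<Sum>i\<le>m. a i * t ^ i)" "\<forall>t. g t = (\<Sum>i\<le>m. b i * t ^ i)"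
 thus "\<exists>c. \<forall>t. f t + g t = (\<Sum>i\<le>m. c i * t ^ i)"
  by (intro exI[of _ "%i. a i + b i"]) (simp add: distrib_right sum.distrib)
qed

lemma degree_le_cmult: "degree_le m f ==> degree_le m (%t. c * f t)"
 unfolding degree_le_def
proof safe
 fix a assume "\<forall>t. f t = (\<Sum>i\<le>m. a i * t ^ i)"
 thus "\<exists>b. \<forall>t. c * f t = (\<Sum>i\<le>m. b i * t ^ i)"
  by (intro exI[of _ "%i. c * a i"]) (simp add: sum_distrib_left mult.assoc)
qed

lemma degree_le_zero: "degree_le m (%_. 0)"
 unfolding degree_le_def by (intro exI[of _ "%_. 0"]) simp

lemma degree_le_sum: "(!!i. i \<in> I ==> degree_le m (f i)) ==> degree_le m (%t. \<Sum>i\<in>I. f i t)"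
 by (induction I rule: infinite_finite_induct) (simp_all add: degree_le_zero degree_le_add)

lemma degree_le_affine_mult: "degree_le m f ==> degree_le (Suc m) (%t. (t * b - c) * f t)"
 unfolding degree_le_def
proof safe
 fix a assume f: "\<forall>t. f t = (\<Sum>i\<le>m. a i * t ^ i)"
 define a' where "a' i = (if i = 0 then 0 else b * a (i - 1)) - (if i <= m then c * a i else 0)" for i
 have "(t * b - c) * f t = (\<Sum>i\<le>Suc m. a' i * t ^ i)" for t
 proof -
  have "(\<Sum>i\<le>Suc m. a' i * t ^ i) = (\<Sum>i\<le>Suc m. (if i = 0 then 0 else b * a (i - 1)) * t ^ i)
    - (\<Sum>i\<le>Suc m. (if i <= m then c * a i else 0) * t ^ i)"
   unfolding a'_def left_diff_distrib sum_subtractf by (rule refl)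
  also have "(\<Sum>i\<le>Suc m. (if i = 0 then 0 else b * a (i - 1)) * t ^ i) = t * b * f t"
   unfolding sum.atMost_Suc_shift by (simp add: f sum_distrib_left mult_ac)
  also have "(\<Sum>i\<le>Suc m. (if i <= m then c * a i else 0) * t ^ i) = c * f t"
   by (simp add: f sum_distrib_left mult_ac)
  finally show ?thesis by (simp add: left_diff_distrib)
 qed
 thus "\<exists>a. \<forall>t. (t * b - c) * f t = (\<Sum>i\<le>Suc m. a i * t ^ i)" by blast
qed

lemma flat_killing_degree:
 assumes P: "P \<in> flat_killing p"
 shows "degree_le p (%t. P (t *\<^sub>R x) J)"
proof -
 have 1: "degree_le q (%t. diag q T (t *\<^sub>R x - w) L)" for q T w L
 proof (induction q arbitrary: L)
  case 0
  show ?case unfolding degree_le_def by (intro exI[of _ "%_. T L"]) simp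
 next
  case (Suc q)
  have "degree_le (Suc q) (%t. \<Sum>k\<in>UNIV. (t * x $ k - w $ k) * diag q T (t *\<^sub>R x - w) (k # L))"
   by (intro degree_le_sum degree_le_affine_mult Suc.IH)
  thus ?case by simp
 qed
 have 2: "degree_le p (%t. fdiff c K (G t) z)" if "!!w. degree_le p (%t. G t w)" for c K G and z :: "real^'n"
 proof (induction K arbitrary: z)
  case (Cons k K)
  from degree_le_add[OF Cons degree_le_cmult[OF Cons, of "-1"]] show ?case by simp
 qed (simp add: that)
 show ?thesis
 proof (cases "length J = p")
  case True
  have "P (t *\<^sub>R x) J = interpolant p 1 0 P (t *\<^sub>R x) J" for t
   using flat_killing_interpolant[OF P, of 1 0] by simp
  hence "(%t. P (t *\<^sub>R x) J) = (%t. 1 / fact p * fdiff 1 J (%w. diag p (P w) (t *\<^sub>R x - w) []) 0)"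
   using True by (simp add: interpolant_def)
  thus ?thesis by (simp only: degree_le_cmult[OF 2[OF 1]])
 next
  case False
  hence "P y J = 0" for y using P sym_comps_off unfolding flat_killing_def by blast
  thus ?thesis by (simp add: degree_le_zero)
 qed
qed

text \<open>Restrict to a line through the origin, where the tensor is a polynomial of degree at most two whose
coefficients are read off from its derivatives at \<open>0\<close>.\<close>

lemma flat_killing_jet_zero:
 assumes P: "P \<in> flat_killing p" and p: "p <= 2"
  and j0: "P 0 J = 0" and j1: "!!k. partial k (%y. P y J) 0 = 0"
  and j2: "p = 1 \<or> (\<forall>k l. partial l (partial k (%y. P y J)) 0 = 0)"
 shows "P x J = 0"
proof -
 have sm: "smooth_on UNIV (%y. P y J)" using P unfolding flat_killing_def by auto
 let ?f = "%y. P y J"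
 define g where "g t = ?f (t *\<^sub>R x)" for t
 define g1 where "g1 t = (\<Sum>k\<in>UNIV. x $ k * partial k ?f (t *\<^sub>R x))" for t
 obtain a where a: "!!t. g t = (\<Sum>i\<le>p. a i * t ^ i)"
  using flat_killing_degree[OF P, of x J] unfolding degree_le_def g_def by blast
 have line: "((%t. u (t *\<^sub>R x)) has_real_derivative (\<Sum>k\<in>UNIV. x $ k * partial k u (t *\<^sub>R x))) (at t)"
  if "smooth_on UNIV u" for u t
  using has_derivative_ray[of u 0 t x UNIV] smooth_on_differentiable[OF that] by simp
 have g1: "(g has_real_derivative g1 t) (at t)" for t unfolding g_def[abs_def] g1_def by (rule line[OF sm])
 have g2: "(g1 has_real_derivative (\<Sum>k\<in>UNIV. x $ k * (\<Sum>l\<in>UNIV. x $ l * partial l (partial k ?f) (t *\<^sub>R x)))) (at t)" for t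
  unfolding g1_def[abs_def] by (intro DERIV_sum DERIV_cmult line smooth_on_partial sm open_UNIV)
 define c where "c i = (if i <= p then a i else 0)" for i
 have gc: "g = (%t. c 0 + c 1 * t + c 2 * t\<^sup>2)"
 proof
  fix t
  have "g t = (\<Sum>i\<le>2. c i * t ^ i)" unfolding a
   by (rule sum.mono_neutral_cong_left) (use p in \<open>auto simp: c_def\<close>)
  thus "g t = c 0 + c 1 * t + c 2 * t\<^sup>2" by (simp add: numeral_2_eq_2)
 qed
 have "(g has_real_derivative c 1 + 2 * c 2 * t) (at t)" for t
  unfolding gc by (auto intro!: derivative_eq_intros)
 hence g1c: "g1 = (%t. c 1 + 2 * c 2 * t)" using DERIV_unique[OF g1] by blast
 have "(g1 has_real_derivative 2 * c 2) (at 0)" unfolding g1c by (auto intro!: derivative_eq_intros)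
 from DERIV_unique[OF g2 this] have c2: "(\<Sum>k\<in>UNIV. x $ k * (\<Sum>l\<in>UNIV. x $ l * partial l (partial k ?f) 0)) = 2 * c 2" by simp
 have "c 2 = 0"
 proof (cases "p = 1")
  case False
  thus ?thesis using j2 c2 by simp
 qed (simp add: c_def)
 moreover have "c 1 = 0" using fun_cong[OF g1c, of 0] j1 by (simp add: g1_def)
 moreover have "c 0 = 0" using fun_cong[OF gc, of 0] j0 by (simp add: g_def)
 ultimately have "g 1 = 0" by (simp add: gc)
 thus ?thesis by (simp add: g_def)
qed

section \<open>Dimensions of tensor spaces\<close>

lemma function_space_finite_dim: "\<exists>A. finite A & (V :: ('x::finite => real) set) \<subseteq> span A"
proof (intro exI conjI subsetI)
 show "finite ((%s x. if x = s then 1 else 0) ` UNIV :: ('x => real) set)" by simp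
 show "f \<in> span ((%s x. if x = s then 1 else 0) ` UNIV)" for f :: "'x => real"
  by (rule finite_support_in_span) auto
qed

lemma dim_function_image:
 fixes f :: "('x::finite => real) => 'w::real_vector"
 assumes "linear f" "subspace V"
 shows "dim V = dim (f ` V) + dim {x \<in> V. f x = 0}"
 using function_space_finite_dim[of V] dim_kernel_image[OF assms] by blast

text \<open>The indicator functions of the fibres form a basis.\<close>

lemma dim_invariant_functions:
 fixes q :: "'x::finite => 'y"
 shows "dim {F :: 'x => real. \<forall>x y. q x = q y --> F x = F y} = card (range q)"
proof (rule dim_unique)
 let ?e = "%c x. if q x = c then (1 :: real) else 0"
 let ?B = "?e ` range q"
 have inj: "inj_on ?e (range q)"
  by (rule inj_onI) (auto simp: fun_eq_iff split: if_splits)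
 show "?B \<subseteq> {F. \<forall>x y. q x = q y --> F x = F y}" by auto
 show "card ?B = card (range q)" by (rule card_image[OF inj])
 show "{F. \<forall>x y. q x = q y --> F x = F y} \<subseteq> span ?B"
 proof
  fix F :: "'x => real" assume "F \<in> {F. \<forall>x y. q x = q y --> F x = F y}"
  moreover have "q (inv q (q x)) = q x" for x by (simp add: f_inv_into_f)
  ultimately have F: "F (inv q (q x)) = F x" for x by blast
  have "F = (\<Sum>c\<in>range q. F (inv q c) *\<^sub>R ?e c)"
  proof
   fix x
   have "(\<Sum>c\<in>range q. F (inv q c) *\<^sub>R ?e c) x = (\<Sum>c\<in>range q. if q x = c then F (inv q c) else 0)"
    unfolding sum_fun_apply by (intro sum.cong refl) (simp add: scaleR_fun_def)
   thus "F x = (\<Sum>c\<in>range q. F (inv q c) *\<^sub>R ?e c) x" using F by (simp add: sum.delta')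
  qed
  also have "... \<in> span ?B" by (intro span_sum span_scale span_base) auto
  finally show "F \<in> span ?B" .
 qed
 show "independent ?B"
  unfolding independent_explicit_module
 proof (intro allI impI)
  fix t u v assume t: "finite t" "t \<subseteq> ?B" "(\<Sum>v\<in>t. u v *\<^sub>R v) = 0" and v: "v \<in> t"
  from t v obtain x where x: "v = ?e (q x)" by auto
  have "u w *\<^sub>R w x = (if w = v then u v else 0)" if "w \<in> t" for w
  proof -
   from that t obtain y where y: "w = ?e (q y)" by auto
   have "w = v \<longleftrightarrow> q y = q x" unfolding x y by (auto simp: fun_eq_iff split: if_splits)
   thus ?thesis unfolding y by auto
  qed
  hence "(\<Sum>w\<in>t. u w *\<^sub>R w) x = (\<Sum>w\<in>t. if w = v then u v else 0)"
   unfolding sum_fun_apply by (intro sum.cong refl) (simp add: scaleR_fun_def)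
  thus "u v = 0" using t v by simp
 qed
qed

lemma dim_eq_card_classes:
 fixes q :: "'x::finite => 'y" and V :: "('x => real) set"
 assumes "!!F x y. F \<in> V ==> q x = q y ==> F x = F y" "!!F. (!!x y. q x = q y ==> F x = F y) ==> F \<in> V"
  and "range q = Q"
 shows "dim V = card Q"
proof -
 have "V = {F. \<forall>x y. q x = q y --> F x = F y}" using assms(1,2) by blast
 thus ?thesis using dim_invariant_functions[of q] assms(3) by simp
qed

lemma card_multisets: "card {M :: 'n::finite multiset. size M = m} = (CARD('n) + m - 1) choose m"
 using card_multisets_of_size[of "UNIV :: 'n set" m] by (simp add: multisets_of_size_def)

lemma range_multiset2: "range (%x. {#fst x, snd x :: 'n#}) = {M. size M = 2}"
proof -
 have "\<exists>x. M = {#fst x, snd x#}" if M: "size M = 2" for M :: "'n multiset"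
 proof -
  obtain i N where N: "M = add_mset i N" using M size_eq_Suc_imp_eq_union[of M 1] by auto
  hence "size N = 1" using M by simp
  then obtain j where "N = {#j#}" using size_1_singleton_mset by blast
  thus ?thesis using N by (intro exI[of _ "(i, j)"]) simp
 qed
 thus ?thesis by (auto simp: image_iff)
qed

lemma range_multiset3: "range (%x. {#fst x, fst (snd x), snd (snd x) :: 'n#}) = {M. size M = 3}"
proof -
 have "\<exists>x. M = {#fst x, fst (snd x), snd (snd x)#}" if M: "size M = 3" for M :: "'n multiset"
 proof -
  obtain i N where N: "M = add_mset i N" using M size_eq_Suc_imp_eq_union[of M 2] by auto
  hence "size N = 2" using M by simp
  hence "N \<in> range (%x. {#fst x, snd x#})" by (simp add: range_multiset2)
  then obtain x where "N = {#fst x, snd x#}" by blast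
  thus ?thesis using N by (intro exI[of _ "(i, x)"]) simp
 qed
 thus ?thesis by (auto simp: image_iff)
qed

type_synonym 'n tensor2 = "'n \<times> 'n => real"
type_synonym 'n tensor3 = "'n \<times> 'n \<times> 'n => real"
type_synonym 'n tensor4 = "'n \<times> 'n \<times> 'n \<times> 'n => real"

text \<open>Components of tensors as functions on tuples: \<open>sym21\<close> stands for \<open>S\<^sup>2 \<otimes> V\<close>, with symmetry in the first
two slots, \<open>sym22\<close> for \<open>S\<^sup>2 \<otimes> S\<^sup>2\<close> and \<open>sym31\<close> for \<open>S\<^sup>3 \<otimes> V\<close>.\<close>

abbreviation sym2 :: "('n::finite) tensor2 set" where
 "sym2 \<equiv> {a. \<forall>i j. a (i, j) = a (j, i)}"

abbreviation sym3 :: "('n::finite) tensor3 set" where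
 "sym3 \<equiv> {a. \<forall>i j k. a (i, j, k) = a (j, i, k) & a (i, j, k) = a (i, k, j)}"

abbreviation sym21 :: "('n::finite) tensor3 set" where
 "sym21 \<equiv> {b. \<forall>i j k. b (i, j, k) = b (j, i, k)}"

abbreviation sym22 :: "('n::finite) tensor4 set" where
 "sym22 \<equiv> {c. \<forall>i j k l. c (i, j, k, l) = c (j, i, k, l) & c (i, j, k, l) = c (i, j, l, k)}"

abbreviation sym31 :: "('n::finite) tensor4 set" where
 "sym31 \<equiv> {c. \<forall>i j k l. c (i, j, k, l) = c (j, i, k, l) & c (i, j, k, l) = c (i, k, j, l)}"

lemma multiset2_eq: "{#a, b#} = {#c, d#} \<longleftrightarrow> a = c & b = d \<or> a = d & b = c"
 by (auto simp: add_eq_conv_ex)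

lemma symmetric_of_multiset3:
 assumes swap: "!!i j k. h i j k = h j i k" "!!i j k. h i j k = h i k j" and eq: "{#a, b, c#} = {#a', b', c'#}"
 shows "h a b c = h a' b' c'"
proof -
 consider "a = a'" "{#b, c#} = {#b', c'#}" | M where "{#b, c#} = add_mset a' M" "{#b', c'#} = add_mset a M"
  using eq unfolding add_eq_conv_ex[of a "{#b, c#}"] by blast
 thus ?thesis
 proof cases
  case 1
  thus ?thesis unfolding multiset2_eq using swap by metis
 next
  case 2
  hence "size M = 1" by (metis One_nat_def add_left_cancel plus_1_eq_Suc size_add_mset size_single)
  then obtain x where "M = {#x#}" using size_1_singleton_mset by blast
  with 2 have "b = a' & c = x \<or> b = x & c = a'" "b' = a & c' = x \<or> b' = x & c' = a"
   by (simp_all add: multiset2_eq)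
  thus ?thesis using swap by metis
 qed
qed

lemma range_pair_map:
 assumes "!!z. \<phi> (\<psi> z) = z"
 shows "range (%x. (f (fst (\<phi> x)), g (snd (\<phi> x)))) = range f \<times> range g"
proof (intro set_eqI iffI)
 fix z assume "z \<in> range f \<times> range g"
 then obtain a b where "z = (f a, g b)" by auto
 thus "z \<in> range (%x. (f (fst (\<phi> x)), g (snd (\<phi> x))))" using assms[of "(a, b)"] by (intro image_eqI[of _ _ "\<psi> (a, b)"]) auto
qed auto

text \<open>A tensor with prescribed symmetries is a function of the corresponding multisets of indices.\<close>

lemma dim_sym:
 shows "dim (sym2 :: ('n::finite) tensor2 set) = (CARD('n) + 1) choose 2"
  and "dim (sym3 :: 'n tensor3 set) = (CARD('n) + 2) choose 3"
  and "dim (sym21 :: 'n tensor3 set) = ((CARD('n) + 1) choose 2) * CARD('n)"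
  and "dim (sym22 :: 'n tensor4 set) = ((CARD('n) + 1) choose 2) * ((CARD('n) + 1) choose 2)"
  and "dim (sym31 :: 'n tensor4 set) = ((CARD('n) + 2) choose 3) * CARD('n)"
proof -
 let ?q2 = "%x :: 'n \<times> 'n. {#fst x, snd x#}"
 let ?q3 = "%x :: 'n \<times> 'n \<times> 'n. {#fst x, fst (snd x), snd (snd x)#}"
 let ?q21 = "%x :: 'n \<times> 'n \<times> 'n. ({#fst x, fst (snd x)#}, snd (snd x))"
 let ?q22 = "%x :: 'n \<times> 'n \<times> 'n \<times> 'n. ({#fst x, fst (snd x)#}, {#fst (snd (snd x)), snd (snd (snd x))#})"
 let ?q31 = "%x :: 'n \<times> 'n \<times> 'n \<times> 'n. ({#fst x, fst (snd x), fst (snd (snd x))#}, snd (snd (snd x)))"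
 have c2: "card {M :: 'n multiset. size M = 2} = (CARD('n) + 1) choose 2"
  and c3: "card {M :: 'n multiset. size M = 3} = (CARD('n) + 2) choose 3"
  unfolding card_multisets by (simp_all add: numeral_2_eq_2 numeral_3_eq_3)
 show "dim (sym2 :: 'n tensor2 set) = (CARD('n) + 1) choose 2"
  unfolding c2[symmetric] c3[symmetric] card_cartesian_product[symmetric]
 proof (rule dim_eq_card_classes[of _ ?q2])
  fix F :: "'n \<times> 'n => real" and x y assume F: "F \<in> sym2" and eq: "?q2 x = ?q2 y"
  show "F x = F y"
   using F eq by (cases x; cases y) (simp only: fst_conv snd_conv prod.inject multiset2_eq mem_Collect_eq, metis)
 next
  fix F :: "'n \<times> 'n => real" assume *: "!!x y. ?q2 x = ?q2 y ==> F x = F y"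
  show "F \<in> sym2" by (intro CollectI allI conjI *) (simp_all add: add_mset_commute)
 next
  show "range ?q2 = {M. size M = 2}" by (rule range_multiset2)
 qed
 show "dim (sym3 :: 'n tensor3 set) = (CARD('n) + 2) choose 3"
  unfolding c2[symmetric] c3[symmetric] card_cartesian_product[symmetric]
 proof (rule dim_eq_card_classes[of _ ?q3])
  fix F :: "'n \<times> 'n \<times> 'n => real" and x y assume F: "F \<in> sym3" and eq: "?q3 x = ?q3 y"
  show "F x = F y"
   using symmetric_of_multiset3[of "%i j k. F (i, j, k)" "fst x" "fst (snd x)" "snd (snd x)" "fst y" "fst (snd y)" "snd (snd y)"] F eq by simp
 next
  fix F :: "'n \<times> 'n \<times> 'n => real" assume *: "!!x y. ?q3 x = ?q3 y ==> F x = F y"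
  show "F \<in> sym3" by (intro CollectI allI conjI *) (simp_all add: add_mset_commute)
 next
  show "range ?q3 = {M. size M = 3}" by (rule range_multiset3)
 qed
 show "dim (sym21 :: 'n tensor3 set) = ((CARD('n) + 1) choose 2) * CARD('n)"
  unfolding c2[symmetric] c3[symmetric] card_cartesian_product[symmetric]
 proof (rule dim_eq_card_classes[of _ ?q21])
  fix F :: "'n \<times> 'n \<times> 'n => real" and x y assume F: "F \<in> sym21" and eq: "?q21 x = ?q21 y"
  show "F x = F y"
   using F eq by (cases x; cases y) (simp only: fst_conv snd_conv prod.inject multiset2_eq mem_Collect_eq, metis)
 next
  fix F :: "'n \<times> 'n \<times> 'n => real" assume *: "!!x y. ?q21 x = ?q21 y ==> F x = F y"
  show "F \<in> sym21" by (intro CollectI allI conjI *) (simp_all add: add_mset_commute)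
 next
  have "range ?q21 = range ?q2 \<times> range (%k. k)"
   using range_pair_map[of "%x. ((fst x, fst (snd x)), snd (snd x))" "%z. (fst (fst z), snd (fst z), snd z)" ?q2 "%k. k"] by simp
  thus "range ?q21 = {M. size M = 2} \<times> UNIV" unfolding range_multiset2 range_multiset3 by simp
 qed
 show "dim (sym22 :: 'n tensor4 set) = ((CARD('n) + 1) choose 2) * ((CARD('n) + 1) choose 2)"
  unfolding c2[symmetric] c3[symmetric] card_cartesian_product[symmetric]
 proof (rule dim_eq_card_classes[of _ ?q22])
  fix F :: "'n \<times> 'n \<times> 'n \<times> 'n => real" and x y assume F: "F \<in> sym22" and eq: "?q22 x = ?q22 y"
  show "F x = F y"
   using F eq by (cases x; cases y) (simp only: fst_conv snd_conv prod.inject multiset2_eq mem_Collect_eq, metis)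
 next
  fix F :: "'n \<times> 'n \<times> 'n \<times> 'n => real" assume *: "!!x y. ?q22 x = ?q22 y ==> F x = F y"
  show "F \<in> sym22" by (intro CollectI allI conjI *) (simp_all add: add_mset_commute)
 next
  have "range ?q22 = range ?q2 \<times> range ?q2"
   using range_pair_map[of "%x. ((fst x, fst (snd x)), snd (snd x))" "%z. (fst (fst z), snd (fst z), snd z)" ?q2 ?q2] by simp
  thus "range ?q22 = {M. size M = 2} \<times> {M. size M = 2}" unfolding range_multiset2 range_multiset3 by simp
 qed
 show "dim (sym31 :: 'n tensor4 set) = ((CARD('n) + 2) choose 3) * CARD('n)"
  unfolding c2[symmetric] c3[symmetric] card_cartesian_product[symmetric]
 proof (rule dim_eq_card_classes[of _ ?q31])
  fix F :: "'n \<times> 'n \<times> 'n \<times> 'n => real" and x y assume F: "F \<in> sym31" and eq: "?q31 x = ?q31 y"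
  show "F x = F y"
   using symmetric_of_multiset3[of "%i j k. F (i, j, k, snd (snd (snd x)))" "fst x" "fst (snd x)" "fst (snd (snd x))"
    "fst y" "fst (snd y)" "fst (snd (snd y))"] F eq by simp
 next
  fix F :: "'n \<times> 'n \<times> 'n \<times> 'n => real" assume *: "!!x y. ?q31 x = ?q31 y ==> F x = F y"
  show "F \<in> sym31" by (intro CollectI allI conjI *) (simp_all add: add_mset_commute)
 next
  have "range ?q31 = range ?q3 \<times> range (%k. k)"
   using range_pair_map[of "%x. ((fst x, fst (snd x), fst (snd (snd x))), snd (snd (snd x)))" "%z. (fst (fst z), fst (snd (fst z)), snd (snd (fst z)), snd z)" ?q3 "%k. k"] by simp
  thus "range ?q31 = {M. size M = 3} \<times> UNIV" unfolding range_multiset2 range_multiset3 by simp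
 qed
qed

lemma subspace_kernel_on: "linear f ==> subspace V ==> subspace {x \<in> V. f x = 0}"
 by (auto simp: subspace_def linear_0 linear_add linear_scale)

lemma subspace_sym [simp]: "subspace sym2" "subspace sym3" "subspace sym21" "subspace sym22" "subspace sym31"
 by (auto simp: subspace_def)

lemma dim_functions: "dim (UNIV :: ('x::finite => real) set) = CARD('x)"
 using dim_eq_card_classes[of UNIV "%x :: 'x. x" UNIV] by simp

abbreviation antisym2 :: "('n::finite) tensor2 set" where
 "antisym2 \<equiv> {b. \<forall>i j. b (i, j) + b (j, i) = 0}"

lemma dim_antisym2: "(CARD('n) + 1 choose 2) + dim (antisym2 :: ('n::finite) tensor2 set) = CARD('n) * CARD('n)"
proof -
 define f :: "'n tensor2 => 'n \<times> 'n => real" where "f b = (%(i, j). b (i, j) + b (j, i))" for b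
 have lin: "linear f" by (rule linearI) (auto simp: f_def fun_eq_iff algebra_simps)
 have "a \<in> f ` UNIV" if a: "a \<in> sym2" for a
  by (rule image_eqI[of _ _ "(1/2) *\<^sub>R a"]) (use a in \<open>auto simp: f_def fun_eq_iff\<close>)
 moreover have "f b \<in> sym2" for b by (simp add: f_def)
 ultimately have im: "f ` UNIV = sym2" by auto
 have ker: "{b \<in> UNIV. f b = 0} = antisym2" by (auto simp: f_def fun_eq_iff)
 show ?thesis
  using dim_function_image[OF lin subspace_UNIV] unfolding im ker dim_functions dim_sym(1) by simp
qed

definition cyclic3 :: "'n tensor3 => 'n \<times> 'n \<times> 'n => real" where
 "cyclic3 b = (%(i, j, k). b (i, j, k) + b (j, k, i) + b (k, i, j))"

definition trace3 :: "('n::finite) tensor3 => 'n => real" where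
 "trace3 b = (%j. \<Sum>i\<in>UNIV. b (i, j, i))"

definition cyclic4 :: "'n tensor4 => 'n \<times> 'n \<times> 'n \<times> 'n => real" where
 "cyclic4 c = (%(i, j, k, l). c (i, j, k, l) + c (j, k, i, l) + c (k, i, j, l))"

definition trace4 :: "('n::finite) tensor4 => 'n \<times> 'n => real" where
 "trace4 c = (%(j, l). \<Sum>i\<in>UNIV. c (i, j, i, l))"

lemma linear_cyclic_trace: "linear cyclic3" "linear trace3" "linear cyclic4" "linear trace4"
proof -
 show "linear cyclic3" by (rule linearI) (auto simp: cyclic3_def fun_eq_iff algebra_simps)
 show "linear cyclic4" by (rule linearI) (auto simp: cyclic4_def fun_eq_iff algebra_simps)
 show "linear trace3" by (rule linearI) (auto simp: trace3_def fun_eq_iff sum.distrib sum_distrib_left)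
 show "linear trace4" by (rule linearI) (auto simp: trace4_def fun_eq_iff sum.distrib sum_distrib_left)
qed

text \<open>The possible first and second Taylor coefficients of a divergence-free Killing tensor of degree two: the
cyclic sums are the Killing equation, the traces the divergence.\<close>

abbreviation "linear_part \<equiv> {b \<in> {b \<in> sym21. cyclic3 b = 0}. trace3 b = 0}"
abbreviation "quadratic_part \<equiv> {c \<in> {c \<in> sym22. cyclic4 c = 0}. trace4 c = 0}"

lemma cyclic3_image: "cyclic3 ` sym21 = (sym3 :: ('n::finite) tensor3 set)"
proof
 show "cyclic3 ` sym21 \<subseteq> (sym3 :: 'n tensor3 set)"
 proof
  fix e assume "e \<in> cyclic3 ` (sym21 :: 'n tensor3 set)"
  then obtain b where b: "!!i j k. b (i, j, k) = b (j, i, k)" and e: "e = cyclic3 b" by blast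
  have "e (i, j, k) = e (j, i, k)" "e (i, j, k) = e (i, k, j)" for i j k
   using b[of i j k] b[of j k i] b[of k i j] by (simp_all add: e cyclic3_def)
  thus "e \<in> sym3" by blast
 qed
 show "sym3 \<subseteq> cyclic3 ` (sym21 :: 'n tensor3 set)"
 proof
  fix e :: "'n \<times> 'n \<times> 'n => real" assume "e \<in> sym3"
  hence e: "e (i, j, k) = e (j, i, k)" "e (i, j, k) = e (i, k, j)" for i j k by blast+
  have "e = cyclic3 ((1/3) *\<^sub>R e)"
  proof (rule ext, clarify)
   fix i j k
   have "e (j, k, i) = e (i, j, k)" "e (k, i, j) = e (i, j, k)" by (metis e)+
   thus "e (i, j, k) = cyclic3 ((1/3) *\<^sub>R e) (i, j, k)" by (simp add: cyclic3_def)
  qed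
  moreover have "(1/3) *\<^sub>R e \<in> sym21" using e(1) by simp
  ultimately show "e \<in> cyclic3 ` sym21" by (rule image_eqI)
 qed
qed

text \<open>The preimage is the combination of permuted copies of \<open>e\<close> whose terms other than \<open>e (i, j, k, l)\<close> cancel in
the cyclic sum.\<close>

lemma cyclic4_image: "cyclic4 ` sym22 = (sym31 :: ('n::finite) tensor4 set)"
proof
 show "cyclic4 ` sym22 \<subseteq> (sym31 :: 'n tensor4 set)"
 proof
  fix e assume "e \<in> cyclic4 ` (sym22 :: 'n tensor4 set)"
  then obtain c where c: "!!i j k l. c (i, j, k, l) = c (j, i, k, l)" and e: "e = cyclic4 c" by blast
  have "e (i, j, k, l) = e (j, i, k, l)" "e (i, j, k, l) = e (i, k, j, l)" for i j k l
   using c[of i j k l] c[of j k i l] c[of k i j l] by (simp_all add: e cyclic4_def)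
  thus "e \<in> sym31" by blast
 qed
 show "sym31 \<subseteq> cyclic4 ` (sym22 :: 'n tensor4 set)"
 proof
  fix e :: "'n \<times> 'n \<times> 'n \<times> 'n => real" assume "e \<in> sym31"
  hence e: "e (i, j, k, l) = e (j, i, k, l)" "e (i, j, k, l) = e (i, k, j, l)" for i j k l by blast+
  define c where "c = (%(i, j, k, l). (e (i, j, k, l) + e (i, j, l, k)) / 3 - (e (i, k, l, j) + e (j, k, l, i)) / 6)"
  have "c \<in> sym22"
  proof (intro CollectI allI conjI)
   fix i j k l
   show "c (i, j, k, l) = c (j, i, k, l)" using e(1)[of i j] by (simp add: c_def)
   show "c (i, j, k, l) = c (i, j, l, k)" using e(2)[of i k l j] e(2)[of j k l i] by (simp add: c_def)
  qed
  moreover have "e = cyclic4 c"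
  proof (rule ext, clarify)
   fix i j k l
   have 1: "e (j, k, i, l) = e (i, j, k, l)" "e (k, i, j, l) = e (i, j, k, l)" by (metis e)+
   have 2: "e (k, j, l, i) = e (j, k, l, i)" "e (k, i, l, j) = e (i, k, l, j)" "e (j, i, l, k) = e (i, j, l, k)" by (metis e)+
   show "e (i, j, k, l) = cyclic4 c (i, j, k, l)"
    unfolding cyclic4_def c_def case_prod_conv 1 2 by (simp add: field_simps)
  qed
  ultimately show "e \<in> cyclic4 ` sym22" by blast
 qed
qed

lemma sum_delta_mult: "(\<Sum>i\<in>UNIV. (if i = j then 1 else 0) * g i) = (g (j :: 'n::finite) :: real)"
 "(\<Sum>i\<in>UNIV. (if j = i then 1 else 0) * g i) = (g (j :: 'n::finite) :: real)"
 by (simp_all add: if_distrib[of "%x. x * _"] cong: if_cong)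

text \<open>The tensor \<open>\<delta>\<^sub>i\<^sub>j v\<^sub>k\<close>, corrected to have cyclic sum zero, has trace \<open>(1 - n)/2\<close> times \<open>v\<close>.\<close>

lemma trace3_image:
 assumes n: "CARD('n::finite) >= 2"
 shows "trace3 ` {b \<in> sym21. cyclic3 b = 0} = (UNIV :: ('n => real) set)"
proof -
 have "v \<in> trace3 ` {b \<in> sym21. cyclic3 b = 0}" for v :: "'n => real"
 proof -
  define d :: "'n => 'n => real" where "d i j = (if i = j then 1 else 0)" for i j
  define a where "a = 2 / (1 - real CARD('n))"
  define b where "b = (%(i, j, k). a * (d i j * v k - (d i k * v j + d j k * v i) / 2))"
  have dc: "d i j = d j i" for i j by (simp add: d_def)
  have "b \<in> sym21" by (simp add: b_def dc add.commute)
  moreover have "cyclic3 b = 0"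
  proof (rule ext, clarify)
   fix i j k
   show "cyclic3 b (i, j, k) = 0 (i, j, k)"
    unfolding cyclic3_def b_def by (simp add: dc[of j i] dc[of k i] dc[of k j] field_simps)
  qed
  moreover have "trace3 b = v"
  proof
   fix j
   have "trace3 b j = a * ((\<Sum>i\<in>UNIV. d i j * v i) - (real CARD('n) * v j + (\<Sum>i\<in>UNIV. d j i * v i)) / 2)"
    unfolding trace3_def b_def
    by (simp add: sum_distrib_left[symmetric] sum_subtractf sum_divide_distrib[symmetric] sum.distrib d_def[of i i for i])
   also have "... = a * ((1 - real CARD('n)) / 2 * v j)" unfolding d_def sum_delta_mult by (simp add: field_simps)
   also have "... = v j" using n by (simp add: a_def)
   finally show "trace3 b j = v j" .
  qed
  ultimately show ?thesis by blast
 qed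
 thus ?thesis by blast
qed

text \<open>The tensor \<open>\<delta> h\<close> corrected to have cyclic sum zero. For \<open>n >= 3\<close> the traces of such tensors are all
symmetric tensors; for \<open>n = 2\<close> and \<open>h = \<delta>\<close> the trace is \<open>-\<delta>\<close>.\<close>

lemma trace4_element:
 fixes h :: "'n::finite \<times> 'n => real"
 assumes h: "h \<in> sym2"
 obtains c where "c \<in> sym22" "cyclic4 c = 0"
  "!!j l. trace4 c (j, l) = (2 - real CARD('n)) / 2 * h (j, l) - (if j = l then (\<Sum>i\<in>UNIV. h (i, i)) / 2 else 0)"
proof -
 define d :: "'n => 'n => real" where "d i j = (if i = j then 1 else 0)" for i j
 have dc: "d i j = d j i" for i j by (simp add: d_def)
 have hc: "h (i, j) = h (j, i)" for i j using h by blast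
 define c where "c = (%(i, j, k, l). d i j * h (k, l) + d k l * h (i, j)
   - (d i k * h (j, l) + d i l * h (j, k) + d j k * h (i, l) + d j l * h (i, k)) / 2)"
 have "c \<in> sym22"
 proof (intro CollectI allI conjI)
  fix i j k l
  show "c (i, j, k, l) = c (j, i, k, l)" by (simp add: c_def dc[of j i] hc[of j i] field_simps)
  show "c (i, j, k, l) = c (i, j, l, k)" by (simp add: c_def dc[of l k] hc[of l k] field_simps)
 qed
 moreover have "cyclic4 c = 0"
 proof (rule ext, clarify)
  fix i j k l
  show "cyclic4 c (i, j, k, l) = 0 (i, j, k, l)"
   unfolding cyclic4_def c_def by (simp add: dc[of j i] dc[of k i] dc[of k j] hc[of j i] hc[of k i] hc[of k j] field_simps)
 qed
 moreover have "trace4 c (j, l) = (2 - real CARD('n)) / 2 * h (j, l) - (if j = l then (\<Sum>i\<in>UNIV. h (i, i)) / 2 else 0)" for j l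
 proof -
  have "trace4 c (j, l) = (\<Sum>i\<in>UNIV. d i j * h (i, l)) + (\<Sum>i\<in>UNIV. d i l * h (i, j))
    - (real CARD('n) * h (j, l) + (\<Sum>i\<in>UNIV. d i l * h (j, i)) + (\<Sum>i\<in>UNIV. d j i * h (i, l)) + d j l * (\<Sum>i\<in>UNIV. h (i, i))) / 2"
   unfolding trace4_def c_def
   by (simp add: sum_subtractf sum_divide_distrib[symmetric] sum.distrib d_def[of i i for i] sum_distrib_left)
  also have "... = h (j, l) + h (l, j) - (real CARD('n) * h (j, l) + h (j, l) + h (j, l) + d j l * (\<Sum>i\<in>UNIV. h (i, i))) / 2"
   unfolding d_def sum_delta_mult by (rule refl)
  finally show ?thesis using hc[of l j] by (cases "j = l") (simp_all add: d_def field_simps)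
 qed
 ultimately show ?thesis by (rule that)
qed

text \<open>As for curvature tensors: combine the four cyclic identities for \<open>i, j, k, l\<close>.\<close>

lemma pair_symmetry:
 assumes c: "c \<in> sym22" "cyclic4 c = 0"
 shows "c (i, j, k, l) = c (k, l, i, j)"
proof -
 have s: "c (i, j, k, l) = c (j, i, k, l)" "c (i, j, k, l) = c (i, j, l, k)" for i j k l using c(1) by blast+
 have z: "c (i, j, k, l) + c (j, k, i, l) + c (k, i, j, l) = 0" for i j k l
  using fun_cong[OF c(2), of "(i, j, k, l)"] by (simp add: cyclic4_def)
 show ?thesis
  using z[of i j k l] z[of j k l i] z[of k l i j] z[of l i j k]
   s(1)[of j k i l] s(1)[of k l i j] s(1)[of i j k l] s s(2)[of i j k l] s(2)[of j k i l] s(2)[of k i j l] s(2)[of k l i j]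
  by (smt (verit))
qed

text \<open>To hit \<open>a\<close>, take \<open>h = \<alpha> a + \<beta> (tr a) \<delta>\<close> in \<open>trace4_element\<close>; the coefficients solve a triangular system.\<close>

lemma trace4_image:
 assumes n: "CARD('n::finite) >= 3"
 shows "trace4 ` {c \<in> sym22. cyclic4 c = 0} = (sym2 :: 'n tensor2 set)"
proof
 show "trace4 ` {c \<in> sym22. cyclic4 c = 0} \<subseteq> (sym2 :: 'n tensor2 set)"
 proof clarify
  fix c :: "'n \<times> 'n \<times> 'n \<times> 'n => real" and j l
  assume c: "\<forall>i j k l. c (i, j, k, l) = c (j, i, k, l) & c (i, j, k, l) = c (i, j, l, k)" "cyclic4 c = 0"
  hence "c (i, j, i, l) = c (i, l, i, j)" for i by (intro pair_symmetry) auto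
  thus "trace4 c (j, l) = trace4 c (l, j)" by (simp add: trace4_def)
 qed
 show "(sym2 :: 'n tensor2 set) \<subseteq> trace4 ` {c \<in> sym22. cyclic4 c = 0}"
 proof
  fix a :: "'n \<times> 'n => real" assume a: "a \<in> sym2"
  define N where "N = real CARD('n)"
  have N: "N >= 3" using n by (simp add: N_def)
  define \<alpha> where "\<alpha> = 2 / (2 - N)"
  define \<beta> where "\<beta> = \<alpha> / (2 - 2 * N)"
  define t where "t = (\<Sum>i\<in>UNIV. a (i, i))"
  define h where "h = (%(i, j). \<alpha> * a (i, j) + (if i = j then \<beta> * t else 0))"
  have "h \<in> sym2" using a by (simp add: h_def)
  then obtain c where c: "c \<in> sym22" "cyclic4 c = 0" and tr:
   "!!j l. trace4 c (j, l) = (2 - N) / 2 * h (j, l) - (if j = l then (\<Sum>i\<in>UNIV. h (i, i)) / 2 else 0)"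
   using trace4_element[of h] unfolding N_def by blast
  have th: "(\<Sum>i\<in>UNIV. h (i, i)) = (\<alpha> + N * \<beta>) * t"
   by (simp add: h_def sum.distrib sum_distrib_left[symmetric] t_def[symmetric] N_def algebra_simps)
  have \<alpha>: "(2 - N) / 2 * \<alpha> = 1" using N by (simp add: \<alpha>_def)
  have "(2 - 2 * N) * \<beta> = \<alpha>" using N by (simp add: \<beta>_def)
  hence \<beta>: "(2 - N) / 2 * \<beta> - (\<alpha> + N * \<beta>) / 2 = 0" by (simp add: field_simps)
  have "trace4 c = a"
  proof (rule ext, clarify)
   fix j l
   have "trace4 c (j, l) = ((2 - N) / 2 * \<alpha>) * a (j, l) + (if j = l then ((2 - N) / 2 * \<beta> - (\<alpha> + N * \<beta>) / 2) * t else 0)"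
    unfolding tr th by (simp add: h_def field_simps)
   thus "trace4 c (j, l) = a (j, l)" unfolding \<alpha> \<beta> by simp
  qed
  thus "a \<in> trace4 ` {c \<in> sym22. cyclic4 c = 0}" using c by blast
 qed
qed

lemma dim_trivial: "V \<subseteq> {0} ==> dim V = 0"
 using dim_unique[of "{}" V 0] independent_empty by simp

lemma dim_pos:
 assumes "v \<in> V" "v ~= 0" "finite A & V \<subseteq> span A"
 shows "dim V >= 1"
proof -
 obtain B where B: "B \<subseteq> V" "independent B" "V \<subseteq> span B" "card B = dim V" by (rule basis_exists)
 have "finite B" using independent_span_bound[of A B] B assms by blast
 moreover have "B ~= {}" using B(3) assms(1,2) by auto
 ultimately show ?thesis using B(4) by (metis One_nat_def Suc_leI card_gt_0_iff)
qed

lemma span_image_intro: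
 assumes "linear f" "x \<in> span S"
 shows "f x \<in> span (f ` S)"
proof -
 have "f ` span S = span (f ` S)" using assms(1) by (metis linear_span_image)
 thus ?thesis using assms(2) by blast
qed

lemma dim_product:
 fixes S :: "'v::real_vector set" and T :: "'w::real_vector set"
 assumes S: "subspace S" "finite A" "S \<subseteq> span A" and T: "subspace T" "finite B" "T \<subseteq> span B"
 shows "dim (S \<times> T) = dim S + dim T" "\<exists>C. finite C & S \<times> T \<subseteq> span C" "subspace (S \<times> T)"
proof -
 have l1: "linear (%a :: 'v. (a, 0 :: 'w))" and l2: "linear (%b :: 'w. (0 :: 'v, b))" and l3: "linear (fst :: 'v \<times> 'w => 'v)"
  by (auto intro: linearI)
 let ?C = "(%a. (a, 0)) ` A \<union> (%b. (0, b)) ` B"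
 have sub: "S \<times> T \<subseteq> span ?C"
 proof clarify
  fix s t assume "s \<in> S" "t \<in> T"
  hence st: "s \<in> span A" "t \<in> span B" using S T by auto
  have "(s, 0 :: 'w) \<in> span ((%a. (a, 0)) ` A)"
   using span_image_intro[OF l1 st(1)] .
  hence 1: "(s, 0) \<in> span ?C" by (rule subsetD[OF span_mono, rotated]) simp
  have "(0 :: 'v, t) \<in> span ((%b. (0, b)) ` B)"
   using span_image_intro[OF l2 st(2)] .
  hence 2: "(0, t) \<in> span ?C" by (rule subsetD[OF span_mono, rotated]) simp
  from 1 2 have "(s, 0) + (0, t) \<in> span ?C" by (rule span_add)
  thus "(s, t) \<in> span ?C" by simp
 qed
 show "\<exists>C. finite C & S \<times> T \<subseteq> span C"
  by (rule exI[of _ ?C], rule conjI[OF _ sub]) (simp add: S(2) T(2))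
 show V: "subspace (S \<times> T)"
 proof (rule subspaceI)
  show "0 \<in> S \<times> T" using subspace_0[OF S(1)] subspace_0[OF T(1)] by (simp add: zero_prod_def)
  show "x + y \<in> S \<times> T" if "x \<in> S \<times> T" "y \<in> S \<times> T" for x y
   using that subspace_add[OF S(1)] subspace_add[OF T(1)] by auto
  show "c *\<^sub>R x \<in> S \<times> T" if "x \<in> S \<times> T" for c x
   using that subspace_scale[OF S(1)] subspace_scale[OF T(1)] by auto
 qed
 have "dim (S \<times> T) = dim (fst ` (S \<times> T)) + dim {x \<in> S \<times> T. fst x = 0}"
  by (rule dim_kernel_image[OF l3 V _ sub]) (use S T in auto)
 also have "fst ` (S \<times> T) = S" using subspace_0[OF T(1)] by force
 also have "{x \<in> S \<times> T. fst x = 0} = (%b. (0, b)) ` T" using subspace_0[OF S(1)] by auto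
 also have "dim ((%b. (0 :: 'v, b)) ` T) = dim T"
 proof -
  have "dim {x \<in> T. (0 :: 'v, x) = 0} = 0" by (rule dim_trivial) (auto simp: zero_prod_def)
  thus ?thesis using dim_kernel_image[OF l2 T] by simp
 qed
 finally show "dim (S \<times> T) = dim S + dim T" .
qed

text \<open>For \<open>n = 1\<close> the cyclic condition leaves only zero; otherwise the trace is onto.\<close>

lemma dim_linear_part:
 "dim (linear_part :: ('n::finite) tensor3 set) + ((CARD('n) + 2) choose 3) + (if CARD('n) = 1 then 0 else CARD('n))
  = ((CARD('n) + 1) choose 2) * CARD('n)"
proof -
 let ?N = "{b \<in> sym21. cyclic3 b = 0} :: 'n tensor3 set"
 have N: "subspace ?N" by (intro subspace_kernel_on linear_cyclic_trace subspace_sym)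
 have 1: "((CARD('n) + 1) choose 2) * CARD('n) = ((CARD('n) + 2) choose 3) + dim ?N"
  using dim_function_image[OF linear_cyclic_trace(1), of "sym21 :: 'n tensor3 set"] unfolding cyclic3_image dim_sym by simp
 have 2: "dim ?N = dim (trace3 ` ?N) + dim (linear_part :: 'n tensor3 set)"
  by (rule dim_function_image[OF linear_cyclic_trace(2) N])
 have "dim (trace3 ` ?N) = (if CARD('n) = 1 then 0 else CARD('n))"
 proof (cases "CARD('n) = 1")
  case True
  then obtain a where a: "(UNIV :: 'n set) = {a}" by (auto simp: card_1_singleton_iff)
  hence eq: "i = a" for i by auto
  have "b = 0" if "b \<in> ?N" for b
  proof (rule ext, clarify)
   fix i j k
   from that have "cyclic3 b (i, j, k) = 0" by simp
   thus "b (i, j, k) = 0 (i, j, k)" using eq[of i] eq[of j] eq[of k] by (simp add: cyclic3_def)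
  qed
  hence "trace3 ` ?N \<subseteq> {0}" using linear_0[OF linear_cyclic_trace(2)] by auto
  thus ?thesis using True dim_trivial by simp
 next
  case False
  hence "CARD('n) >= 2" using zero_less_card_finite[where 'a = 'n] by linarith
  thus ?thesis using False trace3_image[where 'n = 'n] dim_functions[where 'x = 'n] by simp
 qed
 with 1 2 show ?thesis by simp
qed

text \<open>For \<open>n = 2\<close> the kernel of the cyclic sum has dimension one and its trace is not zero.\<close>

lemma dim_quadratic_part:
 "int (dim (quadratic_part :: ('n::finite) tensor4 set)) =
  (if CARD('n) <= 2 then 0 else int ((CARD('n) + 1) choose 2) * int ((CARD('n) + 1) choose 2)
   - int ((CARD('n) + 2) choose 3) * int CARD('n) - int ((CARD('n) + 1) choose 2))"
proof -
 let ?N = "{c \<in> sym22. cyclic4 c = 0} :: 'n tensor4 set"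
 have N: "subspace ?N" by (intro subspace_kernel_on linear_cyclic_trace subspace_sym)
 have 1: "((CARD('n) + 1) choose 2) * ((CARD('n) + 1) choose 2) = ((CARD('n) + 2) choose 3) * CARD('n) + dim ?N"
  using dim_function_image[OF linear_cyclic_trace(3), of "sym22 :: 'n tensor4 set"] unfolding cyclic4_image dim_sym by simp
 have 2: "dim ?N = dim (trace4 ` ?N) + dim (quadratic_part :: 'n tensor4 set)"
  by (rule dim_function_image[OF linear_cyclic_trace(4) N])
 consider "CARD('n) = 1" | "CARD('n) = 2" | "CARD('n) >= 3"
  using zero_less_card_finite[where 'a = 'n] by linarith
 thus ?thesis
 proof cases
  case one: 1
  with 1 2 show ?thesis by (simp add: numeral_2_eq_2 numeral_3_eq_3)
 next
  case two: 2
  define h :: "'n \<times> 'n => real" where "h = (%(i, j). if i = j then 1 else 0)"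
  have "h \<in> sym2" by (auto simp: h_def)
  then obtain c where c: "c \<in> sym22" "cyclic4 c = 0" and tr:
   "!!j l. trace4 c (j, l) = (2 - real CARD('n)) / 2 * h (j, l) - (if j = l then (\<Sum>i\<in>UNIV. h (i, i)) / 2 else 0)"
   using trace4_element[of h] by blast
  have "trace4 c (j, j) ~= 0" for j unfolding tr by (simp add: h_def two)
  hence "trace4 c ~= 0" by (metis zero_fun_def)
  moreover have "trace4 c \<in> trace4 ` ?N" using c by blast
  moreover have "\<exists>A. finite A & trace4 ` ?N \<subseteq> span A" by (rule function_space_finite_dim)
  then obtain A where "finite A & trace4 ` ?N \<subseteq> span A" ..
  ultimately have "dim (trace4 ` ?N) >= 1" using dim_pos[of "trace4 c" "trace4 ` ?N" A] by simp
  with 1 2 two show ?thesis by (simp add: numeral_3_eq_3 numeral_2_eq_2)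
 next
  case 3
  have "dim (trace4 ` ?N) = (CARD('n) + 1) choose 2" unfolding trace4_image[OF 3] by (rule dim_sym(1))
  hence N2: "int (dim ?N) = int ((CARD('n) + 1) choose 2) + int (dim (quadratic_part :: 'n tensor4 set))"
   using arg_cong[OF 2, of int] by (simp only: of_nat_add)
  have N1: "int ((CARD('n) + 1) choose 2) * int ((CARD('n) + 1) choose 2)
    = int ((CARD('n) + 2) choose 3) * int CARD('n) + int (dim ?N)"
   using arg_cong[OF 1, of int] by (simp only: of_nat_add of_nat_mult)
  have "~ CARD('n) <= 2" using 3 by linarith
  thus ?thesis unfolding if_not_P[OF \<open>~ CARD('n) <= 2\<close>] using N1 N2 by linarith
 qed
qed

section \<open>Flat Killing tensors of low degree\<close>

lemma polynomial_partial_commute: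
 fixes q :: "real^'n::finite => real"
 assumes "real_polynomial_function q"
 shows "partial k (partial l q) y = partial l (partial k q) y"
 using assms
proof (induction arbitrary: y)
 case (linear f)
 hence "partial k f = (%_. f (axis k 1))" for k
  by (intro ext partial_eq_derivative bounded_linear_imp_has_derivative)
 thus ?case by simp
next
 case (const c)
 have "partial k (%_ :: real^'n. c) = (%_. 0)" for k by (simp add: fun_eq_iff)
 thus ?case by simp
next
 case (add f g)
 have d: "f differentiable (at y)" "g differentiable (at y)" "partial k f differentiable (at y)" "partial k g differentiable (at y)" for k y
  using add polynomial_partial differentiable_at_real_polynomial_function by blast+
 have "partial k (%x. f x + g x) = (%x. partial k f x + partial k g x)" for k by (intro ext partial_add d)
 thus ?case using add.IH by (simp add: partial_add[OF d(3,4)])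
next
 case (mult f g)
 have d: "f differentiable (at y)" "g differentiable (at y)" "partial k f differentiable (at y)" "partial k g differentiable (at y)" for k y
  using mult polynomial_partial differentiable_at_real_polynomial_function by blast+
 have "partial k (%x. f x * g x) = (%x. partial k f x * g x + f x * partial k g x)" for k by (intro ext partial_mult d)
 thus ?case using mult.IH
  by (simp add: partial_add[OF differentiable_mult[OF d(3,2)] differentiable_mult[OF d(1,4)]] partial_mult d)
qed

lemma flat_killing_components:
 assumes "P \<in> flat_killing p"
 shows "smooth_on UNIV (%y. P y J)" "P y \<in> sym_comps p" "flat_deriv P y J = 0" "flat_div P y J = 0"
  "(%y. P y J) differentiable (at y)" "partial k (%y. P y J) differentiable (at y)"
  "partial k (partial l (%y. P y J)) y = partial l (partial k (%y. P y J)) y"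
proof -
 show sm: "smooth_on UNIV (%y. P y J)" and "P y \<in> sym_comps p" "flat_deriv P y J = 0" "flat_div P y J = 0"
  using assms unfolding flat_killing_def by auto
 show "(%y. P y J) differentiable (at y)" "partial k (%y. P y J) differentiable (at y)"
  using smooth_on_differentiable[OF sm UNIV_I] smooth_on_differentiable[OF smooth_on_partial[OF sm] UNIV_I] .
 show "partial k (partial l (%y. P y J)) y = partial l (partial k (%y. P y J)) y"
  by (rule polynomial_partial_commute[OF flat_killing_polynomial[OF assms]])
qed

lemma partial_linear_sum: "partial m (%y :: real^'n::finite. \<Sum>k\<in>UNIV. b k * y $ k) y = b m"
proof -
 have d: "(%y :: real^'n. b k * y $ k) differentiable (at y)" for k y
  by (intro differentiable_mult differentiable_const bounded_linear_imp_differentiable bounded_linear_vec_nth)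
 have "partial m (%y :: real^'n. b k * y $ k) y = (if k = m then b k else 0)" for k
  by (subst partial_cmult) (auto intro: bounded_linear_imp_differentiable bounded_linear_vec_nth)
 thus ?thesis by (subst partial_sum[OF d]) simp
qed

lemma dim_injective_image:
 fixes f :: "'v::real_vector => 'w::real_vector"
 assumes "linear f" "subspace V" "\<exists>A. finite A & V \<subseteq> span A" "!!x. x \<in> V ==> f x = 0 ==> x = 0"
 shows "dim (f ` V) = dim V"
proof -
 have "{x \<in> V. f x = 0} \<subseteq> {0}" using assms(4) by blast
 hence "dim {x \<in> V. f x = 0} = 0" by (rule dim_trivial)
 moreover obtain A where "finite A" "V \<subseteq> span A" using assms(3) by blast
 ultimately show ?thesis using dim_kernel_image[OF assms(1,2)] by simp
qed

lemma flat_killing_off: "P \<in> flat_killing p ==> length J ~= p ==> P y J = 0"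
 using flat_killing_components(2) sym_comps_off by blast

lemma flat_killing_diff: "P \<in> flat_killing p ==> Q \<in> flat_killing p ==> P - Q \<in> flat_killing p"
 by (rule subspace_diff[OF subspace_flat_killing])

text \<open>The fields \<open>a + b y\<close> with antisymmetric \<open>b\<close>.\<close>

lemma dim_flat_killing_1: "dim (flat_killing 1 :: 'n::finite field set) = (CARD('n) + 1) choose 2"
proof -
 let ?K = "flat_killing 1 :: 'n field set"
 let ?V = "(UNIV :: ('n => real) set) \<times> (antisym2 :: 'n tensor2 set)"
 define W :: "('n => real) \<times> 'n tensor2 => 'n field" where
  "W = (%(a, b) y J. case J of [i] => a i + (\<Sum>k\<in>UNIV. b (i, k) * y $ k) | _ => 0)"
 have W1: "W (a, b) y [i] = a i + (\<Sum>k\<in>UNIV. b (i, k) * y $ k)" for a b y i by (simp add: W_def)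
 have W0: "W z y J = 0" if "length J ~= 1" for z y J
  using that by (auto simp: W_def split: list.splits prod.splits)
 have sm: "smooth_on UNIV (%y. W (a, b) y J)" for a b J
 proof (cases "length J = 1")
  case True
  then obtain i where "J = [i]" by (auto simp: length_Suc_conv)
  thus ?thesis unfolding W1
   by (simp only: W1) (intro smooth_on_add smooth_on_sum smooth_on_mult smooth_on_const smooth_on_nth open_UNIV)
 qed (simp add: W0 smooth_on_const)
 have pW: "partial k (%y. W (a, b) y [i]) y = b (i, k)" for a b i k y
 proof -
  have "(%y :: real^'n. \<Sum>k\<in>UNIV. b (i, k) * y $ k) differentiable (at y)"
   by (rule smooth_on_differentiable[OF _ UNIV_I], intro smooth_on_sum smooth_on_mult smooth_on_const smooth_on_nth open_UNIV)
  thus ?thesis unfolding W1 by (subst partial_add) (simp_all add: partial_linear_sum)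
 qed
 have V: "subspace (antisym2 :: 'n tensor2 set)"
 proof (rule subspaceI)
  fix b c :: "'n \<times> 'n => real" and r :: real
  assume b: "b \<in> antisym2" and c: "c \<in> antisym2"
  have *: "(b + c) (i, j) + (b + c) (j, i) = (b (i, j) + b (j, i)) + (c (i, j) + c (j, i))" for i j by simp
  show "b + c \<in> antisym2" using b c by (simp only: mem_Collect_eq *) simp
  have *: "(r *\<^sub>R b) (i, j) + (r *\<^sub>R b) (j, i) = r * (b (i, j) + b (j, i))" for i j by (simp add: distrib_left)
  show "r *\<^sub>R b \<in> antisym2" using b by (simp only: mem_Collect_eq *) simp
 qed simp
 obtain A where A: "finite A" "(UNIV :: ('n => real) set) \<subseteq> span A"
  using function_space_finite_dim by blast
 obtain B where B: "finite B" "(antisym2 :: 'n tensor2 set) \<subseteq> span B"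
  using function_space_finite_dim by blast
 note prod = dim_product[OF subspace_UNIV A V B]
 have lin: "linear W" by (rule linearI) (auto simp: W_def fun_eq_iff algebra_simps sum.distrib sum_distrib_left split: list.splits)
 have inj: "z = 0" if "W z = 0" for z
 proof -
  obtain a b where z: "z = (a, b)" by (cases z)
  have W_zero: "W (a, b) y J = 0" for y J using that z by simp
  have "b (i, k) = 0" for i k using pW[of k a b i 0] unfolding W_zero by simp
  hence "b = 0" by (auto simp: fun_eq_iff)
  moreover have "a i = 0" for i using W_zero[of 0 "[i]"] unfolding W1 by simp
  ultimately show ?thesis unfolding z by (auto simp: fun_eq_iff zero_prod_def)
 qed
 have mem: "W (a, b) \<in> ?K" if b: "b \<in> antisym2" for a b
 proof -
  have sym: "W (a, b) y \<in> sym_comps 1" for y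
  proof (rule sym_compsI[OF W0])
   fix I J :: "'n list" assume IJ: "mset I = mset J"
   show "W (a, b) y I = W (a, b) y J"
   proof (cases "length I = 1")
    case True
    then obtain i where "I = [i]" by (auto simp: length_Suc_conv)
    thus ?thesis using IJ by simp
   next
    case False
    thus ?thesis using mset_eq_length[OF IJ] by (simp add: W0)
   qed
  qed
  have "flat_deriv (W (a, b)) y = 0" for y
  proof
   fix J :: "'n list"
   show "flat_deriv (W (a, b)) y J = 0 J"
   proof (cases "length J = 2")
    case True
    then obtain i k where J: "J = [i, k]" by (auto simp: length_Suc_conv numeral_2_eq_2)
    have "flat_deriv (W (a, b)) y J = partial i (%y. W (a, b) y [k]) y + partial k (%y. W (a, b) y [i]) y"
    by (simp add: flat_deriv_def J numeral_2_eq_2)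
    thus ?thesis using b by (simp add: pW)
   next
    case False
    thus ?thesis using sym_comps_off[OF flat_deriv_sym_comps[OF sym]] by (simp add: numeral_2_eq_2)
   qed
  qed
  moreover have "flat_div (W (a, b)) y = 0" for y
  proof
   fix J :: "'n list"
   have "b (i, i) + b (i, i) = 0" for i using b by blast
   hence "b (i, i) = 0" for i by simp
   show "flat_div (W (a, b)) y J = 0 J"
   proof (cases "J = []")
    case True
    thus ?thesis using \<open>!!i. b (i, i) = 0\<close> by (simp add: flat_div_def pW)
   qed (use sym_comps_off[OF flat_div_sym_comps[OF sym]] in simp)
  qed
  ultimately show ?thesis using sym sm by (simp add: flat_killing_def)
 qed
 have surj: "P \<in> W ` ?V" if P: "P \<in> ?K" for P
 proof -
  define a where "a i = P 0 [i]" for i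
  define b where "b = (%(i, k). partial k (%y. P y [i]) 0)"
  have b: "b \<in> antisym2"
  proof (intro CollectI allI)
   fix i j
   have "flat_deriv P 0 [i, j] = 0" by (rule flat_killing_components(3)[OF P])
   thus "b (i, j) + b (j, i) = 0" by (simp add: flat_deriv_def b_def numeral_2_eq_2)
  qed
  have "P - W (a, b) = 0"
  proof (intro ext)
   fix y J
   have Q: "P - W (a, b) \<in> ?K" by (rule flat_killing_diff[OF P mem[OF b]])
   show "(P - W (a, b)) y J = 0 y J"
   proof (cases "length J = 1")
    case True
    then obtain i where J: "J = [i]" by (auto simp: length_Suc_conv)
    have "partial k (%y. (P - W (a, b)) y [i]) 0 = 0" for k
    proof -
    have "partial k (%y. (P - W (a, b)) y [i]) 0 = partial k (%y. P y [i]) 0 - b (i, k)"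
    unfolding fun_diff_def partial_diff[OF flat_killing_components(5)[OF P] flat_killing_components(5)[OF mem[OF b]]] pW ..
    thus ?thesis by (simp add: b_def)
    qed
    moreover have "(P - W (a, b)) 0 [i] = 0" by (simp add: W1 a_def)
    ultimately show ?thesis unfolding J using flat_killing_jet_zero[OF Q] by simp
   qed (use flat_killing_off[OF Q] in simp)
  qed
  thus ?thesis using b by (intro image_eqI[of _ _ "(a, b)"]) auto
 qed
 have "?K = W ` ?V" using mem surj by auto
 hence "dim ?K = dim ?V" using dim_injective_image[OF lin prod(3,2) inj] by simp
 also have "... = CARD('n) + dim (antisym2 :: 'n tensor2 set)" using prod(1) dim_functions[where 'x = 'n] by simp
 finally have "dim ?K + ((CARD('n) + 1) choose 2) = CARD('n) + CARD('n) * CARD('n)" using dim_antisym2[where 'n = 'n] by simp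
 moreover have "((CARD('n) + 1) choose 2) * 2 = (CARD('n) + 1) * CARD('n)"
  using Suc_times_binomial_eq[of "CARD('n)" 1] by (simp add: numeral_2_eq_2)
 ultimately show ?thesis by (simp add: algebra_simps)
qed

lemma partial_quadratic_sum:
 assumes C: "!!k l. C k l = C l k"
 shows "partial m (%y :: real^'n::finite. \<Sum>k\<in>UNIV. y $ k * (\<Sum>l\<in>UNIV. C k l * y $ l)) y = 2 * (\<Sum>l\<in>UNIV. C m l * y $ l)"
proof -
 have dL: "(%y :: real^'n. \<Sum>l\<in>UNIV. C k l * y $ l) differentiable (at y)" for k y
  by (rule smooth_on_differentiable[OF _ UNIV_I], intro smooth_on_sum smooth_on_mult smooth_on_const smooth_on_nth open_UNIV)
 have dn: "(%y :: real^'n. y $ k) differentiable (at y)" for k y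
  by (rule smooth_on_differentiable[OF smooth_on_nth UNIV_I]) simp
 have p: "partial m (%y :: real^'n. y $ k * (\<Sum>l\<in>UNIV. C k l * y $ l)) y
   = (if k = m then \<Sum>l\<in>UNIV. C k l * y $ l else 0) + C m k * y $ k" for k
  unfolding partial_mult[OF dn dL] partial_linear_sum by (simp add: C[of k m])
 have "partial m (%y :: real^'n. \<Sum>k\<in>UNIV. y $ k * (\<Sum>l\<in>UNIV. C k l * y $ l)) y
   = (\<Sum>k\<in>UNIV. (if k = m then \<Sum>l\<in>UNIV. C k l * y $ l else 0) + C m k * y $ k)"
  unfolding partial_sum[OF differentiable_mult[OF dn dL]] p ..
 thus ?thesis by (simp add: sum.distrib)
qed

text \<open>A tensor is determined by its Taylor coefficients \<open>a\<close>, \<open>b\<close>, \<open>c\<close> of order at most two at the origin, and the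
equations at the origin are the conditions on them; conversely these conditions imply the equations
everywhere.\<close>

lemma dim_flat_killing_2_parts:
 "dim (flat_killing 2 :: 'n::finite field set) = ((CARD('n) + 1) choose 2)
  + (dim (linear_part :: 'n tensor3 set) + dim (quadratic_part :: 'n tensor4 set))"
proof -
 let ?K = "flat_killing 2 :: 'n field set"
 let ?A = "sym2 :: 'n tensor2 set"
 let ?B = "linear_part :: 'n tensor3 set"
 let ?C = "quadratic_part :: 'n tensor4 set"
 define W :: "'n tensor2 \<times> 'n tensor3 \<times> 'n tensor4 => 'n field" where
  "W z y J = (if length J = 2 then fst z (J ! 0, J ! 1) + (\<Sum>k\<in>UNIV. fst (snd z) (J ! 0, J ! 1, k) * y $ k)
   + 1/2 * (\<Sum>k\<in>UNIV. y $ k * (\<Sum>l\<in>UNIV. snd (snd z) (J ! 0, J ! 1, k, l) * y $ l)) else 0)" for z y J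
 have W1: "W (a, b, c) y [i, j] = a (i, j) + (\<Sum>k\<in>UNIV. b (i, j, k) * y $ k)
   + 1/2 * (\<Sum>k\<in>UNIV. y $ k * (\<Sum>l\<in>UNIV. c (i, j, k, l) * y $ l))" for a b c y i j
  unfolding W_def by simp
 have W0: "W z y J = 0" if "length J ~= 2" for z y J unfolding W_def using that by simp
 have two: "\<exists>i j. J = [i, j]" if "length J = 2" for J :: "'n list"
  using that by (auto simp: length_Suc_conv numeral_2_eq_2)
 have smq: "smooth_on UNIV (%y :: real^'n. 1/2 * (\<Sum>k\<in>UNIV. y $ k * (\<Sum>l\<in>UNIV. C k l * y $ l)))"
  "smooth_on UNIV (%y :: real^'n. \<Sum>k\<in>UNIV. y $ k * (\<Sum>l\<in>UNIV. C k l * y $ l))"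
  "smooth_on UNIV (%y :: real^'n. d + (\<Sum>k\<in>UNIV. h k * y $ k))" for C h d
  by (intro smooth_on_add smooth_on_sum smooth_on_mult smooth_on_const smooth_on_nth open_UNIV)+
 have sm: "smooth_on UNIV (%y. W (a, b, c) y J)" for a b c J
 proof (cases "length J = 2")
  case True
  then obtain i j where J: "J = [i, j]" using two by blast
  show ?thesis unfolding J W1 by (intro smooth_on_add[OF open_UNIV] smq)
 qed (simp add: W0 smooth_on_const)
 have pL: "partial m (%y :: real^'n. d + (\<Sum>k\<in>UNIV. h k * y $ k)) y = h m" for m d h y
 proof -
  have "(%y :: real^'n. \<Sum>k\<in>UNIV. h k * y $ k) differentiable (at y)"
   using smooth_on_differentiable[OF smq(3)[of 0 h] UNIV_I] by simp
  thus ?thesis by (subst partial_add) (simp_all add: partial_linear_sum)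
 qed
 have pW: "partial m (%y. W (a, b, c) y [i, j]) = (%y. b (i, j, m) + (\<Sum>l\<in>UNIV. c (i, j, m, l) * y $ l))"
  if c: "c \<in> sym22" for a b c i j m
 proof
  fix y :: "real^'n"
  have c': "c (i, j, k, l) = c (i, j, l, k)" for k l using c by blast
  have q: "partial m (%y. 1/2 * (\<Sum>k\<in>UNIV. y $ k * (\<Sum>l\<in>UNIV. c (i, j, k, l) * y $ l))) y = (\<Sum>l\<in>UNIV. c (i, j, m, l) * y $ l)"
   unfolding partial_cmult[OF smooth_on_differentiable[OF smq(2)[of "%k l. c (i, j, k, l)"] UNIV_I]]
   by (subst partial_quadratic_sum[of "%k l. c (i, j, k, l)", OF c']) simp
  show "partial m (%y. W (a, b, c) y [i, j]) y = b (i, j, m) + (\<Sum>l\<in>UNIV. c (i, j, m, l) * y $ l)"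
   unfolding W1 partial_add[OF smooth_on_differentiable[OF smq(3)[of "a (i, j)" "%k. b (i, j, k)"] UNIV_I]
    smooth_on_differentiable[OF smq(1)[of "%k l. c (i, j, k, l)"] UNIV_I]] q pL[of m "a (i, j)" "%k. b (i, j, k)"] ..
 qed
 have ppW: "partial l (partial m (%y. W (a, b, c) y [i, j])) y = c (i, j, m, l)" if c: "c \<in> sym22" for a b c i j m l y
  unfolding pW[OF c] pL ..
 have sB: "subspace ?B" and sC: "subspace ?C"
  by (intro subspace_kernel_on linear_cyclic_trace subspace_sym)+
 obtain F1 where F1: "finite F1" "?A \<subseteq> span F1" using function_space_finite_dim[of ?A] by (elim exE conjE)
 obtain F2 where F2: "finite F2" "?B \<subseteq> span F2" using function_space_finite_dim[of ?B] by (elim exE conjE)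
 obtain F3 where F3: "finite F3" "?C \<subseteq> span F3" using function_space_finite_dim[of ?C] by (elim exE conjE)
 note BC = dim_product[OF sB F2 sC F3]
 obtain F4 where F4: "finite F4" "?B \<times> ?C \<subseteq> span F4" using BC(2) by (elim exE conjE)
 note ABC = dim_product[OF subspace_sym(1) F1 BC(3) F4]
 have lin: "linear W"
 proof (rule linearI)
  show "W (z + z') = W z + W z'" for z z'
   by (intro ext) (simp add: W_def algebra_simps sum.distrib)
  show "W (r *\<^sub>R z) = r *\<^sub>R W z" for r z
   by (intro ext) (simp add: W_def algebra_simps sum_distrib_left)
 qed
 have inj: "z = 0" if z: "z \<in> ?A \<times> ?B \<times> ?C" and Wz: "W z = 0" for z
 proof -
  obtain a b c where abc: "z = (a, b, c)" by (cases z)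
  have c: "c \<in> sym22" using z unfolding abc by simp
  have W_zero: "W (a, b, c) y J = 0" for y J using Wz abc by simp
  have "b (i, j, k) = 0" for i j k using fun_cong[OF pW[OF c, of k a b i j], of 0] unfolding W_zero by simp
  hence "b = 0" by (auto simp: fun_eq_iff)
  moreover have const: "partial k (%_ :: real^'n. 0) = (%_. 0)" for k by (simp add: fun_eq_iff)
  have "c (i, j, k, l) = 0" for i j k l using ppW[OF c, of l k a b i j 0] unfolding W_zero const by simp
  hence "c = 0" by (auto simp: fun_eq_iff)
  moreover have "a (i, j) = 0" for i j using W_zero[of 0 "[i, j]"] unfolding W1 by simp
  hence "a = 0" by (auto simp: fun_eq_iff)
  ultimately show ?thesis unfolding abc by (simp add: zero_prod_def)
 qed
 have mem: "W (a, b, c) \<in> ?K" if a: "a \<in> ?A" and b: "b \<in> ?B" and c: "c \<in> ?C" for a b c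
 proof -
  have as: "a (i, j) = a (j, i)" for i j using a by blast
  have bs: "b (i, j, k) = b (j, i, k)" for i j k using b by blast
  have cs: "c (i, j, k, l) = c (j, i, k, l)" for i j k l using c by blast
  have c22: "c \<in> sym22" using c by blast
  have z: "cyclic3 b = 0" "cyclic4 c = 0" "trace3 b = 0" "trace4 c = 0" using b c by blast+
  have b3: "b (i, j, k) + b (j, k, i) + b (k, i, j) = 0" for i j k
   using fun_cong[OF z(1), of "(i, j, k)"] by (simp add: cyclic3_def)
  have c4: "c (i, j, k, l) + c (j, k, i, l) + c (k, i, j, l) = 0" for i j k l
   using fun_cong[OF z(2), of "(i, j, k, l)"] by (simp add: cyclic4_def)
  have bt: "(\<Sum>i\<in>UNIV. b (i, j, i)) = 0" for j using fun_cong[OF z(3), of j] by (simp add: trace3_def)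
  have ct: "(\<Sum>i\<in>UNIV. c (i, j, i, l)) = 0" for j l using fun_cong[OF z(4), of "(j, l)"] by (simp add: trace4_def)
  have sym: "W (a, b, c) y \<in> sym_comps 2" for y
  proof (rule sym_compsI[OF W0])
   fix I J :: "'n list" assume IJ: "mset I = mset J"
   show "W (a, b, c) y I = W (a, b, c) y J"
   proof (cases "length I = 2")
    case True
    moreover have "length J = 2" using mset_eq_length[OF IJ] True by simp
    ultimately obtain i j i' j' where I: "I = [i, j]" and J: "J = [i', j']" using two by metis
    have "{#i, j#} = {#i', j'#}" using IJ by (simp add: I J)
    hence "i = i' & j = j' \<or> i = j' & j = i'" by (simp add: multiset2_eq)
    thus ?thesis unfolding I J W1 using as[of i j] bs[of i j] cs[of i j] by (elim disjE conjE) simp_all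
   next
    case False
    thus ?thesis using mset_eq_length[OF IJ] by (simp add: W0)
   qed
  qed
  have "flat_deriv (W (a, b, c)) y = 0" for y
  proof
   fix J :: "'n list"
   show "flat_deriv (W (a, b, c)) y J = 0 J"
   proof (cases "length J = 3")
    case True
    then obtain i j k where J: "J = [i, j, k]" by (auto simp: length_Suc_conv numeral_3_eq_3)
    have "flat_deriv (W (a, b, c)) y J = partial i (%y. W (a, b, c) y [j, k]) y
    + partial j (%y. W (a, b, c) y [i, k]) y + partial k (%y. W (a, b, c) y [i, j]) y"
    by (simp add: flat_deriv_def J numeral_3_eq_3)
    also have "... = (b (i, j, k) + b (j, k, i) + b (k, i, j))
    + (\<Sum>l\<in>UNIV. (c (i, j, k, l) + c (j, k, i, l) + c (k, i, j, l)) * y $ l)"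
    unfolding pW[OF c22] by (simp add: bs[of i k j] cs[of i k j] distrib_right sum.distrib)
    finally show ?thesis by (simp add: b3 c4)
   next
    case False
    thus ?thesis using sym_comps_off[OF flat_deriv_sym_comps[OF sym]] by simp
   qed
  qed
  moreover have "flat_div (W (a, b, c)) y = 0" for y
  proof
   fix J :: "'n list"
   show "flat_div (W (a, b, c)) y J = 0 J"
   proof (cases "length J = 1")
    case True
    then obtain j where J: "J = [j]" by (auto simp: length_Suc_conv)
    have "flat_div (W (a, b, c)) y J = - ((\<Sum>i\<in>UNIV. b (i, j, i)) + (\<Sum>i\<in>UNIV. \<Sum>l\<in>UNIV. c (i, j, i, l) * y $ l))"
    unfolding flat_div_def J pW[OF c22] sum.distrib ..
    also have "(\<Sum>i\<in>UNIV. \<Sum>l\<in>UNIV. c (i, j, i, l) * y $ l) = (\<Sum>l\<in>UNIV. (\<Sum>i\<in>UNIV. c (i, j, i, l)) * y $ l)"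
    unfolding sum_distrib_right by (rule sum.swap)
    finally show ?thesis by (simp add: bt ct)
   qed (use sym_comps_off[OF flat_div_sym_comps[OF sym]] in simp)
  qed
  ultimately show ?thesis using sym sm by (simp add: flat_killing_def)
 qed
 have surj: "P \<in> W ` (?A \<times> ?B \<times> ?C)" if P: "P \<in> ?K" for P
 proof -
  define a where "a = (%(i, j). P 0 [i, j])"
  define b where "b = (%(i, j, k). partial k (%y. P y [i, j]) 0)"
  define c where "c = (%(i, j, k, l). partial l (partial k (%y. P y [i, j])) 0)"
  note K = flat_killing_components[OF P]
  have Ps: "P y [i, j] = P y [j, i]" for y i j by (rule sym_comps_sym[OF K(2)]) simp
  have kill: "partial i (%y. P y [j, k]) y + partial j (%y. P y [k, i]) y + partial k (%y. P y [i, j]) y = 0" for i j k y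
   using K(3)[of y "[i, j, k]"] unfolding Ps[of _ k i] by (simp add: flat_deriv_def numeral_3_eq_3)
  have div: "(\<Sum>i\<in>UNIV. partial i (%y. P y [i, j]) y) = 0" for j y
   using K(4)[of y "[j]"] by (simp add: flat_div_def)
  have a: "a \<in> ?A" by (simp add: a_def Ps)
  have b: "b \<in> ?B"
  proof (intro CollectI conjI allI)
   show "b (i, j, k) = b (j, i, k)" for i j k unfolding b_def case_prod_conv Ps[of _ i j] ..
   show "cyclic3 b = 0"
    by (rule ext) (use kill[of _ _ _ 0] in \<open>simp add: cyclic3_def b_def add_ac split: prod.splits\<close>)
   show "trace3 b = 0" by (rule ext) (simp add: trace3_def b_def div)
  qed
  have c: "c \<in> ?C"
  proof (intro CollectI conjI allI)
   show "c (i, j, k, l) = c (j, i, k, l)" for i j k l unfolding c_def case_prod_conv Ps[of _ i j] ..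
   show "c (i, j, k, l) = c (i, j, l, k)" for i j k l unfolding c_def case_prod_conv by (rule K(7))
   show "cyclic4 c = 0"
   proof (rule ext, clarify)
    fix i j k l
    have "partial l (%y. partial i (%y. P y [j, k]) y + partial j (%y. P y [k, i]) y + partial k (%y. P y [i, j]) y) 0 = 0"
    unfolding kill by simp
    hence "partial l (partial i (%y. P y [j, k])) 0 + partial l (partial j (%y. P y [k, i])) 0 + partial l (partial k (%y. P y [i, j])) 0 = 0"
    by (simp only: partial_add[OF differentiable_add[OF K(6) K(6)] K(6)] partial_add[OF K(6) K(6)])
    thus "cyclic4 c (i, j, k, l) = 0 (i, j, k, l)" by (simp add: cyclic4_def c_def)
   qed
   show "trace4 c = 0"
   proof (rule ext, clarify)
    fix j l
    have "partial l (%y. \<Sum>i\<in>UNIV. partial i (%y. P y [i, j]) y) 0 = 0" unfolding div by simp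
    hence "(\<Sum>i\<in>UNIV. partial l (partial i (%y. P y [i, j])) 0) = 0" by (simp only: partial_sum[OF K(6)])
    thus "trace4 c (j, l) = 0 (j, l)" by (simp add: trace4_def c_def)
   qed
  qed
  have c22: "c \<in> sym22" using c by blast
  note Wm = mem[OF a b c]
  note KW = flat_killing_components[OF Wm]
  have Q: "P - W (a, b, c) \<in> ?K" by (rule flat_killing_diff[OF P Wm])
  have "P - W (a, b, c) = 0"
  proof (intro ext)
   fix y J
   show "(P - W (a, b, c)) y J = 0 y J"
   proof (cases "length J = 2")
    case True
    then obtain i j where J: "J = [i, j]" using two by blast
    have d1: "partial k (%y. (P - W (a, b, c)) y [i, j]) = (%y. partial k (%y. P y [i, j]) y - partial k (%y. W (a, b, c) y [i, j]) y)" for k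
    unfolding fun_diff_def by (rule ext) (rule partial_diff[OF K(5) KW(5)])
    have z1: "partial k (%y. (P - W (a, b, c)) y [i, j]) 0 = 0" for k
    unfolding d1 pW[OF c22] by (simp add: b_def)
    have z2: "partial l (partial k (%y. (P - W (a, b, c)) y [i, j])) 0 = 0" for k l
    unfolding d1 partial_diff[OF K(6) KW(6)] ppW[OF c22] by (simp add: c_def)
    have z0: "(P - W (a, b, c)) 0 [i, j] = 0" by (simp add: W1 a_def)
    have "(P - W (a, b, c)) y [i, j] = 0"
    by (rule flat_killing_jet_zero[OF Q order_refl z0 z1]) (intro disjI2 allI z2)
    thus ?thesis unfolding J by (simp only: zero_fun_def)
   qed (use flat_killing_off[OF Q] in simp)
  qed
  hence "P = W (a, b, c)" by simp
  moreover have "(a, b, c) \<in> ?A \<times> ?B \<times> ?C" by (intro SigmaI a b c)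
  ultimately show ?thesis by (rule image_eqI)
 qed
 have "?K = W ` (?A \<times> ?B \<times> ?C)"
 proof
  show "W ` (?A \<times> ?B \<times> ?C) \<subseteq> ?K"
  proof (rule image_subsetI)
   fix z assume "z \<in> ?A \<times> ?B \<times> ?C"
   thus "W z \<in> ?K" using mem[of "fst z" "fst (snd z)" "snd (snd z)"] by (simp only: mem_Times_iff prod.collapse)
  qed
 qed (use surj in blast)
 moreover have "dim (W ` (?A \<times> ?B \<times> ?C)) = dim (?A \<times> ?B \<times> ?C)"
  by (rule dim_injective_image[OF lin ABC(3,2) inj])
 ultimately have "dim ?K = dim (?A \<times> ?B \<times> ?C)" by (simp only:)
 thus ?thesis unfolding ABC(1) BC(1) dim_sym(1) .
qed

lemma dim_flat_killing_2:
 "real (dim (flat_killing 2 :: 'n::finite field set)) =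
   (if CARD('n) = 1 then 1 else if CARD('n) = 2 then 3
   else 1 / real CARD('n) * real ((CARD('n) + 2) choose 3) * real ((CARD('n) + 1) choose 2)
    - real CARD('n) * (real CARD('n) + 3) / 2)"
proof -
 define n where "n = CARD('n)"
 define x where "x = (n + 1) choose 2"
 define z where "z = (n + 2) choose 3"
 have n: "n >= 1" using zero_less_card_finite[where 'a = 'n] unfolding n_def by linarith
 have "x * 2 = (n + 1) * n"
  using Suc_times_binomial_eq[of n 1] by (simp add: x_def numeral_2_eq_2)
 hence x: "real x = (real n + 1) * real n / 2" by (metis of_nat_1 of_nat_add of_nat_mult of_nat_numeral nonzero_mult_div_cancel_right zero_neq_numeral)
 have "(n + 2) * x = z * 3"
  using Suc_times_binomial_eq[of "n + 1" 2] by (simp add: x_def z_def numeral_3_eq_3 numeral_2_eq_2)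
 hence "(real n + 2) * real x = real z * 3" by (metis of_nat_add of_nat_mult of_nat_numeral)
 hence z: "real z = (real n + 2) * real x / 3" by simp
 define b where "b = dim (linear_part :: 'n tensor3 set)"
 define c where "c = dim (quadratic_part :: 'n tensor4 set)"
 have "b + z + (if n = 1 then 0 else n) = x * n" using dim_linear_part[where 'n = 'n] unfolding b_def z_def x_def n_def .
 hence b: "real b = real x * real n - real z - (if n = 1 then 0 else real n)"
  by (cases "n = 1") (simp_all flip: of_nat_mult of_nat_add, linarith?)
 have "int c = (if n <= 2 then 0 else int x * int x - int z * int n - int x)"
  using dim_quadratic_part[where 'n = 'n] unfolding c_def z_def x_def n_def .
 hence "real_of_int (int c) = (if n <= 2 then 0 else real x * real x - real z * real n - real x)" by simp
 hence c: "real c = (if n <= 2 then 0 else real x * real x - real z * real n - real x)" by simp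
 have total: "real (dim (flat_killing 2 :: 'n field set)) = real x + (real b + real c)"
  unfolding dim_flat_killing_2_parts x_def b_def c_def n_def by simp
 consider "n = 1" | "n = 2" | "n >= 3" using n by linarith
 hence "real (dim (flat_killing 2 :: 'n field set)) =
   (if n = 1 then 1 else if n = 2 then 3 else 1 / real n * real z * real x - real n * (real n + 3) / 2)"
 proof cases
  case 3
  have "real x + (real b + real c) = real x * real n - real z - real n + real x * real x - real z * real n"
   using 3 by (simp add: b c)
  also have "... = 1 / real n * real z * real x - real n * (real n + 3) / 2"
   using 3 unfolding z x by (simp add: field_simps power2_eq_square)
  finally show ?thesis using 3 total by simp
 qed (simp_all add: total b c z x)
 thus ?thesis unfolding n_def x_def z_def .
qed

section \<open>The theorem\<close>

text \<open>The kernel of the closure of the operator, with \<open>L\<^sup>2\<close> limits spelled out.\<close>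

definition witten_kernel :: "('n => real) => nat => 'n::finite field set" where
 "witten_kernel e p = {u \<in> L2_fields p. \<exists>s. (\<forall>j::nat. s j \<in> test_fields p) &
   (%j. L2_norm2 p (s j - u)) \<longlonglongrightarrow> 0 & (%j. L2_norm2 p (witten_laplacian e (s j))) \<longlonglongrightarrow> 0}"

lemma subspace_null_fields: "subspace null_fields"
proof (rule subspaceI)
 show "0 \<in> null_fields" by (simp add: null_fields_def)
next
 fix u v :: "'n::finite field" assume "u \<in> null_fields" "v \<in> null_fields"
 hence "AE y in lborel. u y = 0" "AE y in lborel. v y = 0" by (simp_all add: null_fields_def)
 hence "AE y in lborel. (u + v) y = 0" by eventually_elim simp
 thus "u + v \<in> null_fields" by (simp add: null_fields_def)
next
 fix u :: "'n::finite field" and a :: real assume "u \<in> null_fields"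
 hence "AE y in lborel. u y = 0" by (simp add: null_fields_def)
 hence "AE y in lborel. (a *\<^sub>R u) y = 0" by eventually_elim simp
 thus "a *\<^sub>R u \<in> null_fields" by (simp add: null_fields_def)
qed

lemma witten_kernel_flat_killing:
 assumes "!!k. e k = 1 \<or> e k = -1" "p >= 1" "u \<in> witten_kernel e p"
 obtains P where "P \<in> flat_killing p" "AE y in lborel. u y = exp (- quadratic e y) *\<^sub>R P y"
proof -
 obtain s where s: "!!j :: nat. s j \<in> test_fields p" "(%j. L2_norm2 p (s j - u)) \<longlonglongrightarrow> 0"
  "(%j. L2_norm2 p (witten_laplacian e (s j))) \<longlonglongrightarrow> 0" and u: "u \<in> L2_fields p"
  using assms(3) unfolding witten_kernel_def by blast
 from kernel_is_flat_killing[OF assms(1,2) u s] show ?thesis using that by blast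
qed

text \<open>The quotient is zero, so the empty set represents a basis.\<close>

lemma witten_kernel_dim_growing:
 fixes e :: "'n::finite => real"
 assumes e: "!!k. e k = 1 \<or> e k = -1" and p: "p >= 1" and k: "e k = -1"
 shows "basis_mod (witten_kernel e p) null_fields {}"
proof -
 have "u \<in> null_fields" if u: "u \<in> witten_kernel e p" for u
 proof -
  obtain P where P: "P \<in> flat_killing p" and AE: "AE y in lborel. u y = exp (- quadratic e y) *\<^sub>R P y"
   using witten_kernel_flat_killing[OF e p u] .
  have uL: "u \<in> L2_fields p" using u unfolding witten_kernel_def by blast
  have "P y J = 0" for y J
  proof (rule growing_flat_killing_zero[of e k P p, OF k P])
   fix J :: "'n list" assume J: "length J = p"
   have "sq_int (%y. exp (- quadratic e y) * P y J) = sq_int (%y. u y J)"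
    unfolding sq_int_def by (rule nn_integral_cong_AE) (use AE in eventually_elim, simp)
   also have "... <= ennreal (fact p) * L2_norm2 p u"
    by (rule sq_int_component_le[OF _ J]) (use uL in \<open>simp add: L2_fields_def\<close>)
   also have "... < \<infinity>" using uL by (simp add: L2_fields_def ennreal_mult_less_top)
   finally show "sq_int (%y. exp (- quadratic e y) * P y J) < \<infinity>" .
  qed
  hence "P = 0" by (auto simp: fun_eq_iff)
  thus ?thesis using AE by (simp add: null_fields_def)
 qed
 thus ?thesis by (auto simp: basis_mod_def independent_empty)
qed

lemma witten_kernel_dim_minimum:
 fixes p :: nat
 assumes p: "p >= 1"
 obtains B where "finite B" "card B = dim (flat_killing p :: 'n::finite field set)"
  "basis_mod (witten_kernel (%_ :: 'n. 1) p) null_fields B"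
proof -
 let ?e = "%_ :: 'n. 1 :: real"
 define \<Phi> :: "'n field => 'n field" where "\<Phi> P = (%y. exp (- quadratic ?e y) *\<^sub>R P y)" for P
 have lin: "linear \<Phi>"
 proof (rule linearI)
  show "\<Phi> (P + Q) = \<Phi> P + \<Phi> Q" for P Q by (rule ext) (simp add: \<Phi>_def scaleR_add_right)
  show "\<Phi> (r *\<^sub>R P) = r *\<^sub>R \<Phi> P" for r P by (rule ext) (simp add: \<Phi>_def mult.commute)
 qed
 have null: "P = 0" if P: "P \<in> flat_killing p" and z: "\<Phi> P \<in> null_fields" for P
 proof (intro ext)
  fix y and J :: "'n list"
  have "AE y in lborel. \<Phi> P y = 0" using z by (simp add: null_fields_def)
  hence "AE y in lborel. y \<in> UNIV --> P y J = 0"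
  proof eventually_elim
   case (elim y)
   hence "P y = 0" by (simp add: \<Phi>_def)
   thus ?case by simp
  qed
  hence "P y J = 0"
   by (rule continuous_AE_zero[OF smooth_on_continuous[OF flat_killing_components(1)[OF P]] open_UNIV _ UNIV_I])
  thus "P y J = 0 y J" by simp
 qed
 obtain B where B: "finite B" "independent B" "span B = (flat_killing p :: 'n field set)"
  using flat_killing_finite_dim by blast
 have "inj_on \<Phi> (flat_killing p)"
  unfolding inj_on_linear_iff[OF lin subspace_flat_killing]
 proof (intro ballI impI)
  fix P assume "P \<in> flat_killing p" "\<Phi> P = 0"
  thus "P = 0" using subspace_0[OF subspace_null_fields] by (intro null) simp_all
 qed
 hence inj: "inj_on \<Phi> (span B)" using B(3) by simp
 show ?thesis
 proof (rule that[of "\<Phi> ` B"])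
  show "finite (\<Phi> ` B)" using B(1) by simp
  show "card (\<Phi> ` B) = dim (flat_killing p :: 'n field set)"
   using card_image[OF inj_on_subset[OF inj span_superset]] dim_span_eq_card_independent[OF B(2)] B(3) by simp
  have im: "span (\<Phi> ` B) = \<Phi> ` flat_killing p" using linear_span_image[OF lin, of B] B(3) by simp
  show "basis_mod (witten_kernel ?e p) null_fields (\<Phi> ` B)"
   unfolding basis_mod_def
  proof (intro conjI ballI)
   have mem: "\<Phi> P \<in> witten_kernel ?e p" if "P \<in> flat_killing p" for P
    using flat_killing_in_kernel[OF that] unfolding witten_kernel_def \<Phi>_def by blast
   show "\<Phi> ` B \<subseteq> witten_kernel ?e p" using mem B(3) span_superset[of B] by blast
   show "independent (\<Phi> ` B)" by (rule linear_independent_injective_image[OF lin B(2) inj])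
   show "span (\<Phi> ` B) \<inter> null_fields \<subseteq> {0}" unfolding im using null linear_0[OF lin] by auto
  next
   fix w assume w: "w \<in> witten_kernel ?e p"
   obtain P where P: "P \<in> flat_killing p" and AE: "AE y in lborel. w y = exp (- quadratic ?e y) *\<^sub>R P y"
    using witten_kernel_flat_killing[OF _ p w] by auto
   from AE have "AE y in lborel. (w - \<Phi> P) y = 0" by eventually_elim (simp add: \<Phi>_def)
   hence "w - \<Phi> P \<in> null_fields" by (simp add: null_fields_def)
   thus "\<exists>b\<in>span (\<Phi> ` B). w - b \<in> null_fields" unfolding im using P by blast
  qed
 qed
qed

text \<open>The model operator depends on the metric and the function near the critical point only, where both
have the normal form.\<close>

lemma model_kernel_eq_witten_kernel:
 fixes A :: "('a, 'n::finite) chart set"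
 assumes M: "smooth_manifold X A" and c: "adapted_chart A g f x c"
  and grad: "!!y i. y \<in> chart_image c ==> partial i (f \<circ> chart_inv c) y = e i * y $ i"
 shows "model_kernel A g f p c = witten_kernel e p"
proof -
 let ?L = "model_op (metric_matrix A g c) (f \<circ> chart_inv c)"
 have cA: "c \<in> A" "x \<in> fst c" "snd c x = 0" and G: "!!y. y \<in> chart_image c ==> metric_matrix A g c y = mat 1"
  using c unfolding adapted_chart_def by blast+
 have U: "open (chart_image c)"
  using M cA(1) unfolding smooth_manifold_def is_chart_def by blast
 have 0: "0 \<in> chart_image c" using cA(2,3) unfolding chart_image_def by force
 have L: "?L s - 0 = witten_laplacian e s" if s: "s \<in> test_fields p" for s
 proof (intro ext)
  fix y J
  have sm: "smooth_on UNIV (%y. s y J)" for J by (rule test_function_smooth[OF test_field_components(1)[OF s]])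
  have "?L s y J = witten_laplacian e s y J"
  proof (rule model_op_eq_witten_laplacian[OF U 0 G grad])
   show "(%z. s z J) differentiable (at y)" for J by (rule smooth_on_differentiable[OF sm UNIV_I])
   show "partial k (%z. s z J) differentiable (at y)" for k J
    by (rule smooth_on_differentiable[OF smooth_on_partial[OF sm] UNIV_I])
   show "s y I = s y J" if "mset I = mset J" for I J by (rule test_field_components(2)[OF s that])
  qed
  thus "(?L s - 0) y J = witten_laplacian e s y J" by simp
 qed
 have "(0 :: 'n field) \<in> L2_fields p"
  using subspace_0[OF subspace_sym_comps] by (simp add: L2_fields_def L2_norm2_def sym_norm2_def)
 hence "(u, 0) \<in> closure_graph p ?L \<longleftrightarrow> u \<in> witten_kernel e p" for u
  unfolding closure_graph_def witten_kernel_def using L by (simp cong: conj_cong)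
 thus ?thesis unfolding model_kernel_def by blast
qed

theorem model_kernel_dimension:
 fixes A :: "('a, 'n::finite) chart set"
 assumes M: "smooth_manifold X A" and f: "f \<in> smooth_functions A" and p: "p >= 1" and c: "adapted_chart A g f x c"
 shows "finite_dim_mod (model_kernel A g f p c) null_fields"
  and "model_kernel_dim A g f p c = (if morse_index A f x = 0 then dim (flat_killing p :: 'n field set) else 0)"
proof -
 obtain N where N: "card N = morse_index A f x"
  and "!!y. y \<in> chart_image c ==> (f \<circ> chart_inv c) y = f x + (\<Sum>k\<in>UNIV. (if k \<in> N then -1 else 1) * (1/2 * (y $ k)\<^sup>2))"
  and grad: "!!y i. y \<in> chart_image c ==> partial i (f \<circ> chart_inv c) y = (if i \<in> N then -1 else 1) * y $ i"
  by (rule adapted_chart_gradient[OF M f c], rule that, assumption+)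
 let ?e = "%i. if i \<in> N then -1 else 1 :: real"
 have K: "model_kernel A g f p c = witten_kernel ?e p"
  by (rule model_kernel_eq_witten_kernel[OF M c grad])
 obtain B where B: "finite B" "basis_mod (model_kernel A g f p c) null_fields B"
  "card B = (if morse_index A f x = 0 then dim (flat_killing p :: 'n field set) else 0)"
 proof (cases "N = {}")
  case True
  obtain B where "finite B" "card B = dim (flat_killing p :: 'n field set)"
   "basis_mod (witten_kernel (%_ :: 'n. 1) p) null_fields B"
   using witten_kernel_dim_minimum[OF p] .
  moreover have "morse_index A f x = 0" using N True by simp
  ultimately show ?thesis using that[of B] K True by simp
 next
  case False
  then obtain k where "k \<in> N" by blast
  hence "basis_mod (witten_kernel ?e p) null_fields {}"
   by (intro witten_kernel_dim_growing[OF _ p, of ?e k]) auto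
  moreover have "morse_index A f x ~= 0" using N False finite[of N] by (metis card_eq_0_iff)
  ultimately show ?thesis using that[of "{}"] K by simp
 qed
 show "finite_dim_mod (model_kernel A g f p c) null_fields" using B(1,2) unfolding finite_dim_mod_def by blast
 show "model_kernel_dim A g f p c = (if morse_index A f x = 0 then dim (flat_killing p :: 'n field set) else 0)"
  unfolding model_kernel_dim_def dim_mod_eq_card[OF B(2,1) subspace_null_fields] by (rule B(3))
qed

theorem theorem1p1:
  fixes X :: "'a topology" and A :: "('a, 'n::finite) chart set"
    and g :: "'a tensor_field" and f :: "'a \<Rightarrow> real" and p :: nat
    and y :: "'a \<Rightarrow> ('a, 'n) chart"
  assumes "closed_connected_riemannian X A g"
    and "p \<ge> 1"
    and "morse_function A f"
    and "adapted_metric A g f"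
    and "\<And>x. x \<in> critical_points A f \<Longrightarrow> adapted_chart A g f x (y x)"
  shows "(\<exists>B. finite B \<and> span B = killing_div_free A g p) \<and>
    finite (critical_points A f) \<and>
    (\<forall>x\<in>critical_points A f. finite_dim_mod (model_kernel A g f p (y x)) null_fields) \<and>
    dim (killing_div_free A g p) \<le> (\<Sum>x\<in>critical_points A f. model_kernel_dim A g f p (y x)) \<and>
    (\<forall>(X' :: 'b topology) (A' :: ('b, 'k::finite) chart set) g' f' c'.
       CARD('k) = CARD('n) \<and> closed_connected_riemannian X' A' g' \<and>
       morse_function A' f' \<and> adapted_metric A' g' f' \<longrightarrow>
       (\<forall>x\<in>critical_points A f. \<forall>x'\<in>critical_points A' f'.
          adapted_chart A' g' f' x' c' \<and> morse_index A f x = morse_index A' f' x' \<longrightarrow>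
          model_kernel_dim A g f p (y x) = model_kernel_dim A' g' f' p c')) \<and>
    (\<forall>x\<in>critical_points A f. morse_index A f x \<ge> p \<or> morse_index A f x = CARD('n) \<longrightarrow>
       model_kernel_dim A g f p (y x) = 0) \<and>
    (\<forall>x\<in>critical_points A f. morse_index A f x = 0 \<and> p = 1 \<longrightarrow>
       model_kernel_dim A g f p (y x) = (CARD('n) + 1) choose 2) \<and>
    (\<forall>x\<in>critical_points A f. morse_index A f x = 0 \<and> p = 2 \<longrightarrow>
       real (model_kernel_dim A g f p (y x)) =
         (if CARD('n) = 1 then 1 else if CARD('n) = 2 then 3
          else 1 / real CARD('n) * real ((CARD('n) + 2) choose 3) * real ((CARD('n) + 1) choose 2)
               - real CARD('n) * (real CARD('n) + 3) / 2))"
proof -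
 have M: "smooth_manifold X A" and comp: "compact_space X"
  using assms(1) unfolding closed_connected_riemannian_def by blast+
 have f: "f \<in> smooth_functions A" using assms(3) unfolding morse_function_def by blast
 note ker = model_kernel_dimension[OF M f assms(2) assms(5)]
 have fin: "finite (critical_points A f)" by (rule finite_critical_points[OF M f comp assms(4)])
 have minimum: "\<exists>x\<in>critical_points A f. morse_index A f x = 0" if "points A ~= {}"
  using minimum_index_zero[OF M f comp assms(4) that] by blast
 have flat: "\<exists>c\<in>A. 0 \<in> chart_image c & (\<forall>y\<in>chart_image c. metric_matrix A g c y = mat 1)" if ne: "points A ~= {}"
 proof -
  obtain x where x: "x \<in> critical_points A f" using minimum[OF ne] by blast
  have "y x \<in> A" "x \<in> fst (y x)" "snd (y x) x = 0" "\<forall>z\<in>chart_image (y x). metric_matrix A g (y x) z = mat 1"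
   using assms(5)[OF x] unfolding adapted_chart_def by blast+
  moreover from this have "0 \<in> chart_image (y x)" unfolding chart_image_def by force
  ultimately show ?thesis by blast
 qed
 obtain B where B: "finite B" "span B = killing_div_free A g p"
  "dim (killing_div_free A g p) <= dim (flat_killing p :: 'n field set)" "points A = {} ==> dim (killing_div_free A g p) = 0"
  by (rule killing_div_free_finite_dim[where p = p, OF assms(1) flat], assumption, rule that, assumption+)
 have bound: "dim (killing_div_free A g p) <= (\<Sum>x\<in>critical_points A f. model_kernel_dim A g f p (y x))"
 proof (cases "points A = {}")
  case False
  then obtain x where x: "x \<in> critical_points A f" "morse_index A f x = 0" using minimum by blast
  have "dim (killing_div_free A g p) <= model_kernel_dim A g f p (y x)" using B(3) ker(2)[OF x(1)] x(2) by simp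
  also have "... <= (\<Sum>x\<in>critical_points A f. model_kernel_dim A g f p (y x))"
   by (rule member_le_sum[OF x(1) _ fin]) simp
  finally show ?thesis .
 qed (simp add: B(4))
 have invariant: "model_kernel_dim A g f p (y x) = model_kernel_dim A' g' f' p c'"
  if "CARD('k) = CARD('n)" "closed_connected_riemannian X' A' g'" "x \<in> critical_points A f"
   "adapted_chart A' g' f' x' c'" "morse_index A f x = morse_index A' f' x'" "morse_function A' f'"
  for X' :: "'b topology" and A' :: "('b, 'k) chart set" and g' f' c' x x'
 proof -
  have M': "smooth_manifold X' A'" using that(2) unfolding closed_connected_riemannian_def by blast
  have f': "f' \<in> smooth_functions A'" using that(6) unfolding morse_function_def by blast
  have "dim (flat_killing p :: 'n field set) = dim (flat_killing p :: 'k field set)"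
   by (intro order_antisym dim_flat_killing_le) (simp_all add: that(1))
  thus ?thesis
   using ker(2)[OF that(3)] model_kernel_dimension(2)[OF M' f' assms(2) that(4)] that(5) by simp
 qed
 have positive: "CARD('n) ~= 0" using zero_less_card_finite[where 'a = 'n] by linarith
 show ?thesis
 proof (intro conjI ballI allI impI)
  show "\<exists>B. finite B & span B = killing_div_free A g p" using B(1,2) by blast
  show "finite (critical_points A f)" by (rule fin)
  show "finite_dim_mod (model_kernel A g f p (y x)) null_fields" if "x \<in> critical_points A f" for x by (rule ker(1)[OF that])
  show "dim (killing_div_free A g p) <= (\<Sum>x\<in>critical_points A f. model_kernel_dim A g f p (y x))" by (rule bound)
 next
  fix X' :: "'b topology" and A' :: "('b, 'k) chart set" and g' f' c' x x'
  assume "CARD('k) = CARD('n) & closed_connected_riemannian X' A' g' & morse_function A' f' & adapted_metric A' g' f'"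
   "x \<in> critical_points A f" "x' \<in> critical_points A' f'"
   "adapted_chart A' g' f' x' c' & morse_index A f x = morse_index A' f' x'"
  thus "model_kernel_dim A g f p (y x) = model_kernel_dim A' g' f' p c'" by (intro invariant) blast+
 next
  fix x assume "x \<in> critical_points A f" "p <= morse_index A f x \<or> morse_index A f x = CARD('n)"
  thus "model_kernel_dim A g f p (y x) = 0" using ker(2) assms(2) positive by auto
 next
  fix x assume "x \<in> critical_points A f" "morse_index A f x = 0 & p = 1"
  thus "model_kernel_dim A g f p (y x) = (CARD('n) + 1) choose 2"
   using ker(2) dim_flat_killing_1[where 'n = 'n] by simp
 next
  fix x assume "x \<in> critical_points A f" "morse_index A f x = 0 & p = 2"
  thus "real (model_kernel_dim A g f p (y x)) =
    (if CARD('n) = 1 then 1 else if CARD('n) = 2 then 3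
    else 1 / real CARD('n) * real ((CARD('n) + 2) choose 3) * real ((CARD('n) + 1) choose 2)
    - real CARD('n) * (real CARD('n) + 3) / 2)"
   using ker(2) dim_flat_killing_2[where 'n = 'n] by simp
 qed
qed

end
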